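(* Let $\mathcal T$ be a connected template on more than $6$ vertices that is both cyclotomic and small-span. Then $\mathcal T$ is equivalent to a sub-template (induced subgraph) of $\mathcal P_n$ or of $\mathcal Q_n$ for some $n\ge3$.
   Context: Hermitian matrices $A=(w(u,v))$ are viewed as weighted graphs: vertices $u,v$ are adjacent if $w(u,v)\neq0$, and $w(v,v)$ is the charge of $v$. Subgraphs are induced subgraphs. For a ring $R\subseteq\mathbb C$, $A$ and $B$ are strongly equivalent if $A=\sigma(QBQ^* )$ for a unitary $Q$ with entries in $R$ and a Galois automorphism $\sigma$ of the Galois closure of the field generated by $R$ applied entrywise; equivalent if $A$ is strongly equivalent to $\pm B+cI$, $c\in\mathbb Z$. A template $\mathcal T$ is a $\mathbb C$-graph, not equivalent to a $\mathbb Z$-graph, whose weights are all determined except some irrational edge-weights $\pm\alpha$ where only $a=\alpha\bar\alpha$ is specified; $(\mathcal T,\mathcal O_{\mathbb Q(\sqrt d)})$ is the set of graphs obtained by substituting for $\alpha$ some $\rho\in\mathcal O_{\mathbb Q(\sqrt d)}$ with $\rho\bar\rho=a$; $\mathcal T$ has a property if all graphs in $(\mathcal T,\mathcal O_{\mathbb Q(\sqrt d)})$ have it, for all $d$ for which this set is nonempty. A graph is cyclotomic if all its eigenvalues lie in $[-2,2]$, and small-span if its characteristic polynomial is a monic integer polynomial whose span (largest zero minus smallest zero) is less than $4$. $\mathcal P_n$ ($n\ge3$): the path $p_1,\dots,p_n$ with $w(p_2,p_1)=\alpha$, $|\alpha|^2=2$, $w(p_i,p_{i+1})=1$ for $2\le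 i\le n-1$, $p_n$ of charge $1$, others uncharged. $\mathcal Q_n$ ($n\ge3$): an uncharged $n$-cycle in which all edges have weight $1$ except one edge of irrational weight $\alpha$ with $|\alpha|^2=1$. *)

theory Defs
  imports
    "Jordan_Normal_Form.Spectral_Radius"
    "Jordan_Normal_Form.Schur_Decomposition"
    "Jordan_Normal_Form.DL_Submatrix"
    "HOL-Computational_Algebra.Computational_Algebra"
begin

section \<open>Galois closures of subfields of the complex numbers\<close>

definition csubfield :: "complex set \<Rightarrow> bool" where
  "csubfield K \<longleftrightarrow> 0 \<in> K \<and> 1 \<in> K \<and>
     (\<forall>x\<in>K. \<forall>y\<in>K. x + y \<in> K \<and> x * y \<in> K) \<and>
     (\<forall>x\<in>K. - x \<in> K \<and> inverse x \<in> K)"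

definition field_generated :: "complex set \<Rightarrow> complex set" where
  "field_generated R = \<Inter>{K. csubfield K \<and> R \<subseteq> K}"

definition normal_over_rat :: "complex set \<Rightarrow> bool" where
  "normal_over_rat L \<longleftrightarrow>
     (\<forall>p :: rat poly. irreducible p \<longrightarrow>
        (\<exists>x\<in>L. poly (map_poly of_rat p) x = 0) \<longrightarrow>
        {x :: complex. poly (map_poly of_rat p) x = 0} \<subseteq> L)"

definition galois_closure :: "complex set \<Rightarrow> complex set" where
  "galois_closure K = \<Inter>{L. csubfield L \<and> K \<subseteq> L \<and> normal_over_rat L}"

text \<open>Automorphisms of \<open>L\<close> are total functions of which only the restriction to \<open>L\<close> matters;
  they fix the rationals automatically.\<close>

definition galois_aut :: "complex set \<Rightarrow> (complex \<Rightarrow> complex) \<Rightarrow> bool" where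
  "galois_aut L \<sigma> \<longleftrightarrow> bij_betw \<sigma> L L \<and> \<sigma> 1 = 1 \<and>
     (\<forall>x\<in>L. \<forall>y\<in>L. \<sigma> (x + y) = \<sigma> x + \<sigma> y \<and> \<sigma> (x * y) = \<sigma> x * \<sigma> y)"

definition quadratic_field :: "int \<Rightarrow> complex set" where
  "quadratic_field d = {of_rat a + of_rat b * csqrt (of_int d) | a b. True}"

definition quadratic_integers :: "int \<Rightarrow> complex set" where
  "quadratic_integers d = {x \<in> quadratic_field d. algebraic_int x}"

definition quadratic_param :: "int \<Rightarrow> bool" where
  "quadratic_param d \<longleftrightarrow> squarefree d \<and> d \<noteq> 1"


section \<open>Hermitian matrices as weighted graphs\<close>

definition graph_over :: "complex set \<Rightarrow> complex mat \<Rightarrow> bool" where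
  "graph_over R A \<longleftrightarrow> square_mat A \<and> mat_adjoint A = A \<and> elements_mat A \<subseteq> R"

definition unitary_over :: "complex set \<Rightarrow> nat \<Rightarrow> complex mat \<Rightarrow> bool" where
  "unitary_over R n Q \<longleftrightarrow> Q \<in> carrier_mat n n \<and> elements_mat Q \<subseteq> R \<and>
     Q * mat_adjoint Q = 1\<^sub>m n \<and> mat_adjoint Q * Q = 1\<^sub>m n"

definition strongly_equivalent :: "complex set \<Rightarrow> complex mat \<Rightarrow> complex mat \<Rightarrow> bool" where
  "strongly_equivalent R A B \<longleftrightarrow>
     graph_over R A \<and> graph_over R B \<and> dim_row A = dim_row B \<and>
     (\<exists>Q \<sigma>. unitary_over R (dim_row A) Q \<and> galois_aut (galois_closure (field_generated R)) \<sigma> \<and>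
        A = map_mat \<sigma> (Q * B * mat_adjoint Q))"

definition equivalent :: "complex set \<Rightarrow> complex mat \<Rightarrow> complex mat \<Rightarrow> bool" where
  "equivalent R A B \<longleftrightarrow>
     (\<exists>c :: int. strongly_equivalent R A (B + of_int c \<cdot>\<^sub>m 1\<^sub>m (dim_row B)) \<or>
                 strongly_equivalent R A (- B + of_int c \<cdot>\<^sub>m 1\<^sub>m (dim_row B)))"

definition connected_graph :: "complex mat \<Rightarrow> bool" where
  "connected_graph A \<longleftrightarrow>
     (\<forall>u < dim_row A. \<forall>v < dim_row A.
        (u, v) \<in> {(i, j). i < dim_row A \<and> j < dim_row A \<and> A $$ (i, j) \<noteq> 0}\<^sup>*)"

definition cyclotomic_graph :: "complex mat \<Rightarrow> bool" where
  "cyclotomic_graph A \<longleftrightarrow> spectrum A \<subseteq> complex_of_real ` {-2..2}"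

text \<open>Only used for characteristic polynomials of Hermitian matrices, all of whose zeros are real.\<close>

definition poly_span :: "int poly \<Rightarrow> real" where
  "poly_span p = Max {x. poly (of_int_poly p) x = 0} - Min {x. poly (of_int_poly p) x = 0}"

definition small_span_graph :: "complex mat \<Rightarrow> bool" where
  "small_span_graph A \<longleftrightarrow>
     (\<exists>p :: int poly. char_poly A = of_int_poly p \<and> monic p \<and> poly_span p < 4)"


section \<open>Templates\<close>

text \<open>A weight is either determined, or one of \<open>\<alpha>\<close>, \<open>-\<alpha>\<close> and, since an edge of weight \<open>\<plusminus>\<alpha>\<close> has the
  conjugate weight in the opposite direction, of their complex conjugates.\<close>

datatype weight = Det complex | Alpha | NegAlpha | CnjAlpha | NegCnjAlpha

fun cnj_weight :: "weight \<Rightarrow> weight" where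
  "cnj_weight (Det z) = Det (cnj z)"
| "cnj_weight Alpha = CnjAlpha"
| "cnj_weight NegAlpha = NegCnjAlpha"
| "cnj_weight CnjAlpha = Alpha"
| "cnj_weight NegCnjAlpha = NegAlpha"

fun subst_weight :: "complex \<Rightarrow> weight \<Rightarrow> complex" where
  "subst_weight \<rho> (Det z) = z"
| "subst_weight \<rho> Alpha = \<rho>"
| "subst_weight \<rho> NegAlpha = - \<rho>"
| "subst_weight \<rho> CnjAlpha = cnj \<rho>"
| "subst_weight \<rho> NegCnjAlpha = - cnj \<rho>"

text \<open>The field \<open>alpha_norm\<close> is the specified value of \<open>\<alpha>\<close> times its complex conjugate.\<close>

record template =
  weights :: "weight mat"
  alpha_norm :: real

text \<open>As \<open>\<alpha>\<close> stands for an irrational weight, rational values of \<open>\<rho>\<close> are not substituted. The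
  determined weights have to lie in the ring too, so that the result is a graph over that ring.\<close>

definition template_graphs :: "template \<Rightarrow> int \<Rightarrow> complex mat set" where
  "template_graphs T d =
     {A. \<exists>\<rho> \<in> quadratic_integers d. \<rho> \<notin> \<rat> \<and> \<rho> * cnj \<rho> = of_real (alpha_norm T) \<and>
         A = map_mat (subst_weight \<rho>) (weights T) \<and> elements_mat A \<subseteq> quadratic_integers d}"

definition template_has :: "(complex mat \<Rightarrow> bool) \<Rightarrow> template \<Rightarrow> bool" where
  "template_has P T \<longleftrightarrow>
     (\<forall>d. quadratic_param d \<longrightarrow> (\<forall>A \<in> template_graphs T d. P A))"

text \<open>The symmetry condition forces the diagonal weights (charges) to be determined and real.\<close>

definition is_template :: "template \<Rightarrow> bool" where
  "is_template T \<longleftrightarrow>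
     square_mat (weights T) \<and>
     (\<forall>i < dim_row (weights T). \<forall>j < dim_row (weights T).
        weights T $$ (j, i) = cnj_weight (weights T $$ (i, j))) \<and>
     (\<exists>w \<in> elements_mat (weights T). w \<notin> range Det) \<and>
     (\<forall>d. quadratic_param d \<longrightarrow> (\<forall>A \<in> template_graphs T d.
        \<not> (\<exists>B. graph_over \<int> B \<and> equivalent (quadratic_integers d) A B)))"

text \<open>Whether \<open>T\<close> is equivalent to \<open>S\<close> is, like every other property of \<open>T\<close>, tested on the graphs
  that \<open>T\<close> represents over each quadratic integer ring.\<close>

definition template_equivalent :: "template \<Rightarrow> template \<Rightarrow> bool" where
  "template_equivalent T S \<longleftrightarrow>
     (\<forall>d. quadratic_param d \<longrightarrow> (\<forall>A \<in> template_graphs T d.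
        \<exists>B \<in> template_graphs S d. equivalent (quadratic_integers d) A B))"

definition sub_template :: "template \<Rightarrow> nat set \<Rightarrow> template" where
  "sub_template T I = T\<lparr>weights := submatrix (weights T) I I\<rparr>"

text \<open>Vertex \<open>p\<^sub>i\<close> has index \<open>i - 1\<close>.\<close>

definition template_P :: "nat \<Rightarrow> template" where
  "template_P n = \<lparr>
     weights = mat n n (\<lambda>(i, j).
       if i = 1 \<and> j = 0 then Alpha
       else if i = 0 \<and> j = 1 then CnjAlpha
       else if j = i + 1 \<or> i = j + 1 then Det 1
       else if i = n - 1 \<and> j = n - 1 then Det 1
       else Det 0),
     alpha_norm = 2\<rparr>"

definition template_Q :: "nat \<Rightarrow> template" where
  "template_Q n = \<lparr>
     weights = mat n n (\<lambda>(i, j).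
       if i = n - 1 \<and> j = 0 then Alpha
       else if i = 0 \<and> j = n - 1 then CnjAlpha
       else if j = i + 1 \<or> i = j + 1 then Det 1
       else Det 0),
     alpha_norm = 1\<rparr>"

end

theory Submission
  imports Defs "HOL-Analysis.Product_Topology" "HOL-Analysis.Topology_Euclidean_Space"
begin

text \<open>
  If a connected Hermitian matrix \<open>A\<close> has its spectrum in \<open>[-2, 2]\<close> and does not have both \<open>2\<close> and \<open>-2\<close> as
  eigenvalues, then \<open>A v\<close> is strictly shorter than \<open>2 v\<close> unless \<open>A v = \<plusminus> 2 v\<close>. Since the graph has more than
  six vertices, a vector of small support is never such an eigenvector, so every choice of one yields a
  strict inequality; these bound the row norms and the sums over walks of length two.

  The weights are quadratic integers. In an imaginary field the squares of their absolute values are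
  integers. In a real field the Galois conjugate of \<open>A\<close> has the same characteristic polynomial, hence
  satisfies the same inequalities, and together they exclude weights of golden ratio type, the only ones of
  non-integral square that are small together with their conjugates.

  If some edge has a weight of norm at least two, then it is the end of a path that has to exhaust the graph.
  Otherwise real weights are integers, and in the imaginary case all weights are zero or units. Either all
  closed walks then have rational gain, and switching makes \<open>A\<close> an integer matrix, or a shortest cycle of
  irrational gain is induced and no vertex can be attached to it, so that it is the whole graph. As the
  absolute values of the weights depend on the template only, the shape of one of its graphs determines the
  shape of all of them.
\<close>


text \<open>In matrix terms \<open>4I - A^2\<close> is positive semidefinite, and its kernel is an
  eigenspace for only one of the values 2 and -2. This is used in two ways. On vectors supported by
  two vertices it is a 2 by 2 minor: the squared modulus of a walk sum lies below the product of the
  defects \<open>4 - deg\<close>. For two vertices of degree 3 the product is 1, and discreteness of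
  the ring turns "below 1" into 0. These exact orthogonality relations either fail outright or force
  the gain of a cycle to be rational. Where they say nothing, a test vector is exhibited whose image
  has squared length at least four times its own. Many of these vectors imitate null vectors of
  affine diagrams, restricted to one colour class; the image is then nonzero at a vertex where the
  vector vanishes, so it is no eigenvector. Short cycles shape the proof: squares whose gain is a
  cube root of unity, complete bipartite graphs on 2 + 3 vertices and hexagons all need vectors of
  their own. Closed configurations are excluded by the edge that must leave any set of at most six
  vertices.\<close>

locale hermitian_weights =
  fixes n :: nat and a :: "nat \<Rightarrow> nat \<Rightarrow> complex"
  assumes herm: "\<And>i j. i < n \<Longrightarrow> j < n \<Longrightarrow> a j i = cnj (a i j)"
begin

definition app :: "(nat \<Rightarrow> complex) \<Rightarrow> nat \<Rightarrow> complex" where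
  "app u i = (\<Sum>j<n. a i j * u j)"

definition sqnorm :: "(nat \<Rightarrow> complex) \<Rightarrow> real" where
  "sqnorm u = (\<Sum>i<n. (cmod (u i))\<^sup>2)"

lemma app_adjoint: "(\<Sum>i<n. cnj (w i) * app v i) = (\<Sum>i<n. cnj (app w i) * v i)"
proof -
  have "(\<Sum>i<n. cnj (w i) * app v i) = (\<Sum>i<n. \<Sum>j<n. cnj (w i) * a i j * v j)"
    by (simp add: app_def sum_distrib_left mult.assoc)
  also have "\<dots> = (\<Sum>j<n. \<Sum>i<n. cnj (w i) * a i j * v j)"
    by (rule sum.swap)
  also have "\<dots> = (\<Sum>j<n. cnj (app w j) * v j)"
  proof (rule sum.cong[OF refl])
    fix j assume "j \<in> {..<n}"
    then have "\<And>i. i < n \<Longrightarrow> cnj (a j i) = a i j" using herm[of _ j] by auto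
    then show "(\<Sum>i<n. cnj (w i) * a i j * v j) = cnj (app w j) * v j"
      by (simp add: app_def sum_distrib_right sum_distrib_left mult.commute mult.left_commute)
  qed
  finally show ?thesis .
qed

lemma app_lin: "app (\<lambda>i. u i + t * w i) i = app u i + t * app w i"
  by (simp add: app_def algebra_simps sum.distrib sum_distrib_left)

lemma sqnorm_lin: "sqnorm (\<lambda>i. u i + complex_of_real t * w i) =
   sqnorm u + 2 * t * Re (\<Sum>i<n. cnj (w i) * u i) + t\<^sup>2 * sqnorm w"
proof -
  have "(cmod (u i + complex_of_real t * w i))\<^sup>2 =
     (cmod (u i))\<^sup>2 + 2 * t * Re (cnj (w i) * u i) + t\<^sup>2 * (cmod (w i))\<^sup>2" for i
    by (simp only: cmod_power2) (simp add: power2_eq_square algebra_simps)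
  then show ?thesis
    by (simp only: sqnorm_def sum.distrib sum_distrib_left Re_sum)
qed

lemma sqnorm_nonneg: "sqnorm u \<ge> 0"
  by (simp add: sqnorm_def sum_nonneg)

lemma sqnorm_eq_0: "sqnorm u = 0 \<longleftrightarrow> (\<forall>i<n. u i = 0)"
  by (auto simp: sqnorm_def sum_nonneg_eq_0_iff)

lemma sqnorm_scale: "sqnorm (\<lambda>i. complex_of_real t * w i) = t\<^sup>2 * sqnorm w"
  by (simp add: sqnorm_def sum_distrib_left norm_mult power_mult_distrib)

lemma app_scale: "app (\<lambda>i. t * w i) i = t * app w i"
  by (simp add: app_def algebra_simps sum_distrib_left)

lemma linear_coeff_zero:
  fixes b c :: real
  assumes "\<And>t. 0 \<le> 2 * t * b + t\<^sup>2 * c"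
  shows "b = 0"
proof (rule ccontr)
  assume b: "b \<noteq> 0"
  \<comment> \<open>At \<open>t = - b / k\<close> with \<open>k > c\<close> the linear term
    outweighs the quadratic one.\<close>
  define k where "k = \<bar>c\<bar> + 1"
  have k: "k > 0" "c < k" by (auto simp: k_def)
  have "0 \<le> 2 * (- b / k) * b + (- b / k)\<^sup>2 * c" by (rule assms)
  also have "\<dots> = (b\<^sup>2 / k\<^sup>2) * (c - 2 * k)"
    using k by (simp add: field_simps power2_eq_square)
  also have "\<dots> < 0"
    using b k by (intro mult_pos_neg) auto
  finally show False by simp
qed

text \<open>Vanishing of the first variation of the Rayleigh quotient of \<open>A\<^sup>2\<close> at a maximum.\<close>

lemma extremal_eigenvector:
  assumes bound: "\<And>v. sqnorm (app v) \<le> l * sqnorm v"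
    and eq: "sqnorm (app u) = l * sqnorm u"
    and i: "i < n"
  shows "app (app u) i = of_real l * u i"
proof -
  \<comment> \<open>Moving \<open>u\<close> in the direction of this residual makes
    \<open>sqnorm w\<close> the linear coefficient of the nonnegative defect
    \<open>l |v|^2 - |A v|^2\<close>.\<close>
  define w where "w = (\<lambda>i. of_real l * u i - app (app u) i)"
  define c where "c = l * sqnorm w - sqnorm (app w)"
  have "0 \<le> 2 * t * sqnorm w + t\<^sup>2 * c" for t
  proof -
    have "0 \<le> l * sqnorm (\<lambda>i. u i + complex_of_real t * w i)
        - sqnorm (app (\<lambda>i. u i + complex_of_real t * w i))"
      using bound by simp
    also have "app (\<lambda>i. u i + complex_of_real t * w i) = (\<lambda>i. app u i + complex_of_real t * app w i)"
      by (rule ext) (rule app_lin)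
    also have "l * sqnorm (\<lambda>i. u i + complex_of_real t * w i)
        - sqnorm (\<lambda>i. app u i + complex_of_real t * app w i)
       = 2 * t * (l * Re (\<Sum>i<n. cnj (w i) * u i) - Re (\<Sum>i<n. cnj (app w i) * app u i))
         + t\<^sup>2 * c"
      unfolding sqnorm_lin using eq by (simp add: c_def algebra_simps)
    also have "(\<Sum>i<n. cnj (app w i) * app u i) = (\<Sum>i<n. cnj (w i) * app (app u) i)"
      using app_adjoint[of w "app u"] by simp
    also have "l * Re (\<Sum>i<n. cnj (w i) * u i) - Re (\<Sum>i<n. cnj (w i) * app (app u) i)
       = Re (\<Sum>i<n. cnj (w i) * w i)"
    proof -
      have "Re (cnj (w i) * w i) = l * Re (cnj (w i) * u i) - Re (cnj (w i) * app (app u) i)" for i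
        
        using arg_cong[where f = "\<lambda>z. Re (cnj (w i) * z)", OF fun_cong[OF w_def, of i]]
        by (simp add: algebra_simps)
      then show ?thesis by (simp only: Re_sum sum_distrib_left sum_subtractf)
    qed
    also have "\<dots> = sqnorm w"
      unfolding sqnorm_def Re_sum
      by (intro sum.cong refl) (simp only: cmod_power2, simp add: power2_eq_square)
    finally show ?thesis .
  qed
  then have "sqnorm w = 0" by (rule linear_coeff_zero)
  then show ?thesis using i unfolding sqnorm_eq_0 w_def by simp
qed

text \<open>Vectors are functions on all of \<open>nat\<close>; requiring zero beyond
  \<open>n\<close> places the sphere inside a product of closed discs and points, so that
  Tychonoff's theorem applies.\<close>

lemma compact_unit_sphere: "compact {u :: nat \<Rightarrow> complex. (\<forall>i\<ge>n. u i = 0) \<and> sqnorm u = 1}"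
proof -
  define P where "P = PiE UNIV (\<lambda>i. if i < n then cball (0::complex) 1 else {0})"
  have "compactin (product_topology (\<lambda>i::nat. euclidean :: complex topology) UNIV) P"
    unfolding P_def compactin_PiE by (auto simp: compactin_euclidean_iff)
  then have P: "compact P"
    by (simp add: euclidean_product_topology compactin_euclidean_iff)
  have "continuous_on UNIV sqnorm"
    unfolding sqnorm_def[abs_def]
    by (intro continuous_intros continuous_on_product_coordinates)
  then have "closed (sqnorm -` {1})"
    by (intro closed_vimage) auto
  moreover have "{u :: nat \<Rightarrow> complex. (\<forall>i\<ge>n. u i = 0) \<and> sqnorm u = 1} = P \<inter> sqnorm -` {1}"
  proof (intro Set.set_eqI iffI)
    fix u assume u: "u \<in> {u :: nat \<Rightarrow> complex. (\<forall>i\<ge>n. u i = 0) \<and> sqnorm u = 1}"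
    have "cmod (u i) \<le> 1" if "i < n" for i
    proof -
      have "(cmod (u i))\<^sup>2 \<le> sqnorm u"
        unfolding sqnorm_def using that by (intro member_le_sum) auto
      then show ?thesis using u by (simp add: power_le_one_iff abs_square_le_1)
    qed
    with u show "u \<in> P \<inter> sqnorm -` {1}" by (auto simp: P_def PiE_def Pi_def)
  next
    fix u assume "u \<in> P \<inter> sqnorm -` {1}"
    then show "u \<in> {u :: nat \<Rightarrow> complex. (\<forall>i\<ge>n. u i = 0) \<and> sqnorm u = 1}"
      by (auto simp: P_def PiE_iff split: if_splits) (metis not_less singletonD)
  qed
  ultimately show ?thesis using P by (simp add: compact_Int_closed)
qed

text \<open>The norm of \<open>A\<close> is attained on the compact sphere, and homogeneity extends
  the bound to all vectors.\<close>

lemma sqnorm_app_max: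
  assumes "n > 0"
  shows "\<exists>u. sqnorm u = 1 \<and> (\<forall>v. sqnorm (app v) \<le> sqnorm (app u) * sqnorm v)"
proof -
  define K where "K = {u :: nat \<Rightarrow> complex. (\<forall>i\<ge>n. u i = 0) \<and> sqnorm u = 1}"
  have "(\<lambda>i. if i = 0 then 1 else 0) \<in> K"
    using assms by (auto simp: K_def sqnorm_def if_distrib[of "\<lambda>z. (cmod z)\<^sup>2"] cong: if_cong)
  then have ne: "K \<noteq> {}" by blast
  have "continuous_on UNIV (\<lambda>u. app u i)" for i
    unfolding app_def
    by (intro continuous_on_sum continuous_on_mult continuous_on_const
        continuous_on_product_coordinates)
  then have "continuous_on UNIV (\<lambda>u. sqnorm (app u))"
    unfolding sqnorm_def
    by (intro continuous_on_sum continuous_on_power continuous_on_norm)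
  then have "continuous_on K (\<lambda>u. sqnorm (app u))"
    by (rule continuous_on_subset) auto
  from continuous_attains_sup[OF compact_unit_sphere[folded K_def] ne this]
  obtain u where u: "u \<in> K" and max: "\<And>v. v \<in> K \<Longrightarrow> sqnorm (app v) \<le> sqnorm (app u)"
    by blast
  have "sqnorm (app v) \<le> sqnorm (app u) * sqnorm v" for v
  proof (cases "sqnorm v = 0")
    case True
    then have "\<forall>i<n. v i = 0" by (simp add: sqnorm_eq_0)
    then have "sqnorm (app v) = 0" by (simp add: sqnorm_eq_0 app_def)
    then show ?thesis using True by simp
  next
    case False
    then have pos: "sqnorm v > 0" using sqnorm_nonneg[of v] by linarith
    define t where "t = 1 / sqrt (sqnorm v)"
    have t2: "t\<^sup>2 = 1 / sqnorm v" using pos by (simp add: t_def power_divide)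
    define w where "w = (\<lambda>i. complex_of_real t * (if i < n then v i else 0))"
    have "sqnorm (\<lambda>i. if i < n then v i else 0) = sqnorm v"
      by (simp add: sqnorm_def)
    then have "w \<in> K" using pos unfolding w_def K_def by (simp add: sqnorm_scale t2)
    from max[OF this] have "sqnorm (app w) \<le> sqnorm (app u)" .
    moreover have "app w = (\<lambda>i. complex_of_real t * app v i)"
      unfolding w_def by (rule ext, subst app_scale) (simp add: app_def)
    ultimately show ?thesis using pos by (simp add: sqnorm_scale t2 field_simps)
  qed
  then show ?thesis using u unfolding K_def by (intro exI[of _ u]) simp
qed

end

text \<open>In place of the spectral theorem: a maximiser \<open>m\<close> satisfies
  \<open>A^2 m = l m\<close>, and factoring \<open>A^2 - l\<close> yields an eigenvector for
  \<open>sqrt l\<close> or \<open>- sqrt l\<close>, so \<open>l \<le> 4\<close>. Equality at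
  \<open>u\<close> then means \<open>A^2 u = 4 u\<close>, and \<open>A u + 2 u\<close> and
  \<open>A u - 2 u\<close> are nonzero eigenvectors for 2 and for -2.\<close>

lemma (in hermitian_weights) strict_bound:
  assumes n: "n > 0"
    and eig: "\<And>\<mu> u. \<exists>i<n. u i \<noteq> 0 \<Longrightarrow> \<forall>i<n. app u i = \<mu> * u i \<Longrightarrow>
                \<exists>r. \<mu> = complex_of_real r \<and> \<bar>r\<bar> \<le> 2"
    and one_sided: "\<And>u v. \<exists>i<n. u i \<noteq> 0 \<Longrightarrow> \<forall>i<n. app u i = 2 * u i \<Longrightarrow>
                \<exists>i<n. v i \<noteq> 0 \<Longrightarrow> \<forall>i<n. app v i = - 2 * v i \<Longrightarrow> False"
    and not_plus: "\<not> (\<forall>i<n. app u i = 2 * u i)"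
    and not_minus: "\<not> (\<forall>i<n. app u i = - 2 * u i)"
  shows "sqnorm (app u) < 4 * sqnorm u"
proof -
  obtain m where m': "sqnorm m = 1 \<and> (\<forall>v. sqnorm (app v) \<le> sqnorm (app m) * sqnorm v)"
    using sqnorm_app_max[OF n] ..
  then have m: "sqnorm m = 1" and max: "sqnorm (app v) \<le> sqnorm (app m) * sqnorm v" for v
    by simp_all
  define l where "l = sqnorm (app m)"
  have l0: "l \<ge> 0" by (simp add: l_def sqnorm_nonneg)
  have sq: "app (app m) i = of_real l * m i" if "i < n" for i
    unfolding l_def by (rule extremal_eigenvector[OF max _ that]) (simp add: m)
  define \<mu> where "\<mu> = sqrt l"
  have mu2: "complex_of_real \<mu> * complex_of_real \<mu> = of_real l"
    using l0 by (simp add: \<mu>_def flip: of_real_mult)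
  have mu0: "\<mu> \<ge> 0" using l0 by (simp add: \<mu>_def)
  have m0: "\<exists>i<n. m i \<noteq> 0" using m sqnorm_eq_0[of m] by auto
  define w where "w = (\<lambda>i. app m i + of_real \<mu> * m i)"
  have "\<mu> \<le> 2"
  proof (cases "\<exists>i<n. w i \<noteq> 0")
    case True
    have "\<forall>i<n. app w i = of_real \<mu> * w i"
      unfolding w_def app_lin using sq mu2 by (auto simp: algebra_simps)
    from eig[OF True this] mu0 show ?thesis by auto
  next
    case False
    then have "\<forall>i<n. app m i = of_real (- \<mu>) * m i"
      by (auto simp: w_def add_eq_0_iff)
    from eig[OF m0 this] show ?thesis by (metis abs_le_iff minus_minus of_real_eq_iff minus_le_iff)
  qed
  then have "l \<le> 4" using sqrt_le_D[of l 2] unfolding \<mu>_def by simp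
  then have bound: "sqnorm (app v) \<le> 4 * sqnorm v" for v
    using max[of v] sqnorm_nonneg[of v] unfolding l_def[symmetric]
    by (meson mult_right_mono order_trans)
  show ?thesis
  proof (rule ccontr)
    assume "\<not> ?thesis"
    with bound[of u] have eq: "sqnorm (app u) = 4 * sqnorm u" by simp
    have sq: "app (app u) i = 4 * u i" if "i < n" for i
      using extremal_eigenvector[OF bound eq that] by simp
    define p where "p = (\<lambda>i. app u i + 2 * u i)"
    define q where "q = (\<lambda>i. app u i + (- 2) * u i)"
    have "\<exists>i<n. p i \<noteq> 0" using not_minus by (auto simp: p_def add_eq_0_iff)
    moreover have "\<forall>i<n. app p i = 2 * p i"
      unfolding p_def app_lin using sq by (auto simp: algebra_simps)
    moreover have "\<exists>i<n. q i \<noteq> 0" using not_plus by (auto simp: q_def)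
    moreover have "\<forall>i<n. app q i = - 2 * q i"
      unfolding q_def app_lin using sq by (auto simp: algebra_simps)
    ultimately show False by (rule one_sided)
  qed
qed

section \<open>Consequences of the strict inequality: row norms and walks of length two\<close>

locale small_span_weights = hermitian_weights +
  assumes strict: "\<And>u. \<not> (\<forall>i<n. app u i = 2 * u i) \<Longrightarrow> \<not> (\<forall>i<n. app u i = - 2 * u i) \<Longrightarrow>
      sqnorm (app u) < 4 * sqnorm u"
    and connected: "\<And>S. S \<subseteq> {..<n} \<Longrightarrow> S \<noteq> {} \<Longrightarrow>
      (\<And>x y. x \<in> S \<Longrightarrow> y < n \<Longrightarrow> a x y \<noteq> 0 \<Longrightarrow> y \<in> S) \<Longrightarrow> S = {..<n}"
    and size: "n > 6"
begin

text \<open>\<open>deg\<close> and \<open>paths2\<close> are the diagonal and the general entries of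
  \<open>A^2\<close>; a charge counts in both, as a loop.\<close>

definition deg :: "nat \<Rightarrow> real" where
  "deg v = (\<Sum>x<n. (cmod (a x v))\<^sup>2)"

definition paths2 :: "nat \<Rightarrow> nat \<Rightarrow> complex" where
  "paths2 u v = (\<Sum>x<n. a u x * a x v)"

lemma cmod_sym: "i < n \<Longrightarrow> j < n \<Longrightarrow> cmod (a j i) = cmod (a i j)"
  using herm[of i j] by simp

lemma zero_sym: "i < n \<Longrightarrow> j < n \<Longrightarrow> a j i = 0 \<longleftrightarrow> a i j = 0"
  using herm[of i j] by simp

lemma mult_sym: "i < n \<Longrightarrow> j < n \<Longrightarrow> a i j * a j i = of_real ((cmod (a i j))\<^sup>2)"
  using herm[of i j] complex_norm_square[of "a i j"] by simp

lemma app_supp: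
  assumes "X \<subseteq> {..<n}"
  shows "app (\<lambda>i. if i \<in> X then f i else 0) y = (\<Sum>x\<in>X. a y x * f x)"
proof -
  have "app (\<lambda>i. if i \<in> X then f i else 0) y = (\<Sum>x<n. if x \<in> X then a y x * f x else 0)"
    unfolding app_def by (rule sum.cong) auto
  also have "\<dots> = (\<Sum>x\<in>{..<n} \<inter> X. a y x * f x)"
    by (simp add: sum.inter_restrict)
  also have "{..<n} \<inter> X = X" using assms by blast
  finally show ?thesis .
qed

lemma sqnorm_supp:
  assumes "X \<subseteq> {..<n}"
  shows "sqnorm (\<lambda>i. if i \<in> X then f i else 0) = (\<Sum>x\<in>X. (cmod (f x))\<^sup>2)"
proof -
  have "sqnorm (\<lambda>i. if i \<in> X then f i else 0) = (\<Sum>x<n. if x \<in> X then (cmod (f x))\<^sup>2 else 0)"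
    unfolding sqnorm_def by (rule sum.cong) auto
  also have "\<dots> = (\<Sum>x\<in>{..<n} \<inter> X. (cmod (f x))\<^sup>2)"
    by (simp add: sum.inter_restrict)
  also have "{..<n} \<inter> X = X" using assms by blast
  finally show ?thesis .
qed

text \<open>The form in which test vectors are used: rows may be dropped on the left, and a nonzero
  image coordinate at \<open>y\<close>, where the vector vanishes, excludes both eigenvalue
  equations.\<close>

lemma vector_bound:
  assumes X: "X \<subseteq> {..<n}" and Y: "Y \<subseteq> {..<n}"
    and y: "y < n" "y \<notin> X" "(\<Sum>x\<in>X. a y x * f x) \<noteq> 0"
  shows "(\<Sum>y\<in>Y. (cmod (\<Sum>x\<in>X. a y x * f x))\<^sup>2) < 4 * (\<Sum>x\<in>X. (cmod (f x))\<^sup>2)"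
proof -
  let ?u = "\<lambda>i. if i \<in> X then f i else 0"
  have "(\<Sum>y\<in>Y. (cmod (\<Sum>x\<in>X. a y x * f x))\<^sup>2) \<le> sqnorm (app ?u)"
    unfolding sqnorm_def app_supp[OF X] using Y by (intro sum_mono2) auto
  also have "sqnorm (app ?u) < 4 * sqnorm ?u"
    using y by (intro strict) (auto simp: app_supp[OF X] intro!: exI[of _ y])
  finally show ?thesis by (simp only: sqnorm_supp[OF X])
qed

lemma deg_ge: "F \<subseteq> {..<n} \<Longrightarrow> (\<Sum>x\<in>F. (cmod (a x v))\<^sup>2) \<le> deg v"
  unfolding deg_def by (rule sum_mono2) auto

lemma entry_le_deg: "x < n \<Longrightarrow> (cmod (a x v))\<^sup>2 \<le> deg v"
  using deg_ge[of "{x}" v] by simp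

lemma neighbour_exists:
  assumes "v < n" obtains x where "x < n" "x \<noteq> v" "a x v \<noteq> 0"
proof -
  have "{v} \<noteq> {..<n}" using size by (metis card_lessThan is_singletonI is_singleton_altdef not_less_iff_gr_or_eq numeral_One numeral_less_iff semiring_norm(76))
  with connected[of "{v}"] assms obtain y where "y < n" "a v y \<noteq> 0" "y \<noteq> v" by blast
  with that zero_sym assms show ?thesis by blast
qed

lemma deg_less_4:
  assumes "v < n" shows "deg v < 4"
proof -
  obtain x where "x < n" "x \<noteq> v" "a x v \<noteq> 0" using neighbour_exists[OF assms] .
  then show ?thesis
    using vector_bound[of "{v}" "{..<n}" x "\<lambda>_. 1"] assms by (simp add: deg_def)
qed

lemma paths2_herm: "u < n \<Longrightarrow> v < n \<Longrightarrow> paths2 v u = cnj (paths2 u v)"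
  unfolding paths2_def cnj_sum
  by (rule sum.cong) (auto simp: herm[of u] herm[of _ v] mult.commute)

text \<open>This is positivity of the 2 by 2 principal minor of \<open>4I - A^2\<close> at
  \<open>u\<close> and \<open>w\<close>. Strictness requires that the vector on \<open>u\<close> and
  \<open>w\<close> be no eigenvector for 2 or -2, which each alternative of \<open>side\<close>
  guarantees.\<close>

lemma paths2_bound:
  assumes u: "u < n" and w: "w < n" and uw: "u \<noteq> w"
    and side: "a u w = 0 \<or> (a u u = 0 \<and> a w w = 0) \<or>
      (\<exists>x<n. x \<noteq> u \<and> x \<noteq> w \<and> a x u \<noteq> 0 \<and> a x w = 0)"
  shows "(cmod (paths2 u w))\<^sup>2 < (4 - deg u) * (4 - deg w)"
proof -
  define \<alpha> where "\<alpha> = 4 - deg w"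
  have \<alpha>: "\<alpha> > 0" using deg_less_4[OF w] by (simp add: \<alpha>_def)
  define \<beta> where "\<beta> = paths2 w u"
  \<comment> \<open>With this vector the form of \<open>4I - A^2\<close> takes the value
    \<open>\<alpha> (\<alpha> (4 - deg u) - |\<beta>|^2)\<close>.\<close>
  define f where "f = (\<lambda>i. if i = u then complex_of_real \<alpha> else if i = w then \<beta> else 0)"
  have app_f: "app f y = of_real \<alpha> * a y u + \<beta> * a y w" if "y < n" for y
  proof -
    have "app f y = app (\<lambda>i. if i \<in> {u, w} then f i else 0) y"
      by (rule arg_cong2[where f = app]) (auto simp: f_def)
    also have "\<dots> = (\<Sum>x\<in>{u, w}. a y x * f x)" using u w by (intro app_supp) auto
    finally show ?thesis using uw by (simp add: f_def mult.commute)
  qed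
  have sq_f: "sqnorm f = \<alpha>\<^sup>2 + (cmod \<beta>)\<^sup>2"
  proof -
    have "sqnorm f = sqnorm (\<lambda>i. if i \<in> {u, w} then f i else 0)"
      by (rule arg_cong[where f = sqnorm]) (auto simp: f_def)
    also have "\<dots> = (\<Sum>x\<in>{u, w}. (cmod (f x))\<^sup>2)" using u w by (intro sqnorm_supp) auto
    finally show ?thesis using uw by (simp add: f_def)
  qed
  have no: "\<not> (\<forall>i<n. app f i = e * f i)" if e: "e = 2 \<or> e = - 2" for e :: complex
  proof
    assume all: "\<forall>i<n. app f i = e * f i"
    have ee: "e * e = 4" using e by auto
    have ru: "of_real \<alpha> * a u u + \<beta> * a u w = e * of_real \<alpha>"
      using all u app_f[OF u] by (simp add: f_def)
    have rw: "of_real \<alpha> * a w u + \<beta> * a w w = e * \<beta>"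
      using all w app_f[OF w] uw by (simp add: f_def)
    from side consider "a u w = 0" | "a u u = 0" "a w w = 0" |
      x where "x < n" "x \<noteq> u" "x \<noteq> w" "a x u \<noteq> 0" "a x w = 0" by blast
    then show False
    proof cases
      case 1
      then have "a u u = e" using ru \<alpha> by (simp add: mult.commute)
      then have "(cmod (a u u))\<^sup>2 = 4" using e by auto
      with entry_le_deg[OF u, of u] deg_less_4[OF u] show False by simp
    next
      case 2
      have "of_real \<alpha> * a w u * a u w = e * (\<beta> * a u w)" using 2 rw by simp
      also have "\<dots> = 4 * of_real \<alpha>" using 2 ru ee by (simp add: mult.assoc[symmetric])
      finally have "a w u * a u w = 4" using \<alpha> by (simp add: mult.assoc mult.commute)
      then have "complex_of_real ((cmod (a w u))\<^sup>2) = of_real 4" using mult_sym[OF w u] by simp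
      then have "(cmod (a w u))\<^sup>2 = 4" by (simp only: of_real_eq_iff)
      with entry_le_deg[OF w, of u] deg_less_4[OF u] show False by simp
    next
      case 3
      then have "of_real \<alpha> * a x u = 0" using all app_f[of x] by (simp add: f_def)
      with 3 \<alpha> show False by simp
    qed
  qed
  have "sqnorm (app f) < 4 * (\<alpha>\<^sup>2 + (cmod \<beta>)\<^sup>2)"
    using strict[OF no[of 2] no[of "- 2"]] sq_f by simp
  moreover have "sqnorm (app f) = \<alpha>\<^sup>2 * deg u + (cmod \<beta>)\<^sup>2 * deg w + 2 * \<alpha> * (cmod \<beta>)\<^sup>2"
  proof -
    have "(cmod (app f y))\<^sup>2 = \<alpha>\<^sup>2 * (cmod (a y u))\<^sup>2 + (cmod \<beta>)\<^sup>2 * (cmod (a y w))\<^sup>2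
        + 2 * \<alpha> * Re (cnj \<beta> * (a w y * a y u))" if "y < n" for y
    proof -
      have "cmod (x + z) ^ 2 = cmod x ^ 2 + cmod z ^ 2 + 2 * Re (cnj z * x)" for x z
        by (simp only: cmod_power2) (simp add: power2_eq_square algebra_simps)
      note exp = this
      define z where "z = cnj \<beta> * (a w y * a y u)"
      have cross: "cnj (\<beta> * a y w) * (of_real \<alpha> * a y u) = of_real \<alpha> * z"
        using herm[OF that w] by (simp add: z_def mult_ac)
      have n1: "(cmod (of_real \<alpha> * a y u))\<^sup>2 = \<alpha>\<^sup>2 * (cmod (a y u))\<^sup>2"
        by (simp add: norm_mult power_mult_distrib)
      have n2: "(cmod (\<beta> * a y w))\<^sup>2 = (cmod \<beta>)\<^sup>2 * (cmod (a y w))\<^sup>2"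
        by (simp add: norm_mult power_mult_distrib)
      have n3: "2 * Re (of_real \<alpha> * z) = 2 * \<alpha> * Re z" by simp
      show ?thesis unfolding app_f[OF that] exp cross n1 n2 n3[unfolded z_def] z_def ..
    qed
    then have "sqnorm (app f) = (\<Sum>y<n. \<alpha>\<^sup>2 * (cmod (a y u))\<^sup>2 + (cmod \<beta>)\<^sup>2 * (cmod (a y w))\<^sup>2
        + 2 * \<alpha> * Re (cnj \<beta> * (a w y * a y u)))"
      unfolding sqnorm_def by (intro sum.cong) auto
    also have "\<dots> = \<alpha>\<^sup>2 * deg u + (cmod \<beta>)\<^sup>2 * deg w + 2 * \<alpha> * Re (cnj \<beta> * \<beta>)"
      unfolding deg_def \<beta>_def paths2_def
      by (simp only: sum.distrib sum_distrib_left Re_sum cnj_sum)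
    also have "Re (cnj \<beta> * \<beta>) = (cmod \<beta>)\<^sup>2"
      by (simp only: cmod_power2) (simp add: power2_eq_square)
    finally show ?thesis .
  qed
  ultimately have "\<alpha> * (cmod \<beta>)\<^sup>2 < \<alpha> * (\<alpha> * (4 - deg u))"
    unfolding \<alpha>_def by (simp add: algebra_simps power2_eq_square)
  then have "(cmod \<beta>)\<^sup>2 < \<alpha> * (4 - deg u)" using \<alpha> by simp
  then show ?thesis using paths2_herm[OF u w] by (simp add: \<alpha>_def \<beta>_def mult.commute)
qed

text \<open>More than six vertices: configurations in which every listed vertex has all its
  neighbours in the list are excluded by this edge.\<close>

lemma closed_large:
  assumes "length xs \<le> 6" "set xs \<subseteq> {..<n}" "xs \<noteq> []"
  obtains x y where "x \<in> set xs" "y < n" "y \<notin> set xs" "a x y \<noteq> 0"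
proof -
  have "set xs \<noteq> {..<n}" using assms size card_length[of xs] by (metis card_lessThan le_trans not_le)
  with connected[of "set xs"] assms that show ?thesis by auto
qed

end

section \<open>Graphs with an edge of norm at least two\<close>

definition path_pattern :: "real \<Rightarrow> nat \<Rightarrow> nat \<Rightarrow> nat \<Rightarrow> real" where
  "path_pattern c n i j =
     (if i + j = 1 then 2 else if j = i + 1 \<or> i = j + 1 then 1
      else if i = n - 1 \<and> j = n - 1 then c else 0)"

definition cycle_pattern :: "nat \<Rightarrow> nat \<Rightarrow> nat \<Rightarrow> real" where
  "cycle_pattern n i j =
     (if j = i + 1 \<or> i = j + 1 \<or> i = 0 \<and> j = n - 1 \<or> i = n - 1 \<and> j = 0 then 1 else 0)"

text \<open>Only squared moduli are recorded, since these are common to all graphs of a template.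
  \<open>path_pattern 1 n\<close> is the shape of \<open>template_P n\<close>;
  \<open>path_pattern 0 n\<close> lacks the final charge and is the shape of the first
  \<open>n\<close> vertices of \<open>template_P (n + 1)\<close>.\<close>

definition has_pattern :: "nat \<Rightarrow> (nat \<Rightarrow> nat \<Rightarrow> real) \<Rightarrow> (nat \<Rightarrow> nat \<Rightarrow> complex) \<Rightarrow> bool" where
  "has_pattern n P a \<longleftrightarrow> (\<exists>p. bij_betw p {..<n} {..<n} \<and>
     (\<forall>i<n. \<forall>j<n. (cmod (a (p i) (p j)))\<^sup>2 = P i j))"

context small_span_weights
begin

lemma paths2_supp:
  assumes "F \<subseteq> {..<n}" "\<And>x. x < n \<Longrightarrow> x \<notin> F \<Longrightarrow> a u x = 0 \<or> a x w = 0"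
  shows "paths2 u w = (\<Sum>x\<in>F. a u x * a x w)"
  unfolding paths2_def using assms by (intro sum.mono_neutral_right) auto

text \<open>An initial segment of the path that is being uncovered: its first edge has norm two, and
  every vertex but the last already has all its neighbours in the segment. Charge and outer
  neighbours of the last vertex stay open.\<close>

definition chain :: "nat \<Rightarrow> (nat \<Rightarrow> nat) \<Rightarrow> bool" where
  "chain m p \<longleftrightarrow> m \<ge> 2 \<and> inj_on p {..<m} \<and> p ` {..<m} \<subseteq> {..<n} \<and>
     (\<forall>i<m. \<forall>j<m. \<not> (i = m - 1 \<and> j = m - 1) \<longrightarrow>
        (cmod (a (p i) (p j)))\<^sup>2 = path_pattern 0 m i j) \<and>
     (\<forall>i<m - 1. \<forall>x<n. x \<notin> p ` {..<m} \<longrightarrow> a x (p i) = 0)"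

lemma chain_entry:
  "chain m p \<Longrightarrow> i < m \<Longrightarrow> j < m \<Longrightarrow> \<not> (i = m - 1 \<and> j = m - 1) \<Longrightarrow>
     (cmod (a (p i) (p j)))\<^sup>2 = path_pattern 0 m i j"
  unfolding chain_def by blast

lemma chain_vertex: "chain m p \<Longrightarrow> i < m \<Longrightarrow> p i < n"
  unfolding chain_def by blast

lemma chain_entry_0:
  assumes "chain m p" "i < m" "j < m" "i + 1 < j \<or> j + 1 < i \<or> (i = j \<and> i < m - 1)"
  shows "a (p i) (p j) = 0"
proof -
  have "i + j \<noteq> 1" using assms(4) by presburger
  then show ?thesis
    using chain_entry[OF assms(1-3)] assms by (auto simp: path_pattern_def split: if_splits)
qed

lemma chain_mult:
  assumes "chain m p" "1 \<le> k" "k + 1 < m"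
  shows "a (p k) (p (k + 1)) * a (p (k + 1)) (p k) = 1"
    "cmod (a (p k) (p (k + 1))) = 1" "cmod (a (p (k + 1)) (p k)) = 1"
proof -
  have 1: "(cmod (a (p k) (p (k + 1))))\<^sup>2 = 1"
    using chain_entry[OF assms(1), of k "k + 1"] assms by (auto simp: path_pattern_def)
  show 2: "a (p k) (p (k + 1)) * a (p (k + 1)) (p k) = 1"
    using chain_vertex[OF assms(1)] assms(3) by (subst mult_sym, simp_all only: 1) auto
  show "cmod (a (p k) (p (k + 1))) = 1" using 1 norm_ge_zero[of "a (p k) (p (k + 1))"]
    unfolding power2_eq_1_iff by linarith
  then show "cmod (a (p (k + 1)) (p k)) = 1"
    using cmod_sym[of "p k" "p (k + 1)"] chain_vertex[OF assms(1)] assms(3) by simp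
qed

text \<open>The vector below is the restriction to one colour class of the null vector
  \<open>(1, \<surd>2, \<surd>2, \<dots>)\<close> of the affine diagram that the chain is about to become.\<close>

lemma chain_vector:
  assumes c: "chain m p" and k: "1 \<le> k" "k < m"
  shows "\<exists>g. (\<forall>j>k. g j = 0) \<and> g (k - 1) = 0 \<and> (cmod (g k))\<^sup>2 = 2 \<and>
     (\<Sum>j\<le>k. a (p (k - 1)) (p j) * g j) \<noteq> 0 \<and>
     4 * (\<Sum>j\<le>k. (cmod (g j))\<^sup>2) - 4 \<le> (\<Sum>i<k. (cmod (\<Sum>j\<le>k. a (p i) (p j) * g j))\<^sup>2)"
  using k
proof (induction k rule: less_induct)
  case (less k)
  have "k = 1 \<or> k = 2 \<or> k = (k - 2) + 2 \<and> k - 2 \<ge> 1" using less.prems by arith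
  then consider "k = 1" | "k = 2" | l where "k = l + 2" "l \<ge> 1" by blast
  then show ?case
  proof cases
    case 1
    \<comment> \<open>The scale \<open>|g k|^2 = 2\<close> is chosen so that both parities of
      \<open>k\<close> start with the same deficit 4.\<close>
    define g where "g = (\<lambda>j::nat. if j = 1 then complex_of_real (sqrt 2) else 0)"
    have e: "(cmod (a (p 0) (p 1)))\<^sup>2 = 2"
      using chain_entry[OF c, of 0 1] less.prems 1 by (auto simp: path_pattern_def)
    have s: "{..1::nat} = {0, 1}" by auto
    have row: "(\<Sum>j\<le>1. a (p 0) (p j) * g j) = a (p 0) (p 1) * sqrt 2"
      by (simp add: s g_def)
    show ?thesis unfolding 1
      by (rule exI[of _ g]) (use e in \<open>auto simp: row[simplified] s g_def norm_mult power_mult_distrib lessThan_Suc\<close>)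
  next
    case 2
    then have m: "2 < m" using less.prems by simp
    have e10: "(cmod (a (p 1) (p 0)))\<^sup>2 = 2"
      using chain_entry[OF c, of 1 0] m by (auto simp: path_pattern_def)
    have e12: "a (p 1) (p 2) * a (p 2) (p 1) = 1" "cmod (a (p 2) (p 1)) = 1"
      using chain_mult[OF c, of 1] m by (auto simp: numeral_2_eq_2)
    define z where "z = a (p 2) (p 1) * a (p 1) (p 0)"
    define g where "g = (\<lambda>j::nat. if j = 0 then 1 else if j = 2 then z else 0)"
    have zn: "(cmod z)\<^sup>2 = 2" using e10 e12 by (simp add: z_def norm_mult power_mult_distrib)
    have s: "{..2::nat} = {0, 1, 2}" by auto
    have row: "(\<Sum>j\<le>2. a (p 1) (p j) * g j) = 2 * a (p 1) (p 0)"
      using e12 by (simp add: s g_def z_def mult.assoc[symmetric])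
    have "(cmod (2 * a (p 1) (p 0)))\<^sup>2 = 8" using e10 by (simp add: norm_mult power_mult_distrib)
    moreover have "{..<2::nat} = {0, 1}" by auto
    ultimately have "8 \<le> (\<Sum>i<2. (cmod (\<Sum>j\<le>2. a (p i) (p j) * g j))\<^sup>2)"
      by (simp add: row[unfolded One_nat_def])
    moreover have "a (p 1) (p 0) \<noteq> 0" using e10 by auto
    moreover have "(\<Sum>j\<le>2. (cmod (g j))\<^sup>2) = 3" using zn by (simp add: s g_def)
    ultimately show ?thesis unfolding 2
      by (intro exI[of _ g]) (use zn row in \<open>auto simp: g_def\<close>)
  next
    case 3
    have l: "l < k" "l < m" using 3 less.prems by auto
    from less.IH[OF l(1) 3(2) l(2)] obtain g where
      g0: "\<forall>j>l. g j = 0" and gl: "g (l - 1) = 0" and gn: "(cmod (g l))\<^sup>2 = 2"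
      and gs: "4 * (\<Sum>j\<le>l. (cmod (g j))\<^sup>2) - 4 \<le> (\<Sum>i<l. (cmod (\<Sum>j\<le>l. a (p i) (p j) * g j))\<^sup>2)"
      by blast
    have m: "l + 2 < m" using 3 less.prems by simp
    have e1: "a (p (l + 1)) (p (l + 2)) * a (p (l + 2)) (p (l + 1)) = 1"
      "cmod (a (p (l + 2)) (p (l + 1))) = 1"
      using chain_mult[OF c, of "l + 1"] m 3 by (auto simp: numeral_2_eq_2)
    have e0: "cmod (a (p (l + 1)) (p l)) = 1" using chain_mult[OF c, of l] m 3 by simp
    \<comment> \<open>The value at \<open>l\<close> is transported along two unit edges, so
      \<open>l\<close> and \<open>l + 2\<close> contribute equally to the row between them. That row
      becomes 8 in square, four times the new \<open>|z|^2 = 2\<close>, and the deficit stays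
      4.\<close>
    define z where "z = a (p (l + 2)) (p (l + 1)) * a (p (l + 1)) (p l) * g l"
    define h where "h = g(l + 2 := z)"
    have zn: "(cmod z)\<^sup>2 = 2" using e0 e1 gn by (simp add: z_def norm_mult power_mult_distrib)
    have spl: "(\<Sum>j\<le>l + 2. F j * h j) = (\<Sum>j\<le>l. F j * g j) + F (l + 2) * z" for F :: "nat \<Rightarrow> complex"
    proof -
      have "(\<Sum>j\<le>l + 2. F j * h j) = (\<Sum>j\<le>l. F j * h j) + F (l + 1) * h (l + 1) + F (l + 2) * h (l + 2)"
        by (simp add: numeral_2_eq_2)
      moreover have "(\<Sum>j\<le>l. F j * h j) = (\<Sum>j\<le>l. F j * g j)"
        by (rule sum.cong) (auto simp: h_def)
      ultimately show ?thesis using g0 by (simp add: h_def)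
    qed
    have old: "(\<Sum>j\<le>l + 2. a (p i) (p j) * h j) = (\<Sum>j\<le>l. a (p i) (p j) * g j)" if "i < l" for i
      unfolding spl using chain_entry_0[OF c, of i "l + 2"] that m by simp
    have new: "(\<Sum>j\<le>l + 2. a (p (l + 1)) (p j) * h j) = 2 * (a (p (l + 1)) (p l) * g l)"
    proof -
      have "(\<Sum>j\<le>l. a (p (l + 1)) (p j) * g j) = (\<Sum>j\<in>{l}. a (p (l + 1)) (p j) * g j)"
        using chain_entry_0[OF c, of "l + 1"] m by (intro sum.mono_neutral_right) auto
      moreover have "a (p (l + 1)) (p (l + 2)) * z = a (p (l + 1)) (p l) * g l"
        using e1 by (simp add: z_def mult.assoc[symmetric])
      ultimately show ?thesis unfolding spl by simp
    qed
    have newn: "(cmod (2 * (a (p (l + 1)) (p l) * g l)))\<^sup>2 = 8"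
      using e0 gn by (simp add: norm_mult power_mult_distrib)
    have "(\<Sum>j\<le>l + 2. (cmod (h j))\<^sup>2) = (\<Sum>j\<le>l. (cmod (g j))\<^sup>2) + 2"
    proof -
      have "(\<Sum>j\<le>l + 2. (cmod (h j))\<^sup>2) = (\<Sum>j\<le>l. (cmod (h j))\<^sup>2) + (cmod (h (l + 1)))\<^sup>2 + (cmod (h (l + 2)))\<^sup>2"
        by (simp add: numeral_2_eq_2)
      moreover have "(\<Sum>j\<le>l. (cmod (h j))\<^sup>2) = (\<Sum>j\<le>l. (cmod (g j))\<^sup>2)"
        by (rule sum.cong) (auto simp: h_def)
      ultimately show ?thesis using g0 zn by (simp add: h_def)
    qed
    moreover have "(\<Sum>i<l + 2. (cmod (\<Sum>j\<le>l + 2. a (p i) (p j) * h j))\<^sup>2)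
        \<ge> (\<Sum>i<l. (cmod (\<Sum>j\<le>l. a (p i) (p j) * g j))\<^sup>2) + 8"
    proof -
      define R where "R = (\<lambda>i. (cmod (\<Sum>j\<le>l + 2. a (p i) (p j) * h j))\<^sup>2)"
      have "sum R {..<l + 2} = sum R {..<l} + R l + R (l + 1)" by (simp add: numeral_2_eq_2)
      moreover have "R l \<ge> 0" by (simp add: R_def)
      moreover have "R (l + 1) = 8" unfolding R_def new by (rule newn)
      moreover have "sum R {..<l} = (\<Sum>i<l. (cmod (\<Sum>j\<le>l. a (p i) (p j) * g j))\<^sup>2)"
      proof (rule sum.cong[OF refl])
        fix i assume "i \<in> {..<l}"
        then show "R i = (cmod (\<Sum>j\<le>l. a (p i) (p j) * g j))\<^sup>2"
          unfolding R_def by (subst old) auto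
      qed
      ultimately show ?thesis by (simp add: R_def)
    qed
    ultimately have "4 * (\<Sum>j\<le>l + 2. (cmod (h j))\<^sup>2) - 4 \<le> (\<Sum>i<l + 2. (cmod (\<Sum>j\<le>l + 2. a (p i) (p j) * h j))\<^sup>2)"
      using gs by linarith
    moreover have "2 * (a (p (l + 1)) (p l) * g l) \<noteq> 0" using newn by auto
    then have "(\<Sum>j\<le>l + 2. a (p (l + 2 - 1)) (p j) * h j) \<noteq> 0" using new by simp
    moreover have "\<forall>j>l + 2. h j = 0" "h (l + 2 - 1) = 0" "(cmod (h (l + 2)))\<^sup>2 = 2"
      using g0 zn by (auto simp: h_def)
    ultimately show ?thesis unfolding 3(1) by blast
  qed
qed

text \<open>For the vector of \<open>chain_vector\<close> the rows inside the chain fall short of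
  the bound by at most 4, and every remaining row, that of the last vertex included, adds twice the
  squared weight towards the last vertex. These squared weights therefore total less than 2.\<close>

lemma chain_end:
  assumes c: "chain m p"
  shows "deg (p (m - 1)) < (cmod (a (p (m - 2)) (p (m - 1))))\<^sup>2 + 2"
proof -
  define k where "k = m - 1"
  have m2: "m \<ge> 2" using c by (simp add: chain_def)
  have k: "1 \<le> k" "k < m" using m2 by (auto simp: k_def)
  obtain g where g0: "\<forall>j>k. g j = 0" and gl: "g (k - 1) = 0" and gn: "(cmod (g k))\<^sup>2 = 2"
    and nz: "(\<Sum>j\<le>k. a (p (k - 1)) (p j) * g j) \<noteq> 0"
    and gs: "4 * (\<Sum>j\<le>k. (cmod (g j))\<^sup>2) - 4 \<le> (\<Sum>i<k. (cmod (\<Sum>j\<le>k. a (p i) (p j) * g j))\<^sup>2)"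
    using chain_vector[OF c k] by blast
  have mk: "{..<m} = insert k {..<k}" using m2 by (auto simp: k_def)
  have inj: "inj_on p {..k}"
    using c k unfolding chain_def by (auto intro: inj_on_subset)
  have V: "p i < n" if "i \<le> k" for i using chain_vertex[OF c] that k by simp
  \<comment> \<open>The support is cut down to the nonzero coordinates, so that
    \<open>p (k - 1)\<close> lies outside it and can serve as the witness of
    \<open>vector_bound\<close>.\<close>
  define J where "J = {j. j \<le> k \<and> g j \<noteq> 0}"
  define X where "X = p ` J"
  define f where "f = (\<lambda>x. g (inv_into {..k} p x))"
  have fp: "f (p j) = g j" if "j \<le> k" for j using inj that by (simp add: f_def)
  have injJ: "inj_on p J" by (rule inj_on_subset[OF inj]) (auto simp: J_def)
  have X: "X \<subseteq> {..<n}" using V by (auto simp: X_def J_def)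
  have row: "(\<Sum>x\<in>X. a y x * f x) = (\<Sum>j\<le>k. a y (p j) * g j)" for y
  proof -
    have "(\<Sum>x\<in>X. a y x * f x) = (\<Sum>j\<in>J. a y (p j) * g j)"
      unfolding X_def using injJ fp by (simp add: sum.reindex J_def)
    also have "\<dots> = (\<Sum>j\<le>k. a y (p j) * g j)"
      by (rule sum.mono_neutral_left) (auto simp: J_def)
    finally show ?thesis .
  qed
  have nrm: "(\<Sum>x\<in>X. (cmod (f x))\<^sup>2) = (\<Sum>j\<le>k. (cmod (g j))\<^sup>2)"
  proof -
    have "(\<Sum>x\<in>X. (cmod (f x))\<^sup>2) = (\<Sum>j\<in>J. (cmod (g j))\<^sup>2)"
      unfolding X_def using injJ fp by (simp add: sum.reindex J_def)
    also have "\<dots> = (\<Sum>j\<le>k. (cmod (g j))\<^sup>2)"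
      by (rule sum.mono_neutral_left) (auto simp: J_def)
    finally show ?thesis .
  qed
  have notX: "p (k - 1) \<notin> X"
    using inj gl k by (auto simp: X_def J_def inj_on_eq_iff)
  have bound: "(\<Sum>y<n. (cmod (\<Sum>j\<le>k. a y (p j) * g j))\<^sup>2) < 4 * (\<Sum>j\<le>k. (cmod (g j))\<^sup>2)"
    using vector_bound[OF X, of "{..<n}" "p (k - 1)" f] V[of "k - 1"] notX nz by (simp add: row nrm)
  define R where "R = (\<lambda>y. (cmod (\<Sum>j\<le>k. a y (p j) * g j))\<^sup>2)"
  define P where "P = p ` {..<k}"
  have P: "P \<subseteq> {..<n}" using V by (auto simp: P_def)
  have "sum R {..<n} = sum R P + sum R ({..<n} - P)"
    using P by (metis finite_lessThan sum.subset_diff add.commute)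
  moreover have "sum R P = (\<Sum>i<k. R (p i))"
    unfolding P_def using inj by (subst sum.reindex) (auto intro: inj_on_subset)
  moreover have "sum R ({..<n} - P) = (\<Sum>y\<in>{..<n} - P. 2 * (cmod (a y (p k)))\<^sup>2)"
  proof (rule sum.cong[OF refl])
    fix y assume y: "y \<in> {..<n} - P"
    have "a y (p j) * g j = 0" if "j < k" for j
    proof (cases "y = p k")
      case True
      show ?thesis
      proof (cases "j = k - 1")
        case False
        then show ?thesis using True chain_entry_0[OF c, of k j] that k by simp
      qed (use gl in simp)
    next
      case False
      then have "y \<notin> p ` {..<m}"
        using y mk by (auto simp: P_def)
      then have "a y (p j) = 0" using c y that unfolding chain_def k_def by auto
      then show ?thesis by simp
    qed
    then have "(\<Sum>j<k. a y (p j) * g j) = 0" by (intro sum.neutral) auto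
    then have "(\<Sum>j\<le>k. a y (p j) * g j) = a y (p k) * g k"
      by (simp add: lessThan_Suc_atMost[symmetric])
    then show "R y = 2 * (cmod (a y (p k)))\<^sup>2"
      using gn by (simp add: R_def norm_mult power_mult_distrib)
  qed
  ultimately have "2 * (\<Sum>y\<in>{..<n} - P. (cmod (a y (p k)))\<^sup>2) < 4"
    using bound gs by (simp add: R_def sum_distrib_left)
  moreover have "deg (p k) = (\<Sum>y\<in>{..<n} - P. (cmod (a y (p k)))\<^sup>2) + (\<Sum>y\<in>P. (cmod (a y (p k)))\<^sup>2)"
    unfolding deg_def using P by (metis finite_lessThan sum.subset_diff)
  moreover have "(\<Sum>y\<in>P. (cmod (a y (p k)))\<^sup>2) = (\<Sum>y\<in>{p (k - 1)}. (cmod (a y (p k)))\<^sup>2)"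
  proof (rule sum.mono_neutral_right)
    show "\<forall>y\<in>P - {p (k - 1)}. (cmod (a y (p k)))\<^sup>2 = 0"
    proof
      fix y assume "y \<in> P - {p (k - 1)}"
      then obtain j where j: "j < k" "y = p j" "j \<noteq> k - 1" by (auto simp: P_def)
      then show "(cmod (a y (p k)))\<^sup>2 = 0" using chain_entry_0[OF c, of j k] k by simp
    qed
  qed (use k in \<open>auto simp: P_def\<close>)
  ultimately show ?thesis
    by (simp add: k_def numeral_2_eq_2)
qed

end

text \<open>The interface shared by imaginary and real fields. \<open>orthogonal\<close> is an
  assumption because its proofs differ: the squared modulus is an integer in one case, the product
  of the two conjugates in the other.\<close>

locale integral_weights = small_span_weights +
  assumes nat_norm: "\<And>i j. i < n \<Longrightarrow> j < n \<Longrightarrow> (cmod (a i j))\<^sup>2 \<in> \<nat>"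
    and orthogonal: "\<And>u w. u < n \<Longrightarrow> w < n \<Longrightarrow> u \<noteq> w \<Longrightarrow> a u w = 0 \<Longrightarrow>
      deg u = 3 \<Longrightarrow> deg w = 3 \<Longrightarrow> paths2 u w = 0"
begin

lemma norm_ge_1: "i < n \<Longrightarrow> j < n \<Longrightarrow> a i j \<noteq> 0 \<Longrightarrow> (cmod (a i j))\<^sup>2 \<ge> 1"
  using nat_norm[of i j] by (metis Nats_cases Suc_leI neq0_conv norm_eq_zero of_nat_0 of_nat_1 of_nat_le_iff power_eq_0_iff One_nat_def of_nat_eq_0_iff)

lemma deg_le_3: assumes "v < n" shows "deg v \<le> 3"
proof -
  have sumN: "sum f S \<in> \<nat>" if "\<And>x. x \<in> S \<Longrightarrow> f x \<in> \<nat>" for f :: "nat \<Rightarrow> real" and S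
    using that by (induction S rule: infinite_finite_induct) auto
  have "deg v \<in> \<nat>" unfolding deg_def using nat_norm assms by (intro sumN) auto
  then obtain k where k: "deg v = of_nat k" by (auto elim: Nats_cases)
  then show ?thesis using deg_less_4[OF assms] by simp
qed

lemma saturated:
  assumes "v < n" "F \<subseteq> {..<n}" "(\<Sum>x\<in>F. (cmod (a x v))\<^sup>2) \<ge> 3"
  shows "deg v = 3" "\<And>x. x < n \<Longrightarrow> x \<notin> F \<Longrightarrow> a x v = 0" "\<And>x. x < n \<Longrightarrow> x \<notin> F \<Longrightarrow> a v x = 0"
proof -
  show "deg v = 3" using deg_le_3[OF assms(1)] deg_ge[OF assms(2), of v] assms(3) by simp
  show *: "a x v = 0" if "x < n" "x \<notin> F" for x
  proof (rule ccontr)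
    assume "a x v \<noteq> 0"
    then have "(cmod (a x v))\<^sup>2 \<ge> 1" using norm_ge_1 that assms by simp
    moreover have "finite F" using assms finite_subset by blast
    ultimately have "(\<Sum>y\<in>insert x F. (cmod (a y v))\<^sup>2) \<ge> 4" using that assms by simp
    then show False using deg_ge[of "insert x F" v] deg_le_3[OF assms(1)] that assms by simp
  qed
  show "a v x = 0" if "x < n" "x \<notin> F" for x using *[OF that] zero_sym[of v x] assms that by simp
qed

text \<open>By \<open>chain_end\<close> the last vertex has at most one further weight, of norm one.
  None at all ends the path without a charge, a loop ends it with a charge, and a new vertex
  lengthens the chain.\<close>

lemma chain_step:
  assumes c: "chain m p"
  shows "(\<exists>q. chain (m + 1) q) \<or> (\<exists>e\<in>{0,1}. has_pattern n (path_pattern e n) a)"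
proof -
  have m2: "m \<ge> 2" using c by (simp add: chain_def)
  define z where "z = p (m - 1)"
  define y where "y = p (m - 2)"
  have inj: "inj_on p {..<m}" and img: "p ` {..<m} \<subseteq> {..<n}" using c by (auto simp: chain_def)
  have V: "z < n" "y < n" using chain_vertex[OF c] m2 by (auto simp: z_def y_def)
  have end_bound: "deg z < (cmod (a y z))\<^sup>2 + 2" using chain_end[OF c] by (simp add: z_def y_def)
  have yz: "y \<noteq> z" using inj m2 by (auto simp: y_def z_def inj_on_eq_iff)
  have closed_case: "n = m \<and> bij_betw p {..<n} {..<n}" if cl: "\<And>x. x < n \<Longrightarrow> x \<notin> p ` {..<m} \<Longrightarrow> a x z = 0"
  proof -
    have "p ` {..<m} = {..<n}"
    proof (rule connected[OF img])
      show "p ` {..<m} \<noteq> {}" using m2 by (auto simp: lessThan_empty_iff)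
      fix x w assume "x \<in> p ` {..<m}" and w: "w < n" and nz: "a x w \<noteq> 0"
      then obtain i where i: "i < m" "x = p i" by auto
      show "w \<in> p ` {..<m}"
      proof (rule ccontr)
        assume nw: "w \<notin> p ` {..<m}"
        have "a w x = 0"
        proof (cases "i = m - 1")
          case True then show ?thesis using cl[OF w nw] i by (simp add: z_def)
        next
          case False then show ?thesis using c i w nw unfolding chain_def by auto
        qed
        then show False using nz zero_sym[OF w chain_vertex[OF c i(1)]] i by simp
      qed
    qed
    moreover from this have "n = m" using inj card_image by fastforce
    ultimately show ?thesis using inj by (simp add: bij_betw_def)
  qed
  show ?thesis
  proof (cases "\<forall>x<n. x \<noteq> y \<longrightarrow> a x z = 0")
    case True
    then have cl: "\<And>x. x < n \<Longrightarrow> x \<notin> p ` {..<m} \<Longrightarrow> a x z = 0"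
      using m2 by (auto simp: y_def)
    have "a z z = 0" using True V yz by auto
    then have "(cmod (a (p i) (p j)))\<^sup>2 = path_pattern 0 n i j" if "i < n" "j < n" for i j
      using chain_entry[OF c, of i j] closed_case[OF cl] that
      by (cases "i = m - 1 \<and> j = m - 1") (use m2 in \<open>auto simp: path_pattern_def z_def\<close>)
    then have "has_pattern n (path_pattern 0 n) a"
      unfolding has_pattern_def using closed_case[OF cl] by blast
    then show ?thesis by blast
  next
    case False
    then obtain x where x: "x < n" "x \<noteq> y" "a x z \<noteq> 0" by blast
    have others: "a w z = 0" if "w < n" "w \<noteq> x" "w \<noteq> y" for w
    proof (rule ccontr)
      assume "a w z \<noteq> 0"
      then have "(\<Sum>v\<in>{w, x, y}. (cmod (a v z))\<^sup>2) \<ge> 2 + (cmod (a y z))\<^sup>2"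
        using norm_ge_1[of w z] norm_ge_1[of x z] x V that by simp
      then show False using deg_ge[of "{w, x, y}" z] end_bound x V that by simp
    qed
    have nx: "(cmod (a x z))\<^sup>2 = 1"
    proof -
      have "(\<Sum>v\<in>{x, y}. (cmod (a v z))\<^sup>2) \<le> deg z" using x V by (intro deg_ge) auto
      then have "(cmod (a x z))\<^sup>2 < 2" using end_bound x by simp
      moreover have "(cmod (a x z))\<^sup>2 \<ge> 1" using norm_ge_1 x V by simp
      moreover obtain k where "(cmod (a x z))\<^sup>2 = of_nat k" using nat_norm[OF x(1) V(1)] by (auto elim: Nats_cases)
      ultimately show ?thesis by simp
    qed
    show ?thesis
    proof (cases "x = z")
      case True
      then have cl: "\<And>w. w < n \<Longrightarrow> w \<notin> p ` {..<m} \<Longrightarrow> a w z = 0"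
        using others m2 by (fastforce simp: y_def z_def)
      have "(cmod (a (p i) (p j)))\<^sup>2 = path_pattern 1 n i j" if "i < n" "j < n" for i j
        using chain_entry[OF c, of i j] closed_case[OF cl] that nx True
        by (cases "i = m - 1 \<and> j = m - 1") (use m2 in \<open>auto simp: path_pattern_def z_def\<close>)
      then have "has_pattern n (path_pattern 1 n) a"
        unfolding has_pattern_def using closed_case[OF cl] by blast
      then show ?thesis by blast
    next
      case False
      have out: "x \<notin> p ` {..<m}"
      proof
        assume "x \<in> p ` {..<m}"
        then obtain i where i: "i < m" "x = p i" by auto
        with x False have "i \<noteq> m - 1" "i \<noteq> m - 2" by (auto simp: y_def z_def)
        then have "a (p i) (p (m - 1)) = 0" using chain_entry_0[OF c, of i "m - 1"] i m2 by auto
        then show False using x i by (simp add: z_def)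
      qed
      define q where "q = p(m := x)"
      have img_q: "q ` {..<m + 1} = insert x (p ` {..<m})"
        by (auto simp: q_def lessThan_Suc)
      have inj_q: "inj_on q {..<m + 1}"
        unfolding lessThan_Suc[of m, simplified, folded Suc_eq_plus1] using inj out
        by (auto simp: q_def inj_on_def)
      have cl: "a w (q i) = 0" if "i < m" "w < n" "w \<notin> q ` {..<m + 1}" for i w
      proof (cases "i = m - 1")
        case True
        have "y \<in> p ` {..<m}" using m2 by (auto simp: y_def)
        then have "w \<noteq> x" "w \<noteq> y" using that img_q by auto
        then show ?thesis using others that True m2 by (simp add: q_def z_def)
      next
        case False
        then show ?thesis using c that img_q unfolding chain_def by (auto simp: q_def)
      qed
      have zz: "a z z = 0" using others[of z] V False yz by auto
      have far: "a x (p i) = 0" if "i < m - 1" for i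
        using c out x that unfolding chain_def by blast
      have pat: "(cmod (a (q i) (q j)))\<^sup>2 = path_pattern 0 (m + 1) i j"
        if "i < m + 1" "j < m + 1" "\<not> (i = m \<and> j = m)" for i j
      proof -
        have row: "(cmod (a x (p j)))\<^sup>2 = path_pattern 0 (m + 1) m j" if "j < m" for j
          using far[of j] nx that m2 by (cases "j = m - 1") (auto simp: path_pattern_def z_def)
        have "i = m \<and> j < m \<or> j = m \<and> i < m \<or> i < m \<and> j < m"
          using that by auto
        then consider "i = m" "j < m" | "j = m" "i < m" | "i < m" "j < m" "\<not> (i = m - 1 \<and> j = m - 1)" |
          "i = m - 1" "j = m - 1" by blast
        then show ?thesis
        proof cases
          case 1 then show ?thesis using row by (simp add: q_def)
        next
          case 2
          have "path_pattern 0 (m + 1) i m = path_pattern 0 (m + 1) m i"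
            by (auto simp: path_pattern_def)
          then show ?thesis using row[of i] cmod_sym[OF x(1) chain_vertex[OF c, of i]] 2
            by (simp add: q_def)
        next
          case 3
          then show ?thesis using chain_entry[OF c 3] by (auto simp: q_def path_pattern_def)
        next
          case 4
          then show ?thesis using zz m2 by (auto simp: q_def path_pattern_def z_def)
        qed
      qed
      have "chain (m + 1) q"
        unfolding chain_def using m2 inj_q img_q img x pat cl by auto
      then show ?thesis by blast
    qed
  qed
qed

lemma chain_pattern:
  assumes "chain m p"
  shows "\<exists>e\<in>{0,1}. has_pattern n (path_pattern e n) a"
  using assms
proof (induction "n - m" arbitrary: m p rule: less_induct)
  case less
  have le: "m \<le> n" if "chain m p" for m p
    using that card_mono[of "{..<n}" "p ` {..<m}"] by (auto simp: chain_def card_image)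
  show ?case
  proof (cases "\<exists>q. chain (m + 1) q")
    case True
    then obtain q where q: "chain (m + 1) q" by blast
    have "n - (m + 1) < n - m" using le[OF q] by simp
    from less.hyps[OF this q] show ?thesis .
  next
    case False
    then show ?thesis using chain_step[OF less.prems] by blast
  qed
qed

lemma leaf_pattern:
  assumes "u < n" "v < n" "u \<noteq> v" "(cmod (a u v))\<^sup>2 = 2" "\<And>x. x < n \<Longrightarrow> x \<noteq> v \<Longrightarrow> a x u = 0"
  shows "\<exists>e\<in>{0,1}. has_pattern n (path_pattern e n) a"
proof (rule chain_pattern)
  have "{..<2::nat} = {0, 1}" by auto
  then show "chain 2 (\<lambda>i. if i = 0 then u else v)"
    using assms cmod_sym[of u v]
    by (auto simp: chain_def path_pattern_def inj_on_def less_2_cases_iff)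
qed

text \<open>Both ends of \<open>uv\<close> are saturated. If \<open>x\<close> and \<open>w\<close>
  are not adjacent, the walk from \<open>x\<close> to \<open>v\<close> has norm 2, against a bound
  of at most \<open>4 - 2\<close>. If they are, \<open>x\<close> has degree 3 too, and two walks of
  norms 2 and 1 would have to cancel.\<close>

lemma no_heavy_inner_edge:
  assumes V: "u < n" "v < n" "x < n" "w < n" "y < n"
    and dist: "u \<noteq> v" "x \<noteq> u" "x \<noteq> v" "w \<noteq> u" "w \<noteq> v" "x \<noteq> w" "y \<noteq> u" "y \<noteq> v" "y \<noteq> x" "y \<noteq> w"
    and uv: "(cmod (a u v))\<^sup>2 = 2" and xu: "a x u \<noteq> 0" and wv: "a w v \<noteq> 0" and yx: "a y x \<noteq> 0"
  shows False
proof -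
  have n1: "(cmod (a x u))\<^sup>2 \<ge> 1" "(cmod (a w v))\<^sup>2 \<ge> 1" "(cmod (a y x))\<^sup>2 \<ge> 1"
    using norm_ge_1 V xu wv yx by auto
  have vu: "(cmod (a v u))\<^sup>2 = 2" using cmod_sym[of u v] V uv by simp
  have satv: "(\<Sum>z\<in>{u, w}. (cmod (a z v))\<^sup>2) \<ge> 3" using n1 uv dist by simp
  have satu: "(\<Sum>z\<in>{v, x}. (cmod (a z u))\<^sup>2) \<ge> 3" using n1 vu dist by simp
  note sv = saturated[OF V(2) _ satv] and su = saturated[OF V(1) _ satu]
  have ux1: "(cmod (a x u))\<^sup>2 = 1"
    using deg_ge[of "{v, x}" u] deg_le_3[OF V(1)] n1 vu V dist by (intro antisym) simp_all
  have wv1: "(cmod (a w v))\<^sup>2 = 1"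
    using deg_ge[of "{u, w}" v] deg_le_3[OF V(2)] n1 uv V dist by (intro antisym) simp_all
  have xv: "a x v = 0" using sv(2)[of x] V dist by simp
  have s: "paths2 x v = a x u * a u v + a x w * a w v"
    using paths2_supp[of "{u, w}" x v] sv(2) V dist by auto
  have dv: "deg v = 3" using sv(1) V by simp
  have bound: "(cmod (paths2 x v))\<^sup>2 < (4 - deg x) * (4 - deg v)"
    using paths2_bound[of x v] V dist xv by simp
  have ux: "(cmod (a u x))\<^sup>2 = 1" using ux1 cmod_sym[of x u] V by simp
  show False
  proof (cases "a x w = 0")
    case True
    have "deg x \<ge> 2" using deg_ge[of "{u, y}" x] ux n1 V dist by simp
    moreover have "(cmod (paths2 x v))\<^sup>2 = 2"
      unfolding s using True ux1 uv by (simp add: norm_mult power_mult_distrib)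
    ultimately show False using bound dv by simp
  next
    case False
    then have "(cmod (a w x))\<^sup>2 \<ge> 1" using norm_ge_1 zero_sym[of x w] V by simp
    then have sat: "(\<Sum>z\<in>{u, y, w}. (cmod (a z x))\<^sup>2) \<ge> 3" using ux n1 dist by simp
    then have dx: "deg x = 3" using saturated(1)[OF V(3) _ sat] V by simp
    have "(cmod (a w x))\<^sup>2 = 1"
      using deg_ge[of "{u, y, w}" x] deg_le_3[OF V(3)] ux n1 V dist \<open>(cmod (a w x))\<^sup>2 \<ge> 1\<close> by (intro antisym) simp_all
    then have xw: "(cmod (a x w))\<^sup>2 = 1" using cmod_sym[of x w] V by simp
    have "paths2 x v = 0" using orthogonal[OF V(3,2) dist(3) xv dx dv] .
    then have "a x u * a u v = - (a x w * a w v)" unfolding s by (simp add: eq_neg_iff_add_eq_0)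
    then have "(cmod (a x u * a u v))\<^sup>2 = (cmod (a x w * a w v))\<^sup>2" by simp
    then show False using ux1 uv xw wv1 by (simp add: norm_mult power_mult_distrib)
  qed
qed

text \<open>Both ends are saturated. If \<open>v\<close> carries a charge (\<open>x = v\<close>), no
  edge leaves the pair; otherwise the walk from \<open>v\<close> to \<open>u\<close> through the
  charge has norm 2, while the bound is 1.\<close>

lemma heavy_edge_charge:
  assumes V: "u < n" "v < n" "u \<noteq> v" and uv: "(cmod (a u v))\<^sup>2 = 2" and uu: "a u u \<noteq> 0"
    and x: "x < n" "x \<noteq> u" "a x v \<noteq> 0"
  shows False
proof -
  have vu: "(cmod (a v u))\<^sup>2 = 2" using cmod_sym[of u v] V uv by simp
  have n1: "(cmod (a u u))\<^sup>2 \<ge> 1" "(cmod (a x v))\<^sup>2 \<ge> 1" using norm_ge_1 V x uu by auto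
  have satu: "(\<Sum>z\<in>{u, v}. (cmod (a z u))\<^sup>2) \<ge> 3" using n1 vu V by simp
  have satv: "(\<Sum>z\<in>{u, x}. (cmod (a z v))\<^sup>2) \<ge> 3" using n1 uv x by simp
  note su = saturated[OF V(1) _ satu] and sv = saturated[OF V(2) _ satv]
  have uu1: "(cmod (a u u))\<^sup>2 = 1"
    using deg_ge[of "{u, v}" u] deg_le_3[OF V(1)] n1 vu V by (intro antisym) simp_all
  show False
  proof (cases "x = v")
    case True
    obtain s t where "s \<in> {u, v}" "t < n" "t \<notin> {u, v}" "a s t \<noteq> 0"
      using closed_large[of "[u, v]"] V by auto
    then show False using su(3)[of t] sv(3)[of t] V True by auto
  next
    case False
    have "a v v = 0" using sv(2)[of v] V x False by auto
    then have s: "paths2 v u = a v u * a u u"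
      using paths2_supp[of "{u, v}" v u] su(2) V by auto
    have "(cmod (paths2 v u))\<^sup>2 < (4 - deg v) * (4 - deg u)"
      using V x False su(2)[of x] by (intro paths2_bound) auto
    then show False using s su(1) sv(1) V x vu uu1 by (simp add: norm_mult power_mult_distrib)
  qed
qed

text \<open>Degrees are at most 3, so the norm is 2 or 3. Norm 3 closes off a component of two
  vertices. At norm 2 an end without further weights starts a chain; otherwise both ends have a
  further neighbour, and a triangle or an edge leaving these four vertices gives a
  contradiction.\<close>

lemma heavy_edge_pattern:
  assumes V: "u < n" "v < n" "u \<noteq> v" and uv: "(cmod (a u v))\<^sup>2 \<ge> 2"
  shows "\<exists>e\<in>{0,1}. has_pattern n (path_pattern e n) a"
proof -
  obtain k where k: "(cmod (a u v))\<^sup>2 = real k" using nat_norm[OF V(1,2)] by (auto elim: Nats_cases)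
  have sym: "(cmod (a v u))\<^sup>2 = (cmod (a u v))\<^sup>2" using cmod_sym[of u v] V by simp
  have "real k \<le> 3" using entry_le_deg[of u v] deg_le_3[of v] V k by simp
  with uv k have "k = 2 \<or> k = 3" by auto
  then show ?thesis
  proof
    assume "k = 3"
    then have "(\<Sum>z\<in>{v}. (cmod (a z u))\<^sup>2) \<ge> 3" "(\<Sum>z\<in>{u}. (cmod (a z v))\<^sup>2) \<ge> 3" using k sym by auto
    note s = saturated(3)[OF V(1) _ this(1)] saturated(3)[OF V(2) _ this(2)]
    obtain s t where "s \<in> {u, v}" "t < n" "t \<notin> {u, v}" "a s t \<noteq> 0"
      using closed_large[of "[u, v]"] V by auto
    then show ?thesis using s V by auto
  next
    assume "k = 2"
    then have uv: "(cmod (a u v))\<^sup>2 = 2" and vu: "(cmod (a v u))\<^sup>2 = 2" using k sym by auto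
    show ?thesis
    proof (rule ccontr)
      assume no: "\<not> ?thesis"
      from no leaf_pattern[OF V uv] obtain x where x: "x < n" "x \<noteq> v" "a x u \<noteq> 0" by blast
      from no leaf_pattern[OF V(2,1) _ vu] V obtain w where w: "w < n" "w \<noteq> u" "a w v \<noteq> 0" by blast
      have xu: "x \<noteq> u" using heavy_edge_charge[OF V uv _ w] x by blast
      have wv: "w \<noteq> v" using heavy_edge_charge[OF V(2,1) _ vu _ x] V w by blast
      have n1: "(cmod (a x u))\<^sup>2 \<ge> 1" "(cmod (a w v))\<^sup>2 \<ge> 1" using norm_ge_1 V x w by auto
      have satu: "(\<Sum>z\<in>{v, x}. (cmod (a z u))\<^sup>2) \<ge> 3" using n1 vu x by simp
      have satv: "(\<Sum>z\<in>{u, w}. (cmod (a z v))\<^sup>2) \<ge> 3" using n1 uv w by simp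
      note su = saturated[OF V(1) _ satu] and sv = saturated[OF V(2) _ satv]
      have x1: "(cmod (a x u))\<^sup>2 = 1"
        using deg_ge[of "{v, x}" u] deg_le_3[OF V(1)] n1 vu V x by (intro antisym) simp_all
      have w1: "(cmod (a w v))\<^sup>2 = 1"
        using deg_ge[of "{u, w}" v] deg_le_3[OF V(2)] n1 uv V w by (intro antisym) simp_all
      have ch: "a u u = 0" "a v v = 0" using su(2)[of u] sv(2)[of v] V x w xu wv by auto
      have "x \<noteq> w"
      proof
        assume eq: "x = w"
        have "paths2 u v = a u x * a x v"
          using paths2_supp[of "{u, v, x}" u v] su(3) V x xu ch by auto
        moreover have "(cmod (paths2 u v))\<^sup>2 < (4 - deg u) * (4 - deg v)"
          using V ch by (intro paths2_bound) auto
        moreover have "(cmod (a u x))\<^sup>2 = 1" using x1 cmod_sym[of x u] V x by simp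
        ultimately show False using su(1) sv(1) V x w w1 eq by (simp add: norm_mult power_mult_distrib)
      qed
      obtain s t where st: "s \<in> {u, v, x, w}" "t < n" "t \<notin> {u, v, x, w}" "a s t \<noteq> 0"
        using closed_large[of "[u, v, x, w]"] V x w by auto
      then have "s = x \<or> s = w" using su(3)[of t] sv(3)[of t] V x w by auto
      then show False
      proof
        assume "s = x"
        then show False
          using no_heavy_inner_edge[of u v x w t] V x w xu wv st uv \<open>x \<noteq> w\<close> zero_sym[of t x] by auto
      next
        assume "s = w"
        then show False
          using no_heavy_inner_edge[of v u w x t] V x w xu wv st vu \<open>x \<noteq> w\<close> zero_sym[of t w] by auto
      qed
    qed
  qed
qed

end

section \<open>Unit weights: cycles of irrational gain\<close>

lemma cmod_lin:
  assumes "cmod g = 1"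
  shows "(cmod (of_real p + of_real q * g))\<^sup>2 = p\<^sup>2 + q\<^sup>2 + 2 * p * q * Re g"
proof -
  have "(Re g)\<^sup>2 + (Im g)\<^sup>2 = 1" using assms cmod_power2[of g] by simp
  then have "q\<^sup>2 * ((Re g)\<^sup>2 + (Im g)\<^sup>2) = q\<^sup>2" by simp
  then show ?thesis
    by (simp add: cmod_power2 power_mult_distrib algebra_simps power2_sum)
qed

text \<open>Here and in the following identities a primed or reversed name denotes the inverse. Each
  is certified by writing the difference of the two sides as an explicit combination of the
  hypotheses.\<close>

lemma gain_eq_minus_1:
  fixes x :: complex
  assumes "p * p' = 1" "q * q' = 1" "x * c + q' * p' = 0"
  shows "x * p * q * c = - 1"
proof -
  have "x * p * q * c - (- 1) = p * q * (x * c + q' * p') - (p * p' - 1) * (q * q') - (q * q' - 1)"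
    by (simp add: algebra_simps)
  then show ?thesis using assms by (simp add: eq_neg_iff_add_eq_0)
qed

lemma gain_eq_minus_1':
  fixes x :: complex
  assumes "x * y + p * q = 0" "p * p' = 1" "q * q' = 1"
  shows "x * y * q' * p' = - 1"
proof -
  have "x * y * q' * p' - (- 1) = q' * p' * (x * y + p * q) - (p * p' - 1) * (q * q') - (q * q' - 1)"
    by (simp add: algebra_simps)
  then show ?thesis using assms by (simp add: eq_neg_iff_add_eq_0)
qed

lemma factor_gain:
  fixes x :: complex
  assumes "p * p' = 1" "q * q' = 1"
  shows "x * y + p * q = (1 + x * y * q' * p') * (p * q)"
proof -
  have "(x * y + p * q) - (1 + x * y * q' * p') * (p * q) = - (x * y * ((p * p' - 1) * (q * q') + (q * q' - 1)))"
    by (simp add: algebra_simps)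
  then show ?thesis using assms by simp
qed

lemma ladder_alg:
  fixes pv :: complex
  assumes "pv * qp + wv * qw = 0" "wq * qw = 1" "pv * vp = 1"
  shows "wv * vp = - (wq * qp)"
proof -
  have "wv * vp - (- (wq * qp)) = wq * vp * (pv * qp + wv * qw) - wq * qp * (pv * vp - 1) - wv * vp * (wq * qw - 1)"
    by (simp add: algebra_simps)
  then show ?thesis using assms by (simp add: eq_neg_iff_add_eq_0)
qed

lemma ladder_alg2:
  fixes pq :: complex
  assumes "pq * qp = 1" "rq * qr = 1"
  shows "rq * (qp * (1 + pq * qr * rs * sp)) + rs * sp = rq * qp * (1 + 2 * (pq * qr * rs * sp))"
proof -
  have "(rq * (qp * (1 + pq * qr * rs * sp)) + rs * sp) - rq * qp * (1 + 2 * (pq * qr * rs * sp)) = - (rs * sp * ((pq * qp - 1) * (rq * qr) + (rq * qr - 1)))"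
    by (simp add: algebra_simps)
  then show ?thesis using assms by simp
qed

lemma square_alg:
  fixes pq :: complex
  assumes "sr * rs = 1" "rq * qr = 1" "pq * qp = 1"
  shows "sp * 5 + sr * (rq * qp * (4 + 3 * (pq * qr * rs * sp))) =
    sr * rq * qp * (4 + 8 * (pq * qr * rs * sp))"
proof -
  have "(sp * 5 + sr * (rq * qp * (4 + 3 * (pq * qr * rs * sp)))) - sr * rq * qp * (4 + 8 * (pq * qr * rs * sp)) = - (5 * sp * ((sr * rs - 1) * (rq * qr) * (pq * qp) + (rq * qr - 1) * (pq * qp) + (pq * qp - 1)))"
    by (simp add: algebra_simps)
  then show ?thesis using assms by simp
qed

lemma square_alg2:
  fixes pq :: complex
  assumes "pq * qp = 1" "qr * rq = 1"
  shows "qp * 2 + qr * (rq * qp + rs * sp) = qp * (3 + pq * qr * rs * sp)"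
proof -
  have "(qp * 2 + qr * (rq * qp + rs * sp)) - qp * (3 + pq * qr * rs * sp) = (qr * rq - 1) * qp - (pq * qp - 1) * (qr * rs * sp)"
    by (simp add: algebra_simps)
  then show ?thesis using assms by simp
qed

text \<open>\<open>R\<close> is going to be the ring of integers of an imaginary quadratic field.
  Besides the ring operations only its discreteness enters: squared moduli are natural numbers and
  traces \<open>2 * Re x\<close> are integers.\<close>

locale unit_weights = integral_weights +
  fixes R :: "complex set"
  assumes unit_entry: "\<And>i j. i < n \<Longrightarrow> j < n \<Longrightarrow> a i j = 0 \<or> cmod (a i j) = 1"
    and R_entry: "\<And>i j. i < n \<Longrightarrow> j < n \<Longrightarrow> a i j \<in> R"
    and R_mult: "\<And>x y. x \<in> R \<Longrightarrow> y \<in> R \<Longrightarrow> x * y \<in> R"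
    and R_add: "\<And>x y. x \<in> R \<Longrightarrow> y \<in> R \<Longrightarrow> x + y \<in> R"
    and R_0: "0 \<in> R" and R_1: "1 \<in> R"
    and R_norm: "\<And>x. x \<in> R \<Longrightarrow> (cmod x)\<^sup>2 \<in> \<nat>"
    and R_trace: "\<And>x. x \<in> R \<Longrightarrow> 2 * Re x \<in> \<int>"
begin

lemma unit_cmod: "i < n \<Longrightarrow> j < n \<Longrightarrow> a i j \<noteq> 0 \<Longrightarrow> cmod (a i j) = 1"
  using unit_entry by blast

lemma unit_mult: "i < n \<Longrightarrow> j < n \<Longrightarrow> a i j \<noteq> 0 \<Longrightarrow> a i j * a j i = 1"
  by (subst mult_sym) (simp_all add: unit_cmod)

lemma charge_rat: "i < n \<Longrightarrow> a i i \<in> \<rat>"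
proof (cases "a i i = 0")
  case False
  assume i: "i < n"
  have im: "Im (a i i) = 0" using herm[OF i i] by (simp add: complex_eq_iff)
  then have "\<bar>Re (a i i)\<bar> = 1" using unit_cmod[OF i i False] by (simp add: cmod_def)
  then have "Re (a i i) = 1 \<or> Re (a i i) = - 1" by linarith
  then have "a i i = 1 \<or> a i i = - 1" using im by (auto simp: complex_eq_iff)
  then show ?thesis by auto
qed auto

lemma three_neighbours:
  assumes v: "v < n" and x: "distinct [x1, x2, x3]" "x1 < n" "x2 < n" "x3 < n"
    and nz: "a v x1 \<noteq> 0" "a v x2 \<noteq> 0" "a v x3 \<noteq> 0"
  shows "deg v = 3" "\<And>y. y < n \<Longrightarrow> y \<notin> {x1, x2, x3} \<Longrightarrow> a v y = 0"
    "\<And>y. y < n \<Longrightarrow> y \<notin> {x1, x2, x3} \<Longrightarrow> a y v = 0"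
proof -
  have "cmod (a x1 v) = 1" "cmod (a x2 v) = 1" "cmod (a x3 v) = 1"
    using unit_cmod zero_sym[of _ v] v x nz by auto
  then have sat: "(\<Sum>y\<in>{x1, x2, x3}. (cmod (a y v))\<^sup>2) \<ge> 3" using x by auto
  show "deg v = 3" using saturated(1)[OF v _ sat] x by auto
  show "a v y = 0" "a y v = 0" if "y < n" "y \<notin> {x1, x2, x3}" for y
    using saturated(2,3)[OF v _ sat, of y] x that by auto
qed

lemma paths2_R: "u < n \<Longrightarrow> w < n \<Longrightarrow> paths2 u w \<in> R"
proof -
  assume uw: "u < n" "w < n"
  have "finite S \<Longrightarrow> S \<subseteq> {..<n} \<Longrightarrow> (\<Sum>x\<in>S. a u x * a x w) \<in> R" for S
    by (induction S rule: finite_induct) (use uw in \<open>auto intro!: R_0 R_add R_mult R_entry\<close>)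
  then show ?thesis unfolding paths2_def by auto
qed

text \<open>Both vertices have degree 3, so \<open>paths2_bound\<close> gives a squared modulus
  below 1, and an element of \<open>R\<close> of modulus below 1 vanishes. Listing the neighbours of
  \<open>u\<close> makes the sum explicit; those of \<open>w\<close> certify its degree.\<close>

lemma orthogonal3:
  assumes u: "u < n" and w: "w < n" "u \<noteq> w"
    and x: "distinct [x1, x2, x3]" "x1 < n" "x2 < n" "x3 < n"
    and xu: "a u x1 \<noteq> 0" "a u x2 \<noteq> 0" "a u x3 \<noteq> 0"
    and y: "distinct [y1, y2, y3]" "y1 < n" "y2 < n" "y3 < n"
    and yw: "a w y1 \<noteq> 0" "a w y2 \<noteq> 0" "a w y3 \<noteq> 0"
    and side: "a u w = 0 \<or> (a u u = 0 \<and> a w w = 0) \<or>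
      (\<exists>x<n. x \<noteq> u \<and> x \<noteq> w \<and> a x u \<noteq> 0 \<and> a x w = 0)"
  shows "a u x1 * a x1 w + a u x2 * a x2 w + a u x3 * a x3 w = 0"
proof -
  note tu = three_neighbours[OF u x xu] and tw = three_neighbours[OF w(1) y yw]
  have "(cmod (paths2 u w))\<^sup>2 < 1"
    using paths2_bound[OF u w side] tu(1) tw(1) by simp
  moreover have "(cmod (paths2 u w))\<^sup>2 \<in> \<nat>" using R_norm paths2_R u w by blast
  ultimately have "(cmod (paths2 u w))\<^sup>2 = 0" by (auto elim!: Nats_cases)
  then have "paths2 u w = 0" by simp
  moreover have "paths2 u w = (\<Sum>z\<in>{x1, x2, x3}. a u z * a z w)"
    using tu(2) x by (intro paths2_supp) auto
  ultimately show ?thesis using x by (simp add: add.assoc)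
qed

lemma vector3:
  assumes x: "distinct [x1, x2, x3]" "x1 < n" "x2 < n" "x3 < n"
    and ys: "distinct ys" "set ys \<subseteq> {..<n}"
    and y0: "y0 < n" "y0 \<noteq> x1" "y0 \<noteq> x2" "y0 \<noteq> x3"
    and nz: "a y0 x1 * f1 + a y0 x2 * f2 + a y0 x3 * f3 \<noteq> 0"
  shows "(\<Sum>y\<leftarrow>ys. (cmod (a y x1 * f1 + a y x2 * f2 + a y x3 * f3))\<^sup>2)
     < 4 * ((cmod f1)\<^sup>2 + (cmod f2)\<^sup>2 + (cmod f3)\<^sup>2)"
proof -
  define f where "f = (\<lambda>x. if x = x1 then f1 else if x = x2 then f2 else f3)"
  have row: "(\<Sum>x\<in>{x1, x2, x3}. a y x * f x) = a y x1 * f1 + a y x2 * f2 + a y x3 * f3" for y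
    using x by (auto simp: f_def add.assoc)
  have nrm: "(\<Sum>x\<in>{x1, x2, x3}. (cmod (f x))\<^sup>2) = (cmod f1)\<^sup>2 + (cmod f2)\<^sup>2 + (cmod f3)\<^sup>2"
    using x by (auto simp: f_def add.assoc)
  have "(\<Sum>y\<in>set ys. (cmod (\<Sum>x\<in>{x1, x2, x3}. a y x * f x))\<^sup>2) <
      4 * (\<Sum>x\<in>{x1, x2, x3}. (cmod (f x))\<^sup>2)"
  proof (rule vector_bound)
    show "(\<Sum>x\<in>{x1, x2, x3}. a y0 x * f x) \<noteq> 0" unfolding row by (rule nz)
  qed (use x ys y0 in auto)
  then show ?thesis unfolding row nrm using ys by (simp add: sum.distinct_set_conv_list)
qed

subsection \<open>Triangles with irrational gain\<close>

definition triangle :: "nat \<Rightarrow> nat \<Rightarrow> nat \<Rightarrow> bool" where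
  "triangle u v w \<longleftrightarrow> u < n \<and> v < n \<and> w < n \<and> distinct [u, v, w] \<and>
     a u v \<noteq> 0 \<and> a v w \<noteq> 0 \<and> a w u \<noteq> 0 \<and> a u v * a v w * a w u \<notin> \<rat>"

lemma triangle_rot: "triangle u v w \<Longrightarrow> triangle v w u"
  unfolding triangle_def by (auto simp: mult_ac)

lemma cnj_Rats_iff: "cnj z \<in> \<rat> \<longleftrightarrow> z \<in> \<rat>"
proof -
  have "cnj w \<in> \<rat>" if "w \<in> \<rat>" for w
  proof -
    from that obtain i j where "w = of_int i / of_int j" by (auto elim: Rats_cases')
    then show ?thesis by simp
  qed
  from this[of z] this[of "cnj z"] show ?thesis by auto
qed

lemma triangle_rev: "triangle u v w \<Longrightarrow> triangle u w v"
proof -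
  assume t: "triangle u v w"
  then have V: "u < n" "v < n" "w < n" by (auto simp: triangle_def)
  have "a u w * a w v * a v u = cnj (a u v * a v w * a w u)"
    using herm[of u v] herm[of v w] herm[of w u] V by (simp add: mult_ac)
  then show ?thesis using t zero_sym V unfolding triangle_def
    by (metis cnj_Rats_iff distinct_length_2_or_more)
qed

text \<open>If \<open>y\<close> differed from \<open>x\<close>, both \<open>u\<close> and
  \<open>v\<close> would have degree 3, and orthogonality would leave
  \<open>a u v * a v v + a u w * a w v = 0\<close>. Then gain times charge of \<open>v\<close> is
  -1, although charges are rational and the gain is not. The case \<open>y = v\<close> of a charge
  is covered.\<close>

lemma triangle_only_shared:
  assumes t: "triangle u v w" and x: "x < n" "x \<notin> {u, v, w}" "a u x \<noteq> 0"
    and y: "y < n" "y \<notin> {u, w}" "a v y \<noteq> 0"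
  shows "y = x"
proof (rule ccontr)
  assume ne: "y \<noteq> x"
  from t have V: "u < n" "v < n" "w < n" "distinct [u, v, w]" "a u v \<noteq> 0" "a v w \<noteq> 0" "a w u \<noteq> 0"
    and irr: "a u v * a v w * a w u \<notin> \<rat>" by (auto simp: triangle_def)
  have uw: "a u w \<noteq> 0" and vu: "a v u \<noteq> 0" and wv: "a w v \<noteq> 0" using V zero_sym by auto
  note tu = three_neighbours[of u v w x] and tv = three_neighbours[of v u w y]
  have uu: "a u u = 0" using tu(2)[of u] V x uw by auto
  have xv: "a x v = 0" using tv(3)[of x] V x y ne vu by auto
  have "a u v * a v v + a u w * a w v + a u x * a x v = 0"
  proof (rule orthogonal3[of u v v w x u w y])
    show "a u v = 0 \<or> a u u = 0 \<and> a v v = 0 \<or> (\<exists>z<n. z \<noteq> u \<and> z \<noteq> v \<and> a z u \<noteq> 0 \<and> a z v = 0)"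
      using x xv V zero_sym[of u x] by auto
  qed (use V x y uw vu ne in auto)
  then have eq: "a u v * a v v + a u w * a w v = 0" using xv by simp
  have "a v w * a w v = 1" "a w u * a u w = 1" using unit_mult V by auto
  then have "a u v * a v w * a w u * a v v = - 1"
    using eq by (rule gain_eq_minus_1)
  moreover from this have "a v v \<noteq> 0" by auto
  ultimately have "a u v * a v w * a w u = - 1 / a v v" by (simp add: field_simps)
  then show False using irr charge_rat[of v] V by auto
qed

text \<open>A vertex \<open>x\<close> adjacent to two triangle vertices needs an edge leaving the
  four, which orthogonality of \<open>x\<close> and \<open>u\<close> forbids. So \<open>x\<close>
  hangs at \<open>u\<close> alone, \<open>v\<close> and \<open>w\<close> have no weights outside the
  triangle, and the graph continues from \<open>x\<close>; then a test vector attains the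
  bound.\<close>

lemma no_triangle_neighbour:
  assumes t: "triangle u v w" and x: "x < n" "x \<notin> {u, v, w}" "a u x \<noteq> 0"
  shows False
proof -
  have shared: False
    if t: "triangle u v w" and x: "x < n" "x \<notin> {u, v, w}" "a u x \<noteq> 0" and vx: "a v x \<noteq> 0" for u v w
  proof -
    from t have V: "u < n" "v < n" "w < n" "distinct [u, v, w]" "a u v \<noteq> 0" "a v w \<noteq> 0" "a w u \<noteq> 0"
      by (auto simp: triangle_def)
    have nz: "a u w \<noteq> 0" "a v u \<noteq> 0" "a w v \<noteq> 0" "a x u \<noteq> 0" "a x v \<noteq> 0"
      using V x vx zero_sym by auto
    note tu = three_neighbours[of u v w x] and tv = three_neighbours[of v u w x]
    obtain s y where sy: "s \<in> set [u, v, w, x]" "y < n" "y \<notin> set [u, v, w, x]" "a s y \<noteq> 0"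
      using closed_large[of "[u, v, w, x]"] V x by auto
    have "s \<noteq> u" using tu(2)[of y] V x nz sy by auto
    moreover have "s \<noteq> v" using tv(2)[of y] V x nz vx sy by auto
    moreover have "s \<noteq> w"
      using triangle_only_shared[OF triangle_rev[OF t], of x y] x sy by auto
    ultimately have s: "s = x" using sy by auto
    note tx = three_neighbours[of x u v y]
    have "a u u = 0" using tu(2)[of u] V x nz by auto
    moreover have "a x x = 0" using tx(2)[of x] V x nz sy s by auto
    moreover have "a y u = 0" using tu(3)[of y] V x nz sy by auto
    moreover have "a x u * a u u + a x v * a v u + a x y * a y u = 0"
      by (rule orthogonal3[of x u u v y v w x]) (use V x nz sy s calculation in auto)
    ultimately show False using nz by simp
  qed
  from t have V: "u < n" "v < n" "w < n" "distinct [u, v, w]" "a u v \<noteq> 0" "a v w \<noteq> 0" "a w u \<noteq> 0"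
    by (auto simp: triangle_def)
  have nz: "a u w \<noteq> 0" "a v u \<noteq> 0" "a w v \<noteq> 0" "a x u \<noteq> 0"
    using V x zero_sym by auto
  have vx: "a v x = 0" using shared[OF t x] by blast
  have wx: "a w x = 0" using shared[OF triangle_rev[OF t]] x by blast
  have v_only: "a v y = 0" if "y < n" "y \<notin> {u, w}" for y
    using triangle_only_shared[OF t x that] vx by blast
  have w_only: "a w y = 0" if "y < n" "y \<notin> {u, v}" for y
    using triangle_only_shared[OF triangle_rev[OF t], of x y] x that wx by blast
  note tu = three_neighbours[of u v w x]
  obtain s y where sy: "s \<in> set [u, v, w, x]" "y < n" "y \<notin> set [u, v, w, x]" "a s y \<noteq> 0"
    using closed_large[of "[u, v, w, x]"] V x by auto
  have "s \<noteq> u" using tu(2)[of y] V x nz sy by auto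
  then have s: "s = x" using sy v_only[of y] w_only[of y] by auto
  have yu: "a y u = 0" using tu(3)[of y] V x nz sy by auto
  have z: "a v v = 0" "a w w = 0" "a y v = 0" "a y w = 0" "a x v = 0" "a x w = 0"
    using v_only[of v] w_only[of w] v_only[of y] w_only[of y] vx wx V x sy zero_sym by auto
  have m: "a u x * a x u = 1" "a u v * a v u = 1" "a u w * a w u = 1"
    using unit_mult V x nz by auto
  have c: "cmod (a x u) = 1" "cmod (a v u) = 1" "cmod (a w u) = 1" "cmod (a v w) = 1"
    "cmod (a w v) = 1" "cmod (a y x) = 1"
    using unit_cmod V x nz sy s zero_sym[of x y] by auto
  \<comment> \<open>The values are aligned so that row \<open>u\<close> is 3; rows \<open>v\<close>,
    \<open>w\<close> and \<open>y\<close> have modulus 1, and 9 + 1 + 1 + 1 = 4 * 3.\<close>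
  have "(\<Sum>z\<leftarrow>[u, v, w, y]. (cmod (a z x * a x u + a z v * a v u + a z w * a w u))\<^sup>2)
      < 4 * ((cmod (a x u))\<^sup>2 + (cmod (a v u))\<^sup>2 + (cmod (a w u))\<^sup>2)"
    by (rule vector3[where ?y0.0 = u]) (use V x sy m in auto)
  then show False using m z c vx wx by (simp add: norm_mult)
qed

lemma no_triangle: "\<not> triangle u v w"
proof
  assume t: "triangle u v w"
  then have V: "u < n" "v < n" "w < n" by (auto simp: triangle_def)
  obtain s y where sy: "s \<in> set [u, v, w]" "y < n" "y \<notin> set [u, v, w]" "a s y \<noteq> 0"
    using closed_large[of "[u, v, w]"] V by auto
  then show False
    using no_triangle_neighbour[OF t, of y] no_triangle_neighbour[OF triangle_rot[OF t], of y]
      no_triangle_neighbour[OF triangle_rot[OF triangle_rot[OF t]], of y] by auto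
qed

subsection \<open>Quadrilaterals with irrational gain\<close>

text \<open>The diagonals are non-edges, as in the shortest cycles to which this is applied. Charges
  are left open and are excluded by \<open>square_uncharged\<close>.\<close>

definition square :: "nat \<Rightarrow> nat \<Rightarrow> nat \<Rightarrow> nat \<Rightarrow> bool" where
  "square p q r s \<longleftrightarrow> p < n \<and> q < n \<and> r < n \<and> s < n \<and> distinct [p, q, r, s] \<and>
     a p q \<noteq> 0 \<and> a q r \<noteq> 0 \<and> a r s \<noteq> 0 \<and> a s p \<noteq> 0 \<and> a p r = 0 \<and> a q s = 0 \<and>
     a p q * a q r * a r s * a s p \<notin> \<rat>"

lemma squareD:
  assumes "square p q r s"
  shows "p < n" "q < n" "r < n" "s < n" "distinct [p, q, r, s]"
    "a p q \<noteq> 0" "a q r \<noteq> 0" "a r s \<noteq> 0" "a s p \<noteq> 0" "a p r = 0" "a q s = 0"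
    "a q p \<noteq> 0" "a r q \<noteq> 0" "a s r \<noteq> 0" "a p s \<noteq> 0" "a r p = 0" "a s q = 0"
    "a p q * a q r * a r s * a s p \<notin> \<rat>"
  using assms zero_sym unfolding square_def by auto

lemma square_rot: "square p q r s \<Longrightarrow> square q r s p"
  unfolding square_def using zero_sym by (auto simp: mult_ac)

lemma square_rev:
  assumes "square p q r s" shows "square p s r q"
proof -
  note D = squareD[OF assms]
  have "a p s * a s r * a r q * a q p = cnj (a p q * a q r * a r s * a s p)"
    using herm[of p q] herm[of q r] herm[of r s] herm[of s p] D by (simp add: mult_ac)
  then have "a p s * a s r * a r q * a q p \<notin> \<rat>" using D(18) by (simp only: cnj_Rats_iff) simp
  then show ?thesis unfolding square_def using D by auto
qed

lemma square_adjacent_extra: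
  assumes sq: "square p q r s"
    and x: "x < n" "x \<notin> {q, s}" "a p x \<noteq> 0" and y: "y < n" "y \<notin> {p, r}" "a q y \<noteq> 0"
  shows "a p q * a q q + a p x * a x q = 0"
proof -
  note D = squareD[OF sq]
  have "a p q * a q q + a p s * a s q + a p x * a x q = 0"
    by (rule orthogonal3[of p q q s x p r y]) (use D x y in auto)
  then show ?thesis using D by simp
qed

text \<open>Orthogonality of \<open>p\<close> and \<open>r\<close>. If \<open>x\<close> were not
  adjacent to \<open>r\<close>, the two walks around the square would cancel, which means gain
  -1.\<close>

lemma square_opposite_extra:
  assumes sq: "square p q r s"
    and x: "x < n" "x \<notin> {q, s}" "a p x \<noteq> 0" and y: "y < n" "y \<notin> {q, s}" "a r y \<noteq> 0"
  shows "a p q * a q r + a p s * a s r + a p x * a x r = 0" "a x r \<noteq> 0"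
proof -
  note D = squareD[OF sq]
  show eq: "a p q * a q r + a p s * a s r + a p x * a x r = 0"
    by (rule orthogonal3[of p r q s x q s y]) (use D x y in auto)
  show "a x r \<noteq> 0"
  proof
    assume "a x r = 0"
    then have "a p q * a q r + a p s * a s r = 0" using eq by simp
    moreover have "a p s * a s p = 1" "a s r * a r s = 1" using unit_mult D by auto
    ultimately have "a p q * a q r * a r s * a s p = - 1"
      using gain_eq_minus_1'[of "a p q" "a q r" "a p s" "a s r" "a s p" "a r s"] by simp
    then show False using D(18) by simp
  qed
qed

text \<open>The two walks from \<open>p\<close> to \<open>r\<close> add up to a unit times
  \<open>1 + g\<close>, where \<open>g\<close> is the gain. Since \<open>deg p = 3\<close> and
  \<open>deg r \<ge> 2\<close>, the natural number \<open>|1 + g|^2\<close> is below 2; it is not 0,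
  hence 1, and \<open>g\<close> is a primitive cube root of unity. The constants of the later
  vectors rest on \<open>Re g = - 1 / 2\<close>.\<close>

lemma square_gain:
  assumes sq: "square p q r s" and x: "x < n" "x \<notin> {q, s}" "a p x \<noteq> 0" "a x r = 0"
  shows "cmod (a p q * a q r + a p s * a s r) = 1"
    "Re (a p q * a q r * a r s * a s p) = - 1 / 2" "cmod (a p q * a q r * a r s * a s p) = 1"
proof -
  note D = squareD[OF sq]
  define g where "g = a p q * a q r * a r s * a s p"
  have m: "a p s * a s p = 1" "a s r * a r s = 1" using unit_mult D by auto
  have c: "cmod (a p s) = 1" "cmod (a s r) = 1" "cmod (a p q) = 1" "cmod (a q r) = 1"
    "cmod (a r s) = 1" "cmod (a s p) = 1" "cmod (a q r) = 1" "cmod (a q r) = 1" "cmod (a s r) = 1"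
    using unit_cmod D by auto
  have g1: "cmod g = 1" by (simp add: g_def norm_mult c)
  have fac: "a p q * a q r + a p s * a s r = (1 + g) * (a p s * a s r)"
    unfolding g_def by (rule factor_gain[OF m])
  have s: "paths2 p r = a p q * a q r + a p s * a s r"
  proof -
    have "paths2 p r = (\<Sum>z\<in>{q, s, x}. a p z * a z r)"
      using three_neighbours(2)[of p q s x] D x by (intro paths2_supp) auto
    then show ?thesis using D x by (auto simp: add.assoc)
  qed
  have dp: "deg p = 3" using three_neighbours(1)[of p q s x] D x by auto
  have dr: "deg r \<ge> 2" using deg_ge[of "{q, s}" r] D c by simp
  have "(cmod (paths2 p r))\<^sup>2 < (4 - deg p) * (4 - deg r)" by (rule paths2_bound) (use D in auto)
  then have lt: "(cmod (1 + g))\<^sup>2 < 2" using dp dr unfolding s fac by (simp add: norm_mult c)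
  have "(cmod (1 + g))\<^sup>2 \<in> \<nat>"
    unfolding g_def using D by (intro R_norm R_add R_mult R_1 R_entry)
  then obtain k where k: "(cmod (1 + g))\<^sup>2 = real k" by (auto elim: Nats_cases)
  have "k \<noteq> 0"
  proof
    assume "k = 0"
    then have "g = - 1" using k by (simp add: add_eq_0_iff)
    then show False using D(18) by (simp add: g_def)
  qed
  then have k1: "(cmod (1 + g))\<^sup>2 = 1" using lt k by simp
  then show "Re (a p q * a q r * a r s * a s p) = - 1 / 2"
    using cmod_lin[OF g1, of 1 1] unfolding g_def by simp
  show "cmod (a p q * a q r * a r s * a s p) = 1" using g1 by (simp add: g_def)
  have "cmod (1 + g) = 1" using k1 norm_ge_zero[of "1 + g"] unfolding power2_eq_1_iff by linarith
  then show "cmod (a p q * a q r + a p s * a s r) = 1" unfolding fac by (simp add: norm_mult c)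
qed

text \<open>If \<open>p\<close> is charged and \<open>q\<close> has an extra weight, then
  \<open>q\<close> is charged too, \<open>r\<close> and \<open>s\<close> have nothing extra, and no
  edge leaves the square. So \<open>q\<close> and \<open>s\<close> have no extra weights, and a test
  vector on \<open>p\<close>, \<open>q\<close>, \<open>s\<close> attains the bound.\<close>

lemma square_uncharged:
  assumes sq: "square p q r s" shows "a p p = 0"
proof (rule ccontr)
  assume pp: "a p p \<noteq> 0"
  have main: False if sq: "square p q r s" and qy: "y < n" "y \<notin> {p, r}" "a q y \<noteq> 0" and pp: "a p p \<noteq> 0" for q s y
  proof -
    note D = squareD[OF sq]
    have e: "a p q * a q q + a p p * a p q = 0"
      using square_adjacent_extra[OF sq, of p y] D qy pp by auto
    then have qq: "a q q \<noteq> 0" using D pp by auto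
    have r: "a r y = 0" if "y < n" "y \<notin> {q, s}" for y
      using square_opposite_extra(2)[OF sq, of p y] D pp that by auto
    have s: "a s y = 0" if "y < n" "y \<notin> {r, p}" for y
      using square_opposite_extra(2)[OF square_rot[OF sq], of q y] D qq that by auto
    obtain t z where tz: "t \<in> set [p, q, r, s]" "z < n" "z \<notin> set [p, q, r, s]" "a t z \<noteq> 0"
      using closed_large[of "[p, q, r, s]"] D by auto
    show False
      using tz r[of z] s[of z] three_neighbours(2)[of p q s p z] three_neighbours(2)[of q p r q z] D pp qq
      by auto
  qed
  note D = squareD[OF sq]
  have q: "a q y = 0" if "y < n" "y \<notin> {p, r}" for y
    using main[OF sq that _ pp] by blast
  have s: "a s y = 0" if "y < n" "y \<notin> {p, r}" for y
    using main[OF square_rev[OF sq] that _ pp] by blast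
  have z: "a q q = 0" "a s s = 0" using q[of q] s[of s] D by auto
  have m: "a p q * a q p = 1" "a p s * a s p = 1" using unit_mult D by auto
  have c: "cmod (a p p) = 1" "cmod (a q p) = 1" "cmod (a s p) = 1" using unit_cmod D pp by auto
  have "cmod (a p q * a q r + a p s * a s r) = 1" using square_gain(1)[OF sq, of p] D pp by auto
  moreover have "a r q * (a q p * a p p) + a r s * (a s p * a p p) = cnj (a p q * a q r + a p s * a s r) * a p p"
    using herm[of p q] herm[of q r] herm[of s r] herm[of p s] D by (simp add: algebra_simps)
  ultimately have rr: "cmod (a r q * (a q p * a p p) + a r s * (a s p * a p p)) = 1"
    by (simp only: norm_mult complex_mod_cnj c)
  have rp: "a p p * 1 + a p q * (a q p * a p p) + a p s * (a s p * a p p) = 3 * a p p"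
    using m by (simp add: mult.assoc[symmetric])
  \<comment> \<open>Row \<open>p\<close> is three times the charge, the other rows have modulus 1: 9
    + 1 + 1 + 1 = 4 * 3.\<close>
  have "(\<Sum>y\<leftarrow>[p, q, s, r]. (cmod (a y p * 1 + a y q * (a q p * a p p) + a y s * (a s p * a p p)))\<^sup>2)
      < 4 * ((cmod 1)\<^sup>2 + (cmod (a q p * a p p))\<^sup>2 + (cmod (a s p * a p p))\<^sup>2)"
    by (rule vector3[where ?y0.0 = r]) (use D rr in auto)
  moreover have "(cmod (a p p * 1 + a p q * (a q p * a p p) + a p s * (a s p * a p p)))\<^sup>2 = 9"
    unfolding rp by (simp add: norm_mult c)
  ultimately show False using D z c rr by (simp add: norm_mult)
qed

text \<open>A complete bipartite graph on 2 + 3 vertices; the last clause is the orthogonality of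
  \<open>p\<close> and \<open>r\<close>. Three units with sum zero differ by cube roots of unity, so
  the squares in it have primitive cube roots of unity as gains and are consistent with all
  relations found for single squares.\<close>

definition k23 :: "nat \<Rightarrow> nat \<Rightarrow> nat \<Rightarrow> nat \<Rightarrow> nat \<Rightarrow> bool" where
  "k23 p r x y z \<longleftrightarrow> p < n \<and> r < n \<and> x < n \<and> y < n \<and> z < n \<and> distinct [p, r, x, y, z] \<and>
     a p x \<noteq> 0 \<and> a p y \<noteq> 0 \<and> a p z \<noteq> 0 \<and> a r x \<noteq> 0 \<and> a r y \<noteq> 0 \<and> a r z \<noteq> 0 \<and>
     a x y = 0 \<and> a y z = 0 \<and> a x z = 0 \<and> a x x = 0 \<and> a y y = 0 \<and> a z z = 0 \<and>
     a p x * a x r + a p y * a y r + a p z * a z r = 0"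

lemma k23D:
  assumes "k23 p r x y z"
  shows "p < n" "r < n" "x < n" "y < n" "z < n" "distinct [p, r, x, y, z]"
    "a p x \<noteq> 0" "a p y \<noteq> 0" "a p z \<noteq> 0" "a r x \<noteq> 0" "a r y \<noteq> 0" "a r z \<noteq> 0"
    "a x p \<noteq> 0" "a y p \<noteq> 0" "a z p \<noteq> 0" "a x r \<noteq> 0" "a y r \<noteq> 0" "a z r \<noteq> 0"
    "a x y = 0" "a y z = 0" "a x z = 0" "a y x = 0" "a z y = 0" "a z x = 0"
    "a x x = 0" "a y y = 0" "a z z = 0"
    "a p x * a x r + a p y * a y r + a p z * a z r = 0"
  using assms zero_sym unfolding k23_def by auto

lemma k23_swap:
  "k23 p r x y z \<Longrightarrow> k23 p r y x z" "k23 p r x y z \<Longrightarrow> k23 p r x z y" "k23 p r x y z \<Longrightarrow> k23 p r z y x"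
  unfolding k23_def using zero_sym by (auto simp: add_ac)

text \<open>Multiplication by the unit \<open>a p x * a y r\<close> turns the two walks from
  \<open>x\<close> to \<open>y\<close> into the first two terms of the defining sum, which equal
  minus the third.\<close>

lemma k23_paths:
  assumes "k23 p r x y z"
  shows "cmod (a x p * a p y + a x r * a r y) = 1"
proof -
  note D = k23D[OF assms]
  have m: "a p x * a x p = 1" "a y r * a r y = 1" using unit_mult D by auto
  have c: "cmod (a p x) = 1" "cmod (a y r) = 1" "cmod (a p z) = 1" "cmod (a z r) = 1"
    using unit_cmod D by auto
  have "a p x * a y r * (a x p * a p y + a x r * a r y) =
      (a p x * a x p) * (a p y * a y r) + (a y r * a r y) * (a p x * a x r)"
    by (simp add: algebra_simps)
  also have "\<dots> = - (a p z * a z r)"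
    unfolding m using D(28) by (simp add: eq_neg_iff_add_eq_0 add_ac)
  finally have "cmod (a p x * a y r * (a x p * a p y + a x r * a r y)) = 1"
    by (simp only: norm_minus_cancel norm_mult c)
  then show ?thesis by (simp add: norm_mult c)
qed

text \<open>Distinct extra neighbours would give \<open>x\<close> and \<open>y\<close> degree 3, and
  orthogonality would annihilate a sum of modulus 1.\<close>

lemma k23_extra_shared:
  assumes k: "k23 p r x y z" and w: "w < n" "w \<notin> {p, r}" "a x w \<noteq> 0"
    and t: "t < n" "t \<notin> {p, r}" "a y t \<noteq> 0"
  shows "t = w"
proof (rule ccontr)
  assume "t \<noteq> w"
  note D = k23D[OF k]
  have "a w y = 0" using three_neighbours(3)[of y p r t w] D w t \<open>t \<noteq> w\<close> by auto
  moreover have "a x p * a p y + a x r * a r y + a x w * a w y = 0"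
    by (rule orthogonal3[of x y p r w p r t]) (use D w t in auto)
  ultimately show False using k23_paths[OF k] by simp
qed

text \<open>The edge leaving the six vertices must start at \<open>w\<close>, which therefore has
  degree 3. Orthogonality of \<open>w\<close> to \<open>p\<close> and to \<open>r\<close> makes two
  of the three terms in the defining sum equal, so twice a unit would be minus a unit.\<close>

lemma k23_two_shared:
  assumes k: "k23 p r x y z" and w: "w < n" "w \<notin> {p, r, x, y, z}" "a x w \<noteq> 0" "a y w \<noteq> 0" "a z w = 0"
  shows False
proof -
  note D = k23D[OF k]
  have nz: "a w x \<noteq> 0" "a w y \<noteq> 0" using w D zero_sym by auto
  have z_only: "a z t = 0" if "t < n" "t \<notin> {p, r}" for t
    using k23_extra_shared[OF k23_swap(2)[OF k], of w t] w D that by auto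
  obtain s t where st: "s \<in> set [p, r, x, y, z, w]" "t < n" "t \<notin> set [p, r, x, y, z, w]" "a s t \<noteq> 0"
    using closed_large[of "[p, r, x, y, z, w]"] D w by auto
  have "s \<noteq> p" "s \<noteq> r" "s \<noteq> x" "s \<noteq> y" "s \<noteq> z"
    using three_neighbours(2)[of p x y z t] three_neighbours(2)[of r x y z t]
      three_neighbours(2)[of x p r w t] three_neighbours(2)[of y p r w t] z_only[of t] D w st by auto
  then have s: "s = w" using st by auto
  have tp: "a t p = 0" "a t r = 0" "a w p = 0" "a w r = 0"
    using three_neighbours(3)[of p x y z] three_neighbours(3)[of r x y z] D w st by auto
  have "a w x * a x p + a w y * a y p + a w t * a t p = 0"
    by (rule orthogonal3[of w p x y t x y z]) (use D w nz st s tp in auto)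
  then have e1: "a w x * a x p + a w y * a y p = 0" using tp by simp
  have "a w x * a x r + a w y * a y r + a w t * a t r = 0"
    by (rule orthogonal3[of w r x y t x y z]) (use D w nz st s tp in auto)
  then have e2: "a w x * a x r = - (a w y * a y r)" using tp by (simp add: eq_neg_iff_add_eq_0)
  have "cnj (a w x * a x p + a w y * a y p) = 0" using e1 by simp
  then have "a x w * a p x + a y w * a p y = 0"
    using herm[of w x] herm[of x p] herm[of w y] herm[of y p] D w by simp
  then have e3: "a x w * a p x = - (a y w * a p y)" by (simp add: eq_neg_iff_add_eq_0)
  have m: "a x w * a w x = 1" "a y w * a w y = 1" using unit_mult D w by auto
  have "a p x * a x r = (a x w * a w x) * (a p x * a x r)" using m by simp
  also have "\<dots> = (a x w * a p x) * (a w x * a x r)" by (simp add: mult_ac)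
  also have "\<dots> = (a y w * a w y) * (a p y * a y r)" unfolding e2 e3 by (simp add: mult_ac)
  finally have "a p x * a x r = a p y * a y r" using m by simp
  then have "2 * (a p y * a y r) = - (a p z * a z r)"
    using D(28) by (simp add: eq_neg_iff_add_eq_0)
  then have "cmod (2 * (a p y * a y r)) = cmod (a p z * a z r)" by simp
  then show False using unit_cmod D by (simp add: norm_mult)
qed

text \<open>One of \<open>x\<close>, \<open>y\<close>, \<open>z\<close> has an outer neighbour
  \<open>w\<close>. If all three are adjacent to \<open>w\<close>, the six vertices are saturated;
  two of them is \<open>k23_two_shared\<close>; if \<open>w\<close> hangs at \<open>x\<close> alone,
  a vector on the three neighbours of \<open>x\<close> attains the bound.\<close>

lemma no_k23: "\<not> k23 p r x y z"
proof
  have nbr: False if k: "k23 p r x y z" and w: "w < n" "w \<notin> {p, r, x, y, z}" "a x w \<noteq> 0" for x y z w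
  proof -
    note D = k23D[OF k]
    have nz: "a w x \<noteq> 0" using w D zero_sym by auto
    consider "a y w \<noteq> 0" "a z w \<noteq> 0" | "a y w \<noteq> 0" "a z w = 0" | "a y w = 0" "a z w \<noteq> 0" | "a y w = 0" "a z w = 0"
      by blast
    then show False
    proof cases
      case 1
      then have nz': "a w y \<noteq> 0" "a w z \<noteq> 0" using w D zero_sym by auto
      obtain s t where st: "s \<in> set [p, r, x, y, z, w]" "t < n" "t \<notin> set [p, r, x, y, z, w]" "a s t \<noteq> 0"
        using closed_large[of "[p, r, x, y, z, w]"] D w by auto
      then show False
        using three_neighbours(2)[of p x y z t] three_neighbours(2)[of r x y z t]
          three_neighbours(2)[of x p r w t] three_neighbours(2)[of y p r w t]
          three_neighbours(2)[of z p r w t] three_neighbours(2)[of w x y z t] D w nz nz' 1 by auto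
    next
      case 2
      then show False using k23_two_shared[OF k] w by auto
    next
      case 3
      then show False using k23_two_shared[OF k23_swap(2)[OF k]] w by auto
    next
      case 4
      have y_only: "a y t = 0" if "t < n" "t \<notin> {p, r}" for t
        using k23_extra_shared[OF k, of w t] w that 4 by auto
      have z_only: "a z t = 0" if "t < n" "t \<notin> {p, r}" for t
        using k23_extra_shared[OF k23_swap(2)[OF k], of w t] w that 4 by auto
      obtain s t where st: "s \<in> set [p, r, x, y, z, w]" "t < n" "t \<notin> set [p, r, x, y, z, w]" "a s t \<noteq> 0"
        using closed_large[of "[p, r, x, y, z, w]"] D w by auto
      have "s \<noteq> p" "s \<noteq> r" "s \<noteq> x" "s \<noteq> y" "s \<noteq> z"
        using three_neighbours(2)[of p x y z t] three_neighbours(2)[of r x y z t]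
          three_neighbours(2)[of x p r w t] y_only[of t] z_only[of t] D w st by auto
      then have s: "s = w" using st by auto
      have z0: "a t p = 0" "a t r = 0" "a y w = 0" "a z w = 0"
        using three_neighbours(3)[of p x y z t] three_neighbours(3)[of r x y z t] D w st 4 by auto
      have m: "a x p * a p x = 1" "a x r * a r x = 1" "a x w * a w x = 1" using unit_mult D w by auto
      have c: "cmod (a p x) = 1" "cmod (a r x) = 1" "cmod (a w x) = 1" "cmod (a t w) = 1"
        using unit_cmod D w nz st s zero_sym[of w t] by auto
      have cy: "cmod (a y p * a p x + a y r * a r x) = 1" using k23_paths[OF k23_swap(1)[OF k]] .
      have cz: "cmod (a z p * a p x + a z r * a r x) = 1"
        using k23_paths[OF k23_swap(1)[OF k23_swap(2)[OF k]]] .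
      \<comment> \<open>Row \<open>x\<close> is 3; rows \<open>y\<close> and \<open>z\<close> have
        modulus 1 by \<open>k23_paths\<close>, as has row \<open>t\<close>: 9 + 1 + 1 + 1 = 4 *
        3.\<close>
      have "(\<Sum>v\<leftarrow>[x, y, z, t]. (cmod (a v p * a p x + a v r * a r x + a v w * a w x))\<^sup>2)
          < 4 * ((cmod (a p x))\<^sup>2 + (cmod (a r x))\<^sup>2 + (cmod (a w x))\<^sup>2)"
        by (rule vector3[where ?y0.0 = x]) (use D w st m in auto)
      then show False using m z0 c cy cz by (simp add: norm_mult)
    qed
  qed
  assume k: "k23 p r x y z"
  note D = k23D[OF k]
  obtain s t where st: "s \<in> set [p, r, x, y, z]" "t < n" "t \<notin> set [p, r, x, y, z]" "a s t \<noteq> 0"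
    using closed_large[of "[p, r, x, y, z]"] D by auto
  have "s \<noteq> p" "s \<noteq> r"
    using three_neighbours(2)[of p x y z t] three_neighbours(2)[of r x y z t] D st by auto
  then have "s = x \<or> s = y \<or> s = z" using st by auto
  then show False
    using nbr[OF k, of t] nbr[OF k23_swap(1)[OF k], of t] nbr[OF k23_swap(3)[OF k], of t] st by auto
qed

text \<open>Adjacency to \<open>q\<close> or \<open>s\<close> contradicts orthogonality because
  these are uncharged; adjacency to \<open>r\<close> would complete a \<open>k23\<close>.\<close>

lemma square_private:
  assumes sq: "square p q r s" and v: "v < n" "v \<notin> {p, q, r, s}" "a p v \<noteq> 0"
  shows "a v q = 0" "a v s = 0" "a v r = 0"
proof -
  note D = squareD[OF sq]
  have adj: "a v q = 0" if sq: "square p q r s" and v: "v \<notin> {p, q, r, s}" for q s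
  proof (rule ccontr)
    note D = squareD[OF sq]
    assume "a v q \<noteq> 0"
    moreover from this have "a q v \<noteq> 0" using zero_sym[of q v] D that assms by auto
    then have "a p q * a q q + a p v * a v q = 0"
      using square_adjacent_extra[OF sq, of v v] assms that D by auto
    moreover have "a q q = 0" using square_uncharged[OF square_rot[OF sq]] .
    ultimately show False using assms by auto
  qed
  show vq: "a v q = 0" using adj[OF sq] v by auto
  show vs: "a v s = 0" using adj[OF square_rev[OF sq]] v by auto
  show "a v r = 0"
  proof (rule ccontr)
    assume vr: "a v r \<noteq> 0"
    have nz: "a r v \<noteq> 0" "a v p \<noteq> 0" "a q v = 0" "a s v = 0" using vr vq vs v D zero_sym by auto
    have vv: "a v v = 0"
    proof (rule ccontr)
      assume "a v v \<noteq> 0"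
      have "a p q * a q v + a p s * a s v + a p v * a v v = 0"
        by (rule orthogonal3[of p v q s v p r v]) (use D v nz vr \<open>a v v \<noteq> 0\<close> in auto)
      then show False using nz v \<open>a v v \<noteq> 0\<close> by simp
    qed
    have "k23 p r q s v"
      unfolding k23_def using D v nz vr vv vq vs square_uncharged[OF square_rot[OF sq]]
        square_uncharged[OF square_rot[OF square_rot[OF square_rot[OF sq]]]]
        square_opposite_extra(1)[OF sq, of v v] by auto
    then show False using no_k23 by blast
  qed
qed

lemma square_no_opposite:
  assumes sq: "square p q r s" and v: "v < n" "v \<notin> {p, q, r, s}" "a p v \<noteq> 0"
    and y: "y < n" "y \<notin> {q, s}"
  shows "a r y = 0"
  using square_opposite_extra(2)[OF sq, of v y] square_private(3)[OF sq v] v y by auto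

text \<open>A second square \<open>p\<close>, \<open>q\<close>, \<open>w\<close>, \<open>v\<close>
  shares the edge \<open>pq\<close>. Since \<open>v\<close> and \<open>q\<close> have degree 3,
  orthogonality gives the second square gain -1, and then a vector on \<open>q\<close>,
  \<open>s\<close>, \<open>v\<close> attains the bound.\<close>

lemma no_ladder:
  assumes sq: "square p q r s"
    and v: "v < n" "v \<notin> {p, q, r, s}" "a p v \<noteq> 0"
    and w: "w < n" "w \<notin> {p, q, r, s, v}" "a q w \<noteq> 0" and vw: "a v w \<noteq> 0"
    and t: "t < n" "t \<notin> {p, q, r, s, v, w}" "a v t \<noteq> 0"
  shows False
proof -
  note D = squareD[OF sq]
  note vz = square_private[OF sq v]
  have w': "w \<notin> {q, r, s, p}" using w by auto
  note wz = square_private[OF square_rot[OF sq] w(1) w' w(3)]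
  have nz: "a v p \<noteq> 0" "a w q \<noteq> 0" "a w v \<noteq> 0" "a t v \<noteq> 0" using zero_sym D v w t vw by auto
  have tq: "a t q = 0" using three_neighbours(3)[of q p r w t] D w t by auto
  have ts: "a t s = 0" using square_no_opposite[OF square_rot[OF sq], of w t] zero_sym[of s t] D w t by auto
  have "a v p * a p q + a v w * a w q + a v t * a t q = 0"
    by (rule orthogonal3[of v q p w t p r w]) (use D v w t nz vw vz in auto)
  then have e: "a v p * a p q + a v w * a w q = 0" using tq by simp
  have "cnj (a v p * a p q + a v w * a w q) = 0" using e by simp
  then have "a p v * a q p + a w v * a q w = 0"
    using herm[of v p] herm[of p q] herm[of v w] herm[of w q] D v w by simp
  moreover have m: "a w q * a q w = 1" "a p v * a v p = 1" "a p q * a q p = 1" "a p s * a s p = 1"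
    "a r q * a q r = 1" using unit_mult D v w nz by auto
  ultimately have e': "a w v * a v p = - (a w q * a q p)"
    using ladder_alg[of "a p v" "a q p" "a w v" "a q w" "a w q" "a v p"] by simp
  define g where "g = a p q * a q r * a r s * a s p"
  have gf: "Re g = - 1 / 2" "cmod g = 1"
    using square_gain(2,3)[OF sq, of v] v vz D unfolding g_def by auto
  define X where "X = 1 + g"
  have X1: "(cmod X)\<^sup>2 = 1" unfolding X_def using cmod_lin[OF gf(2), of 1 1] gf by simp
  have c: "cmod (a q p) = 1" "cmod (a s p) = 1" "cmod (a v p) = 1" "cmod (a r q) = 1"
    "cmod (a w q) = 1" "cmod (a t v) = 1" using unit_cmod D v w t nz by auto
  have r1: "a p q * (a q p * X) + a p s * a s p + a p v * a v p = 3 + g"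
    unfolding X_def using m by (simp add: mult.assoc[symmetric])
  have n1: "(cmod (3 + g))\<^sup>2 = 7" using cmod_lin[OF gf(2), of 3 1] gf by simp
  have r2: "a r q * (a q p * X) + a r s * a s p = a r q * a q p * (1 + 2 * g)"
    unfolding X_def g_def by (rule ladder_alg2[OF m(3,5)])
  have n2: "(cmod (1 + 2 * g))\<^sup>2 = 3" using cmod_lin[OF gf(2), of 1 2] gf by simp
  have r3: "a w q * (a q p * X) + a w v * a v p = a w q * a q p * g"
    unfolding e' X_def by (simp add: algebra_simps)
  \<comment> \<open>The vector consists of three numbers of modulus 1. Up to units the rows
    \<open>p\<close>, \<open>r\<close>, \<open>w\<close>, \<open>t\<close> are \<open>3 + g\<close>,
    \<open>1 + 2 * g\<close>, \<open>g\<close> and 1, and 7 + 3 + 1 + 1 = 4 * 3.\<close>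
  have "(\<Sum>y\<leftarrow>[p, r, w, t]. (cmod (a y q * (a q p * X) + a y s * a s p + a y v * a v p))\<^sup>2)
      < 4 * ((cmod (a q p * X))\<^sup>2 + (cmod (a s p))\<^sup>2 + (cmod (a v p))\<^sup>2)"
  proof (rule vector3[where ?y0.0 = p])
    have "3 + g \<noteq> 0" using n1 by auto
    then show "a p q * (a q p * X) + a p s * a s p + a p v * a v p \<noteq> 0" unfolding r1 .
  qed (use D v w t in auto)
  moreover have "a r v = 0" "a w s = 0" using vz wz zero_sym D v w by auto
  then have "(cmod (a r q * (a q p * X) + a r s * a s p + a r v * a v p))\<^sup>2 = 3"
    "(cmod (a w q * (a q p * X) + a w s * a s p + a w v * a v p))\<^sup>2 = 1"
    using r2 r3 n2 c gf by (simp_all add: norm_mult)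
  moreover have "(cmod (a p q * (a q p * X) + a p s * a s p + a p v * a v p))\<^sup>2 = 7"
    unfolding r1 by (rule n1)
  ultimately show False using tq ts c X1 by (simp add: norm_mult power_mult_distrib)
qed

text \<open>If \<open>q\<close> has an outer neighbour \<open>w\<close> as well, a test vector
  excludes that \<open>v\<close> and \<open>w\<close> are non-adjacent and \<open>no_ladder\<close>
  that they are adjacent. Otherwise the rest of the graph is reached through \<open>v\<close> only;
  test vectors exclude first a branching at \<open>v\<close>, then a path \<open>p\<close>,
  \<open>v\<close>, \<open>w\<close>, \<open>t\<close>.\<close>

lemma no_square_neighbour:
  assumes sq: "square p q r s" and v: "v < n" "v \<notin> {p, q, r, s}" "a p v \<noteq> 0"
    and s_only: "\<And>y. y < n \<Longrightarrow> y \<notin> {r, p} \<Longrightarrow> a s y = 0"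
  shows False
proof -
  note D = squareD[OF sq]
  note vz = square_private[OF sq v]
  have r_only: "a r y = 0" if "y < n" "y \<notin> {q, s}" for y
    using square_no_opposite[OF sq v that] .
  define g where "g = a p q * a q r * a r s * a s p"
  have gf: "Re g = - 1 / 2" "cmod g = 1" and s1: "cmod (a p q * a q r + a p s * a s r) = 1"
    using square_gain[OF sq, of v] v vz D unfolding g_def by auto
  have nz: "a v p \<noteq> 0" using zero_sym D v by auto
  have m: "a p v * a v p = 1" "a p q * a q p = 1" "a p s * a s p = 1" "a q r * a r q = 1"
    "a s r * a r s = 1" "a r q * a q r = 1" "a r s * a s r = 1" "a s p * a p s = 1" "a q p * a p q = 1"
    using unit_mult D v nz by auto
  have c: "cmod (a v p) = 1" "cmod (a q p) = 1" "cmod (a s p) = 1" "cmod (a s r) = 1" "cmod (a r q) = 1"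
    using unit_cmod D v nz by auto
  have z1: "a r v = 0" using vz zero_sym D v by auto
  have s2: "cmod (a r q * a q p + a r s * a s p) = 1"
  proof -
    have "a r q * a q p + a r s * a s p = cnj (a p q * a q r + a p s * a s r)"
      using herm[of p q] herm[of q r] herm[of s r] herm[of p s] D by (simp add: algebra_simps)
    then show ?thesis using s1 by (simp only: complex_mod_cnj)
  qed
  have p_sat: "a p y = 0" "a y p = 0" if "y < n" "y \<notin> {q, s, v}" for y
    using three_neighbours(2,3)[of p q s v y] D v that by auto
  show False
  proof (cases "\<exists>w<n. w \<notin> {p, r} \<and> a q w \<noteq> 0")
    case True
    then obtain w where w: "w < n" "w \<notin> {p, r}" "a q w \<noteq> 0" by blast
    have "w \<noteq> q" using square_uncharged[OF square_rot[OF sq]] w by auto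
    moreover have "w \<noteq> s" using w D by auto
    moreover have "w \<noteq> v" using w vz(1) zero_sym[of q v] D v by auto
    ultimately have w': "w \<notin> {p, q, r, s, v}" "w \<notin> {q, r, s, p}" using w by auto
    note wz = square_private[OF square_rot[OF sq] w(1) w'(2) w(3)]
    have nzw: "a w q \<noteq> 0" using zero_sym D w by auto
    show False
    proof (cases "a v w = 0")
      case True
      have mw: "a q w * a w q = 1" using unit_mult D w by auto
      have cw: "cmod (a w q) = 1" using unit_cmod D w nzw by auto
      \<comment> \<open>Up to units the vector is 5 at \<open>p\<close>, \<open>Z\<close> at
        \<open>r\<close> and \<open>U\<close> at \<open>w\<close>, which gives 4 * (25 + 13 + 7) =
        180, whereas the rows \<open>v\<close>, \<open>q\<close>, \<open>s\<close> give 25 + 112 +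
        48 = 185.\<close>
      define Z where "Z = 4 + 3 * g"
      define U where "U = 3 + g"
      have nZ: "(cmod Z)\<^sup>2 = 13" unfolding Z_def using cmod_lin[OF gf(2), of 4 3] gf by simp
      have nU: "(cmod U)\<^sup>2 = 7" unfolding U_def using cmod_lin[OF gf(2), of 3 1] gf by simp
      have r1: "a q p * 5 + a q r * (a r q * a q p * Z) + a q w * (a w q * a q p * U) = a q p * (12 + 4 * g)"
      proof -
        have "a q p * 5 + a q r * (a r q * a q p * Z) + a q w * (a w q * a q p * U) =
            a q p * 5 + (a q r * a r q) * (a q p * Z) + (a q w * a w q) * (a q p * U)"
          by (simp add: mult_ac)
        then show ?thesis unfolding m mw Z_def U_def by (simp add: algebra_simps)
      qed
      have n1: "(cmod (12 + 4 * g))\<^sup>2 = 112" using cmod_lin[OF gf(2), of 12 4] gf by simp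
      have r2: "a s p * 5 + a s r * (a r q * a q p * Z) = a s r * a r q * a q p * (4 + 8 * g)"
        unfolding Z_def g_def by (rule square_alg[OF m(5) m(6) m(2)])
      have n2: "(cmod (4 + 8 * g))\<^sup>2 = 48" using cmod_lin[OF gf(2), of 4 8] gf by simp
      have "(\<Sum>y\<leftarrow>[v, q, s]. (cmod (a y p * 5 + a y r * (a r q * a q p * Z) + a y w * (a w q * a q p * U)))\<^sup>2)
          < 4 * ((cmod 5)\<^sup>2 + (cmod (a r q * a q p * Z))\<^sup>2 + (cmod (a w q * a q p * U))\<^sup>2)"
        by (rule vector3[where ?y0.0 = v]) (use D v w w' vz True nz in auto)
      moreover have "(cmod (a q p * 5 + a q r * (a r q * a q p * Z) + a q w * (a w q * a q p * U)))\<^sup>2 = 112"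
        unfolding r1 by (simp add: norm_mult power_mult_distrib c n1)
      moreover have "a s w = 0" using wz(3) zero_sym[of s w] D w by auto
      then have "(cmod (a s p * 5 + a s r * (a r q * a q p * Z) + a s w * (a w q * a q p * U)))\<^sup>2 = 48"
        using r2 by (simp add: norm_mult power_mult_distrib c n2)
      ultimately show False using vz True c cw nZ nU by (simp add: norm_mult power_mult_distrib)
    next
      case False
      obtain x t where xt: "x \<in> set [p, q, r, s, v, w]" "t < n" "t \<notin> set [p, q, r, s, v, w]" "a x t \<noteq> 0"
        using closed_large[of "[p, q, r, s, v, w]"] D v w by auto
      have "a p t = 0" using p_sat xt by auto
      moreover have "a q t = 0" using three_neighbours(2)[of q p r w t] D w w' xt by auto
      moreover have "a r t = 0" "a s t = 0" using r_only[of t] s_only[of t] xt by auto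
      ultimately have "x = v \<or> x = w" using xt by auto
      then show False
      proof
        assume "x = v"
        then show False using no_ladder[OF sq v w(1) w'(1) w(3) False, of t] xt by auto
      next
        assume "x = w"
        have sq': "square q p s r" using square_rev[OF square_rot[OF sq]] .
        have "a w v \<noteq> 0" using False zero_sym v w by auto
        then show False
          using no_ladder[OF sq' w(1), of v t] v w w' xt \<open>x = w\<close> by auto
      qed
    qed
  next
    case False
    then have q_only: "a q y = 0" if "y < n" "y \<notin> {p, r}" for y using that by blast
    obtain x w where xw: "x \<in> set [p, q, r, s, v]" "w < n" "w \<notin> set [p, q, r, s, v]" "a x w \<noteq> 0"
      using closed_large[of "[p, q, r, s, v]"] D v by auto
    have "x = v" using xw p_sat[of w] q_only[of w] r_only[of w] s_only[of w] by auto
    then have w: "w < n" "w \<notin> {p, q, r, s, v}" "a v w \<noteq> 0" "a w v \<noteq> 0"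
      using xw zero_sym[of v w] v by auto
    have out: "a y q = 0" "a y r = 0" "a y s = 0" if "y < n" "y \<notin> {p, q, r, s}" for y
      using q_only[of y] r_only[of y] s_only[of y] zero_sym[of y] D that by auto
    have zz: "a q q = 0" "a s s = 0" using q_only[of q] s_only[of s] D by auto
    have v_only: "a v t = 0" if t: "t < n" "t \<notin> {p, w}" for t
    proof (rule ccontr)
      assume vt: "a v t \<noteq> 0"
      then have t': "t \<notin> {q, r, s}" using vz D v by auto
      have tv: "a t v \<noteq> 0" using vt zero_sym v t by auto
      have ct: "cmod (a t v) = 1" "cmod (a w v) = 1" using unit_cmod tv w v t by auto
      \<comment> \<open>Row \<open>p\<close> is 3 and the rows \<open>r\<close>, \<open>w\<close>,
        \<open>t\<close> have modulus 1, again 12 = 4 * 3.\<close>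
      have "(\<Sum>y\<leftarrow>[p, r, w, t]. (cmod (a y v * a v p + a y q * a q p + a y s * a s p))\<^sup>2)
          < 4 * ((cmod (a v p))\<^sup>2 + (cmod (a q p))\<^sup>2 + (cmod (a s p))\<^sup>2)"
        by (rule vector3[where ?y0.0 = p]) (use D v w t t' m in auto)
      then show False
        using m z1 s2 c ct out[of t] out[of w] t t' w by (simp add: norm_mult)
    qed
    obtain x t where xt: "x \<in> set [p, q, r, s, v, w]" "t < n" "t \<notin> set [p, q, r, s, v, w]" "a x t \<noteq> 0"
      using closed_large[of "[p, q, r, s, v, w]"] D v w by auto
    have "x = w" using xt p_sat[of t] q_only[of t] r_only[of t] s_only[of t] v_only[of t] by auto
    then have tw: "a t w \<noteq> 0" using xt zero_sym w by auto
    define F where "F = a r q * a q p + a r s * a s p"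
    have mw: "a v w * a w v = 1" using unit_mult w v by auto
    have cw: "cmod (a w v) = 1" "cmod (a t w) = 1" using unit_cmod w v tw xt by auto
    have r1: "a v p * 2 + a v w * (a w v * a v p) = 3 * a v p"
      using mw by (simp add: mult.assoc[symmetric])
    have r2: "a q p * 2 + a q r * F = a q p * (3 + g)"
      unfolding F_def g_def by (rule square_alg2[OF m(2) m(4)])
    have r3: "a s p * 2 + a s r * F = a s p * (3 + cnj g)"
    proof -
      have "cnj g = a p s * a s r * a r q * a q p"
        unfolding g_def using herm[of p q] herm[of q r] herm[of r s] herm[of s p] D by (simp add: mult_ac)
      then show ?thesis unfolding F_def
        using square_alg2[OF m(3) m(5), of "a r q" "a q p"] by (simp add: add.commute)
    qed
    have n2: "(cmod (3 + g))\<^sup>2 = 7" using cmod_lin[OF gf(2), of 3 1] gf by simp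
    have n3: "(cmod (3 + cnj g))\<^sup>2 = 7" using cmod_lin[of "cnj g" 3 1] gf by simp
    have z2: "a v r = 0" "a q w = 0" "a s w = 0" "a t p = 0" "a t r = 0"
      using vz q_only[of w] s_only[of w] p_sat[of t] out[of t] xt w by auto
    \<comment> \<open>Moduli 2, 1, 1 at \<open>p\<close>, \<open>r\<close>, \<open>w\<close> give 4
      * 6 = 24, and the rows \<open>v\<close>, \<open>q\<close>, \<open>s\<close>, \<open>t\<close>
      give 9 + 7 + 7 + 1.\<close>
    have "(\<Sum>y\<leftarrow>[v, q, s, t]. (cmod (a y p * 2 + a y r * F + a y w * (a w v * a v p)))\<^sup>2)
        < 4 * ((cmod 2)\<^sup>2 + (cmod F)\<^sup>2 + (cmod (a w v * a v p))\<^sup>2)"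
    proof (rule vector3[where ?y0.0 = v])
      show "a v p * 2 + a v r * F + a v w * (a w v * a v p) \<noteq> 0"
        unfolding z2(1) mult_zero_left add_0_right r1 using nz by simp
    qed (use D v w xt in auto)
    moreover have "(cmod (a q p * 2 + a q r * F))\<^sup>2 = 7" "(cmod (a s p * 2 + a s r * F))\<^sup>2 = 7"
      unfolding r2 r3 by (simp_all add: norm_mult power_mult_distrib c n2 n3)
    moreover have "(cmod (a v p * 2 + a v w * (a w v * a v p)))\<^sup>2 = 9"
      unfolding r1 by (simp add: norm_mult power_mult_distrib c)
    moreover have "cmod F = 1" using s2 by (simp add: F_def)
    ultimately show False using z2 cw c by (simp add: norm_mult)
  qed
qed

text \<open>An extra neighbour of \<open>s\<close> lies outside the square because charges vanish;
  then the opposite vertex \<open>q\<close> has none, and reading the square in the other direction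
  leads back to \<open>no_square_neighbour\<close>.\<close>

lemma no_square: "\<not> square p q r s"
proof
  have nbr: False if sq: "square p q r s" and v: "v < n" "v \<notin> {p, q, r, s}" "a p v \<noteq> 0" for p q r s v
  proof (cases "\<exists>y<n. y \<notin> {r, p} \<and> a s y \<noteq> 0")
    case False
    then show False using no_square_neighbour[OF sq v] by blast
  next
    case True
    then obtain y where y: "y < n" "y \<notin> {r, p}" "a s y \<noteq> 0" by blast
    note D = squareD[OF sq]
    have y': "y \<notin> {s, p, q, r}"
      using y D square_uncharged[OF square_rot[OF square_rot[OF square_rot[OF sq]]]] by auto
    have "a q z = 0" if "z < n" "z \<notin> {p, r}" for z
      using square_no_opposite[OF square_rot[OF square_rot[OF square_rot[OF sq]]] y(1) y' y(3) that] .
    then show False using no_square_neighbour[OF square_rev[OF sq], of v] v by auto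
  qed
  assume sq: "square p q r s"
  note D = squareD[OF sq]
  obtain x v where xv: "x \<in> set [p, q, r, s]" "v < n" "v \<notin> set [p, q, r, s]" "a x v \<noteq> 0"
    using closed_large[of "[p, q, r, s]"] D by auto
  then show False
    using nbr[OF sq, of v] nbr[OF square_rot[OF sq], of v] nbr[OF square_rot[OF square_rot[OF sq]], of v]
      nbr[OF square_rot[OF square_rot[OF square_rot[OF sq]]], of v] by auto
qed

end

text \<open>Rows of the vector used for hexagons; \<open>x10\<close> stands for the weight from
  vertex 1 to vertex 0 of the cycle, and likewise for the other digits.\<close>

lemma hexagon_alg1:
  fixes x10 :: complex
  assumes "x12 * x21 = 1"
  shows "x10 * 3 + x12 * ((2 + g) * (x21 * x10)) = x10 * (5 + g)"
proof -
  have "(x10 * 3 + x12 * ((2 + g) * (x21 * x10))) - x10 * (5 + g) = (2 + g) * x10 * (x12 * x21 - 1)"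
    by (simp add: algebra_simps)
  then show ?thesis using assms by simp
qed

lemma hexagon_alg2:
  fixes x10 :: complex
  assumes "x34 * x43 = 1"
  shows "x32 * ((2 + g) * (x21 * x10)) + x34 * ((1 + 2 * g) * (x43 * (x32 * (x21 * x10))))
    = x32 * x21 * x10 * (3 + 3 * g)"
proof -
  have "(x32 * ((2 + g) * (x21 * x10)) + x34 * ((1 + 2 * g) * (x43 * (x32 * (x21 * x10)))))
      - x32 * x21 * x10 * (3 + 3 * g) = (1 + 2 * g) * x32 * x21 * x10 * (x34 * x43 - 1)"
    by (simp add: algebra_simps)
  then show ?thesis using assms by simp
qed

lemma hexagon_alg3:
  fixes x10 :: complex
  assumes "x01 * x10 = 1" "x12 * x21 = 1" "x23 * x32 = 1" "x34 * x43 = 1" "x45 * x54 = 1"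
    and "g = x01 * x12 * x23 * x34 * x45 * x50"
  shows "x50 * 3 + x54 * ((1 + 2 * g) * (x43 * (x32 * (x21 * x10)))) = x54 * x43 * x32 * x21 * x10 * (1 + 5 * g)"
proof -
  have "x54 * x43 * x32 * x21 * x10 * g =
      (x01 * x10) * (x12 * x21) * (x23 * x32) * (x34 * x43) * (x45 * x54) * x50"
    unfolding assms(6) by (simp add: mult_ac)
  then have "x54 * x43 * x32 * x21 * x10 * g = x50" using assms by simp
  then show ?thesis by (simp add: algebra_simps)
qed

context unit_weights
begin

subsection \<open>Longer cycles\<close>

text \<open>An induced cycle, indexed periodically by integers so that rotations are shifts and
  negative indices run the other way. Only index pairs less than \<open>k\<close> apart are
  constrained; the distances 1 and \<open>k - 1\<close> are the edges. Charges are left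
  open.\<close>

definition icycle :: "(int \<Rightarrow> nat) \<Rightarrow> int \<Rightarrow> bool" where
  "icycle c k \<longleftrightarrow> 3 \<le> k \<and> (\<forall>i. c (i + k) = c i) \<and> (\<forall>i. c i < n) \<and>
     (\<forall>i j. \<bar>i - j\<bar> < k \<longrightarrow> (c i = c j \<longleftrightarrow> i = j) \<and>
        (i \<noteq> j \<longrightarrow> (a (c i) (c j) \<noteq> 0 \<longleftrightarrow> \<bar>i - j\<bar> = 1 \<or> \<bar>i - j\<bar> = k - 1)))"

definition gain :: "(int \<Rightarrow> nat) \<Rightarrow> int \<Rightarrow> complex" where
  "gain c k = (\<Prod>i\<in>{0..<k}. a (c i) (c (i + 1)))"

lemma icycle_per: "icycle c k \<Longrightarrow> c (i + k) = c i"
  by (simp add: icycle_def)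

lemma icycle_V: "icycle c k \<Longrightarrow> c i < n"
  by (simp add: icycle_def)

lemma icycleD:
  assumes "icycle c k" "\<bar>i - j\<bar> < k"
  shows "c i = c j \<longleftrightarrow> i = j"
    "i \<noteq> j \<Longrightarrow> a (c i) (c j) \<noteq> 0 \<longleftrightarrow> \<bar>i - j\<bar> = 1 \<or> \<bar>i - j\<bar> = k - 1"
  using assms unfolding icycle_def by metis+

lemma icycle_ne: "icycle c k \<Longrightarrow> i \<noteq> j \<Longrightarrow> \<bar>i - j\<bar> < k \<Longrightarrow> c i \<noteq> c j"
  using icycleD(1) by metis

lemma icycle_nz: assumes "icycle c k" "\<bar>i - j\<bar> = 1" shows "a (c i) (c j) \<noteq> 0"
proof -
  have "3 \<le> k" using assms by (simp add: icycle_def)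
  then have "\<bar>i - j\<bar> < k" "i \<noteq> j" using assms(2) by auto
  from icycleD(2)[OF assms(1) this] assms(2) show ?thesis by simp
qed

lemma icycle_z: "icycle c k \<Longrightarrow> i \<noteq> j \<Longrightarrow> \<bar>i - j\<bar> < k \<Longrightarrow> \<bar>i - j\<bar> \<noteq> 1 \<Longrightarrow> \<bar>i - j\<bar> \<noteq> k - 1 \<Longrightarrow>
    a (c i) (c j) = 0"
  using icycleD(2) by metis

lemma icycle_wrap: assumes "icycle c k" "\<bar>i - j\<bar> = k - 1" shows "a (c i) (c j) \<noteq> 0"
proof -
  have "3 \<le> k" using assms by (simp add: icycle_def)
  then have "\<bar>i - j\<bar> < k" "i \<noteq> j" using assms(2) by auto
  from icycleD(2)[OF assms(1) this] assms(2) show ?thesis by simp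
qed

lemma icycle_shift: "icycle c k \<Longrightarrow> icycle (\<lambda>i. c (i + s)) k"
proof -
  assume c: "icycle c k"
  have "c (i + k + s) = c (i + s)" for i using icycle_per[OF c, of "i + s"] by (simp add: add_ac)
  moreover have "(i + s) - (j + s) = i - j" for i j :: int by simp
  ultimately show ?thesis using c unfolding icycle_def by (auto simp del: add_diff_cancel_right)
qed

lemma icycle_mod: "icycle c k \<Longrightarrow> c i = c (i mod k)"
proof -
  assume c: "icycle c k"
  have pos: "c (j + int m * k) = c j" for j m
  proof (induction m)
    case (Suc m)
    have "c (j + int (Suc m) * k) = c ((j + int m * k) + k)" by (simp add: algebra_simps)
    then show ?case using icycle_per[OF c] Suc by simp
  qed simp
  have "c (j + m * k) = c j" for j m
  proof (cases "m \<ge> 0")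
    case True then show ?thesis using pos[of j "nat m"] by simp
  next
    case False then show ?thesis using pos[of "j + m * k" "nat (- m)"] by (simp add: algebra_simps)
  qed
  from this[of "i mod k" "i div k"] show ?thesis by (simp add: add.commute)
qed

lemma gain_shift:
  assumes c: "icycle c k" shows "gain (\<lambda>i. c (i + s)) k = gain c k"
proof -
  define F where "F = (\<lambda>i. a (c i) (c (i + 1)))"
  have F: "F (i + k) = F i" for i
    using icycle_per[OF c, of i] icycle_per[OF c, of "i + 1"] by (simp add: F_def add_ac)
  have k: "k \<ge> 3" using c by (simp add: icycle_def)
  define G where "G = (\<lambda>s. prod F {s..<s + k})"
  have step: "G (s + 1) = G s" for s
  proof -
    have "{s..<s + k} = insert s {s + 1..<s + k}" "{s + 1..<s + 1 + k} = insert (s + k) {s + 1..<s + k}"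
      using k by auto
    then show ?thesis by (simp add: G_def F)
  qed
  have "G s = G 0"
  proof (induction s rule: int_induct[of _ 0])
    case (step2 i) then show ?case using step[of "i - 1"] by simp
  qed (auto simp: step)
  moreover have "gain (\<lambda>i. c (i + s)) k = G s"
    unfolding gain_def G_def
    by (rule prod.reindex_bij_witness[of _ "\<lambda>i. i - s" "\<lambda>i. i + s"]) (auto simp: F_def add_ac)
  moreover have "gain c k = G 0" by (simp add: gain_def G_def F_def)
  ultimately show ?thesis by simp
qed

lemma gain_R: assumes "icycle c k" shows "gain c k \<in> R" "cmod (gain c k) = 1"
proof -
  have "finite S \<Longrightarrow> (\<Prod>i\<in>S. a (c i) (c (i + 1))) \<in> R" for S
    by (induction S rule: finite_induct) (auto intro!: R_1 R_mult R_entry icycle_V[OF assms])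
  then show "gain c k \<in> R" by (simp add: gain_def)
  have "cmod (a (c i) (c (i + 1))) = 1" for i
    using unit_cmod icycle_V[OF assms] icycle_nz[OF assms, of i "i + 1"] by simp
  then show "cmod (gain c k) = 1" by (simp add: gain_def prod_norm[symmetric])
qed

text \<open>The arms \<open>c 1\<close>, \<open>c 2\<close>, \<open>c 3\<close> and
  \<open>c (- 1)\<close>, \<open>c (- 2)\<close>, \<open>c (- 3)\<close> and the short arm
  \<open>x\<close> around \<open>c 0\<close> form an affine diagram of type E7; the vector is half
  its null vector on the colour class of \<open>c 0\<close>. A charge at \<open>c 0\<close> takes
  the part of the short arm (\<open>x = c 0\<close>). For \<open>k = 5\<close> the arms overlap but
  their ends remain distinct; for \<open>k = 6\<close> the ends coincide.\<close>

lemma private_core: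
  assumes c: "icycle c k" and k: "k \<ge> 5"
    and x: "x < n" "a x (c 0) \<noteq> 0" "a x (c 2) = 0" "a x (c (- 2)) = 0" "x = c 0 \<or> x \<notin> range c"
    and h: "a (c 3) (c (- 2)) = 0" "a (c (- 3)) (c 2) = 0" "c 3 \<noteq> c (- 3)"
  shows False
proof -
  note V = icycle_V[OF c] and ne = icycle_ne[OF c] and z = icycle_z[OF c] and nz = icycle_nz[OF c]
  have m: "a (c 1) (c 2) * a (c 2) (c 1) = 1" "a (c (- 1)) (c (- 2)) * a (c (- 2)) (c (- 1)) = 1"
    using unit_mult V nz[of 1 2] nz[of "- 1" "- 2"] by auto
  have cm: "cmod (a (c 1) (c 0)) = 1" "cmod (a (c (- 1)) (c 0)) = 1" "cmod (a (c 2) (c 1)) = 1"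
    "cmod (a (c (- 2)) (c (- 1))) = 1" "cmod (a (c 3) (c 2)) = 1" "cmod (a (c (- 3)) (c (- 2))) = 1"
    "cmod (a x (c 0)) = 1"
    using unit_cmod V x nz[of 1 0] nz[of "- 1" 0] nz[of 2 1] nz[of "- 2" "- 1"] nz[of 3 2] nz[of "- 3" "- 2"]
    by auto
  have z0: "a (c 1) (c (- 2)) = 0" "a (c (- 1)) (c 2) = 0" "a (c 3) (c 0) = 0" "a (c (- 3)) (c 0) = 0"
    using z[of 1 "- 2"] z[of "- 1" 2] z[of 3 0] z[of "- 3" 0] k by auto
  define f where "f = a (c 2) (c 1) * a (c 1) (c 0)"
  define h' where "h' = a (c (- 2)) (c (- 1)) * a (c (- 1)) (c 0)"
  have fn: "cmod f = 1" "cmod h' = 1" using cm by (auto simp: f_def h'_def norm_mult)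
  have r1: "a (c 1) (c 0) * 2 + a (c 1) (c 2) * f = 3 * a (c 1) (c 0)"
    using m by (simp add: f_def mult.assoc[symmetric])
  have r2: "a (c (- 1)) (c 0) * 2 + a (c (- 1)) (c (- 2)) * h' = 3 * a (c (- 1)) (c 0)"
    using m by (simp add: h'_def mult.assoc[symmetric])
  have xn: "x \<noteq> c 1" "x \<noteq> c (- 1)" "x \<noteq> c 3" "x \<noteq> c (- 3)"
    using x ne[of 0 1] ne[of 0 "- 1"] ne[of 0 3] ne[of 0 "- 3"] k by auto
  \<comment> \<open>The bound is 4 * (4 + 1 + 1) = 24, and the rows give 9 + 9 + 4 + 1 + 1.\<close>
  have "(\<Sum>y\<leftarrow>[c 1, c (- 1), x, c 3, c (- 3)]. (cmod (a y (c 0) * 2 + a y (c 2) * f + a y (c (- 2)) * h'))\<^sup>2)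
      < 4 * ((cmod 2)\<^sup>2 + (cmod f)\<^sup>2 + (cmod h')\<^sup>2)"
  proof (rule vector3[where ?y0.0 = "c 1"])
    show "distinct [c 0, c 2, c (- 2)]" using ne[of 0 2] ne[of 0 "- 2"] ne[of 2 "- 2"] k by auto
    show "distinct [c 1, c (- 1), x, c 3, c (- 3)]"
      using xn h ne[of 1 "- 1"] ne[of 1 3] ne[of 1 "- 3"] ne[of "- 1" 3] ne[of "- 1" "- 3"] k by auto
    show "a (c 1) (c 0) * 2 + a (c 1) (c 2) * f + a (c 1) (c (- 2)) * h' \<noteq> 0"
      using r1 z0 nz[of 1 0] by simp
  qed (use V x ne[of 1 0] ne[of 1 2] ne[of 1 "- 2"] k in auto)
  moreover have "(cmod (a (c 1) (c 0) * 2 + a (c 1) (c 2) * f + a (c 1) (c (- 2)) * h'))\<^sup>2 = 9"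
    unfolding z0 mult_zero_left add_0_right r1 by (simp add: norm_mult cm)
  moreover have "(cmod (a (c (- 1)) (c 0) * 2 + a (c (- 1)) (c 2) * f + a (c (- 1)) (c (- 2)) * h'))\<^sup>2 = 9"
    unfolding z0 mult_zero_left add_0_right r2 by (simp add: norm_mult cm)
  moreover have "(cmod (a x (c 0) * 2 + a x (c 2) * f + a x (c (- 2)) * h'))\<^sup>2 = 4"
    unfolding x(3,4) mult_zero_left add_0_right by (simp add: norm_mult cm)
  moreover have "(cmod (a (c 3) (c 0) * 2 + a (c 3) (c 2) * f + a (c 3) (c (- 2)) * h'))\<^sup>2 = 1"
    unfolding z0 h(1) mult_zero_left add_0_left add_0_right by (simp add: norm_mult cm fn)
  moreover have "(cmod (a (c (- 3)) (c 0) * 2 + a (c (- 3)) (c 2) * f + a (c (- 3)) (c (- 2)) * h'))\<^sup>2 = 1"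
    unfolding z0 h(2) mult_zero_left add_0_left add_0_right by (simp add: norm_mult cm fn)
  ultimately show False by (simp only: list.map sum_list.Cons sum_list.Nil fn norm_numeral) simp
qed

text \<open>Here the long arms of \<open>private_core\<close> end in the same vertex, and the gain
  has to enter the test vector.\<close>

lemma private_hexagon:
  assumes c: "icycle c 6" and irr: "gain c 6 \<notin> \<rat>"
    and x: "x < n" "a x (c 0) \<noteq> 0" "a x (c 2) = 0" "a x (c 4) = 0" "x = c 0 \<or> x \<notin> range c"
  shows False
proof -
  note V = icycle_V[OF c] and ne = icycle_ne[OF c] and z = icycle_z[OF c] and nz = icycle_nz[OF c]
  define g where "g = gain c 6"
  have c6: "c 6 = c 0" using icycle_per[OF c, of 0] by simp
  have s6: "{0..<6::int} = {0, 1, 2, 3, 4, 5}" by auto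
  have g: "g = a (c 0) (c 1) * a (c 1) (c 2) * a (c 2) (c 3) * a (c 3) (c 4) * a (c 4) (c 5) * a (c 5) (c 0)"
    by (simp add: g_def gain_def s6 c6 mult_ac)
  have g1: "cmod g = 1" and gR: "g \<in> R" using gain_R[OF c] by (auto simp: g_def)
  \<comment> \<open>\<open>2 * Re g\<close> is an integer of absolute value at most 2, and -2 would
    mean \<open>g = - 1\<close>.\<close>
  have re: "Re g \<ge> - 1 / 2"
  proof (rule ccontr)
    assume lt: "\<not> Re g \<ge> - 1 / 2"
    obtain t where t: "2 * Re g = of_int t" using R_trace[OF gR] by (auto elim: Ints_cases)
    have "\<bar>Re g\<bar> \<le> 1" using abs_Re_le_cmod[of g] g1 by simp
    then have "of_int t \<ge> (- 2 :: real)" "of_int t < (- 1 :: real)" using t lt by linarith+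
    then have "t = - 2" by linarith
    then have "Re g = - 1" using t by simp
    moreover from this have "Im g = 0" using g1 cmod_power2[of g] by simp
    ultimately have "g = - 1" by (simp add: complex_eq_iff)
    then show False using irr by (simp add: g_def)
  qed
  have m: "a (c 0) (c 1) * a (c 1) (c 0) = 1" "a (c 1) (c 2) * a (c 2) (c 1) = 1"
    "a (c 2) (c 3) * a (c 3) (c 2) = 1" "a (c 3) (c 4) * a (c 4) (c 3) = 1" "a (c 4) (c 5) * a (c 5) (c 4) = 1"
    using unit_mult V nz[of 0 1] nz[of 1 2] nz[of 2 3] nz[of 3 4] nz[of 4 5] by auto
  have cm: "cmod (a (c 1) (c 0)) = 1" "cmod (a (c 2) (c 1)) = 1" "cmod (a (c 3) (c 2)) = 1"
    "cmod (a (c 4) (c 3)) = 1" "cmod (a (c 5) (c 4)) = 1" "cmod (a x (c 0)) = 1"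
    using unit_cmod V x nz[of 1 0] nz[of 2 1] nz[of 3 2] nz[of 4 3] nz[of 5 4] by auto
  have z0: "a (c 1) (c 4) = 0" "a (c 3) (c 0) = 0" "a (c 5) (c 2) = 0"
    using z[of 1 4] z[of 3 0] z[of 5 2] by auto
  \<comment> \<open>Up to transport along the cycle the values at \<open>c 0\<close>,
    \<open>c 2\<close>, \<open>c 4\<close> are 3, \<open>2 + g\<close>, \<open>1 + 2 * g\<close>:
    linear interpolation from 3 to \<open>3 * g\<close>, which after one full turn is the value 3 at
    \<open>c 0\<close> again. The rows total \<open>79 + 38 * Re g\<close>, the bound is
    \<open>76 + 32 * Re g\<close>, and the two meet at \<open>Re g = - 1 / 2\<close>.\<close>
  define f2 where "f2 = (2 + g) * (a (c 2) (c 1) * a (c 1) (c 0))"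
  define f4 where "f4 = (1 + 2 * g) * (a (c 4) (c 3) * (a (c 3) (c 2) * (a (c 2) (c 1) * a (c 1) (c 0))))"
  have r1: "a (c 1) (c 0) * 3 + a (c 1) (c 2) * f2 = a (c 1) (c 0) * (5 + g)"
    unfolding f2_def by (rule hexagon_alg1[OF m(2)])
  have r3: "a (c 3) (c 2) * f2 + a (c 3) (c 4) * f4 = a (c 3) (c 2) * a (c 2) (c 1) * a (c 1) (c 0) * (3 + 3 * g)"
    unfolding f2_def f4_def by (rule hexagon_alg2[OF m(4)])
  have r5: "a (c 5) (c 0) * 3 + a (c 5) (c 4) * f4 =
      a (c 5) (c 4) * a (c 4) (c 3) * a (c 3) (c 2) * a (c 2) (c 1) * a (c 1) (c 0) * (1 + 5 * g)"
    unfolding f4_def by (rule hexagon_alg3[OF m g])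
  have n: "(cmod (2 + g))\<^sup>2 = 5 + 4 * Re g" "(cmod (1 + 2 * g))\<^sup>2 = 5 + 4 * Re g"
    "(cmod (5 + g))\<^sup>2 = 26 + 10 * Re g" "(cmod (3 + 3 * g))\<^sup>2 = 18 + 18 * Re g"
    "(cmod (1 + 5 * g))\<^sup>2 = 26 + 10 * Re g"
    using cmod_lin[OF g1, of 2 1] cmod_lin[OF g1, of 1 2] cmod_lin[OF g1, of 5 1] cmod_lin[OF g1, of 3 3]
      cmod_lin[OF g1, of 1 5] by simp_all
  have fn: "(cmod f2)\<^sup>2 = 5 + 4 * Re g" "(cmod f4)\<^sup>2 = 5 + 4 * Re g"
    by (simp_all add: f2_def f4_def norm_mult power_mult_distrib cm n)
  have rn: "(cmod (a (c 1) (c 0) * 3 + a (c 1) (c 2) * f2))\<^sup>2 = 26 + 10 * Re g"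
    "(cmod (a (c 3) (c 2) * f2 + a (c 3) (c 4) * f4))\<^sup>2 = 18 + 18 * Re g"
    "(cmod (a (c 5) (c 0) * 3 + a (c 5) (c 4) * f4))\<^sup>2 = 26 + 10 * Re g"
    unfolding r1 r3 r5 by (simp_all add: norm_mult power_mult_distrib cm n)
  have xn: "x \<noteq> c 1" "x \<noteq> c 3" "x \<noteq> c 5"
    using x ne[of 0 1] ne[of 0 3] ne[of 0 5] by auto
  have "(\<Sum>y\<leftarrow>[c 1, c 3, c 5, x]. (cmod (a y (c 0) * 3 + a y (c 2) * f2 + a y (c 4) * f4))\<^sup>2)
      < 4 * ((cmod 3)\<^sup>2 + (cmod f2)\<^sup>2 + (cmod f4)\<^sup>2)"
  proof (rule vector3[where ?y0.0 = "c 1"])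
    show "distinct [c 0, c 2, c 4]" using ne[of 0 2] ne[of 0 4] ne[of 2 4] by auto
    show "distinct [c 1, c 3, c 5, x]" using xn ne[of 1 3] ne[of 1 5] ne[of 3 5] by auto
    have "a (c 1) (c 0) * 3 + a (c 1) (c 2) * f2 \<noteq> 0" using rn(1) re by auto
    then show "a (c 1) (c 0) * 3 + a (c 1) (c 2) * f2 + a (c 1) (c 4) * f4 \<noteq> 0" using z0 by simp
  qed (use V x ne[of 1 0] ne[of 1 2] ne[of 1 4] in auto)
  moreover have "(cmod (a (c 1) (c 0) * 3 + a (c 1) (c 2) * f2 + a (c 1) (c 4) * f4))\<^sup>2 = 26 + 10 * Re g"
    unfolding z0 mult_zero_left add_0_right by (rule rn(1))
  moreover have "(cmod (a (c 3) (c 0) * 3 + a (c 3) (c 2) * f2 + a (c 3) (c 4) * f4))\<^sup>2 = 18 + 18 * Re g"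
    unfolding z0 mult_zero_left add_0_left by (rule rn(2))
  moreover have "(cmod (a (c 5) (c 0) * 3 + a (c 5) (c 2) * f2 + a (c 5) (c 4) * f4))\<^sup>2 = 26 + 10 * Re g"
    unfolding z0 mult_zero_left add_0_right by (rule rn(3))
  moreover have "(cmod (a x (c 0) * 3 + a x (c 2) * f2 + a x (c 4) * f4))\<^sup>2 = 9"
    unfolding x(3,4) mult_zero_left add_0_right by (simp add: norm_mult cm)
  ultimately show False
    using re by (simp only: list.map sum_list.Cons sum_list.Nil fn norm_numeral) simp
qed

text \<open>The charged vertex takes the part of \<open>x\<close> in \<open>private_core\<close> and
  \<open>private_hexagon\<close>. For \<open>k = 5\<close> the ends of its long arms are the
  vertices at distance two from it, whose charges must be shown to vanish first.\<close>

lemma long_cycle_uncharged: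
  assumes c: "icycle c k" and k: "k \<ge> 5" and irr: "gain c k \<notin> \<rat>"
  shows "a (c i) (c i) = 0"
proof (rule ccontr)
  assume nz0: "a (c i) (c i) \<noteq> 0"
  define e where "e = (\<lambda>j. c (j + i))"
  have e: "icycle e k" unfolding e_def by (rule icycle_shift[OF c])
  have irr_e: "gain e k \<notin> \<rat>" unfolding e_def using gain_shift[OF c] irr by simp
  have ch: "a (e 0) (e 0) \<noteq> 0" using nz0 by (simp add: e_def)
  note V = icycle_V[OF e] and ne = icycle_ne[OF e] and z = icycle_z[OF e] and nz = icycle_nz[OF e]
  have z2: "a (e 0) (e 2) = 0" "a (e 0) (e (- 2)) = 0" using z[of 0 2] z[of 0 "- 2"] k by auto
  consider "k = 5" | "k = 6" | "k \<ge> 7" using k by linarith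
  then show False
  proof cases
    case 1
    have two: False if f: "icycle f 5" and ch: "a (f 0) (f 0) \<noteq> 0" "a (f 2) (f 2) \<noteq> 0" for f
    proof -
      note V = icycle_V[OF f] and ne = icycle_ne[OF f] and z = icycle_z[OF f] and nz = icycle_nz[OF f]
      have "a (f 0) (f 0) * a (f 0) (f 2) + a (f 0) (f 1) * a (f 1) (f 2) + a (f 0) (f (- 1)) * a (f (- 1)) (f 2) = 0"
        by (rule orthogonal3[of "f 0" "f 2" "f 0" "f 1" "f (- 1)" "f 2" "f 1" "f 3"])
          (use V ch ne[of 0 1] ne[of 0 "- 1"] ne[of 1 "- 1"] ne[of 0 2] ne[of 2 1] ne[of 2 3] ne[of 1 3]
            nz[of 0 1] nz[of 0 "- 1"] nz[of 2 1] nz[of 2 3] z[of 0 2] in auto)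
      then show False using z[of 0 2] z[of "- 1" 2] nz[of 0 1] nz[of 1 2] by simp
    qed
    have e5: "icycle e 5" using e 1 by simp
    have c2: "a (e 2) (e 2) = 0" using two[OF e5] ch by blast
    have c2': "a (e (- 2)) (e (- 2)) = 0"
      using two[OF icycle_shift[OF e5, of "- 2"]] ch by auto
    have p: "e 3 = e (- 2)" "e (- 3) = e 2"
      using icycle_per[OF e5, of "- 2"] icycle_per[OF e5, of "- 3"] by auto
    show False
      by (rule private_core[OF e5, of "e 0"]) (use V ch z2 c2 c2' p ne[of 2 "- 2"] 1 in auto)
  next
    case 2
    have e6: "icycle e 6" and irr6: "gain e 6 \<notin> \<rat>" using e irr_e 2 by auto
    have p: "e 4 = e (- 2)" using icycle_per[OF e6, of "- 2"] by auto
    show False by (rule private_hexagon[OF e6 irr6, of "e 0"]) (use V ch z2 p in auto)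
  next
    case 3
    show False
      by (rule private_core[OF e k, of "e 0"])
        (use V ch z2 3 z[of 3 "- 2"] z[of "- 3" 2] ne[of 3 "- 3"] in auto)
  qed
qed

text \<open>Orthogonality of \<open>c 0\<close> and \<open>c 1\<close>: without charges, the walk
  through \<open>v\<close> is the only one and cannot vanish.\<close>

lemma adjacent_common_neighbour:
  assumes c: "icycle c k" and k: "k \<ge> 5" and ch: "\<And>i. a (c i) (c i) = 0"
    and v: "v < n" "v \<notin> range c" "a v (c 0) \<noteq> 0" "a v (c 1) \<noteq> 0"
  shows False
proof -
  note V = icycle_V[OF c] and ne = icycle_ne[OF c] and z = icycle_z[OF c] and nz = icycle_nz[OF c]
  have v': "a (c 0) v \<noteq> 0" "a (c 1) v \<noteq> 0" using v V zero_sym by auto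
  have "a (c 0) (c 1) * a (c 1) (c 1) + a (c 0) (c (- 1)) * a (c (- 1)) (c 1) + a (c 0) v * a v (c 1) = 0"
    by (rule orthogonal3[of "c 0" "c 1" "c 1" "c (- 1)" v "c 0" "c 2" v])
      (use V v v' ch ne[of 0 1] ne[of 1 "- 1"] ne[of 0 2] nz[of 0 1] nz[of 0 "- 1"] nz[of 1 0] nz[of 1 2] k in auto)
  then show False using ch z[of "- 1" 1] k v v' by simp
qed

lemma sqnorm_upd: "w < n \<Longrightarrow> u w = 0 \<Longrightarrow> sqnorm (u(w := z)) = sqnorm u + (cmod z)\<^sup>2"
proof -
  assume w: "w < n" "u w = 0"
  have s: "sqnorm f = (cmod (f w))\<^sup>2 + (\<Sum>i\<in>{..<n} - {w}. (cmod (f i))\<^sup>2)" for f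
    unfolding sqnorm_def using w by (subst sum.remove[of _ w]) auto
  have "(\<Sum>i\<in>{..<n} - {w}. (cmod ((u(w := z)) i))\<^sup>2) = (\<Sum>i\<in>{..<n} - {w}. (cmod (u i))\<^sup>2)"
    by (rule sum.cong) auto
  then show ?thesis using s[of u] s[of "u(w := z)"] w by simp
qed

lemma app_upd: "w < n \<Longrightarrow> u w = 0 \<Longrightarrow> app (u(w := z)) y = app u y + a y w * z"
proof -
  assume w: "w < n" "u w = 0"
  have s: "app f y = a y w * f w + (\<Sum>i\<in>{..<n} - {w}. a y i * f i)" for f
    unfolding app_def using w by (subst sum.remove[of _ w]) auto
  have "(\<Sum>i\<in>{..<n} - {w}. a y i * (u(w := z)) i) = (\<Sum>i\<in>{..<n} - {w}. a y i * u i)"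
    by (rule sum.cong) auto
  then show ?thesis using s[of u] s[of "u(w := z)"] w by simp
qed

lemma app_eq_supp:
  assumes "F \<subseteq> {..<n}" "\<And>x. x < n \<Longrightarrow> x \<notin> F \<Longrightarrow> u x = 0 \<or> a y x = 0"
  shows "app u y = (\<Sum>x\<in>F. a y x * u x)"
  unfolding app_def
proof (rule sum.mono_neutral_right)
  show "\<forall>x\<in>{..<n} - F. a y x * u x = 0" using assms(2) by auto
qed (use assms(1) in auto)

end

context unit_weights
begin

text \<open>After rotating the twins \<open>x\<close> and \<open>v\<close>, this is a path with an edge of weight \<open>\<surd>2\<close> at each end.\<close>

lemma no_twins:
  fixes m :: nat
  assumes m: "m \<ge> 3" and P: "\<And>i. i \<le> m \<Longrightarrow> P i < n"
    and inj: "\<And>i j. i \<le> m \<Longrightarrow> j \<le> m \<Longrightarrow> P i = P j \<longleftrightarrow> i = j"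
    and adj: "\<And>i j. i \<le> m \<Longrightarrow> j \<le> m \<Longrightarrow> a (P i) (P j) \<noteq> 0 \<longleftrightarrow> j = i + 1 \<or> i = j + 1"
    and xv: "x < n" "v < n" "x \<noteq> v" "a x x = 0" "a v v = 0" "a x v = 0"
    and out: "\<And>i. i \<le> m \<Longrightarrow> P i \<noteq> x" "\<And>i. i \<le> m \<Longrightarrow> P i \<noteq> v"
    and adjx: "\<And>i. i \<le> m \<Longrightarrow> a x (P i) \<noteq> 0 \<longleftrightarrow> i = 0 \<or> i = m"
    and adjv: "\<And>i. i \<le> m \<Longrightarrow> a v (P i) \<noteq> 0 \<longleftrightarrow> i = 0 \<or> i = m"
    and orth: "a (P 0) x * a x (P m) + a (P 0) v * a v (P m) = 0"
  shows False
proof -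
  \<comment> \<open>A vector built up along the path as far as \<open>P l\<close>: its last value is
    a unit, the row of \<open>P l\<close> vanishes, beyond it only the row of
    \<open>P (l + 1)\<close> does not, and the rows before \<open>P l\<close> miss four times the
    norm by at most \<open>C\<close>. The value \<gamma> at \<open>P 0\<close> enters the rows of
    \<open>x\<close> and \<open>v\<close> at the end, which have to make up for
    \<open>C\<close>.\<close>
  define stage where "stage = (\<lambda>l C \<alpha> \<beta> \<gamma> u. cmod (u (P l)) = 1 \<and>
     (\<forall>y. u y \<noteq> 0 \<longrightarrow> y = x \<or> y = v \<or> (\<exists>j\<le>l. y = P j)) \<and> u x = \<alpha> \<and> u v = \<beta> \<and> u (P 0) = \<gamma> \<and>
     (\<forall>j. l < j \<and> j \<le> m \<longrightarrow> app u (P j) = (if j = l + 1 then a (P j) (P l) * u (P l) else 0)) \<and>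
     app u (P l) = 0 \<and>
     4 * sqnorm u - C \<le> (\<Sum>i<l. (cmod (app u (P i)))\<^sup>2))"
  have stageI: "stage l C \<alpha> \<beta> \<gamma> u"
    if "cmod (u (P l)) = 1" "\<And>y. u y \<noteq> 0 \<Longrightarrow> y = x \<or> y = v \<or> (\<exists>j\<le>l. y = P j)" "u x = \<alpha>" "u v = \<beta>"
      "u (P 0) = \<gamma>"
      "\<And>j. l < j \<Longrightarrow> j \<le> m \<Longrightarrow> app u (P j) = (if j = l + 1 then a (P j) (P l) * u (P l) else 0)"
      "app u (P l) = 0" "4 * sqnorm u - C \<le> (\<Sum>i<l. (cmod (app u (P i)))\<^sup>2)" for l C \<alpha> \<beta> \<gamma> u
    using that unfolding stage_def by simp
  have step: "\<exists>u'. stage (l + 2) C \<alpha> \<beta> \<gamma> u'" if u: "stage l C \<alpha> \<beta> \<gamma> u" and l: "l + 2 \<le> m" for l C \<alpha> \<beta> \<gamma> u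
  proof -
    let ?w = "P (l + 2)"
    define z where "z = a ?w (P (l + 1)) * a (P (l + 1)) (P l) * u (P l)"
    define u' where "u' = u(?w := z)"
    have w: "?w < n" using P l by simp
    have u1: "cmod (u (P l)) = 1" "u x = \<alpha>" "u v = \<beta>" "u (P 0) = \<gamma>"
      and supp: "\<And>y. u y \<noteq> 0 \<Longrightarrow> y = x \<or> y = v \<or> (\<exists>j\<le>l. y = P j)"
      and rows: "\<And>j. l < j \<Longrightarrow> j \<le> m \<Longrightarrow> app u (P j) = (if j = l + 1 then a (P j) (P l) * u (P l) else 0)"
      and sums: "4 * sqnorm u - C \<le> (\<Sum>i<l. (cmod (app u (P i)))\<^sup>2)"
      using u unfolding stage_def by blast+
    have uw: "u ?w = 0"
    proof (rule ccontr)
      assume "u ?w \<noteq> 0"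
      from supp[OF this] out[OF l] obtain j where "j \<le> l" "?w = P j" by auto
      then show False using inj[OF l, of j] l by simp
    qed
    have e: "cmod (a ?w (P (l + 1))) = 1" "cmod (a (P (l + 1)) (P l)) = 1"
      "a (P (l + 1)) ?w * a ?w (P (l + 1)) = 1"
      using unit_cmod unit_mult adj[of "l + 2" "l + 1"] adj[of "l + 1" l] adj[of "l + 1" "l + 2"] P l by auto
    have zn: "cmod z = 1" using e u1 by (simp add: z_def norm_mult)
    have app': "app u' y = app u y + a y ?w * z" for y unfolding u'_def by (rule app_upd[of ?w u z y, OF w uw])
    have ww: "a ?w ?w = 0" using adj[of "l + 2" "l + 2"] l by auto
    have new: "app u' (P (l + 1)) = 2 * (a (P (l + 1)) (P l) * u (P l))"
    proof -
      have "a (P (l + 1)) ?w * z = a (P (l + 1)) (P l) * u (P l)"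
        unfolding z_def mult.assoc[symmetric] e(3) by simp
      moreover have "app u (P (l + 1)) = a (P (l + 1)) (P l) * u (P l)" using rows[of "l + 1"] l by simp
      ultimately show ?thesis unfolding app' by simp
    qed
    have old: "app u' (P i) = app u (P i)" if "i < l" for i
      unfolding app' using adj[of i "l + 2"] that l by simp
    have S8: "4 * sqnorm u' - C \<le> (\<Sum>i<l + 2. (cmod (app u' (P i)))\<^sup>2)"
    proof -
      have "(\<Sum>i<l + 2. (cmod (app u' (P i)))\<^sup>2) =
          (\<Sum>i<l. (cmod (app u' (P i)))\<^sup>2) + (cmod (app u' (P l)))\<^sup>2 + (cmod (app u' (P (l + 1))))\<^sup>2"
        by (simp add: numeral_2_eq_2)
      moreover have "(\<Sum>i<l. (cmod (app u' (P i)))\<^sup>2) = (\<Sum>i<l. (cmod (app u (P i)))\<^sup>2)"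
        by (rule sum.cong) (auto simp: old)
      moreover have "(cmod (app u' (P (l + 1))))\<^sup>2 = 4" unfolding new using e u1 by (simp add: norm_mult)
      moreover have "(cmod (app u' (P l)))\<^sup>2 \<ge> 0" by simp
      moreover have "sqnorm u' = sqnorm u + 1" unfolding u'_def using sqnorm_upd[of ?w u z, OF w uw] zn by simp
      ultimately show ?thesis using sums by linarith
    qed
    have S6: "app u' (P j) = (if j = (l + 2) + 1 then a (P j) ?w * u' ?w else 0)" if "l + 2 < j" "j \<le> m" for j
      unfolding app' using rows[of j] adj[of j "l + 2"] that l by (auto simp: u'_def)
    have S7: "app u' ?w = 0" unfolding app' using rows[of "l + 2"] ww l by simp
    have S2: "y = x \<or> y = v \<or> (\<exists>j\<le>l + 2. y = P j)" if "u' y \<noteq> 0" for y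
    proof (cases "y = ?w")
      case False
      then have "u y \<noteq> 0" using that by (simp add: u'_def)
      then have "y = x \<or> y = v \<or> (\<exists>j\<le>l. y = P j)" by (rule supp)
      moreover have "j \<le> l + 2" if "j \<le> l" for j using that by simp
      ultimately show ?thesis by blast
    qed blast
    have S1: "cmod (u' ?w) = 1" "u' x = \<alpha>" "u' v = \<beta>" "u' (P 0) = \<gamma>"
      using u1 out[of "l + 2"] inj[of 0 "l + 2"] l zn by (auto simp: u'_def)
    have "stage (l + 2) C \<alpha> \<beta> \<gamma> u'"
      by (rule stageI[OF S1(1) S2 S1(2-4) S6 S7 S8])
    then show ?thesis by blast
  qed
  have iter: "\<exists>u'. stage (l + 2 * t) C \<alpha> \<beta> \<gamma> u'" if "stage l C \<alpha> \<beta> \<gamma> u" "l + 2 * t \<le> m" for l t C \<alpha> \<beta> \<gamma> u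
    using that(2)
  proof (induction t)
    case (Suc t)
    then obtain u' where "stage (l + 2 * t) C \<alpha> \<beta> \<gamma> u'" by auto
    from step[OF this] Suc.prems have "\<exists>u'. stage ((l + 2 * t) + 2) C \<alpha> \<beta> \<gamma> u'" by simp
    then show ?case by simp
  qed (use that in auto)
  have fin: False
    if u: "stage m C \<alpha> \<beta> \<gamma> u" and C: "C \<le> (cmod (a x (P 0) * \<gamma> + a x (P m) * u (P m)))\<^sup>2 +
        (cmod (a v (P 0) * \<gamma> + a v (P m) * u (P m)))\<^sup>2" for C \<alpha> \<beta> \<gamma> u
  proof -
    have u1: "cmod (u (P m)) = 1" "u x = \<alpha>" "u v = \<beta>" "u (P 0) = \<gamma>" "app u (P m) = 0"
      and supp: "\<And>y. u y \<noteq> 0 \<Longrightarrow> y = x \<or> y = v \<or> (\<exists>j\<le>m. y = P j)"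
      and sums: "4 * sqnorm u - C \<le> (\<Sum>i<m. (cmod (app u (P i)))\<^sup>2)"
      using u unfolding stage_def by blast+
    have P0m: "P 0 \<noteq> P m" using inj[of 0 m] m by simp
    have vx: "a v x = 0" using xv zero_sym by simp
    have row: "app u w = a w (P 0) * \<gamma> + a w (P m) * u (P m)"
      if w: "a w x = 0" "a w v = 0" "\<And>i. i \<le> m \<Longrightarrow> a w (P i) \<noteq> 0 \<Longrightarrow> i = 0 \<or> i = m" for w
    proof -
      have "app u w = (\<Sum>y\<in>{P 0, P m}. a w y * u y)"
      proof (rule app_eq_supp)
        fix y assume y: "y < n" "y \<notin> {P 0, P m}"
        show "u y = 0 \<or> a w y = 0"
        proof (rule ccontr)
          assume "\<not> (u y = 0 \<or> a w y = 0)"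
          then have nz: "u y \<noteq> 0" "a w y \<noteq> 0" by auto
          from supp[OF nz(1)] nz(2) w(1,2) obtain j where "j \<le> m" "y = P j" by auto
          then show False using w(3)[of j] nz(2) y by auto
        qed
      qed (use P m in auto)
      then show ?thesis using P0m u1(4) by simp
    qed
    have rx: "app u x = a x (P 0) * \<gamma> + a x (P m) * u (P m)"
      by (rule row[OF xv(4,6)]) (use adjx in blast)
    have rv: "app u v = a v (P 0) * \<gamma> + a v (P m) * u (P m)"
      by (rule row[OF vx xv(5)]) (use adjv in blast)
    have "sqnorm (app u) < 4 * sqnorm u"
    proof (rule strict)
      have nz: "u (P m) \<noteq> 0" using u1(1) by auto
      show "\<not> (\<forall>i<n. app u i = 2 * u i)"
      proof
        assume "\<forall>i<n. app u i = 2 * u i"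
        then have "app u (P m) = 2 * u (P m)" using P[of m] by simp
        then show False using u1(5) nz by simp
      qed
      show "\<not> (\<forall>i<n. app u i = - 2 * u i)"
      proof
        assume "\<forall>i<n. app u i = - 2 * u i"
        then have "app u (P m) = - 2 * u (P m)" using P[of m] by simp
        then show False using u1(5) nz by simp
      qed
    qed
    moreover have "(\<Sum>y\<in>insert x (insert v (P ` {..<m})). (cmod (app u y))\<^sup>2) \<le> sqnorm (app u)"
      unfolding sqnorm_def using xv P by (intro sum_mono2) auto
    moreover have "(\<Sum>y\<in>insert x (insert v (P ` {..<m})). (cmod (app u y))\<^sup>2) =
        (cmod (app u x))\<^sup>2 + (cmod (app u v))\<^sup>2 + (\<Sum>i<m. (cmod (app u (P i)))\<^sup>2)"
    proof -
      have "inj_on P {..<m}" using inj by (auto simp: inj_on_def)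
      moreover have "y \<notin> P ` {..<m}" if "\<And>i. i \<le> m \<Longrightarrow> P i \<noteq> y" for y
      proof
        assume "y \<in> P ` {..<m}"
        then obtain i where "i < m" "y = P i" by auto
        then show False using that[of i] by simp
      qed
      then have "x \<notin> insert v (P ` {..<m})" "v \<notin> P ` {..<m}" using xv(3) out by auto
      ultimately show ?thesis by (simp add: sum.reindex)
    qed
    ultimately show False using sums C unfolding rx rv by linarith
  qed
  have ne0: "a x (P 0) \<noteq> 0" "a v (P 0) \<noteq> 0" "a x (P m) \<noteq> 0" "a v (P m) \<noteq> 0" using adjx adjv m by auto
  have cs: "cmod (a x (P 0)) = 1" "cmod (a v (P 0)) = 1" "cmod (a x (P m)) = 1" "cmod (a v (P m)) = 1"
    using unit_cmod ne0 xv P m by auto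
  have orth': "a (P m) x * a x (P 0) + a (P m) v * a v (P 0) = 0"
  proof -
    have "cnj (a (P 0) x * a x (P m) + a (P 0) v * a v (P m)) = 0" using orth by simp
    then show ?thesis
      using herm[of "P 0" x] herm[of x "P m"] herm[of "P 0" v] herm[of v "P m"] P xv m by (simp add: mult.commute)
  qed
  have diag: "a (P i) (P i) = 0" if "i \<le> m" for i using adj[of i i] that by auto
  show False
  proof (cases "even m")
    case True
    \<comment> \<open>Even \<open>m\<close> starts from the unit vector at \<open>P 0\<close>, with
      deficit 4. The rows of \<open>x\<close> and \<open>v\<close> supply it, because
      \<open>orth\<close> cancels their cross terms.\<close>
    define u where "u = (\<lambda>y. if y = P 0 then 1 else 0 :: complex)"
    have app_u: "app u y = a y (P 0)" for y
      using app_eq_supp[of "{P 0}" u y] P m by (auto simp: u_def)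
    have "sqnorm u = 1"
      using P[of 0] m unfolding sqnorm_def u_def by (simp add: if_distrib[of "\<lambda>z. (cmod z)\<^sup>2"] cong: if_cong)
    moreover have "app u (P j) = (if j = 0 + 1 then a (P j) (P 0) * u (P 0) else 0)" if "0 < j" "j \<le> m" for j
      unfolding app_u using adj[of j 0] that by (auto simp: u_def)
    moreover have "app u (P 0) = 0" unfolding app_u using diag by simp
    ultimately have "stage 0 4 0 0 1 u"
      by (intro stageI) (use out[of 0] in \<open>auto simp: u_def\<close>)
    from iter[OF this, of "m div 2"] True obtain u' where u': "stage m 4 0 0 1 u'" by auto
    define z where "z = u' (P m)"
    have z1: "cmod z = 1" using u' unfolding stage_def z_def by blast
    have ex: "(cmod (p + q * z))\<^sup>2 = (cmod p)\<^sup>2 + (cmod q)\<^sup>2 + 2 * Re (cnj p * q * z)" for p q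
    proof -
      have "(cmod (p + q * z))\<^sup>2 = (cmod p)\<^sup>2 + (cmod (q * z))\<^sup>2 + 2 * Re (cnj p * (q * z))"
        by (simp only: cmod_power2) (simp add: power2_eq_square algebra_simps)
      then show ?thesis using z1 by (simp only: norm_mult mult.assoc) simp
    qed
    have "cnj (a x (P 0)) * a x (P m) * z + cnj (a v (P 0)) * a v (P m) * z =
        (a (P 0) x * a x (P m) + a (P 0) v * a v (P m)) * z"
      using herm[of x "P 0"] herm[of v "P 0"] P xv m by (simp add: algebra_simps)
    then have "cnj (a x (P 0)) * a x (P m) * z + cnj (a v (P 0)) * a v (P m) * z = 0"
      unfolding orth by simp
    then have "Re (cnj (a x (P 0)) * a x (P m) * z) + Re (cnj (a v (P 0)) * a v (P m) * z) = 0"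
      by (metis plus_complex.sel(1) zero_complex.sel(1))
    moreover have "(cmod (a x (P 0) + a x (P m) * z))\<^sup>2 + (cmod (a v (P 0) + a v (P m) * z))\<^sup>2 =
        4 + 2 * (Re (cnj (a x (P 0)) * a x (P m) * z) + Re (cnj (a v (P 0)) * a v (P m) * z))"
      unfolding ex cs by simp
    ultimately have "(cmod (a x (P 0) + a x (P m) * z))\<^sup>2 + (cmod (a v (P 0) + a v (P m) * z))\<^sup>2 = 4"
      by simp
    then show False using fin[OF u'] unfolding z_def by simp
  next
    case False
    \<comment> \<open>Odd \<open>m\<close> starts with a unit at \<open>P 1\<close> and halves at
      the twins: 4 * (1 + 1/4 + 1/4) exceeds the 4 of row \<open>P 0\<close> by 2. In the row of
      \<open>P m\<close> the halves cancel by \<open>orth\<close>, and the rows of \<open>x\<close>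
      and \<open>v\<close> finally supply 1 each.\<close>
    define u where "u = (\<lambda>y. if y = P 1 then a (P 1) (P 0) else if y = x then a x (P 0) / 2
        else if y = v then a v (P 0) / 2 else 0)"
    have P1: "P 1 < n" "P 0 < n" using P m by auto
    have d: "P 1 \<noteq> x" "P 1 \<noteq> v" "P 0 \<noteq> P 1" "P 0 \<noteq> x" "P 0 \<noteq> v" using out[of 1] out[of 0] inj[of 0 1] m by auto
    have app_u: "app u y = a y (P 1) * a (P 1) (P 0) + a y x * (a x (P 0) / 2) + a y v * (a v (P 0) / 2)" for y
    proof -
      have "app u y = (\<Sum>w\<in>{P 1, x, v}. a y w * u w)"
        using P1 xv by (intro app_eq_supp) (auto simp: u_def)
      then show ?thesis using d xv by (auto simp: u_def add.assoc)
    qed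
    have c1: "cmod (a (P 1) (P 0)) = 1" using unit_cmod adj[of 1 0] P1 m by auto
    have sq: "sqnorm u = 3 / 2"
    proof -
      have "sqnorm u = sqnorm (\<lambda>i. if i \<in> {P 1, x, v} then u i else 0)"
        by (rule arg_cong[where f = sqnorm]) (auto simp: u_def)
      also have "\<dots> = (\<Sum>w\<in>{P 1, x, v}. (cmod (u w))\<^sup>2)" using P1 xv by (intro sqnorm_supp) auto
      finally show ?thesis using d xv c1 cs by (simp add: u_def norm_divide power_divide)
    qed
    have mult: "a (P 0) (P 1) * a (P 1) (P 0) = 1" "a (P 0) x * a x (P 0) = 1" "a (P 0) v * a v (P 0) = 1"
      using unit_mult adj[of 0 1] ne0 zero_sym[of x "P 0"] zero_sym[of v "P 0"] P1 xv m by auto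
    have r0: "app u (P 0) = 2" unfolding app_u using mult by (simp add: field_simps)
    have zx: "a (P j) x = 0" "a (P j) v = 0" if "0 < j" "j < m" for j
      using adjx[of j] adjv[of j] zero_sym[of x "P j"] zero_sym[of v "P j"] P[of j] xv that by auto
    have rows: "app u (P j) = (if j = 1 + 1 then a (P j) (P 1) * u (P 1) else 0)" if "1 < j" "j \<le> m" for j
    proof (cases "j = m")
      case True
      have "a (P m) x * (a x (P 0) / 2) + a (P m) v * (a v (P 0) / 2) = 0"
        using orth' by (simp add: add_divide_distrib[symmetric])
      then show ?thesis unfolding app_u True using adj[of m 1] m True by (simp add: add.assoc)
    next
      case False
      then show ?thesis unfolding app_u using adj[of j 1] zx[of j] that by (auto simp: u_def)
    qed
    have "app u (P 1) = 0" unfolding app_u using diag[of 1] zx[of 1] m by simp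
    moreover have "4 * sqnorm u - 2 \<le> (\<Sum>i<1. (cmod (app u (P i)))\<^sup>2)" using sq r0 by simp
    ultimately have "stage 1 2 (a x (P 0) / 2) (a v (P 0) / 2) 0 u"
      using rows by (intro stageI) (use d xv c1 in \<open>auto simp: u_def split: if_splits\<close>)
    from iter[OF this, of "(m - 1) div 2"] False m obtain u' where
      u': "stage m 2 (a x (P 0) / 2) (a v (P 0) / 2) 0 u'" by (auto elim!: oddE)
    have "cmod (u' (P m)) = 1" using u' unfolding stage_def by blast
    then show False using fin[OF u'] cs by (simp add: norm_mult)
  qed
qed

end

context unit_weights
begin

text \<open>Orthogonality of \<open>c j\<close> to \<open>c 0\<close> and to \<open>c 2\<close>
  needs a second walk in both cases, which exists only for \<open>j = k - 2\<close> and for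
  \<open>j = 4\<close>. So \<open>k = 6\<close>, and multiplying the three relations gives gain
  -1.\<close>

lemma third_neighbour:
  assumes c: "icycle c k" and k: "k \<ge> 5" and irr: "gain c k \<notin> \<rat>"
    and v: "v < n" "v \<notin> range c" "a v (c 0) \<noteq> 0" "a v (c 2) \<noteq> 0"
    and eq: "a (c 0) (c 1) * a (c 1) (c 2) + a (c 0) v * a v (c 2) = 0"
    and j: "4 \<le> j" "j \<le> k - 2" "a v (c j) \<noteq> 0"
  shows False
proof -
  note V = icycle_V[OF c] and ne = icycle_ne[OF c] and z = icycle_z[OF c] and nz = icycle_nz[OF c]
  have v': "a (c 0) v \<noteq> 0" "a (c 2) v \<noteq> 0" "a (c j) v \<noteq> 0" using v j V zero_sym by auto
  have dj: "distinct [c (j - 1), c (j + 1), v]" "a (c j) (c (j - 1)) \<noteq> 0" "a (c j) (c (j + 1)) \<noteq> 0"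
    using ne[of "j - 1" "j + 1"] nz[of j "j - 1"] nz[of j "j + 1"] v k by auto
  have d0: "distinct [c 1, c (- 1), v]" "a (c 0) (c 1) \<noteq> 0" "a (c 0) (c (- 1)) \<noteq> 0"
    using ne[of 1 "- 1"] nz[of 0 1] nz[of 0 "- 1"] v k by auto
  have d2: "distinct [c 1, c 3, v]" "a (c 2) (c 1) \<noteq> 0" "a (c 2) (c 3) \<noteq> 0"
    using ne[of 1 3] nz[of 2 1] nz[of 2 3] v k by auto
  have z0: "a (c 0) (c j) = 0" "a (c 2) (c j) = 0" "a (c 1) (c j) = 0"
    using z[of 0 j] z[of 2 j] z[of 1 j] j by auto
  have n0: "c 0 \<noteq> c j" "c 2 \<noteq> c j" using ne[of 0 j] ne[of 2 j] j by auto
  have "a (c 0) (c 1) * a (c 1) (c j) + a (c 0) (c (- 1)) * a (c (- 1)) (c j) + a (c 0) v * a v (c j) = 0"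
    by (rule orthogonal3[of "c 0" "c j" "c 1" "c (- 1)" v "c (j - 1)" "c (j + 1)" v])
      (use V v v' d0 dj z0 n0 in auto)
  then have e1: "a (c 0) (c (- 1)) * a (c (- 1)) (c j) + a (c 0) v * a v (c j) = 0" using z0 by simp
  have "a (c 2) (c 1) * a (c 1) (c j) + a (c 2) (c 3) * a (c 3) (c j) + a (c 2) v * a v (c j) = 0"
    by (rule orthogonal3[of "c 2" "c j" "c 1" "c 3" v "c (j - 1)" "c (j + 1)" v])
      (use V v v' d2 dj z0 n0 in auto)
  then have e2: "a (c 2) (c 3) * a (c 3) (c j) + a (c 2) v * a v (c j) = 0" using z0 by simp
  have "j = k - 2"
  proof (rule ccontr)
    assume "j \<noteq> k - 2"
    then have "a (c (- 1)) (c j) = 0" using z[of "- 1" j] j by auto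
    then show False using e1 v' j by simp
  qed
  moreover have "j = 4"
  proof (rule ccontr)
    assume "j \<noteq> 4"
    then have "a (c 3) (c j) = 0" using z[of 3 j] j by auto
    then show False using e2 v' j by simp
  qed
  ultimately have k6: "k = 6" and j4: "j = 4" by auto
  have p: "c 6 = c 0" "c 5 = c (- 1)" using icycle_per[OF c, of 0] icycle_per[OF c, of "- 1"] k6 by auto
  have s6: "{0..<6::int} = {0, 1, 2, 3, 4, 5}" by auto
  have g: "gain c k = (a (c 0) (c 1) * a (c 1) (c 2)) * (a (c 2) (c 3) * a (c 3) (c 4)) *
      (a (c 4) (c (- 1)) * a (c (- 1)) (c 0))"
    unfolding k6 by (simp add: gain_def s6 p mult_ac)
  have "cnj (a (c 0) (c (- 1)) * a (c (- 1)) (c j) + a (c 0) v * a v (c j)) = 0" using e1 by simp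
  then have e3: "a (c 4) (c (- 1)) * a (c (- 1)) (c 0) + a (c 4) v * a v (c 0) = 0"
    using herm[of "c 0" "c (- 1)"] herm[of "c (- 1)" "c j"] herm[of "c 0" v] herm[of v "c j"] V v j4
    by (simp add: mult.commute)
  have m: "a (c 0) v * a v (c 0) = 1" "a (c 2) v * a v (c 2) = 1" "a (c 4) v * a v (c 4) = 1"
    using unit_mult V v v' j4 by auto
  have f: "a (c 0) (c 1) * a (c 1) (c 2) = - (a (c 0) v * a v (c 2))"
    "a (c 2) (c 3) * a (c 3) (c 4) = - (a (c 2) v * a v (c 4))"
    "a (c 4) (c (- 1)) * a (c (- 1)) (c 0) = - (a (c 4) v * a v (c 0))"
    using eq e2 e3 j4 by (simp_all add: eq_neg_iff_add_eq_0)
  have "gain c k = - ((a (c 0) v * a v (c 0)) * (a (c 2) v * a v (c 2)) * (a (c 4) v * a v (c 4)))"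
    unfolding g f by (simp add: mult_ac)
  then have "gain c k = - 1" unfolding m by simp
  then show False using irr by simp
qed

text \<open>Such a \<open>v\<close> is a twin of \<open>c 1\<close>: the two walks from
  \<open>c 0\<close> to \<open>c 2\<close> cancel by orthogonality, and no other vertex of the cycle
  is adjacent to \<open>v\<close>. The rest of the cycle, read backwards from \<open>c 0\<close> to
  \<open>c 2\<close>, is the path for \<open>no_twins\<close>.\<close>

lemma opposite_common_neighbour:
  assumes c: "icycle c k" and k: "k \<ge> 5" and irr: "gain c k \<notin> \<rat>"
    and v: "v < n" "v \<notin> range c" "a v (c 0) \<noteq> 0" "a v (c 2) \<noteq> 0"
  shows False
proof -
  note V = icycle_V[OF c] and ne = icycle_ne[OF c] and z = icycle_z[OF c] and nz = icycle_nz[OF c]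
  have ch: "a (c i) (c i) = 0" for i by (rule long_cycle_uncharged[OF c k irr])
  have v': "a (c 0) v \<noteq> 0" "a (c 2) v \<noteq> 0" using v V zero_sym by auto
  have adj: "\<not> (a v (c i) \<noteq> 0 \<and> a v (c (i + 1)) \<noteq> 0)" for i
    using adjacent_common_neighbour[OF icycle_shift[OF c, of i] k, of v] ch v by (auto simp: add.commute)
  have v1: "a v (c 1) = 0" using adj[of 0] v by auto
  have "a (c 0) (c 1) * a (c 1) (c 2) + a (c 0) (c (- 1)) * a (c (- 1)) (c 2) + a (c 0) v * a v (c 2) = 0"
    by (rule orthogonal3[of "c 0" "c 2" "c 1" "c (- 1)" v "c 1" "c 3" v])
      (use V v v' ne[of 0 2] ne[of 1 "- 1"] ne[of 1 3] nz[of 0 1] nz[of 0 "- 1"] nz[of 2 1] nz[of 2 3]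
        z[of 0 2] k in auto)
  then have eq: "a (c 0) (c 1) * a (c 1) (c 2) + a (c 0) v * a v (c 2) = 0" using z[of "- 1" 2] k by simp
  have vz: "a v (c j) = 0" if "3 \<le> j" "j \<le> k - 1" for j
  proof (rule ccontr)
    assume nzj: "a v (c j) \<noteq> 0"
    have "c (k - 1) = c (- 1)" using icycle_per[OF c, of "- 1"] by simp
    then have "j \<noteq> k - 1" using adj[of "- 1"] v nzj by auto
    moreover have "j \<noteq> 3" using adj[of 2] v nzj by auto
    ultimately show False using third_neighbour[OF c k irr v eq, of j] that nzj by auto
  qed
  have vm: "a v (c (- 1)) = 0" using vz[of "k - 1"] icycle_per[OF c, of "- 1"] k by simp
  have vv: "a v v = 0"
  proof (rule ccontr)
    assume nzv: "a v v \<noteq> 0"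
    have "a (c 0) (c 1) * a (c 1) v + a (c 0) (c (- 1)) * a (c (- 1)) v + a (c 0) v * a v v = 0"
    proof (rule orthogonal3[of "c 0" v "c 1" "c (- 1)" v "c 0" "c 2" v])
      show "a (c 0) v = 0 \<or> a (c 0) (c 0) = 0 \<and> a v v = 0 \<or>
          (\<exists>x<n. x \<noteq> c 0 \<and> x \<noteq> v \<and> a x (c 0) \<noteq> 0 \<and> a x v = 0)"
        using V[of 1] v v1 nz[of 1 0] ne[of 1 0] zero_sym[of v "c 1"] k by auto
    qed (use V v v' nzv ne[of 0 2] ne[of 1 "- 1"] nz[of 0 1] nz[of 0 "- 1"] k in auto)
    then show False using v1 vm zero_sym[of v "c 1"] zero_sym[of v "c (- 1)"] V v v' nzv by simp
  qed
  \<comment> \<open>Index \<open>m\<close> of the backward path is \<open>c 2\<close>, as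
    \<open>- (k - 2)\<close> and 2 differ by the period.\<close>
  define m where "m = nat (k - 2)"
  have mk: "int m = k - 2" using k by (simp add: m_def)
  have cm: "c (- int m) = c 2" using icycle_per[OF c, of "2 - k"] mk by simp
  have wrap: "c (- int i) = c (k - int i)" for i using icycle_per[OF c, of "- int i"] by (simp add: add.commute)
  show False
  proof (rule no_twins[of m "\<lambda>i. c (- int i)" "c 1" v])
    show "m \<ge> 3" using mk k by linarith
    fix i j assume ij: "i \<le> m" "j \<le> m"
    have b: "\<bar>(- int i) - (- int j)\<bar> < k" "\<bar>(- int i) - (- int j)\<bar> \<noteq> k - 1" using ij mk by linarith+
    show "(c (- int i) = c (- int j)) = (i = j)" using ne[of "- int i" "- int j"] b by auto
    have eqv: "(\<bar>(- int i) - (- int j)\<bar> = 1) = (j = i + 1 \<or> i = j + 1)" by linarith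
    show "(a (c (- int i)) (c (- int j)) \<noteq> 0) = (j = i + 1 \<or> i = j + 1)"
      using nz[of "- int i" "- int j"] z[of "- int i" "- int j"] b ch[of "- int i"] eqv by (cases "i = j") auto
  next
    fix i assume i: "i \<le> m"
    have b: "\<bar>(- int i) - 1\<bar> < k" "- int i \<noteq> 1" using i mk by linarith+
    show "c (- int i) \<noteq> c 1" using ne[of "- int i" 1] b by auto
    show "(a (c 1) (c (- int i)) \<noteq> 0) = (i = 0 \<or> i = m)"
    proof (cases "i = 0 \<or> i = m")
      case True
      then show ?thesis using nz[of 1 0] nz[of 1 2] cm by auto
    next
      case False
      then have "\<bar>1 - (- int i)\<bar> \<noteq> 1" "\<bar>1 - (- int i)\<bar> \<noteq> k - 1" "\<bar>1 - (- int i)\<bar> < k" "1 \<noteq> - int i"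
        using i mk by linarith+
      then show ?thesis using z[of 1 "- int i"] False by auto
    qed
    show "(a v (c (- int i)) \<noteq> 0) = (i = 0 \<or> i = m)"
    proof (cases "i = 0 \<or> i = m")
      case True
      then show ?thesis using v cm by auto
    next
      case False
      then have "3 \<le> k - int i" "k - int i \<le> k - 1" using i mk by linarith+
      then show ?thesis using vz[of "k - int i"] wrap[of i] False by auto
    qed
  next
    show "a (c (- int 0)) (c 1) * a (c 1) (c (- int m)) + a (c (- int 0)) v * a v (c (- int m)) = 0"
      using eq by (simp add: cm)
  qed (use V v vv ch v1 zero_sym[of v "c 1"] in auto)
qed

text \<open>After a rotation \<open>v\<close> is adjacent to \<open>e 0\<close> and to neither
  \<open>e 2\<close> nor \<open>e (- 2)\<close>, the situation of \<open>private_core\<close> or,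
  for \<open>k = 6\<close>, of \<open>private_hexagon\<close>.\<close>

lemma no_cycle_neighbour:
  assumes c: "icycle c k" and k: "k \<ge> 5" and irr: "gain c k \<notin> \<rat>"
    and v: "v < n" "v \<notin> range c" "a v (c i) \<noteq> 0"
  shows False
proof -
  define e where "e = (\<lambda>j. c (j + i))"
  have e: "icycle e k" unfolding e_def by (rule icycle_shift[OF c])
  have irr_e: "gain e k \<notin> \<rat>" unfolding e_def using gain_shift[OF c] irr by simp
  have ve: "v \<notin> range e" "a v (e 0) \<noteq> 0" using v by (auto simp: e_def)
  note V = icycle_V[OF e] and ne = icycle_ne[OF e] and z = icycle_z[OF e]
  have ch: "a (e i) (e i) = 0" for i by (rule long_cycle_uncharged[OF e k irr_e])
  have v2: "a v (e 2) = 0" using opposite_common_neighbour[OF e k irr_e v(1) ve] by blast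
  have v2': "a v (e (- 2)) = 0"
  proof (rule ccontr)
    assume "a v (e (- 2)) \<noteq> 0"
    moreover have "gain (\<lambda>j. e (j + - 2)) k \<notin> \<rat>" using gain_shift[OF e, of "- 2"] irr_e by simp
    ultimately show False
      using opposite_common_neighbour[OF icycle_shift[OF e, of "- 2"] k, of v] v ve by auto
  qed
  consider "k = 5" | "k = 6" | "k \<ge> 7" using k by linarith
  then show False
  proof cases
    case 1
    have p: "e 3 = e (- 2)" "e (- 3) = e 2"
      using icycle_per[OF e, of "- 2"] icycle_per[OF e, of "- 3"] 1 by auto
    show False
      by (rule private_core[OF e k v(1) ve(2) v2 v2']) (use ve ch p ne[of 2 "- 2"] 1 in auto)
  next
    case 2
    have e6: "icycle e 6" and irr6: "gain e 6 \<notin> \<rat>" using e irr_e 2 by auto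
    have p: "e 4 = e (- 2)" using icycle_per[OF e6, of "- 2"] by auto
    show False by (rule private_hexagon[OF e6 irr6, of v]) (use v ve v2 v2' p in auto)
  next
    case 3
    show False
      by (rule private_core[OF e k v(1) ve(2) v2 v2'])
        (use ve 3 z[of 3 "- 2"] z[of "- 3" 2] ne[of 3 "- 3"] in auto)
  qed
qed

text \<open>Lengths 3 and 4 are a \<open>triangle\<close> and a \<open>square\<close>; for longer
  cycles \<open>no_cycle_neighbour\<close> makes the set of vertices closed under adjacency, hence
  everything.\<close>

lemma cycle_pattern_if:
  assumes c: "icycle c k" and irr: "gain c k \<notin> \<rat>"
  shows "has_pattern n (cycle_pattern n) a"
proof -
  note V = icycle_V[OF c] and ne = icycle_ne[OF c] and z = icycle_z[OF c] and nz = icycle_nz[OF c]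
  have k3: "k \<ge> 3" using c by (simp add: icycle_def)
  have "k \<noteq> 3"
  proof
    assume k: "k = 3"
    have s: "{0..<3::int} = {0, 1, 2}" by auto
    have p: "c 3 = c 0" using icycle_per[OF c, of 0] k by simp
    have "gain c k = a (c 0) (c 1) * a (c 1) (c 2) * a (c 2) (c 0)"
      unfolding k by (simp add: gain_def s p mult_ac)
    then have "triangle (c 0) (c 1) (c 2)"
      unfolding triangle_def using V ne[of 0 1] ne[of 0 2] ne[of 1 2] nz[of 0 1] nz[of 1 2]
        icycle_wrap[OF c, of 2 0] k irr by auto
    then show False using no_triangle by blast
  qed
  moreover have "k \<noteq> 4"
  proof
    assume k: "k = 4"
    have s: "{0..<4::int} = {0, 1, 2, 3}" by auto
    have p: "c 4 = c 0" using icycle_per[OF c, of 0] k by simp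
    have "gain c k = a (c 0) (c 1) * a (c 1) (c 2) * a (c 2) (c 3) * a (c 3) (c 0)"
      unfolding k by (simp add: gain_def s p mult_ac)
    then have "square (c 0) (c 1) (c 2) (c 3)"
      unfolding square_def
      using V ne[of 0 1] ne[of 0 2] ne[of 0 3] ne[of 1 2] ne[of 1 3] ne[of 2 3] nz[of 0 1] nz[of 1 2]
        nz[of 2 3] z[of 0 2] z[of 1 3] icycle_wrap[OF c, of 3 0] k irr by auto
    then show False using no_square by blast
  qed
  ultimately have k: "k \<ge> 5" using k3 by linarith
  have rng: "range c = {..<n}"
  proof (rule connected)
    fix x y assume "x \<in> range c" and y: "y < n" "a x y \<noteq> 0"
    then obtain i where i: "x = c i" by auto
    show "y \<in> range c"
      using no_cycle_neighbour[OF c k irr y(1), of i] y zero_sym[OF y(1) V[of i]] i by blast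
  qed (use V in auto)
  have inj: "inj_on c {0..<k}"
  proof (rule inj_onI)
    fix i j assume ij: "i \<in> {0..<k}" "j \<in> {0..<k}" and eq: "c i = c j"
    have "\<bar>i - j\<bar> < k" using ij by auto
    then show "i = j" using ne[of i j] eq by blast
  qed
  have img: "c ` {0..<k} = {..<n}"
  proof -
    have "range c \<subseteq> c ` {0..<k}"
    proof (rule image_subsetI)
      fix i
      have "i mod k \<in> {0..<k}" using k by simp
      then have "c (i mod k) \<in> c ` {0..<k}" by (rule imageI)
      then show "c i \<in> c ` {0..<k}" using icycle_mod[OF c, of i] by simp
    qed
    moreover have "c ` {0..<k} \<subseteq> range c" by (rule image_mono) simp
    ultimately have "c ` {0..<k} = range c" by (rule antisym[rotated])
    then show ?thesis using rng by (rule trans)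
  qed
  have "card {0..<k} = n" using card_image[OF inj] img by simp
  then have kn: "k = int n" using k by simp
  define p where "p = (\<lambda>i. c (int i))"
  have "bij_betw p {..<n} {..<n}"
  proof -
    have "bij_betw int {..<n} {0..<k}"
      unfolding kn by (rule bij_betwI[of _ _ _ nat]) auto
    moreover have "bij_betw c {0..<k} {..<n}" using inj img by (simp add: bij_betw_def)
    ultimately show ?thesis unfolding p_def using bij_betw_trans[of int "{..<n}" "{0..<k}" c "{..<n}"]
      by (simp add: comp_def)
  qed
  moreover have "(cmod (a (p i) (p j)))\<^sup>2 = cycle_pattern n i j" if ij: "i < n" "j < n" for i j
  proof -
    have lt: "\<bar>int i - int j\<bar> < k" using ij kn by linarith
    have iff: "a (c (int i)) (c (int j)) \<noteq> 0 \<longleftrightarrow> \<bar>int i - int j\<bar> = 1 \<or> \<bar>int i - int j\<bar> = k - 1"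
    proof (cases "i = j")
      case True
      then show ?thesis using long_cycle_uncharged[OF c k irr] k by simp
    next
      case False
      then show ?thesis using nz[of "int i" "int j"] icycle_wrap[OF c, of "int i" "int j"] z[of "int i" "int j"] lt by auto
    qed
    have "(\<bar>int i - int j\<bar> = 1 \<or> \<bar>int i - int j\<bar> = k - 1) \<longleftrightarrow>
        j = i + 1 \<or> i = j + 1 \<or> i = 0 \<and> j = n - 1 \<or> i = n - 1 \<and> j = 0"
      using ij kn k by linarith
    then show ?thesis
      using iff unit_cmod[OF V V, of "int i" "int j"] by (auto simp: cycle_pattern_def p_def)
  qed
  ultimately show ?thesis unfolding has_pattern_def by blast
qed

subsection \<open>Closed walks\<close>

text \<open>Walks, with gain and length as arguments so that a shortest one of irrational gain can
  be selected. Steps join distinct vertices, so charges do not enter gains.\<close>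

inductive conn :: "nat \<Rightarrow> complex \<Rightarrow> nat \<Rightarrow> nat \<Rightarrow> bool" where
  conn_refl: "u < n \<Longrightarrow> conn u 1 0 u"
| conn_step: "conn u z k v \<Longrightarrow> w < n \<Longrightarrow> v \<noteq> w \<Longrightarrow> a v w \<noteq> 0 \<Longrightarrow> conn u (z * a v w) (Suc k) w"

lemma conn_V: "conn u z k v \<Longrightarrow> u < n \<and> v < n"
  by (induction rule: conn.induct) auto

lemma conn_R: "conn u z k v \<Longrightarrow> z \<in> R \<and> cmod z = 1"
proof (induction rule: conn.induct)
  case (conn_refl u)
  show ?case using R_1 by simp
next
  case (conn_step u z k v w)
  have "v < n" using conn_V[OF conn_step.hyps(1)] by simp
  then show ?case
    using conn_step R_mult[of z "a v w"] R_entry[of v w] unit_cmod[of v w] by (simp add: norm_mult)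
qed

lemma conn_edge: "u < n \<Longrightarrow> v < n \<Longrightarrow> u \<noteq> v \<Longrightarrow> a u v \<noteq> 0 \<Longrightarrow> conn u (a u v) 1 v"
  using conn_step[OF conn_refl[of u], of v] by simp

lemma conn_trans: "conn v z' k' w \<Longrightarrow> conn u z k v \<Longrightarrow> conn u (z * z') (k + k') w"
proof (induction arbitrary: u z k rule: conn.induct)
  case (conn_step v z' k' x w)
  from conn_step.IH[OF conn_step.prems] conn_step.hyps show ?case
    using conn.conn_step[of u "z * z'" "k + k'" x w] by (simp add: mult.assoc)
qed simp

lemma conn_sym: "conn u z k v \<Longrightarrow> conn v (cnj z) k u"
proof (induction rule: conn.induct)
  case (conn_refl u) then show ?case using conn.conn_refl[of u] by simp
next
  case (conn_step u z k v w)
  have V: "v < n" "w < n" using conn_step.hyps conn_V by auto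
  have "conn w (a w v) 1 v"
    using conn_edge[of w v] V conn_step.hyps zero_sym[of v w] by auto
  from conn_trans[OF conn_step.IH this] show ?case
    using herm[OF V] by (simp add: mult.commute)
qed

text \<open>Recovers the sequence of vertices together with the fact that every segment is again a
  walk, as needed for cutting and rejoining.\<close>

lemma conn_walk:
  "conn u z k v \<Longrightarrow> \<exists>w. w 0 = u \<and> w k = v \<and>
     (\<forall>i j. i \<le> j \<and> j \<le> k \<longrightarrow> conn (w i) (\<Prod>t\<in>{i..<j}. a (w t) (w (Suc t))) (j - i) (w j)) \<and>
     z = (\<Prod>t\<in>{0..<k}. a (w t) (w (Suc t))) \<and> (\<forall>i<k. w i \<noteq> w (Suc i) \<and> a (w i) (w (Suc i)) \<noteq> 0)"
proof (induction rule: conn.induct)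
  case (conn_refl u)
  then show ?case using conn.conn_refl[of u] by (intro exI[of _ "\<lambda>_. u"]) auto
next
  case (conn_step u z k v x)
  obtain w where W: "w 0 = u \<and> w k = v \<and>
     (\<forall>i j. i \<le> j \<and> j \<le> k \<longrightarrow> conn (w i) (\<Prod>t\<in>{i..<j}. a (w t) (w (Suc t))) (j - i) (w j)) \<and>
     z = (\<Prod>t\<in>{0..<k}. a (w t) (w (Suc t))) \<and> (\<forall>i<k. w i \<noteq> w (Suc i) \<and> a (w i) (w (Suc i)) \<noteq> 0)"
    using conn_step.IH ..
  then have w: "w 0 = u" "w k = v"
    "\<And>i j. i \<le> j \<Longrightarrow> j \<le> k \<Longrightarrow> conn (w i) (\<Prod>t\<in>{i..<j}. a (w t) (w (Suc t))) (j - i) (w j)"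
    "z = (\<Prod>t\<in>{0..<k}. a (w t) (w (Suc t)))" "\<And>i. i < k \<Longrightarrow> w i \<noteq> w (Suc i) \<and> a (w i) (w (Suc i)) \<noteq> 0"
    by blast+
  define w' where "w' = w(Suc k := x)"
  have old: "w' i = w i" if "i \<le> k" for i using that by (simp add: w'_def)
  have prod: "(\<Prod>t\<in>{i..<j}. a (w' t) (w' (Suc t))) = (\<Prod>t\<in>{i..<j}. a (w t) (w (Suc t)))" if "j \<le> k" for i j
    using that by (intro prod.cong) (auto simp: old)
  have prodS: "(\<Prod>t\<in>{i..<Suc k}. a (w' t) (w' (Suc t))) = (\<Prod>t\<in>{i..<k}. a (w t) (w (Suc t))) * a v x"
    if "i \<le> k" for i
    using that prod[of k i] w(2) by (simp add: prod.atLeastLessThan_Suc old) (simp add: w'_def)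
  have "conn (w' i) (\<Prod>t\<in>{i..<j}. a (w' t) (w' (Suc t))) (j - i) (w' j)" if ij: "i \<le> j" "j \<le> Suc k" for i j
  proof (cases "j = Suc k")
    case False
    then show ?thesis using w(3)[of i j] ij prod[of j i] old by simp
  next
    case True
    show ?thesis
    proof (cases "i = Suc k")
      case True
      then show ?thesis using \<open>j = Suc k\<close> conn.conn_refl[of x] conn_step.hyps by (simp add: w'_def)
    next
      case False
      then have i: "i \<le> k" using ij by simp
      have "conn (w i) ((\<Prod>t\<in>{i..<k}. a (w t) (w (Suc t))) * a v x) (Suc (k - i)) x"
        using conn.conn_step[of "w i" _ "k - i" v x] w(2) w(3)[of i k] i conn_step.hyps by simp
      then show ?thesis using True i prodS[OF i] old[OF i] by (simp add: Suc_diff_le) (simp add: w'_def)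
    qed
  qed
  moreover have "w' 0 = u" "w' (Suc k) = x" using w by (auto simp: w'_def)
  moreover have "z * a v x = (\<Prod>t\<in>{0..<Suc k}. a (w' t) (w' (Suc t)))" using prodS[of 0] w by simp
  moreover have "\<forall>i<Suc k. w' i \<noteq> w' (Suc i) \<and> a (w' i) (w' (Suc i)) \<noteq> 0"
    using w(2,5) conn_step.hyps by (auto simp: w'_def less_Suc_eq)
  ultimately show ?case by blast
qed

lemma connected_conn: "v < n \<Longrightarrow> \<exists>z k. conn 0 z k v"
proof -
  have "{v. v < n \<and> (\<exists>z k. conn 0 z k v)} = {..<n}"
  proof (rule connected)
    show "{v. v < n \<and> (\<exists>z k. conn 0 z k v)} \<noteq> {}" using conn_refl[of 0] size by force
    fix x y assume x: "x \<in> {v. v < n \<and> (\<exists>z k. conn 0 z k v)}" and y: "y < n" "a x y \<noteq> 0"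
    then obtain z k where "conn 0 z k x" by auto
    then show "y \<in> {v. v < n \<and> (\<exists>z k. conn 0 z k v)}"
      using conn_step[of 0 z k x y] x y by (cases "x = y") auto
  qed auto
  then show "v < n \<Longrightarrow> ?thesis" by auto
qed

text \<open>A repeated vertex or a chord splits a closed walk into two shorter ones whose gains
  multiply to the original gain, since the chord is traversed once in each direction. One of the two
  would be irrational, so a shortest irrational closed walk is an induced cycle.\<close>

lemma irrational_closed_walk:
  assumes bad: "conn u z k u" "z \<notin> \<rat>"
  shows "\<exists>c k. icycle c k \<and> gain c k \<notin> \<rat>"
proof -
  define Q where "Q = (\<lambda>k. \<exists>u z. conn u z k u \<and> z \<notin> \<rat>)"
  define k where "k = (LEAST k. Q k)"
  have "Q k" unfolding k_def using LeastI[of Q] bad unfolding Q_def by blast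
  then obtain u z where uz: "conn u z k u" "z \<notin> \<rat>" unfolding Q_def by blast
  have min: "z' \<in> \<rat>" if "conn u' z' k' u'" "k' < k" for u' z' k'
    using not_less_Least[of k' Q] that unfolding k_def Q_def by blast
  obtain w where W: "w 0 = u \<and> w k = u \<and>
     (\<forall>i j. i \<le> j \<and> j \<le> k \<longrightarrow> conn (w i) (\<Prod>t\<in>{i..<j}. a (w t) (w (Suc t))) (j - i) (w j)) \<and>
     z = (\<Prod>t\<in>{0..<k}. a (w t) (w (Suc t))) \<and> (\<forall>i<k. w i \<noteq> w (Suc i) \<and> a (w i) (w (Suc i)) \<noteq> 0)"
    using conn_walk[OF uz(1)] ..
  then have w: "w 0 = u" "w k = u"
    "\<And>i j. i \<le> j \<Longrightarrow> j \<le> k \<Longrightarrow> conn (w i) (\<Prod>t\<in>{i..<j}. a (w t) (w (Suc t))) (j - i) (w j)"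
    "z = (\<Prod>t\<in>{0..<k}. a (w t) (w (Suc t)))" "\<And>i. i < k \<Longrightarrow> w i \<noteq> w (Suc i) \<and> a (w i) (w (Suc i)) \<noteq> 0"
    by blast+
  define G where "G = (\<lambda>i j. \<Prod>t\<in>{i..<j}. a (w t) (w (Suc t)))"
  have G: "conn (w i) (G i j) (j - i) (w j)" if "i \<le> j" "j \<le> k" for i j using w(3) that by (simp add: G_def)
  have split: "z = G 0 i * G i j * G j k" if "i \<le> j" "j \<le> k" for i j
    unfolding w(4) G_def using that by (simp add: prod.atLeastLessThan_concat)
  have V: "w i < n" if "i \<le> k" for i using conn_V[OF G[of i i]] that by simp
  have k2: "k \<ge> 3"
  proof (rule ccontr)
    assume "\<not> k \<ge> 3"
    then consider "k = 0" | "k = 1" | "k = 2" by linarith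
    then show False
    proof cases
      case 1 then show False using w(4) uz by simp
    next
      case 2 then show False using w(5)[of 0] w by simp
    next
      case 3
      then have "z = a (w 0) (w 1) * a (w 1) (w 2)" using w(4) by (simp add: numeral_2_eq_2)
      moreover have "w 2 = w 0" using w 3 by simp
      ultimately have "z = 1" using unit_mult[of "w 0" "w 1"] V[of 0] V[of 1] w(5)[of 0] 3 by simp
      then show False using uz by simp
    qed
  qed
  have dist: "w i \<noteq> w j" if ij: "i < j" "j < k" for i j
  proof
    assume eq: "w i = w j"
    have "G i j \<in> \<rat>" using min[of "w i" "G i j" "j - i"] G[of i j] ij eq by simp
    moreover have "conn (w 0) (G 0 i * G j k) (i + (k - j)) (w 0)"
      using conn_trans[OF G[of j k], of "w 0" "G 0 i" i] G[of 0 i] ij eq w by simp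
    then have "G 0 i * G j k \<in> \<rat>" using min ij by simp
    ultimately have "G i j * (G 0 i * G j k) \<in> \<rat>" by (rule Rats_mult)
    moreover have "z = G i j * (G 0 i * G j k)" using split[of i j] ij by (simp add: mult_ac)
    ultimately show False using uz by simp
  qed
  have chord: "a (w i) (w j) = 0" if ij: "i + 1 < j" "j < k" "\<not> (i = 0 \<and> j = k - 1)" for i j
  proof (rule ccontr)
    assume nz: "a (w i) (w j) \<noteq> 0"
    have Vij: "w i < n" "w j < n" "w i \<noteq> w j" using V dist[of i j] ij by auto
    have nz': "a (w j) (w i) \<noteq> 0" using nz zero_sym Vij by blast
    have "conn (w i) (G i j * a (w j) (w i)) ((j - i) + 1) (w i)"
      using conn_trans[OF conn_edge[OF Vij(2,1)] G[of i j]] Vij nz' ij by simp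
    then have r1: "G i j * a (w j) (w i) \<in> \<rat>" using min ij by auto
    have "conn (w 0) (G 0 i * (a (w i) (w j) * G j k)) (i + (1 + (k - j))) (w 0)"
      using conn_trans[OF conn_trans[OF G[of j k] conn_edge[OF Vij(1,2,3) nz]] G[of 0 i]] ij w by simp
    then have r2: "G 0 i * (a (w i) (w j) * G j k) \<in> \<rat>" using min ij by auto
    have "z = (a (w i) (w j) * a (w j) (w i)) * (G 0 i * G i j * G j k)"
      using split[of i j] ij unit_mult[OF Vij(1,2) nz] by simp
    also have "\<dots> = (G i j * a (w j) (w i)) * (G 0 i * (a (w i) (w j) * G j k))" by (simp add: mult_ac)
    also have "\<dots> \<in> \<rat>" using r1 r2 by (rule Rats_mult)
    finally show False using uz by simp
  qed
  define K where "K = int k"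
  define c where "c = (\<lambda>i. w (nat (i mod K)))"
  have K: "K \<ge> 3" using k2 by (simp add: K_def)
  have range: "0 \<le> i mod K" "i mod K < K" for i using K by simp_all
  have wk: "w k = w 0" using w by simp
  have cs: "c (i + 1) = w (Suc (nat (i mod K)))" for i
  proof (cases "i mod K = K - 1")
    case True
    then have "(i + 1) mod K = 0" by (metis add.commute diff_add_cancel mod_add_left_eq mod_self)
    moreover have "Suc (nat (i mod K)) = k" using True k2 by (simp add: K_def)
    ultimately show ?thesis by (simp add: c_def wk)
  next
    case False
    have "(i + 1) mod K = (i mod K + 1) mod K" by (simp add: mod_add_left_eq)
    also have "\<dots> = i mod K + 1" using range[of i] False by (intro mod_pos_pos_trivial) linarith+
    finally have "(i + 1) mod K = i mod K + 1" .
    then show ?thesis using range[of i] by (simp add: c_def nat_add_distrib)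
  qed
  have entry: "a (w i) (w j) \<noteq> 0 \<longleftrightarrow> \<bar>int i - int j\<bar> = 1 \<or> \<bar>int i - int j\<bar> = K - 1"
    if ij: "i < k" "j < k" "i \<noteq> j" for i j
  proof -
    have half: "a (w i) (w j) \<noteq> 0 \<longleftrightarrow> \<bar>int i - int j\<bar> = 1 \<or> \<bar>int i - int j\<bar> = K - 1" if ij: "i < j" "j < k" for i j
    proof -
      consider "j = i + 1" | "i = 0 \<and> j = k - 1" | "i + 1 < j" "\<not> (i = 0 \<and> j = k - 1)" using ij by linarith
      then show ?thesis
      proof cases
        case 1
        then show ?thesis using w(5)[of i] ij by simp
      next
        case 2
        have "a (w (k - 1)) (w k) \<noteq> 0" using w(5)[of "k - 1"] k2 by simp
        then have "a (w i) (w j) \<noteq> 0" using 2 wk zero_sym[of "w 0" "w (k - 1)"] V[of 0] V[of "k - 1"] by simp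
        then show ?thesis using 2 k2 by (simp add: K_def of_nat_diff)
      next
        case 3
        then show ?thesis using chord[OF 3(1) ij(2) 3(2)] ij by (auto simp: K_def)
      qed
    qed
    show ?thesis
    proof (cases "i < j")
      case True then show ?thesis using half ij by simp
    next
      case False
      then have "j < i" using ij by simp
      from half[OF this ij(1)] zero_sym[of "w i" "w j"] V[of i] V[of j] ij show ?thesis
        by (simp add: abs_minus_commute)
    qed
  qed
  have "icycle c K"
    unfolding icycle_def
  proof (intro conjI allI impI)
    show "3 \<le> K" by (rule K)
    show "c (i + K) = c i" for i by (simp add: c_def)
    show "c i < n" for i unfolding c_def using V[of "nat (i mod K)"] range[of i] by (simp add: K_def)
    fix i j assume ij: "\<bar>i - j\<bar> < K"
    define i' where "i' = nat (i mod K)"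
    define j' where "j' = nat (j mod K)"
    have i': "int i' = i mod K" "i' < k"
      using range[of i] by (simp_all add: i'_def K_def nat_less_iff)
    have j': "int j' = j mod K" "j' < k"
      using range[of j] by (simp_all add: j'_def K_def nat_less_iff)
    have modeq: "(i mod K - j mod K) mod K = (i - j) mod K" by (rule mod_diff_eq)
    have diff: "int i' - int j' = i - j \<or> int i' - int j' = i - j + K \<or> int i' - int j' = i - j - K"
    proof -
      have "K dvd (i - j) - (int i' - int j')"
        using modeq unfolding i' j' by (metis mod_eq_dvd_iff)
      then obtain q where q: "(i - j) - (int i' - int j') = K * q" by (auto elim: dvdE)
      have "\<bar>int i' - int j'\<bar> < K" using i' j' by (simp add: K_def)
      then have b: "\<bar>K * q\<bar> < 2 * K" using ij q by linarith
      then have "\<bar>q\<bar> < 2" using K by (simp add: abs_mult)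
      then have "q = 0 \<or> q = 1 \<or> q = - 1" by linarith
      then show ?thesis
      proof (elim disjE)
        assume "q = 0" then show ?thesis using q by simp
      next
        assume "q = 1" then have "int i' - int j' = i - j - K" using q by simp
        then show ?thesis by blast
      next
        assume "q = - 1" then have "int i' - int j' = i - j + K" using q by simp
        then show ?thesis by blast
      qed
    qed
    have ceq: "c i = w i'" "c j = w j'" by (simp_all add: c_def i'_def j'_def)
    have lt: "\<bar>int i' - int j'\<bar> < K" using i' j' by (simp add: K_def)
    have same: "i' = j' \<longleftrightarrow> i = j"
    proof
      assume "i' = j'"
      then show "i = j" using diff ij by auto
    qed (simp add: i'_def j'_def)
    show "c i = c j \<longleftrightarrow> i = j"
      unfolding ceq same[symmetric] using dist[of i' j'] dist[of j' i'] i' j' by (metis nat_neq_iff)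
    assume "i \<noteq> j"
    then have ne': "i' \<noteq> j'" using same by simp
    show "a (c i) (c j) \<noteq> 0 \<longleftrightarrow> \<bar>i - j\<bar> = 1 \<or> \<bar>i - j\<bar> = K - 1"
      unfolding ceq entry[OF i'(2) j'(2) ne'] using diff ij lt by (elim disjE) auto
  qed
  moreover have "gain c K = z"
  proof -
    have "gain c K = (\<Prod>t\<in>{0..<k}. a (c (int t)) (c (int t + 1)))"
      unfolding gain_def K_def
      by (rule prod.reindex_bij_witness[of _ int nat]) auto
    also have "\<dots> = (\<Prod>t\<in>{0..<k}. a (w t) (w (Suc t)))"
      by (rule prod.cong) (auto simp: cs, auto simp: c_def K_def)
    finally show ?thesis using w(4) by simp
  qed
  ultimately show ?thesis using uz by blast
qed

text \<open>If all closed walks have rational gain, let \<open>t v\<close> be the gain of some walk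
  from 0 to \<open>v\<close>; for distinct adjacent \<open>i\<close> and \<open>j\<close> the
  product \<open>t i * a i j * cnj (t j)\<close> is then the gain of a closed walk at 0.\<close>

lemma unit_dichotomy:
  "has_pattern n (cycle_pattern n) a \<or>
   (\<exists>t. (\<forall>i<n. t i \<in> R \<and> cmod (t i) = 1) \<and> (\<forall>i<n. \<forall>j<n. t i * a i j * cnj (t j) \<in> \<rat>))"
proof (cases "\<exists>u z k. conn u z k u \<and> z \<notin> \<rat>")
  case True
  then show ?thesis using irrational_closed_walk cycle_pattern_if by blast
next
  case False
  define t where "t = (\<lambda>v. SOME z. \<exists>k. conn 0 z k v)"
  have t: "\<exists>k. conn 0 (t v) k v" if "v < n" for v
    unfolding t_def by (rule someI_ex) (use connected_conn[OF that] in blast)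
  have "t i * a i j * cnj (t j) \<in> \<rat>" if ij: "i < n" "j < n" for i j
  proof -
    obtain k l where k: "conn 0 (t i) k i" and l: "conn 0 (t j) l j" using t ij by blast
    consider "i = j" | "a i j = 0" | "i \<noteq> j" "a i j \<noteq> 0" by blast
    then show ?thesis
    proof cases
      case 1
      have "t i * cnj (t i) = 1" using conn_R[OF k] complex_norm_square[of "t i"] by simp
      then have "t i * a i j * cnj (t j) = a i i" using 1 by (simp add: mult_ac)
      then show ?thesis using charge_rat ij by simp
    next
      case 3
      have "conn 0 (t i * a i j * cnj (t j)) (k + 1 + l) 0"
        using conn_trans[OF conn_sym[OF l] conn_trans[OF conn_edge[OF ij 3] k]] .
      then show ?thesis using False by blast
    qed simp
  qed
  then show ?thesis using t conn_R by blast
qed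

end

subsection \<open>Algebraic integers form a ring\<close>

text \<open>\<open>z\<close> is an eigenvalue of an integer matrix, hence a root of its monic
  characteristic polynomial.\<close>

lemma algebraic_int_eigen:
  fixes z :: complex and w :: "nat \<Rightarrow> complex" and c :: "nat \<Rightarrow> nat \<Rightarrow> int"
  assumes nz: "i < N" "w i \<noteq> 0"
    and eq: "\<And>i. i < N \<Longrightarrow> z * w i = (\<Sum>j<N. of_int (c i j) * w j)"
  shows "algebraic_int z"
proof -
  define M where "M = Matrix.mat N N (\<lambda>(i, j). c i j)"
  define M' where "M' = map_mat (of_int :: int \<Rightarrow> complex) M"
  have M: "M \<in> carrier_mat N N" "M' \<in> carrier_mat N N" by (auto simp: M_def M'_def)
  have "M' *\<^sub>v Matrix.vec N w = z \<cdot>\<^sub>v Matrix.vec N w"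
  proof (rule eq_vecI)
    fix i assume "i < dim_vec (z \<cdot>\<^sub>v Matrix.vec N w)"
    then have i: "i < N" by simp
    then have "vec_index (M' *\<^sub>v Matrix.vec N w) i = (\<Sum>j<N. of_int (c i j) * w j)"
      by (simp add: M'_def M_def scalar_prod_def lessThan_atLeast0)
    then show "vec_index (M' *\<^sub>v Matrix.vec N w) i = vec_index (z \<cdot>\<^sub>v Matrix.vec N w) i" using eq[OF i] i by simp
  qed (use M in auto)
  moreover have "Matrix.vec N w \<noteq> 0\<^sub>v N" using nz by (metis index_vec index_zero_vec(1))
  ultimately have "eigenvalue M' z"
    unfolding eigenvalue_def eigenvector_def using M by (intro exI[of _ "Matrix.vec N w"]) auto
  then have "poly (char_poly M') z = 0" using eigenvalue_root_char_poly[OF M(2)] by simp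
  moreover have "char_poly M' = map_poly of_int (char_poly M)"
    unfolding M'_def by (rule of_int_hom.char_poly_hom[OF M(1)])
  moreover have "lead_coeff (char_poly M) = 1" using degree_monic_char_poly[OF M(1)] by simp
  ultimately show ?thesis unfolding algebraic_int_altdef_ipoly by auto
qed

definition int_span :: "nat \<Rightarrow> (nat \<Rightarrow> complex) \<Rightarrow> complex set" where
  "int_span N w = {\<Sum>j<N. of_int (c j) * w j | c. True}"

lemma int_span_zero: "0 \<in> int_span N w"
  unfolding int_span_def by (rule CollectI, rule exI[of _ "\<lambda>_. 0"]) simp

lemma int_span_base: "i < N \<Longrightarrow> w i \<in> int_span N w"
proof -
  assume "i < N"
  then have "w i = (\<Sum>j<N. of_int (if j = i then 1 else 0) * w j)"
    by (simp add: if_distrib[of of_int] if_distrib[of "\<lambda>x. x * _"] cong: if_cong)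
  then show ?thesis
    unfolding int_span_def by (intro CollectI exI[of _ "\<lambda>j. if j = i then 1 else 0"]) simp
qed

lemma int_span_add: "x \<in> int_span N w \<Longrightarrow> y \<in> int_span N w \<Longrightarrow> x + y \<in> int_span N w"
proof -
  assume "x \<in> int_span N w" "y \<in> int_span N w"
  then obtain c d where "x = (\<Sum>j<N. of_int (c j) * w j)" "y = (\<Sum>j<N. of_int (d j) * w j)"
    unfolding int_span_def by auto
  then have "x + y = (\<Sum>j<N. of_int (c j + d j) * w j)" by (simp add: sum.distrib algebra_simps)
  then show ?thesis unfolding int_span_def by (intro CollectI exI[of _ "\<lambda>j. c j + d j"]) simp
qed

lemma int_span_scale: "x \<in> int_span N w \<Longrightarrow> of_int t * x \<in> int_span N w"
proof -
  assume "x \<in> int_span N w"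
  then obtain c where "x = (\<Sum>j<N. of_int (c j) * w j)" unfolding int_span_def by auto
  then have "of_int t * x = (\<Sum>j<N. of_int (t * c j) * w j)" by (simp add: sum_distrib_left mult.assoc)
  then show ?thesis unfolding int_span_def by (intro CollectI exI[of _ "\<lambda>j. t * c j"]) simp
qed

lemma int_span_sum: "finite S \<Longrightarrow> (\<And>s. s \<in> S \<Longrightarrow> f s \<in> int_span N w) \<Longrightarrow> sum f S \<in> int_span N w"
  by (induction S rule: finite_induct) (auto intro: int_span_zero int_span_add)

lemma int_span_mult:
  assumes "\<And>i. i < N \<Longrightarrow> x * w i \<in> int_span N w" "y \<in> int_span N w"
  shows "x * y \<in> int_span N w"
proof -
  obtain c where "y = (\<Sum>j<N. of_int (c j) * w j)" using assms unfolding int_span_def by auto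
  then have "x * y = (\<Sum>j<N. of_int (c j) * (x * w j))" by (simp add: sum_distrib_left mult_ac)
  also have "\<dots> \<in> int_span N w" by (intro int_span_sum int_span_scale assms) auto
  finally show ?thesis .
qed

lemma algebraic_int_stable:
  assumes "i < N" "w i \<noteq> 0" "\<And>i. i < N \<Longrightarrow> z * w i \<in> int_span N w"
  shows "algebraic_int z"
proof -
  have "\<exists>c. z * w i = (\<Sum>j<N. of_int (c j) * w j)" if "i < N" for i
    using assms(3)[OF that] unfolding int_span_def by auto
  then obtain c where "\<And>i. i < N \<Longrightarrow> z * w i = (\<Sum>j<N. of_int (c i j) * w j)" by metis
  then show ?thesis using algebraic_int_eigen[of i N w z c] assms by blast
qed

lemma algebraic_int_power:
  assumes "algebraic_int (x :: complex)"
  obtains m p where "m > 0" "x ^ m = (\<Sum>i<m. of_int (p i) * x ^ i)"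
proof -
  obtain q :: "int poly" where q: "poly (map_poly of_int q) x = 0" "lead_coeff q = 1"
    using assms unfolding algebraic_int_altdef_ipoly by blast
  have deg: "degree (map_poly of_int q :: complex poly) = degree q" by simp
  have "degree q \<noteq> 0"
  proof
    assume "degree q = 0"
    then obtain c where "q = [:c:]" by (auto elim: degree_eq_zeroE)
    then show False using q by simp
  qed
  have "0 = (\<Sum>i\<le>degree q. of_int (coeff q i) * x ^ i)"
    using q(1) unfolding poly_altdef deg by (simp add: coeff_map_poly)
  also have "\<dots> = (\<Sum>i<degree q. of_int (coeff q i) * x ^ i) + x ^ degree q"
    using q(2) by (simp add: lessThan_Suc_atMost[symmetric])
  finally have "x ^ degree q = - (\<Sum>i<degree q. of_int (coeff q i) * x ^ i)"
    by (simp add: eq_neg_iff_add_eq_0 add.commute)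
  also have "\<dots> = (\<Sum>i<degree q. of_int (- coeff q i) * x ^ i)" by (simp add: sum_negf)
  finally show ?thesis using that[of "degree q" "\<lambda>i. - coeff q i"] \<open>degree q \<noteq> 0\<close> by simp
qed

text \<open>The products \<open>x ^ i * y ^ j\<close> with \<open>i < m\<close> and
  \<open>j < k\<close> span a group stable under multiplication by \<open>x\<close> and by
  \<open>y\<close>, hence by their sum and product. Quotient and remainder modulo \<open>k\<close>
  code the pair of exponents.\<close>

lemma algebraic_int_add_mult:
  assumes "algebraic_int (x :: complex)" "algebraic_int y"
  shows "algebraic_int (x + y)" "algebraic_int (x * y)"
proof -
  obtain m p where m: "m > 0" "x ^ m = (\<Sum>i<m. of_int (p i) * x ^ i)"
    using algebraic_int_power[OF assms(1)] .
  obtain k q where k: "k > 0" "y ^ k = (\<Sum>i<k. of_int (q i) * y ^ i)"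
    using algebraic_int_power[OF assms(2)] .
  define w where "w = (\<lambda>t. x ^ (t div k) * y ^ (t mod k))"
  let ?S = "int_span (m * k) w"
  have base: "x ^ i * y ^ j \<in> ?S" if "i < m" "j < k" for i j
  proof -
    have "i * k + j < m * k"
    proof -
      have "i * k + j < (i + 1) * k" using that by simp
      also have "\<dots> \<le> m * k" using that by (intro mult_le_mono1) simp
      finally show ?thesis .
    qed
    from int_span_base[OF this, of w] show ?thesis using that by (simp add: w_def)
  qed
  have dm: "t div k < m" "t mod k < k" if "t < m * k" for t
    using that k by (auto simp: less_mult_imp_div_less)
  have xw: "x * w t \<in> ?S" if "t < m * k" for t
  proof (cases "t div k + 1 < m")
    case True
    then show ?thesis using base[of "t div k + 1" "t mod k"] dm[OF that] by (simp add: w_def mult_ac)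
  next
    case False
    then have "t div k + 1 = m" using dm[OF that] by simp
    then have "x * w t = x ^ m * y ^ (t mod k)" by (auto simp: w_def mult_ac)
    also have "\<dots> = (\<Sum>i<m. of_int (p i) * (x ^ i * y ^ (t mod k)))"
      unfolding m(2) by (simp add: sum_distrib_right mult.assoc)
    also have "\<dots> \<in> ?S" using dm[OF that] by (intro int_span_sum int_span_scale base) auto
    finally show ?thesis .
  qed
  have yw: "y * w t \<in> ?S" if "t < m * k" for t
  proof (cases "t mod k + 1 < k")
    case True
    then show ?thesis using base[of "t div k" "t mod k + 1"] dm[OF that] by (simp add: w_def mult_ac)
  next
    case False
    then have "k = Suc (t mod k)" using dm[OF that] by simp
    then have "y ^ k = y * y ^ (t mod k)" by (metis power_Suc)
    then have "y * w t = x ^ (t div k) * y ^ k" by (simp add: w_def mult_ac)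
    also have "\<dots> = (\<Sum>i<k. of_int (q i) * (x ^ (t div k) * y ^ i))"
      unfolding k(2) by (simp add: sum_distrib_left mult_ac)
    also have "\<dots> \<in> ?S" using dm[OF that] by (intro int_span_sum int_span_scale base) auto
    finally show ?thesis .
  qed
  have w0: "0 < m * k" "w 0 \<noteq> 0" using m k by (auto simp: w_def)
  show "algebraic_int (x + y)"
    by (rule algebraic_int_stable[of 0 "m * k" w, OF w0]) (auto simp: distrib_right intro: int_span_add xw yw)
  show "algebraic_int (x * y)"
    by (rule algebraic_int_stable[of 0 "m * k" w, OF w0]) (auto simp: mult.assoc intro: int_span_mult xw yw)
qed

subsection \<open>Quadratic integers\<close>

lemma of_rat_real_complex: "complex_of_real (of_rat q) = of_rat q"
proof -
  obtain i j where "q = of_int i / of_int j" by (metis Rats_cases' Rats_of_rat of_rat_eq_id id_apply)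
  then show ?thesis by (simp add: of_rat_divide)
qed

lemma cnj_of_rat: "cnj (of_rat q) = of_rat q"
  by (metis of_rat_real_complex complex_cnj_complex_of_real)

locale quadratic =
  fixes d :: int
  assumes param: "quadratic_param d"
begin

abbreviation s :: complex where "s \<equiv> csqrt (of_int d)"
abbreviation K :: "complex set" where "K \<equiv> quadratic_field d"
abbreviation O\<^sub>d :: "complex set" where "O\<^sub>d \<equiv> quadratic_integers d"

lemma ss: "s * s = of_int d"
  by (metis power2_csqrt power2_eq_square)

text \<open>A rational \<open>s\<close> would be an integer whose square is \<open>d\<close>;
  squarefreeness makes it 1 or -1, leaving the excluded \<open>d = 1\<close>.\<close>

lemma s_irrational: "s \<notin> \<rat>"
proof
  assume "s \<in> \<rat>"
  moreover have "algebraic_int s" by (intro algebraic_int_csqrt int_imp_algebraic_int) auto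
  ultimately have "s \<in> \<int>" using rational_algebraic_int_is_int by blast
  then obtain t where "s = of_int t" by (auto elim: Ints_cases)
  then have "(of_int (t * t) :: complex) = of_int d" using ss by simp
  then have t: "t * t = d" by (simp only: of_int_eq_iff)
  then have "t\<^sup>2 dvd d" by (simp add: power2_eq_square)
  then have "t dvd 1" using param unfolding quadratic_param_def squarefree_def by blast
  then have "\<bar>t\<bar> = 1" by simp
  then have "t = 1 \<or> t = - 1" by linarith
  then have "d = 1" using t by auto
  then show False using param by (simp add: quadratic_param_def)
qed

lemma K_unique:
  assumes "of_rat p + of_rat q * s = of_rat p' + of_rat q' * s"
  shows "p = p' \<and> q = q'"
proof -
  have eq: "of_rat (p - p') = of_rat (q' - q) * s"
    using assms by (simp add: of_rat_diff algebra_simps)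
  have "q' - q = 0"
  proof (rule ccontr)
    assume "q' - q \<noteq> 0"
    then have "s = of_rat ((p - p') / (q' - q))" using eq by (simp add: of_rat_divide field_simps)
    then show False using s_irrational by simp
  qed
  then show ?thesis using eq by simp
qed

text \<open>The nontrivial automorphism of the field; the description is definite by
  \<open>K_unique\<close>.\<close>

definition qconj :: "complex \<Rightarrow> complex" where
  "qconj x = (THE y. \<exists>p q. x = of_rat p + of_rat q * s \<and> y = of_rat p - of_rat q * s)"

lemma qconj_eq: "qconj (of_rat p + of_rat q * s) = of_rat p - of_rat q * s"
  unfolding qconj_def
proof (rule the_equality)
  fix y assume "\<exists>p' q'. of_rat p + of_rat q * s = of_rat p' + of_rat q' * s \<and> y = of_rat p' - of_rat q' * s"
  then obtain p' q' where e: "of_rat p + of_rat q * s = of_rat p' + of_rat q' * s"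
    and y: "y = of_rat p' - of_rat q' * s" by (elim exE conjE)
  from K_unique[OF e] show "y = of_rat p - of_rat q * s" unfolding y by simp
qed (intro exI[of _ p] exI[of _ q] conjI refl)

lemma K_cases:
  assumes "x \<in> K" obtains p q where "x = of_rat p + of_rat q * s"
  using assms unfolding quadratic_field_def by blast

lemma K_I: "of_rat p + of_rat q * s \<in> K"
  unfolding quadratic_field_def by blast

lemma K_of_rat: "of_rat p \<in> K" and qconj_of_rat: "qconj (of_rat p) = of_rat p"
  using K_I[of p 0] qconj_eq[of p 0] by auto

lemma K_add: assumes "x \<in> K" "y \<in> K"
  shows "x + y \<in> K" "qconj (x + y) = qconj x + qconj y"
proof -
  obtain p q p' q' where x: "x = of_rat p + of_rat q * s" "y = of_rat p' + of_rat q' * s"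
    using assms K_cases by metis
  have "x + y = of_rat (p + p') + of_rat (q + q') * s" unfolding x by (simp add: of_rat_add algebra_simps)
  moreover have "of_rat (p + p') - of_rat (q + q') * s = qconj x + qconj y"
    unfolding x qconj_eq by (simp add: of_rat_add algebra_simps)
  ultimately show "x + y \<in> K" "qconj (x + y) = qconj x + qconj y"
    using K_I qconj_eq[of "p + p'" "q + q'"] by auto
qed

lemma K_mult: assumes "x \<in> K" "y \<in> K"
  shows "x * y \<in> K" "qconj (x * y) = qconj x * qconj y"
proof -
  obtain p q p' q' where x: "x = of_rat p + of_rat q * s" "y = of_rat p' + of_rat q' * s"
    using assms K_cases by metis
  have d: "of_rat (of_int d) = s * s" using ss by simp
  have "x * y = of_rat (p * p' + q * q' * of_int d) + of_rat (p * q' + q * p') * s"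
    unfolding x of_rat_add of_rat_mult d by (simp add: algebra_simps)
  moreover have "of_rat (p * p' + q * q' * of_int d) - of_rat (p * q' + q * p') * s = qconj x * qconj y"
    unfolding x qconj_eq of_rat_add of_rat_mult d by (simp add: algebra_simps)
  ultimately show "x * y \<in> K" "qconj (x * y) = qconj x * qconj y"
    using K_I qconj_eq[of "p * p' + q * q' * of_int d" "p * q' + q * p'"] by auto
qed

lemma qconj_K: assumes "x \<in> K" shows "qconj x \<in> K"
proof -
  obtain p q where x: "x = of_rat p + of_rat q * s" using assms K_cases by blast
  have "qconj x = of_rat p + of_rat (- q) * s" unfolding x qconj_eq by (simp add: of_rat_minus)
  then show ?thesis using K_I by simp
qed

lemma K_uminus: assumes "x \<in> K" shows "- x \<in> K" "qconj (- x) = - qconj x"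
  using K_mult[OF K_of_rat[of "- 1"] assms] qconj_of_rat[of "- 1"] by auto

lemma K_of_int: "of_int t \<in> K" "qconj (of_int t) = of_int t"
  using K_of_rat[of "of_int t"] qconj_of_rat[of "of_int t"] by auto

lemma K_sum_prod:
  assumes "finite S" "\<And>x. x \<in> S \<Longrightarrow> f x \<in> K"
  shows "sum f S \<in> K" "qconj (sum f S) = (\<Sum>x\<in>S. qconj (f x))"
    "prod f S \<in> K" "qconj (prod f S) = (\<Prod>x\<in>S. qconj (f x))"
proof -
  have "sum f S \<in> K \<and> qconj (sum f S) = (\<Sum>x\<in>S. qconj (f x)) \<and>
      prod f S \<in> K \<and> qconj (prod f S) = (\<Prod>x\<in>S. qconj (f x))"
    using assms
  proof (induction S rule: finite_induct)
    case empty
    then show ?case using K_of_int[of 0] K_of_int[of 1] by simp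
  next
    case (insert x S)
    then show ?case by (simp add: K_add K_mult)
  qed
  then show "sum f S \<in> K" "qconj (sum f S) = (\<Sum>x\<in>S. qconj (f x))"
    "prod f S \<in> K" "qconj (prod f S) = (\<Prod>x\<in>S. qconj (f x))" by simp_all
qed

lemma qconj_trace: assumes "x \<in> K" shows "x + qconj x \<in> \<rat>" "x * qconj x \<in> \<rat>"
proof -
  obtain p q where x: "x = of_rat p + of_rat q * s" using assms K_cases by metis
  have "x + qconj x = of_rat (p + p)" unfolding x qconj_eq of_rat_add by simp
  then show "x + qconj x \<in> \<rat>" by simp
  have d: "of_rat (of_int d) = s * s" using ss by simp
  have "x * qconj x = of_rat (p * p - q * q * of_int d)"
    unfolding x qconj_eq of_rat_diff of_rat_mult d by (simp add: algebra_simps)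
  then show "x * qconj x \<in> \<rat>" by simp
qed

lemma qconj_fixed: assumes "x \<in> K" "qconj x = x" shows "x \<in> \<rat>"
proof -
  have "x + x \<in> \<rat>" using qconj_trace(1)[OF assms(1)] assms(2) by simp
  then have "(x + x) / 2 \<in> \<rat>" by (rule Rats_divide) simp
  then show ?thesis by simp
qed

lemma qconj_algebraic_int:
  assumes "x \<in> K" "algebraic_int x" shows "algebraic_int (qconj x)"
proof -
  obtain p where p: "poly (map_poly of_int p) x = 0" "lead_coeff p = 1"
    using assms(2) unfolding algebraic_int_altdef_ipoly by blast
  have pow: "x ^ i \<in> K \<and> qconj (x ^ i) = qconj x ^ i" for i
    by (induction i) (use K_of_int[of 1] in \<open>auto simp: K_mult assms\<close>)
  have ev: "poly (map_poly of_int p) z = (\<Sum>i\<le>degree p. of_int (coeff p i) * z ^ i)" for z :: complex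
    unfolding poly_altdef by (simp add: coeff_map_poly)
  have "0 = qconj (\<Sum>i\<le>degree p. of_int (coeff p i) * x ^ i)"
    using p(1) K_of_int[of 0] unfolding ev by simp
  also have "\<dots> = (\<Sum>i\<le>degree p. of_int (coeff p i) * qconj x ^ i)"
    by (subst K_sum_prod(2)) (auto simp: K_mult K_of_int pow)
  finally have "poly (map_poly of_int p) (qconj x) = 0" unfolding ev by simp
  then show ?thesis using p(2) unfolding algebraic_int_altdef_ipoly by blast
qed

lemma O_K: "x \<in> O\<^sub>d \<Longrightarrow> x \<in> K" and O_alg: "x \<in> O\<^sub>d \<Longrightarrow> algebraic_int x"
  by (auto simp: quadratic_integers_def)

lemma O_I: "x \<in> K \<Longrightarrow> algebraic_int x \<Longrightarrow> x \<in> O\<^sub>d"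
  by (simp add: quadratic_integers_def)

lemma O_add: "x \<in> O\<^sub>d \<Longrightarrow> y \<in> O\<^sub>d \<Longrightarrow> x + y \<in> O\<^sub>d"
  using O_I[OF K_add(1) algebraic_int_add_mult(1)] O_K O_alg by simp

lemma O_mult: "x \<in> O\<^sub>d \<Longrightarrow> y \<in> O\<^sub>d \<Longrightarrow> x * y \<in> O\<^sub>d"
  using O_I[OF K_mult(1) algebraic_int_add_mult(2)] O_K O_alg by simp

lemma O_of_int: "of_int t \<in> O\<^sub>d"
  using O_I[OF K_of_int(1) int_imp_algebraic_int] by simp

lemma O_0: "0 \<in> O\<^sub>d" and O_1: "1 \<in> O\<^sub>d"
  using O_of_int[of 0] O_of_int[of 1] by auto

lemma O_uminus: "x \<in> O\<^sub>d \<Longrightarrow> - x \<in> O\<^sub>d"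
  using O_mult[OF O_of_int[of "- 1"]] by simp

lemma O_rat: "x \<in> O\<^sub>d \<Longrightarrow> x \<in> \<rat> \<Longrightarrow> x \<in> \<int>"
  using rational_algebraic_int_is_int O_alg by blast

lemma O_qconj: "x \<in> O\<^sub>d \<Longrightarrow> qconj x \<in> O\<^sub>d"
  using O_I[OF qconj_K qconj_algebraic_int] O_K O_alg by simp

lemma O_trace: assumes "x \<in> O\<^sub>d" shows "x + qconj x \<in> \<int>"
  by (rule O_rat[OF O_add[OF assms O_qconj[OF assms]] qconj_trace(1)[OF O_K[OF assms]]])

lemma O_norm: assumes "x \<in> O\<^sub>d" shows "x * qconj x \<in> \<int>"
  by (rule O_rat[OF O_mult[OF assms O_qconj[OF assms]] qconj_trace(2)[OF O_K[OF assms]]])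

lemma neg_s: assumes "d < 0" shows "cnj s = - s"
  using assms by simp

lemma pos_s: assumes "d > 0" shows "s = of_real (sqrt d)"
  using assms by simp

lemma cnj_imag: assumes "d < 0" "x \<in> K" shows "cnj x = qconj x"
proof -
  obtain p q where x: "x = of_rat p + of_rat q * s" using assms K_cases by metis
  show ?thesis unfolding x qconj_eq complex_cnj_add complex_cnj_mult neg_s[OF assms(1)] cnj_of_rat by simp
qed

lemma cnj_real: assumes "d > 0" "x \<in> K" shows "cnj x = x"
proof -
  obtain p q where x: "x = of_rat p + of_rat q * s" using assms K_cases by metis
  show ?thesis unfolding x pos_s[OF assms(1)] complex_cnj_add complex_cnj_mult cnj_of_rat by simp
qed

lemma d_cases: "d < 0 \<or> d > 0"
proof -
  have "d \<noteq> 0" using s_irrational by auto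
  then show ?thesis by linarith
qed

lemma O_cnj: assumes "x \<in> O\<^sub>d" shows "cnj x \<in> O\<^sub>d"
  using d_cases cnj_imag[OF _ O_K[OF assms]] cnj_real[OF _ O_K[OF assms]] O_qconj[OF assms] assms by auto

text \<open>For \<open>d < 0\<close> the conjugations \<open>cnj\<close> and \<open>qconj\<close>
  agree, so these numbers are norm and trace.\<close>

lemma O_imag:
  assumes "d < 0" "x \<in> O\<^sub>d"
  shows "(cmod x)\<^sup>2 \<in> \<nat>" "2 * Re x \<in> \<int>"
proof -
  have c: "cnj x = qconj x" using cnj_imag assms O_K by blast
  have "x * cnj x \<in> \<int>" unfolding c by (rule O_norm[OF assms(2)])
  then obtain t where "x * cnj x = of_int t" by (auto elim: Ints_cases)
  then have "complex_of_real ((cmod x)\<^sup>2) = of_real (of_int t)" using complex_norm_square[of x] by simp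
  then have t: "(cmod x)\<^sup>2 = of_int t" by (simp only: of_real_eq_iff)
  then have "t \<ge> 0" by (metis of_int_0_le_iff zero_le_power2)
  then show "(cmod x)\<^sup>2 \<in> \<nat>" unfolding t by (metis of_nat_in_Nats nonneg_int_cases of_int_of_nat_eq)
  have "x + cnj x \<in> \<int>" unfolding c by (rule O_trace[OF assms(2)])
  then obtain t where "x + cnj x = of_int t" by (auto elim: Ints_cases)
  then have "Re (x + cnj x) = of_int t" by simp
  then show "2 * Re x \<in> \<int>" by simp
qed

lemma det_qconj:
  assumes B: "B \<in> carrier_mat m m" and e: "\<And>i j. i < m \<Longrightarrow> j < m \<Longrightarrow> B $$ (i, j) \<in> K"
  shows "det (map_mat qconj B) = qconj (det B)"
proof -
  have pK: "(\<Prod>i = 0..<m. B $$ (i, p i)) \<in> K"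
    "qconj (\<Prod>i = 0..<m. B $$ (i, p i)) = (\<Prod>i = 0..<m. qconj (B $$ (i, p i)))" if "p permutes {0..<m}" for p
    using e permutes_in_image[OF that] by (auto intro!: K_sum_prod)
  have sg: "signof p \<in> K \<and> qconj (signof p) = (signof p :: complex)" for p :: "nat \<Rightarrow> nat"
    using K_of_int[of 1] K_of_int[of "- 1"] by (cases p rule: sign_cases) auto
  have fin: "finite {p. p permutes {0..<m}}" by (rule finite_permutations) simp
  have "qconj (det B) = (\<Sum>p | p permutes {0..<m}. qconj (signof p * (\<Prod>i = 0..<m. B $$ (i, p i))))"
    unfolding det_def'[OF B] by (rule K_sum_prod(2)[OF fin]) (use K_mult sg pK in auto)
  also have "\<dots> = (\<Sum>p | p permutes {0..<m}. signof p * (\<Prod>i = 0..<m. qconj (B $$ (i, p i))))"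
    by (rule sum.cong) (use K_mult sg pK in auto)
  also have "\<dots> = (\<Sum>p | p permutes {0..<m}. signof p * (\<Prod>i = 0..<m. map_mat qconj B $$ (i, p i)))"
  proof (rule sum.cong[OF refl], rule arg_cong2[where f = times], rule refl, rule prod.cong[OF refl])
    fix p i assume "p \<in> {p. p permutes {0..<m}}" "i \<in> {0..<m}"
    then show "qconj (B $$ (i, p i)) = map_mat qconj B $$ (i, p i)"
      using B permutes_in_image[of p "{0..<m}" i] by auto
  qed
  also have "\<dots> = det (map_mat qconj B)" by (rule det_def'[symmetric]) (use B in simp)
  finally show ?thesis by simp
qed

text \<open>Determinants commute with \<open>qconj\<close>, and at an integer argument the
  characteristic polynomial of \<open>A\<close> has an integer value, which \<open>qconj\<close>
  fixes. So both polynomials agree at infinitely many points.\<close>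

lemma char_poly_qconj:
  assumes A: "A \<in> carrier_mat m m" and e: "\<And>i j. i < m \<Longrightarrow> j < m \<Longrightarrow> A $$ (i, j) \<in> K"
    and p: "char_poly A = map_poly of_int p"
  shows "char_poly (map_mat qconj A) = char_poly A"
proof -
  let ?A = "map_mat qconj A"
  have A': "?A \<in> carrier_mat m m" using A by simp
  have "poly (char_poly ?A) (of_int t) = poly (char_poly A) (of_int t)" for t
  proof -
    have ent: "(- char_matrix A (of_int t)) $$ (i, j) \<in> K" if "i < m" "j < m" for i j
    proof -
      have "(- char_matrix A (of_int t)) $$ (i, j) = - A $$ (i, j) + of_int (if i = j then t else 0)"
        using A that by (auto simp: char_matrix_def)
      then show ?thesis using K_add(1)[OF K_uminus(1)[OF e[OF that]] K_of_int(1)] by simp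
    qed
    have "- char_matrix ?A (of_int t) = map_mat qconj (- char_matrix A (of_int t))"
    proof (rule eq_matI)
      fix i j assume "i < dim_row (map_mat qconj (- char_matrix A (of_int t)))"
        "j < dim_col (map_mat qconj (- char_matrix A (of_int t)))"
      then have ij: "i < m" "j < m" using A by (auto simp: char_matrix_def)
      define z :: complex where "z = (if i = j then of_int t else 0)"
      have z: "z \<in> K" "qconj z = z" using K_of_int[of t] K_of_int[of 0] by (auto simp: z_def)
      have 1: "(- char_matrix A (of_int t)) $$ (i, j) = - A $$ (i, j) + z"
        and 2: "(- char_matrix ?A (of_int t)) $$ (i, j) = - qconj (A $$ (i, j)) + z"
        using A ij by (auto simp: char_matrix_def z_def)
      have "map_mat qconj (- char_matrix A (of_int t)) $$ (i, j) = qconj ((- char_matrix A (of_int t)) $$ (i, j))"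
        using A ij by (subst index_map_mat) (auto simp: char_matrix_def)
      also have "\<dots> = - qconj (A $$ (i, j)) + z"
        unfolding 1 using K_add(2)[OF K_uminus(1)[OF e[OF ij]] z(1)] K_uminus(2)[OF e[OF ij]] z(2) by simp
      finally show "(- char_matrix ?A (of_int t)) $$ (i, j) = map_mat qconj (- char_matrix A (of_int t)) $$ (i, j)"
        unfolding 2 by simp
    qed (use A in \<open>auto simp: char_matrix_def\<close>)
    then have "poly (char_poly ?A) (of_int t) = qconj (poly (char_poly A) (of_int t))"
      unfolding char_poly_matrix[OF A'] char_poly_matrix[OF A]
      using det_qconj[of "- char_matrix A (of_int t)" m] A ent by simp
    moreover have "poly (char_poly A) (of_int t) = of_int (poly p t)" unfolding p by simp
    ultimately show ?thesis using K_of_int(2)[of "poly p t"] by simp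
  qed
  then have "range of_int \<subseteq> {z. poly (char_poly ?A - char_poly A) z = 0}" by auto
  moreover have "infinite (range (of_int :: int \<Rightarrow> complex))"
    by (metis finite_imageD infinite_UNIV_int inj_on_def of_int_eq_iff)
  ultimately have "infinite {z. poly (char_poly ?A - char_poly A) z = 0}" using finite_subset by blast
  then have "char_poly ?A - char_poly A = 0" using poly_roots_finite by blast
  then show ?thesis by simp
qed

end

subsection \<open>Pairs of conjugate weights involving the golden ratio\<close>

text \<open>\<open>phi_sq\<close> and \<open>psi_sq\<close> are the squares of the golden ratio and
  of its conjugate.\<close>

definition phi_sq :: real where "phi_sq = (3 + sqrt 5) / 2"
definition psi_sq :: real where "psi_sq = (3 - sqrt 5) / 2"

lemma phi_psi: "phi_sq + psi_sq = 3" "phi_sq * psi_sq = 1" "phi_sq > 5 / 2" "psi_sq > 1 / 3" "psi_sq < 2 / 5" "phi_sq < 3" "sqrt phi_sq = phi_sq - 1"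
proof -
  have s: "sqrt 5 > 2.2" "sqrt 5 < 2.25"
    using real_less_rsqrt[of "2.2" 5] real_less_lsqrt[of "2.25" 5] by (simp_all add: power2_eq_square)
  have 5: "sqrt 5 * sqrt 5 = 5" by simp
  show "phi_sq + psi_sq = 3" by (simp add: phi_sq_def psi_sq_def field_simps)
  show "phi_sq * psi_sq = 1" using 5 by (simp add: phi_sq_def psi_sq_def field_simps)
  show phi_sq: "phi_sq > 5 / 2" "psi_sq > 1 / 3" "psi_sq < 2 / 5" "phi_sq < 3" using s by (simp_all add: phi_sq_def psi_sq_def)
  have "(phi_sq - 1)\<^sup>2 = phi_sq" using 5 by (simp add: phi_sq_def field_simps power2_eq_square)
  then show "sqrt phi_sq = phi_sq - 1" using phi_sq by (intro real_sqrt_unique) auto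
qed

lemma cmod_add_ge: "(cmod (p + q))\<^sup>2 \<ge> (cmod p - cmod q)\<^sup>2"
  using norm_triangle_ineq3[of p "- q"] by (simp add: abs_le_square_iff[symmetric])

lemma square_1: "(cmod z)\<^sup>2 = 1 \<Longrightarrow> cmod z = 1"
  using norm_ge_zero[of z] unfolding power2_eq_1_iff by linarith

text \<open>\<open>b\<close> is going to be the Galois conjugate of \<open>a\<close>, but only
  moduli of entries are related here. The setting is symmetric (\<open>swap\<close>), so it is
  enough to exclude weights that are big in \<open>a\<close>.\<close>

locale phi_pair = A: small_span_weights n a + B: small_span_weights n b
  for n :: nat and a b :: "nat \<Rightarrow> nat \<Rightarrow> complex" +
  assumes entry: "\<And>i j. i < n \<Longrightarrow> j < n \<Longrightarrow>
      ((cmod (a i j))\<^sup>2 = (cmod (b i j))\<^sup>2 \<and> (cmod (a i j))\<^sup>2 \<in> \<nat>) \<or>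
      ((cmod (a i j))\<^sup>2 = phi_sq \<and> (cmod (b i j))\<^sup>2 = psi_sq) \<or> ((cmod (a i j))\<^sup>2 = psi_sq \<and> (cmod (b i j))\<^sup>2 = phi_sq)"
begin

lemma swap: "phi_pair n b a"
proof -
  have "phi_pair_axioms n b a" unfolding phi_pair_axioms_def using entry by metis
  then show ?thesis unfolding phi_pair_def using A.small_span_weights_axioms B.small_span_weights_axioms by blast
qed

definition big :: "nat \<Rightarrow> nat \<Rightarrow> bool" where
  "big i j \<longleftrightarrow> (cmod (a i j))\<^sup>2 = phi_sq \<and> (cmod (b i j))\<^sup>2 = psi_sq"

definition small :: "nat \<Rightarrow> nat \<Rightarrow> bool" where
  "small i j \<longleftrightarrow> (cmod (a i j))\<^sup>2 = psi_sq \<and> (cmod (b i j))\<^sup>2 = phi_sq"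

lemma zero_iff: "i < n \<Longrightarrow> j < n \<Longrightarrow> b i j = 0 \<longleftrightarrow> a i j = 0"
proof -
  assume ij: "i < n" "j < n"
  have pos: "phi_sq > 0" "psi_sq > 0" using phi_psi by linarith+
  from entry[OF ij] have "(cmod (b i j))\<^sup>2 = 0 \<longleftrightarrow> (cmod (a i j))\<^sup>2 = 0"
    by (elim disjE conjE) (use pos in simp_all)
  then show "b i j = 0 \<longleftrightarrow> a i j = 0" by simp
qed

lemma type_cases:
  assumes "i < n" "j < n" "a i j \<noteq> 0"
  obtains "big i j" | "small i j" | "(cmod (a i j))\<^sup>2 \<ge> 1" "(cmod (b i j))\<^sup>2 = (cmod (a i j))\<^sup>2"
proof -
  have "(cmod (a i j))\<^sup>2 \<ge> 1" if N: "(cmod (a i j))\<^sup>2 \<in> \<nat>"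
  proof -
    obtain k where k: "(cmod (a i j))\<^sup>2 = real k" using N by (auto elim: Nats_cases)
    have "real k \<noteq> 0" unfolding k[symmetric] using assms(3) by simp
    then show ?thesis using k by simp
  qed
  then show ?thesis using entry[OF assms(1,2)] that unfolding big_def small_def by metis
qed

lemma norm_ge_f: assumes "i < n" "j < n" "a i j \<noteq> 0" shows "(cmod (a i j))\<^sup>2 \<ge> psi_sq"
  by (rule type_cases[OF assms]) (use phi_psi in \<open>auto simp: big_def small_def\<close>)

lemma big_sym: "i < n \<Longrightarrow> j < n \<Longrightarrow> big i j \<Longrightarrow> big j i"
  using A.cmod_sym[of i j] B.cmod_sym[of i j] by (simp add: big_def)

lemma small_sym: "i < n \<Longrightarrow> j < n \<Longrightarrow> small i j \<Longrightarrow> small j i"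
  using A.cmod_sym[of i j] B.cmod_sym[of i j] by (simp add: small_def)

lemma big_nz: "big i j \<Longrightarrow> a i j \<noteq> 0" and small_nz: "small i j \<Longrightarrow> a i j \<noteq> 0"
  using phi_psi by (auto simp: big_def small_def)

lemma deg3_bound:
  assumes "v < n" "x < n" "y < n" "z < n" "distinct [x, y, z]"
  shows "(cmod (a x v))\<^sup>2 + (cmod (a y v))\<^sup>2 + (cmod (a z v))\<^sup>2 < 4"
    "(cmod (b x v))\<^sup>2 + (cmod (b y v))\<^sup>2 + (cmod (b z v))\<^sup>2 < 4"
  using A.deg_ge[of "{x, y, z}" v] A.deg_less_4[of v] B.deg_ge[of "{x, y, z}" v] B.deg_less_4[of v] assms by auto

lemma deg2_bound:
  assumes "v < n" "x < n" "y < n" "x \<noteq> y"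
  shows "(cmod (a x v))\<^sup>2 + (cmod (a y v))\<^sup>2 \<le> A.deg v" "(cmod (b x v))\<^sup>2 + (cmod (b y v))\<^sup>2 \<le> B.deg v"
  using A.deg_ge[of "{x, y}" v] B.deg_ge[of "{x, y}" v] assms by auto

text \<open>There is no slack: \<open>phi_sq + psi_sq + 1 = 4\<close>. A third weight could fit into
  \<open>a\<close> only if both others are small, and then they are big in \<open>b\<close>, where
  two such weights already exceed 4.\<close>

lemma big_full:
  assumes V: "v < n" "x < n" "y < n" "x \<noteq> y" and x: "big x v" and y: "a y v \<noteq> 0"
    and z: "z < n" "z \<notin> {x, y}"
  shows "a z v = 0"
proof (rule ccontr)
  assume "a z v \<noteq> 0"
  have d: "(cmod (a x v))\<^sup>2 + (cmod (a y v))\<^sup>2 + (cmod (a z v))\<^sup>2 < 4"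
    "(cmod (b x v))\<^sup>2 + (cmod (b y v))\<^sup>2 + (cmod (b z v))\<^sup>2 < 4"
    using deg3_bound[of v x y z] V z by auto
  show False
    by (rule type_cases[OF V(3) V(1) y]; rule type_cases[OF z(1) V(1) \<open>a z v \<noteq> 0\<close>])
      (use d x phi_psi in \<open>auto simp: big_def small_def\<close>)
qed

lemma small_full:
  assumes "v < n" "x < n" "y < n" "x \<noteq> y" and x: "small x v" and y: "a y v \<noteq> 0"
    and z: "z < n" "z \<notin> {x, y}"
  shows "a z v = 0"
  using phi_pair.big_full[OF swap, of v x y z] assms zero_iff[of y v] zero_iff[of z v]
  unfolding phi_pair.big_def[OF swap] small_def by auto

lemma full:
  assumes "v < n" "x < n" "y < n" "x \<noteq> y" and x: "big x v \<or> small x v" and y: "a y v \<noteq> 0"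
    and z: "z < n" "z \<notin> {x, y}"
  shows "a z v = 0" "a v z = 0"
  using big_full[OF assms(1-4) _ y z] small_full[OF assms(1-4) _ y z] x A.zero_sym[of v z] assms by auto

lemma big_second:
  assumes V: "v < n" "x < n" "y < n" "x \<noteq> y" and x: "big x v" and y: "a y v \<noteq> 0"
  shows "small y v \<or> ((cmod (a y v))\<^sup>2 = 1 \<and> (cmod (b y v))\<^sup>2 = 1)"
proof -
  have d: "(cmod (a x v))\<^sup>2 + (cmod (a y v))\<^sup>2 < 4"
    using deg2_bound[of v x y] A.deg_less_4[of v] V by auto
  show ?thesis
  proof (rule type_cases[OF V(3) V(1) y])
    assume "(cmod (a y v))\<^sup>2 \<ge> 1" and b: "(cmod (b y v))\<^sup>2 = (cmod (a y v))\<^sup>2"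
    moreover have "(cmod (a y v))\<^sup>2 \<noteq> phi_sq" using d x phi_psi by (auto simp: big_def)
    moreover have "(cmod (a y v))\<^sup>2 \<noteq> psi_sq" using \<open>(cmod (a y v))\<^sup>2 \<ge> 1\<close> phi_psi by auto
    ultimately have "(cmod (a y v))\<^sup>2 \<in> \<nat>" using entry[OF V(3) V(1)] by blast
    then obtain k where k: "(cmod (a y v))\<^sup>2 = real k" by (auto elim: Nats_cases)
    have "real k < 2" using d x phi_psi k by (auto simp: big_def)
    then have "k = 1" using k \<open>(cmod (a y v))\<^sup>2 \<ge> 1\<close> by auto
    then show ?thesis using k b by simp
  qed (use d x phi_psi in \<open>auto simp: big_def\<close>)
qed

lemma small_second:
  assumes "v < n" "x < n" "y < n" "x \<noteq> y" and x: "small x v" and y: "a y v \<noteq> 0"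
  shows "big y v \<or> ((cmod (a y v))\<^sup>2 = 1 \<and> (cmod (b y v))\<^sup>2 = 1)"
  using phi_pair.big_second[OF swap, of v x y] assms zero_iff[of y v]
  unfolding phi_pair.big_def[OF swap] phi_pair.small_def[OF swap] small_def big_def by auto

text \<open>By \<open>full\<close> a golden weight occurs only at a vertex with at most two nonzero
  weights.\<close>

lemma three_units:
  assumes V: "v < n" "x < n" "y < n" "z < n" "distinct [x, y, z]"
    and nz: "a x v \<noteq> 0" "a y v \<noteq> 0" "a z v \<noteq> 0"
  shows "(cmod (a x v))\<^sup>2 \<ge> 1" "(cmod (a y v))\<^sup>2 \<ge> 1" "(cmod (a z v))\<^sup>2 \<ge> 1" "A.deg v \<ge> 3"
    "(cmod (a x v))\<^sup>2 < 2"
proof -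
  have ne: "x \<noteq> y" "y \<noteq> x" "z \<noteq> x" "z \<notin> {x, y}" "z \<notin> {y, x}" "y \<notin> {z, x}" using V(5) by auto
  have no: "\<not> (big x v \<or> small x v)" "\<not> (big y v \<or> small y v)" "\<not> (big z v \<or> small z v)"
    using full(1)[OF V(1,2,3) ne(1) _ nz(2) V(4) ne(4)] full(1)[OF V(1,3,2) ne(2) _ nz(1) V(4) ne(5)]
      full(1)[OF V(1,4,2) ne(3) _ nz(1) V(3) ne(6)] nz(2,3) by blast+
  show 1: "(cmod (a x v))\<^sup>2 \<ge> 1" "(cmod (a y v))\<^sup>2 \<ge> 1" "(cmod (a z v))\<^sup>2 \<ge> 1"
    subgoal by (rule type_cases[OF V(2) V(1) nz(1)]) (use no in blast)+
    subgoal by (rule type_cases[OF V(3) V(1) nz(2)]) (use no in blast)+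
    subgoal by (rule type_cases[OF V(4) V(1) nz(3)]) (use no in blast)+
    done
  then show "A.deg v \<ge> 3" using A.deg_ge[of "{x, y, z}" v] V by auto
  show "(cmod (a x v))\<^sup>2 < 2" using deg3_bound(1)[OF V(1-5)] 1 by linarith
qed

lemma unit_of_three:
  assumes V: "v < n" "x < n" "y < n" "z < n" "distinct [x, y, z]"
    and nz: "a x v \<noteq> 0" "a y v \<noteq> 0" "a z v \<noteq> 0"
  shows "cmod (a x v) = 1"
proof -
  note t = three_units[OF V nz]
  have "(cmod (a x v))\<^sup>2 \<noteq> phi_sq" "(cmod (a x v))\<^sup>2 \<noteq> psi_sq" using t phi_psi by auto
  then have "(cmod (a x v))\<^sup>2 \<in> \<nat>" using entry[OF V(2) V(1)] by blast
  then obtain k where k: "(cmod (a x v))\<^sup>2 = real k" by (auto elim: Nats_cases)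
  then have "k = 1" using t by auto
  then have "(cmod (a x v))\<^sup>2 = 1" using k by simp
  then show ?thesis using norm_ge_zero[of "a x v"] unfolding power2_eq_1_iff by linarith
qed

lemma big_cmod: "big i j \<Longrightarrow> cmod (a i j) = phi_sq - 1"
  using phi_psi(7) by (metis big_def norm_ge_zero real_sqrt_abs abs_of_nonneg)

text \<open>With \<open>phi\<close> the golden ratio, \<open>phi^2 - 2 = phi - 1 = 1 / phi\<close>:
  the least modulus that a sum of numbers of moduli \<open>phi\<close> and 1 can have.\<close>

lemma phi_sq_minus_2: "(phi_sq - 2)\<^sup>2 = psi_sq"
proof -
  have "phi_sq * phi_sq = 3 * phi_sq - 1" using phi_psi by (metis (no_types, opaque_lifting) add_diff_cancel_left' distrib_left mult.commute mult.right_neutral diff_eq_eq eq_diff_eq)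
  moreover have "(phi_sq - 2)\<^sup>2 = phi_sq * phi_sq - 4 * phi_sq + 4" by (simp add: power2_eq_square algebra_simps)
  moreover have "psi_sq = 3 - phi_sq" using phi_psi(1) by linarith
  ultimately show ?thesis by linarith
qed

text \<open>A neighbour \<open>u\<close> of \<open>p\<close> leads on to some \<open>w\<close>. If
  \<open>u p\<close> is small, the walk from \<open>u\<close> to \<open>p\<close> has norm 1 in
  \<open>b\<close>, between vertices of degree at least 3 there. If it is a unit, the walk sum has
  norm \<open>phi_sq\<close> for uncharged \<open>u\<close> and at least \<open>psi_sq\<close> for
  charged \<open>u\<close>, against bounds \<open>4 * psi_sq\<close> and
  \<open>psi_sq\<close>.\<close>

lemma no_big_charge:
  assumes p: "p < n" and big: "big p p" shows False
proof -
  obtain u where u: "u < n" "u \<noteq> p" "a u p \<noteq> 0" using A.neighbour_exists[OF p] .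
  note fp = full[OF p p u(1) u(2)[symmetric] disjI1[OF big] u(3)]
  have pu: "a p u \<noteq> 0" using A.zero_sym p u by auto
  obtain s w where sw: "s \<in> set [p, u]" "w < n" "w \<notin> set [p, u]" "a s w \<noteq> 0"
    using A.closed_large[of "[p, u]"] p u by auto
  have s: "s = u" using sw fp(2)[of w] by auto
  have wu: "a w u \<noteq> 0" using A.zero_sym sw s u by auto
  have bpu: "b p u \<noteq> 0" "b w u \<noteq> 0" "b w p = 0" using zero_iff pu wu fp(1)[of w] p u sw by auto
  have sA: "A.paths2 u p = a u p * a p p + a u u * a u p"
    using A.paths2_supp[of "{p, u}" u p] fp p u by auto
  have kA: "(cmod (A.paths2 u p))\<^sup>2 < (4 - A.deg u) * (4 - A.deg p)"
    by (rule A.paths2_bound) (use p u sw wu fp(1)[of w] in auto)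
  from big_second[OF p p u(1) u(2)[symmetric] big u(3)] show False
  proof
    assume sm: "small u p"
    have uu: "a u u = 0" "b u u = 0"
      using full[of u p w u] small_sym[OF u(1) p sm] p u sw wu zero_iff[of u u] by auto
    have sB: "B.paths2 u p = b u p * b p p"
      using B.paths2_supp[of "{p, u}" u p] fp p u uu zero_iff by auto
    have kB: "(cmod (B.paths2 u p))\<^sup>2 < (4 - B.deg u) * (4 - B.deg p)"
      by (rule B.paths2_bound) (use p u sw bpu in auto)
    have "(cmod (B.paths2 u p))\<^sup>2 = 1"
      unfolding sB using sm big phi_psi by (simp add: norm_mult power_mult_distrib small_def big_def)
    moreover have "B.deg p \<ge> 3" using deg2_bound(2)[OF p p u(1)] u sm big phi_psi by (auto simp: small_def big_def)
    moreover have "B.deg u \<ge> 3"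
    proof -
      have "(cmod (b w u))\<^sup>2 \<ge> psi_sq"
        using phi_pair.norm_ge_f[OF swap, of w u] bpu sw u by auto
      moreover have "(cmod (b p u))\<^sup>2 = phi_sq" using small_sym[OF u(1) p sm] by (simp add: small_def)
      ultimately show ?thesis using deg2_bound(2)[OF u(1) p, of w] sw phi_psi by auto
    qed
    moreover have "(4 - B.deg u) * (4 - B.deg p) \<le> 1 * 1"
      using B.deg_less_4[OF p] B.deg_less_4[OF u(1)] calculation by (intro mult_mono) auto
    ultimately show False using kB by simp
  next
    assume un: "(cmod (a u p))\<^sup>2 = 1 \<and> (cmod (b u p))\<^sup>2 = 1"
    have dp: "4 - A.deg p \<le> psi_sq" using deg2_bound(1)[OF p p u(1)] u un big phi_psi by (auto simp: big_def)
    show False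
    proof (cases "a u u = 0")
      case True
      then have "(cmod (A.paths2 u p))\<^sup>2 = phi_sq" unfolding sA using un big by (simp add: norm_mult power_mult_distrib big_def)
      moreover have "(4 - A.deg u) * (4 - A.deg p) \<le> 4 * psi_sq"
        using dp A.deg_less_4[OF p] A.deg_less_4[OF u(1)] A.entry_le_deg[of p u] p
        by (intro mult_mono) (auto intro: order_trans[OF zero_le_power2])
      ultimately show False using kA phi_psi by linarith
    next
      case False
      have cu: "cmod (a u u) = 1" using unit_of_three[of u u p w] False pu wu p u sw by auto
      have du: "A.deg u \<ge> 3" using three_units(4)[of u u p w] False pu wu p u sw by auto
      have "A.paths2 u p = a u p * (a p p + a u u)" unfolding sA by (simp add: algebra_simps)
      then have "(cmod (A.paths2 u p))\<^sup>2 = (cmod (a p p + a u u))\<^sup>2" using un by (simp add: norm_mult power_mult_distrib)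
      also have "\<dots> \<ge> (phi_sq - 1 - 1)\<^sup>2" using cmod_add_ge[of "a p p" "a u u"] big_cmod[OF big] cu by simp
      finally have "(cmod (A.paths2 u p))\<^sup>2 \<ge> psi_sq" using phi_sq_minus_2 by simp
      moreover have "(4 - A.deg u) * (4 - A.deg p) \<le> 1 * psi_sq"
        using dp du A.deg_less_4[OF p] A.deg_less_4[OF u(1)] by (intro mult_mono) auto
      ultimately show False using kA by linarith
    qed
  qed
qed

lemma bounds_mult:
  assumes "u < n" "w < n" "4 - A.deg u \<le> x" "4 - A.deg w \<le> y"
  shows "(4 - A.deg u) * (4 - A.deg w) \<le> x * y"
  using A.deg_less_4[OF assms(1)] A.deg_less_4[OF assms(2)] assms by (intro mult_mono) auto

lemma deg_nonneg: "4 - A.deg v \<le> 4"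
  unfolding A.deg_def by (simp add: sum_nonneg)

text \<open>Golden charges being excluded, the charge is a unit. The walk from \<open>q\<close> to
  \<open>p\<close> through it has norm \<open>phi_sq\<close>, above the bound
  \<open>4 * psi_sq\<close>.\<close>

lemma no_charge_big_edge:
  assumes V: "p < n" "q < n" "p \<noteq> q" and big: "big q p" and ch: "a p p \<noteq> 0"
  shows False
proof -
  have qp: "a q p \<noteq> 0" "a p q \<noteq> 0" "big p q" using big_nz[OF big] A.zero_sym V big_sym[OF V(2,1) big] by auto
  note fp = full[OF V(1,2,1) V(3)[symmetric] disjI1[OF big] ch]
  obtain s w where sw: "s \<in> set [p, q]" "w < n" "w \<notin> set [p, q]" "a s w \<noteq> 0"
    using A.closed_large[of "[p, q]"] V by auto
  have s: "s = q" using sw fp(2)[of w] by auto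
  have wq: "a w q \<noteq> 0" using A.zero_sym sw s V by auto
  have qq: "a q q = 0" using full[of q p w q] qp V sw wq by auto
  have sA: "A.paths2 q p = a q p * a p p"
    using A.paths2_supp[of "{p, q}" q p] fp V qq by auto
  have kA: "(cmod (A.paths2 q p))\<^sup>2 < (4 - A.deg q) * (4 - A.deg p)"
    by (rule A.paths2_bound) (use V sw wq fp(1)[of w] in auto)
  have "\<not> small p p" using phi_pair.no_big_charge[OF swap V(1)] unfolding phi_pair.big_def[OF swap] small_def by auto
  then have pp: "(cmod (a p p))\<^sup>2 = 1" using big_second[of p q p] V big ch by auto
  then have "4 - A.deg p \<le> psi_sq" using deg2_bound(1)[of p q p] V big phi_psi by (auto simp: big_def)
  then have "(4 - A.deg q) * (4 - A.deg p) \<le> 4 * psi_sq" using bounds_mult[of q p 4 psi_sq] deg_nonneg V by auto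
  moreover have "(cmod (A.paths2 q p))\<^sup>2 = phi_sq" unfolding sA using pp big by (simp add: norm_mult power_mult_distrib big_def)
  ultimately show False using kA phi_psi by linarith
qed

lemma no_charge_phi_edge:
  assumes V: "p < n" "q < n" "p \<noteq> q" and e: "big q p \<or> small q p" shows "a p p = 0"
  using no_charge_big_edge[OF V] phi_pair.no_charge_big_edge[OF swap V] e zero_iff[of p p] V
  unfolding phi_pair.big_def[OF swap] small_def by auto

text \<open>If \<open>u\<close> and \<open>v\<close> are not adjacent, the bound for
  \<open>q\<close> and \<open>u\<close> makes \<open>u\<close> a leaf, so the graph continues from
  \<open>v\<close> to some \<open>t\<close>. A big \<open>t v\<close> violates the bound for
  \<open>p\<close> and \<open>v\<close> in \<open>a\<close>; a unit makes \<open>t\<close> a leaf by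
  the bound for \<open>q\<close> and \<open>t\<close> in \<open>b\<close>, and the graph would have
  only five vertices.\<close>

lemma big_edge_unit_small:
  assumes V: "p < n" "q < n" "p \<noteq> q" "u < n" "v < n" and big: "big q p"
    and u: "u \<noteq> q" "(cmod (a u p))\<^sup>2 = 1" and v: "v \<noteq> p" "small v q" and uv: "u \<noteq> v"
  shows False
proof -
  have big': "big p q" using big_sym[OF V(2,1) big] .
  have sq: "small q v" using small_sym[OF V(5,2) v(2)] .
  have nz: "a u p \<noteq> 0" "a v q \<noteq> 0" "a q v \<noteq> 0" "a p u \<noteq> 0"
    using u small_nz[OF v(2)] small_nz[OF sq] A.zero_sym[of u p] V by auto
  have ch: "a p p = 0" "a q q = 0" using no_charge_phi_edge[of p q] no_charge_phi_edge[of q p] V big big' by auto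
  have up: "u \<noteq> p" and vq: "v \<noteq> q" using nz ch by auto
  note fp = full[OF V(1,2,4) u(1)[symmetric] disjI1[OF big] nz(1)]
  note fq = full[OF V(2,1,5) v(1)[symmetric] disjI1[OF big'] nz(2)]
  have z0: "a p v = 0" "a q u = 0" using fp[of v] fq[of u] V u v up vq uv by auto
  have dp: "4 - A.deg p \<le> psi_sq" using deg2_bound(1)[of p q u] V big u phi_psi by (auto simp: big_def)
  have dq: "4 - A.deg q \<le> 1" "4 - B.deg q \<le> 1"
    using deg2_bound[of q p v] V big' v phi_psi by (auto simp: big_def small_def)
  have squ: "A.paths2 q u = a q p * a p u + a q v * a v u"
    using A.paths2_supp[of "{p, v}" q u] fq V v by auto
  have kqu: "(cmod (A.paths2 q u))\<^sup>2 < (4 - A.deg q) * (4 - A.deg u)"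
    by (rule A.paths2_bound) (use V u z0 in auto)
  have kqu': "(4 - A.deg q) * (4 - A.deg u) \<le> 1 * (4 - A.deg u)"
    using bounds_mult[of q u 1 "4 - A.deg u"] dq V by auto
  have symn: "cmod (a p u) = cmod (a u p)" "cmod (a p u) = 1" using A.cmod_sym V u square_1 by auto
  obtain s t where st: "s \<in> set [u, p, q, v]" "t < n" "t \<notin> set [u, p, q, v]" "a s t \<noteq> 0"
    using A.closed_large[of "[u, p, q, v]"] V by auto
  have suv: "s = u \<or> s = v" using st fp(2)[of t] fq(2)[of t] by auto
  have ts: "a t s \<noteq> 0" using A.zero_sym[of t s] st V by auto
  show False
  proof (cases "a u v = 0")
    case True
    then have vu: "a v u = 0" using A.zero_sym V by auto
    have "(cmod (A.paths2 q u))\<^sup>2 = phi_sq"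
      unfolding squ using vu big symn by (simp add: norm_mult power_mult_distrib big_def)
    then have "phi_sq < 1 * (4 - A.deg u)" using less_le_trans[OF kqu kqu'] by (simp only:)
  then have du: "A.deg u < 1 + psi_sq" using phi_psi by simp
    have pu: "(cmod (a p u))\<^sup>2 = 1" using symn by simp
    have u_only: "a y u = 0" "a u y = 0" if "y < n" "y \<noteq> p" for y
    proof -
      show "a y u = 0"
      proof (rule ccontr)
        assume "a y u \<noteq> 0"
        then show False using norm_ge_f[of y u] deg2_bound(1)[of u p y] du pu that V by auto
      qed
      then show "a u y = 0" using A.zero_sym that V by auto
    qed
    have sv: "s = v" using suv st u_only(2)[of t] by auto
    have tv: "a t v \<noteq> 0" using ts sv by simp
    have fv: "a z v = 0" "a v z = 0" if "z < n" "z \<notin> {q, t}" for z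
      using full[of v q t z] sq V st tv vq that by auto
    from small_second[of v q t] sq tv V st vq have "big t v \<or> (cmod (a t v))\<^sup>2 = 1 \<and> (cmod (b t v))\<^sup>2 = 1" by auto
    then show False
    proof
      assume bt: "big t v"
      have s: "A.paths2 p v = a p q * a q v"
        using A.paths2_supp[of "{q, u}" p v] fp V u True by auto
      have k: "(cmod (A.paths2 p v))\<^sup>2 < (4 - A.deg p) * (4 - A.deg v)"
        by (rule A.paths2_bound) (use V v z0 in auto)
      have "(cmod (A.paths2 p v))\<^sup>2 = 1"
        unfolding s using big' sq phi_psi by (simp add: norm_mult power_mult_distrib big_def small_def)
      moreover have "4 - A.deg v \<le> 1" using deg2_bound(1)[of v q t] V st sq bt phi_psi by (auto simp: big_def small_def)
      then have "(4 - A.deg p) * (4 - A.deg v) \<le> psi_sq * 1" using bounds_mult[of p v psi_sq 1] dp V by auto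
      ultimately show False using k phi_psi by linarith
    next
      assume ut: "(cmod (a t v))\<^sup>2 = 1 \<and> (cmod (b t v))\<^sup>2 = 1"
      have bz: "b q x = 0" if "x < n" "x \<notin> {p, v}" for x using fq(2)[OF that] zero_iff[of q x] that V by auto
      have bp: "b p t = 0" using fp(2)[of t] zero_iff[of p t] st V by auto
      have s: "B.paths2 q t = b q v * b v t"
        using B.paths2_supp[of "{p, v}" q t] bz bp V v by auto
      have k: "(cmod (B.paths2 q t))\<^sup>2 < (4 - B.deg q) * (4 - B.deg t)"
        by (rule B.paths2_bound) (use V st bz[of t] in auto)
      have vt: "(cmod (b v t))\<^sup>2 = 1" using ut B.cmod_sym[of t v] st V by simp
      have "(cmod (B.paths2 q t))\<^sup>2 = phi_sq"
        unfolding s using vt sq by (simp add: norm_mult power_mult_distrib small_def)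
      moreover have "(4 - B.deg q) * (4 - B.deg t) \<le> 1 * (4 - B.deg t)"
        using phi_pair.bounds_mult[OF swap, of q t 1 "4 - B.deg t"] dq V st by auto
      ultimately have "phi_sq < 1 * (4 - B.deg t)" using less_le_trans[OF k] by (simp only:)
      then have dt: "B.deg t < 1 + psi_sq" using phi_psi by simp
      have t_only: "a t y = 0" if "y < n" "y \<noteq> v" for y
      proof (rule ccontr)
        assume "a t y \<noteq> 0"
        then have "b y t \<noteq> 0" using zero_iff[of y t] A.zero_sym[of y t] st that by auto
        then show False
          using phi_pair.norm_ge_f[OF swap, of y t] deg2_bound(2)[of t v y] dt vt that V st by auto
      qed
      obtain x y where xy: "x \<in> set [u, p, q, v, t]" "y < n" "y \<notin> set [u, p, q, v, t]" "a x y \<noteq> 0"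
        using A.closed_large[of "[u, p, q, v, t]"] V st by auto
      then show False using u_only(2)[of y] fp(2)[of y] fq(2)[of y] fv(2)[of y] t_only[of y] by auto
    qed
  next
    case False
    then have vu: "a v u \<noteq> 0" using A.zero_sym[of v u] V by auto
    have su: "s = u" using suv st full(2)[of v q u t] sq False V vq u by auto
    have e: "cmod (a v u) = 1" using unit_of_three[of u v p t] vu nz ts st su V uv v by auto
    have du: "4 - A.deg u \<le> 1" using three_units(4)[of u v p t] vu nz ts st su V uv v by auto
    \<comment> \<open>The two walks from \<open>q\<close> to \<open>u\<close> have moduli
      \<open>x\<close> and \<open>y\<close>, the golden ratio and its inverse. These differ by
      exactly 1, and the bound is 1 as well.\<close>
    define x where "x = cmod (a q p)"
    define y where "y = cmod (a q v)"
    have xy: "x\<^sup>2 = phi_sq" "y\<^sup>2 = psi_sq" "x \<ge> 0" "y \<ge> 0" using big sq by (auto simp: x_def y_def big_def small_def)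
    have "(x * y)\<^sup>2 = 1" unfolding power_mult_distrib xy using phi_psi by simp
    then have "x * y = 1" using xy by (metis mult_nonneg_nonneg power2_eq_1_iff not_one_le_zero neg_0_le_iff_le)
    then have "(x - y)\<^sup>2 = 1" unfolding power2_diff xy using phi_psi by simp
    moreover have "(cmod (A.paths2 q u))\<^sup>2 \<ge> (x - y)\<^sup>2"
      unfolding squ using cmod_add_ge[of "a q p * a p u" "a q v * a v u"] symn e by (simp add: norm_mult x_def y_def)
    ultimately show False using less_le_trans[OF kqu kqu'] du by simp
  qed
qed

text \<open>By \<open>big_second\<close> each further weight at \<open>p\<close> and
  \<open>q\<close> is a unit or small. Once \<open>u = v\<close> is excluded, the four combinations
  are settled by walks from an end of the edge to the outer neighbour of the other end; if both
  weights are small, these are walks in \<open>b\<close>.\<close>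

lemma big_edge_inner:
  assumes V: "p < n" "q < n" "p \<noteq> q" "u < n" "v < n" and big: "big q p"
    and u: "u \<noteq> q" "a u p \<noteq> 0" and v: "v \<noteq> p" "a v q \<noteq> 0"
  shows False
proof -
  have big': "big p q" using big_sym[OF V(2,1) big] .
  have nz: "a q p \<noteq> 0" "a p q \<noteq> 0" "a p u \<noteq> 0" "a q v \<noteq> 0"
    using big_nz big big' A.zero_sym V u v by auto
  have ch: "a p p = 0" "a q q = 0" using no_charge_phi_edge[of p q] no_charge_phi_edge[of q p] V big big' by auto
  have up: "u \<noteq> p" and vq: "v \<noteq> q" using u v ch by auto
  note fp = full[OF V(1,2,4) u(1)[symmetric] disjI1[OF big] u(2)]
  note fq = full[OF V(2,1,5) v(1)[symmetric] disjI1[OF big'] v(2)]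
  have tu: "small u p \<or> ((cmod (a u p))\<^sup>2 = 1 \<and> (cmod (b u p))\<^sup>2 = 1)"
    using big_second[of p q u] V big u by auto
  have tv: "small v q \<or> ((cmod (a v q))\<^sup>2 = 1 \<and> (cmod (b v q))\<^sup>2 = 1)"
    using big_second[of q p v] V big' v by auto
  have dp_unit: "4 - A.deg p \<le> psi_sq" if "(cmod (a u p))\<^sup>2 = 1"
    using deg2_bound(1)[of p q u] V big u that phi_psi by (auto simp: big_def)
  have dq_unit: "4 - A.deg q \<le> psi_sq" if "(cmod (a v q))\<^sup>2 = 1"
    using deg2_bound(1)[of q p v] V big' v that phi_psi by (auto simp: big_def)
  have dp_small: "4 - A.deg p \<le> 1" if "small u p"
    using deg2_bound(1)[of p q u] V big u that phi_psi by (auto simp: big_def small_def)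
  have dq_small: "4 - A.deg q \<le> 1" if "small v q"
    using deg2_bound(1)[of q p v] V big' v that phi_psi by (auto simp: big_def small_def)
  have uv: "u \<noteq> v"
  proof
    assume eq: "u = v"
    have s: "A.paths2 p q = a p u * a u q"
      using A.paths2_supp[of "{p, q, u}" p q] fp V ch up vq eq u v by auto
    have k: "(cmod (A.paths2 p q))\<^sup>2 < (4 - A.deg p) * (4 - A.deg q)"
      by (rule A.paths2_bound) (use V ch in auto)
    have n: "(cmod (A.paths2 p q))\<^sup>2 = (cmod (a u p))\<^sup>2 * (cmod (a v q))\<^sup>2"
      unfolding s using A.cmod_sym[of u p] V eq by (simp add: norm_mult power_mult_distrib)
    show False
    proof (cases "small u p \<and> small v q")
      case True
      then have "(cmod (b p u))\<^sup>2 = phi_sq" "(cmod (b q u))\<^sup>2 = phi_sq"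
        using small_sym[OF V(4,1)] small_sym[OF V(5,2)] eq unfolding small_def by auto
      then show False using deg2_bound(2)[of u p q] B.deg_less_4[of u] V phi_psi by auto
    next
      case False
      then consider "(cmod (a u p))\<^sup>2 = 1" "(cmod (a v q))\<^sup>2 = 1" | "(cmod (a u p))\<^sup>2 = 1" "small v q" |
        "small u p" "(cmod (a v q))\<^sup>2 = 1" using tu tv by blast
      then show False
      proof cases
        case 1
        have "(4 - A.deg p) * (4 - A.deg q) \<le> psi_sq * psi_sq" using bounds_mult[OF V(1,2)] dp_unit dq_unit 1 by blast
        also have "\<dots> < 1 * 1" using phi_psi by (intro mult_strict_mono) auto
        finally show False using k n 1 by simp
      next
        case 2
        have "(4 - A.deg p) * (4 - A.deg q) \<le> psi_sq * 1" using bounds_mult[OF V(1,2)] dp_unit dq_small 2 by blast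
        then show False using k n 2 by (simp add: small_def)
      next
        case 3
        have "(4 - A.deg p) * (4 - A.deg q) \<le> 1 * psi_sq" using bounds_mult[OF V(1,2)] dp_small dq_unit 3 by blast
        then show False using k n 3 by (simp add: small_def)
      qed
    qed
  qed
  have z0: "a p v = 0" "a v p = 0" "a q u = 0" "a u q = 0" using fp[of v] fq[of u] V u v up vq uv by auto
  have spv: "A.paths2 p v = a p q * a q v + a p u * a u v"
    using A.paths2_supp[of "{q, u}" p v] fp V u by auto
  have kpv: "(cmod (A.paths2 p v))\<^sup>2 < (4 - A.deg p) * (4 - A.deg v)"
    by (rule A.paths2_bound) (use V v z0 in auto)
  have squ: "A.paths2 q u = a q p * a p u + a q v * a v u"
    using A.paths2_supp[of "{p, v}" q u] fq V v by auto
  have kqu: "(cmod (A.paths2 q u))\<^sup>2 < (4 - A.deg q) * (4 - A.deg u)"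
    by (rule A.paths2_bound) (use V u z0 in auto)
  have c: "cmod (a p q) = phi_sq - 1" "cmod (a q p) = phi_sq - 1" using big_cmod big big' by auto
  have symn: "cmod (a q v) = cmod (a v q)" "cmod (a p u) = cmod (a u p)" "cmod (a u v) = cmod (a v u)"
    using A.cmod_sym V by auto
  obtain s t where st: "s \<in> set [u, p, q, v]" "t < n" "t \<notin> set [u, p, q, v]" "a s t \<noteq> 0"
    using A.closed_large[of "[u, p, q, v]"] V by auto
  have suv: "s = u \<or> s = v" using st fp(2)[of t] fq(2)[of t] by auto
  have ts: "a t s \<noteq> 0" using A.zero_sym[of t s] st V by auto
  consider (UU) "(cmod (a u p))\<^sup>2 = 1" "(cmod (a v q))\<^sup>2 = 1" | (US) "(cmod (a u p))\<^sup>2 = 1" "small v q" |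
    (SU) "small u p" "(cmod (a v q))\<^sup>2 = 1" | (SS) "small u p" "small v q" using tu tv by blast
  then show False
  proof cases
    case UU
    show False
    proof (cases "a u v = 0")
      case True
      then have "(cmod (A.paths2 p v))\<^sup>2 = phi_sq"
        unfolding spv using UU big' symn by (simp add: norm_mult power_mult_distrib big_def)
      moreover have "(4 - A.deg p) * (4 - A.deg v) \<le> psi_sq * 4" using bounds_mult[of p v psi_sq 4] dp_unit UU deg_nonneg V by auto
      ultimately show False using kpv phi_psi by linarith
    next
      case False
      then have vu: "a v u \<noteq> 0" using A.zero_sym[of v u] V by auto
      have u1: "cmod (a u p) = 1" "cmod (a v q) = 1" using UU square_1 by auto
      from suv show False
      proof
        assume sv: "s = v"
        have e: "cmod (a u v) = 1" using unit_of_three[of v u q t] False nz ts st sv V uv u by auto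
        have dv: "A.deg v \<ge> 3" using three_units(4)[of v u q t] False nz ts st sv V uv u by auto
        have "(cmod (A.paths2 p v))\<^sup>2 \<ge> (phi_sq - 1 - 1)\<^sup>2"
          unfolding spv using cmod_add_ge[of "a p q * a q v" "a p u * a u v"] c symn u1 e by (simp add: norm_mult)
        moreover have "(4 - A.deg p) * (4 - A.deg v) \<le> psi_sq * 1" using bounds_mult[of p v psi_sq 1] dp_unit UU dv V by auto
        ultimately show False using kpv phi_sq_minus_2 by simp
      next
        assume su: "s = u"
        have e: "cmod (a v u) = 1" using unit_of_three[of u v p t] vu nz ts st su V uv v by auto
        have du: "A.deg u \<ge> 3" using three_units(4)[of u v p t] vu nz ts st su V uv v by auto
        have "(cmod (A.paths2 q u))\<^sup>2 \<ge> (phi_sq - 1 - 1)\<^sup>2"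
          unfolding squ using cmod_add_ge[of "a q p * a p u" "a q v * a v u"] c symn u1 e by (simp add: norm_mult)
        moreover have "(4 - A.deg q) * (4 - A.deg u) \<le> psi_sq * 1" using bounds_mult[of q u psi_sq 1] dq_unit UU du V by auto
        ultimately show False using kqu phi_sq_minus_2 by simp
      qed
    qed
  next
    case US
    then show False
      using big_edge_unit_small[OF V big u(1) _ v(1) _ uv] by blast
  next
    case SU
    then show False
      using big_edge_unit_small[OF V(2,1) V(3)[symmetric] V(5,4) big' v(1) _ u(1) _ uv[symmetric]] by blast
  next
    case SS
    have inner: False if V: "p < n" "q < n" "p \<noteq> q" "u < n" "v < n" and big: "big q p" and sp: "small u p" "small v q"
      and st: "t < n" "t \<notin> {u, p, q, v}" "a t v \<noteq> 0" and ne: "u \<noteq> q" "v \<noteq> p" "u \<noteq> v" "v \<noteq> q" "u \<noteq> p" for p q u v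
    proof -
      have big': "big p q" using big_sym[OF V(2,1) big] .
      have sq: "small q v" using small_sym[OF V(5,2) sp(2)] .
      have fv: "a z v = 0" "a v z = 0" if "z < n" "z \<notin> {q, t}" for z
        using full[of v q t z] sq V st that by auto
      have fp: "a z p = 0" "a p z = 0" if "z < n" "z \<notin> {q, u}" for z
        using full[of p q u z] big small_nz[OF sp(1)] V ne that by auto
      have bz: "b z v = 0" if "z < n" "z \<notin> {q, t}" for z using fv(1)[OF that] zero_iff[of z v] that V by auto
      have bpz: "b p v = 0" using fp(2)[of v] zero_iff[of p v] V ne by auto
      have bpt: "b p t = 0" using fp(2)[of t] zero_iff[of p t] V st by auto
      have s: "B.paths2 p v = b p q * b q v"
        using B.paths2_supp[of "{q}" p v] bz bpt V st by auto
      have k: "(cmod (B.paths2 p v))\<^sup>2 < (4 - B.deg p) * (4 - B.deg v)"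
        by (rule B.paths2_bound) (use V ne bpz in auto)
      have "(cmod (B.paths2 p v))\<^sup>2 = 1"
        unfolding s using big' sq phi_psi by (simp add: norm_mult power_mult_distrib big_def small_def mult.commute)
      moreover have "B.deg p \<ge> 3" using deg2_bound(2)[of p q u] V ne big sp phi_psi by (auto simp: big_def small_def)
      moreover have "B.deg v \<ge> 3"
      proof -
        have "(cmod (b t v))\<^sup>2 \<ge> psi_sq" using phi_pair.norm_ge_f[OF swap, of t v] st V zero_iff[of t v] by auto
        then show ?thesis using deg2_bound(2)[of v q t] V st sq phi_psi by (auto simp: small_def)
      qed
      moreover have "(4 - B.deg p) * (4 - B.deg v) \<le> 1 * 1"
        using B.deg_less_4[OF V(1)] B.deg_less_4[OF V(5)] calculation by (intro mult_mono) auto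
      ultimately show False using k by simp
    qed
    from suv show False
    proof
      assume "s = v"
      then show False using inner[OF V(1-5) big SS] st ts u v uv up vq by auto
    next
      assume "s = u"
      then show False using inner[OF V(2,1) V(3)[symmetric] V(5,4) big' SS(2,1)] st ts u v uv up vq by auto
    qed
  qed
qed

lemma phi_edge_inner:
  assumes V: "p < n" "q < n" "p \<noteq> q" "u < n" "v < n" and e: "big q p \<or> small q p"
    and u: "u \<noteq> q" "a u p \<noteq> 0" and v: "v \<noteq> p" "a v q \<noteq> 0"
  shows False
  using big_edge_inner[OF V _ u v] phi_pair.big_edge_inner[OF swap V] e u v zero_iff[of u p] zero_iff[of v q] V
  unfolding phi_pair.big_def[OF swap] small_def by auto

text \<open>\<open>p\<close> continues by a unit edge to \<open>u\<close>, and the defect at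
  \<open>p\<close> is at most \<open>psi_sq\<close>. This makes every further neighbour
  \<open>w\<close> of \<open>u\<close> a leaf, since \<open>deg w < 1 + psi_sq\<close>, and its
  weight is at least 1. The size of the graph requires three such leaves, too many for
  \<open>deg u < 4\<close>.\<close>

lemma no_big_leaf:
  assumes V: "p < n" "q < n" "p \<noteq> q" and big: "big q p" and leaf: "\<And>y. y < n \<Longrightarrow> y \<noteq> p \<Longrightarrow> a q y = 0"
  shows False
proof -
  obtain s u where su: "s \<in> set [p, q]" "u < n" "u \<notin> set [p, q]" "a s u \<noteq> 0"
    using A.closed_large[of "[p, q]"] V by auto
  then have pu: "a p u \<noteq> 0" "a u p \<noteq> 0" and u: "u < n" "u \<noteq> p" "u \<noteq> q"
    using leaf[of u] A.zero_sym[of u p] V by auto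
  note fp = full[OF V(1,2) u(1) u(3)[symmetric] disjI1[OF big] pu(2)]
  have qp: "a q p \<noteq> 0" using big_nz[OF big] .
  have nophi: "\<not> (big u p \<or> small u p)"
  proof
    assume e: "big u p \<or> small u p"
    have "a u y = 0" if "y < n" "y \<noteq> p" for y
      using phi_edge_inner[of p u q y] e V u qp that A.zero_sym[of u y] by auto
    moreover obtain x y where "x \<in> set [p, q, u]" "y < n" "y \<notin> set [p, q, u]" "a x y \<noteq> 0"
      using A.closed_large[of "[p, q, u]"] V u by auto
    ultimately show False using leaf[of y] fp(2)[of y] by auto
  qed
  then have pu1: "(cmod (a u p))\<^sup>2 = 1" using big_second[of p q u] V u big pu by auto
  then have pu1': "(cmod (a p u))\<^sup>2 = 1" using A.cmod_sym[of u p] V u by simp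
  have dp: "4 - A.deg p \<le> psi_sq" using deg2_bound(1)[of p q u] V u big pu1 phi_psi by (auto simp: big_def)
  have w_leaf: "(cmod (a w u))\<^sup>2 \<ge> 1" "\<And>y. y < n \<Longrightarrow> y \<noteq> u \<Longrightarrow> a w y = 0"
    if w: "w < n" "w \<notin> {p, q, u}" "a u w \<noteq> 0" for w
  proof -
    have wu: "a w u \<noteq> 0" using A.zero_sym w u by auto
    have no: "\<not> (big w u \<or> small w u)"
    proof
      assume e: "big w u \<or> small w u"
      have "a w y = 0" if "y < n" "y \<noteq> u" for y
        using phi_edge_inner[of u w p y] e V u w pu that A.zero_sym[of w y] by auto
      moreover have "a u y = 0" if "y < n" "y \<notin> {w, p}" for y
        using full(2)[of u w p y] e V u w pu that by auto
      moreover obtain x y where "x \<in> set [p, q, u, w]" "y < n" "y \<notin> set [p, q, u, w]" "a x y \<noteq> 0"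
        using A.closed_large[of "[p, q, u, w]"] V u w by auto
      ultimately show False using leaf[of y] fp(2)[of y] by auto
    qed
    show w1: "(cmod (a w u))\<^sup>2 \<ge> 1" by (rule type_cases[OF w(1) u(1) wu]) (use no in auto)
    have pw: "a p w = 0" using fp(2)[of w] w by auto
    have s: "A.paths2 p w = a p u * a u w"
      using A.paths2_supp[of "{q, u}" p w] fp(2) leaf[of w] V u w by auto
    have k: "(cmod (A.paths2 p w))\<^sup>2 < (4 - A.deg p) * (4 - A.deg w)"
      by (rule A.paths2_bound) (use V w pw in auto)
    have uw1: "(cmod (a u w))\<^sup>2 \<ge> 1" using w1 A.cmod_sym[of w u] u w by simp
    have "(cmod (A.paths2 p w))\<^sup>2 \<ge> 1"
      unfolding s using pu1' uw1 by (simp add: norm_mult power_mult_distrib)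
    moreover have "(4 - A.deg p) * (4 - A.deg w) \<le> psi_sq * (4 - A.deg w)"
      using bounds_mult[of p w psi_sq "4 - A.deg w"] dp V w by auto
    ultimately have "1 < psi_sq * (4 - A.deg w)" using k by linarith
    then have "phi_sq * 1 < phi_sq * (psi_sq * (4 - A.deg w))" using phi_psi by (intro mult_strict_left_mono) auto
    then have "phi_sq < 4 - A.deg w" using phi_psi(2) by (simp add: mult.assoc[symmetric])
    then have dw: "A.deg w < 1 + psi_sq" using phi_psi by linarith
    show "a w y = 0" if y: "y < n" "y \<noteq> u" for y
    proof (rule ccontr)
      assume "a w y \<noteq> 0"
      then have "a y w \<noteq> 0" using A.zero_sym w y by auto
      then show False using norm_ge_f[of y w] deg2_bound(1)[of w u y] dw uw1 u w y by auto
    qed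
  qed
  obtain x w where xw: "x \<in> set [p, q, u]" "w < n" "w \<notin> set [p, q, u]" "a x w \<noteq> 0"
    using A.closed_large[of "[p, q, u]"] V u by auto
  then have w: "w < n" "w \<notin> {p, q, u}" "a u w \<noteq> 0" using leaf[of w] fp(2)[of w] by auto
  obtain x w' where xw': "x \<in> set [p, q, u, w]" "w' < n" "w' \<notin> set [p, q, u, w]" "a x w' \<noteq> 0"
    using A.closed_large[of "[p, q, u, w]"] V u w by auto
  then have w': "w' < n" "w' \<notin> {p, q, u}" "a u w' \<noteq> 0" "w' \<noteq> w"
    using leaf[of w'] fp(2)[of w'] w_leaf(2)[OF w, of w'] by auto
  obtain x y where xy: "x \<in> set [p, q, u, w, w']" "y < n" "y \<notin> set [p, q, u, w, w']" "a x y \<noteq> 0"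
    using A.closed_large[of "[p, q, u, w, w']"] V u w w' by auto
  then have y: "y < n" "y \<notin> {p, q, u}" "a u y \<noteq> 0" "y \<noteq> w" "y \<noteq> w'"
    using leaf[of y] fp(2)[of y] w_leaf(2)[OF w, of y] w_leaf(2)[OF w'(1-3), of y] by auto
  have "(\<Sum>z\<in>{p, w, w', y}. (cmod (a z u))\<^sup>2) \<ge> 4"
    using pu1' w_leaf(1)[OF w] w_leaf(1)[OF w'(1-3)] w_leaf(1)[OF y(1-3)] w w' y by auto
  then show False using A.deg_ge[of "{p, w, w', y}" u] A.deg_less_4[OF u(1)] V w w' y by auto
qed

lemma no_big: assumes V: "p < n" "q < n" and big: "big q p" shows False
proof (cases "p = q")
  case True
  then show False using no_big_charge big V by auto
next
  case False
  have big': "big p q" using big_sym V big by auto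
  show False
  proof (cases "\<exists>y<n. y \<noteq> p \<and> a q y \<noteq> 0")
    case True
    then obtain y where y: "y < n" "y \<noteq> p" "a y q \<noteq> 0" using A.zero_sym V by metis
    have "a p z = 0" if "z < n" "z \<noteq> q" for z
      using big_edge_inner[of p q z y] V False big y that A.zero_sym[of p z] by auto
    then show False using no_big_leaf[of q p] V False big' by auto
  next
    case False
    then show False using no_big_leaf[of p q] V \<open>p \<noteq> q\<close> big by auto
  qed
qed

theorem integral_norms: "i < n \<Longrightarrow> j < n \<Longrightarrow> (cmod (a i j))\<^sup>2 = (cmod (b i j))\<^sup>2 \<and> (cmod (a i j))\<^sup>2 \<in> \<nat>"
  using entry[of i j] no_big[of j i] phi_pair.no_big[OF swap, of j i]
  unfolding big_def phi_pair.big_def[OF swap] by blast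

end

subsection \<open>Weights in quadratic integer rings\<close>

text \<open>If 2 and -2 were both roots, the span would be at least 4; this is the one-sidedness
  needed for \<open>strict_bound\<close>.\<close>

lemma small_span_weights_mat:
  fixes A :: "complex mat" and p :: "int poly"
  assumes A: "A \<in> carrier_mat n n" and size: "n > 6"
    and a: "\<And>i j. i < n \<Longrightarrow> j < n \<Longrightarrow> A $$ (i, j) = a i j"
    and herm: "\<And>i j. i < n \<Longrightarrow> j < n \<Longrightarrow> a j i = cnj (a i j)"
    and conn: "connected_graph A"
    and p: "char_poly A = of_int_poly p" "monic p" "poly_span p < 4"
    and cyc: "\<And>z. poly (char_poly A) z = 0 \<Longrightarrow> z \<in> complex_of_real ` {-2..2}"
  shows "small_span_weights n a"
proof -
  interpret H: hermitian_weights n a by unfold_locales (rule herm)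
  have root: "poly (char_poly A) \<mu> = 0" if u: "\<exists>i<n. u i \<noteq> 0" and e: "\<forall>i<n. H.app u i = \<mu> * u i" for \<mu> u
  proof -
    have "Matrix.vec n u \<noteq> 0\<^sub>v n" using u by (metis index_vec index_zero_vec(1))
    moreover have "A *\<^sub>v Matrix.vec n u = \<mu> \<cdot>\<^sub>v Matrix.vec n u"
    proof (rule eq_vecI)
      fix i assume "i < dim_vec (\<mu> \<cdot>\<^sub>v Matrix.vec n u)"
      then have i: "i < n" by simp
      have "vec_index (A *\<^sub>v Matrix.vec n u) i = (\<Sum>j<n. a i j * u j)"
        using A i a by (auto simp: scalar_prod_def lessThan_atLeast0 intro!: sum.cong)
      then show "vec_index (A *\<^sub>v Matrix.vec n u) i = vec_index (\<mu> \<cdot>\<^sub>v Matrix.vec n u) i" using e i by (simp add: H.app_def)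
    qed (use A in simp)
    ultimately have "eigenvector A (Matrix.vec n u) \<mu>" using A by (simp add: eigenvector_def)
    then have "eigenvalue A \<mu>" by (auto simp: eigenvalue_def)
    then show ?thesis using eigenvalue_root_char_poly[OF A] by simp
  qed
  have one_sided: False if r: "poly (char_poly A) 2 = 0" "poly (char_poly A) (- 2) = 0"
  proof -
    have evc: "poly (char_poly A) (of_int t) = of_int (poly p t)" for t unfolding p(1) by simp
    have evr: "poly (of_int_poly p) (of_int t) = (of_int (poly p t) :: real)" for t by simp
    have "poly p 2 = 0" "poly p (- 2) = 0" using r evc[of 2] evc[of "- 2"] by auto
    then have z: "poly (of_int_poly p) (2 :: real) = 0" "poly (of_int_poly p) (- 2 :: real) = 0"
      using evr[of 2] evr[of "- 2"] by auto
    have "p \<noteq> 0" using p(2) by auto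
    then have "of_int_poly p \<noteq> (0 :: real poly)" by simp
    then have fin: "finite {x :: real. poly (of_int_poly p) x = 0}" by (rule poly_roots_finite)
    have "2 \<le> Max {x :: real. poly (of_int_poly p) x = 0}" "Min {x :: real. poly (of_int_poly p) x = 0} \<le> - 2"
      using fin z by (auto intro: Max_ge Min_le)
    then show False using p(3) unfolding poly_span_def by linarith
  qed
  show ?thesis
  proof unfold_locales
    fix u assume u: "\<not> (\<forall>i<n. H.app u i = 2 * u i)" "\<not> (\<forall>i<n. H.app u i = - 2 * u i)"
    show "H.sqnorm (H.app u) < 4 * H.sqnorm u"
    proof (rule H.strict_bound[OF _ _ _ u])
      show "0 < n" using size by simp
      fix \<mu> v assume v: "\<exists>i<n. v i \<noteq> 0" "\<forall>i<n. H.app v i = \<mu> * v i"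
      obtain r where "r \<in> {-2..2}" "\<mu> = complex_of_real r" using cyc[OF root[OF v]] by blast
      then show "\<exists>r. \<mu> = complex_of_real r \<and> \<bar>r\<bar> \<le> 2" by (intro exI[of _ r]) auto
    next
      fix v w assume v: "\<exists>i<n. v i \<noteq> 0" "\<forall>i<n. H.app v i = 2 * v i"
        and w: "\<exists>i<n. w i \<noteq> 0" "\<forall>i<n. H.app w i = - 2 * w i"
      show False using one_sided[OF root[OF v] root[OF w]] .
    qed
  next
    fix S assume S: "S \<subseteq> {..<n}" "S \<noteq> {}"
      and closed: "\<And>x y. x \<in> S \<Longrightarrow> y < n \<Longrightarrow> a x y \<noteq> 0 \<Longrightarrow> y \<in> S"
    obtain s where s: "s \<in> S" using S(2) by blast
    have "y \<in> S" if y: "y < n" for y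
    proof -
      have "(s, y) \<in> {(i, j). i < n \<and> j < n \<and> A $$ (i, j) \<noteq> 0}\<^sup>*"
        using conn s S(1) y A unfolding connected_graph_def by auto
      then show ?thesis by (induction rule: rtrancl_induct) (use s closed a in auto)
    qed
    then show "S = {..<n}" using S(1) by auto
  qed (rule size)
qed

context quadratic
begin

lemma O_sum: "finite S \<Longrightarrow> (\<And>x. x \<in> S \<Longrightarrow> g x \<in> O\<^sub>d) \<Longrightarrow> sum g S \<in> O\<^sub>d"
  by (induction S rule: finite_induct) (simp_all add: O_0 O_add)

lemma O_real_int:
  assumes "x \<in> O\<^sub>d" "qconj x = x" "(cmod x)\<^sup>2 < 4"
  shows "x = 0 \<or> x = 1 \<or> x = - 1"
proof -
  have "x \<in> \<int>" by (rule O_rat[OF assms(1) qconj_fixed[OF O_K[OF assms(1)] assms(2)]])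
  then obtain t where t: "x = of_int t" by (auto elim: Ints_cases)
  have "(of_int t)\<^sup>2 < (4 :: real)" using assms(3) unfolding t by simp
  then have "t\<^sup>2 < 4" by (metis of_int_less_iff of_int_numeral of_int_power)
  then have "\<bar>t\<bar> < 2" using abs_square_less_1 power2_less_imp_less[of "\<bar>t\<bar>" 2] by simp
  then have "t = 0 \<or> t = 1 \<or> t = - 1" by auto
  then show ?thesis unfolding t by auto
qed

lemma nat_cases_less_2: "(r :: real) \<in> \<nat> \<Longrightarrow> r < 2 \<Longrightarrow> r = 0 \<or> r = 1"
  by (auto elim!: Nats_cases)

lemma imaginary_dichotomy:
  assumes neg: "d < 0" and ssw: "small_span_weights n a"
    and entry: "\<And>i j. i < n \<Longrightarrow> j < n \<Longrightarrow> a i j \<in> O\<^sub>d"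
  shows "(\<exists>e\<in>{0, 1}. has_pattern n (path_pattern e n) a) \<or> has_pattern n (cycle_pattern n) a \<or>
    (\<exists>t. (\<forall>i<n. t i \<in> O\<^sub>d \<and> cmod (t i) = 1) \<and> (\<forall>i<n. \<forall>j<n. t i * a i j * cnj (t j) \<in> \<rat>))"
proof -
  interpret S: small_span_weights n a by (rule ssw)
  have "integral_weights n a"
  proof unfold_locales
    fix i j assume "i < n" "j < n"
    then show "(cmod (a i j))\<^sup>2 \<in> \<nat>" using O_imag(1)[OF neg entry] by simp
  next
    fix u w assume uw: "u < n" "w < n" "u \<noteq> w" "a u w = 0" "S.deg u = 3" "S.deg w = 3"
    have "(cmod (S.paths2 u w))\<^sup>2 < 1"
      using S.paths2_bound[OF uw(1,2,3)] uw(4,5,6) by simp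
    moreover have "S.paths2 u w \<in> O\<^sub>d"
      unfolding S.paths2_def using uw entry by (intro O_sum O_mult) auto
    then have "(cmod (S.paths2 u w))\<^sup>2 \<in> \<nat>" by (rule O_imag(1)[OF neg])
    ultimately have "(cmod (S.paths2 u w))\<^sup>2 = 0" using nat_cases_less_2 by fastforce
    then show "S.paths2 u w = 0" by simp
  qed
  then interpret I: integral_weights n a .
  show ?thesis
  proof (cases "\<exists>u<n. \<exists>v<n. u \<noteq> v \<and> (cmod (a u v))\<^sup>2 \<ge> 2")
    case True
    then show ?thesis using I.heavy_edge_pattern by blast
  next
    case False
    have "unit_weights n a O\<^sub>d"
    proof unfold_locales
      fix i j assume ij: "i < n" "j < n"
      show "a i j = 0 \<or> cmod (a i j) = 1"
      proof (cases "i = j")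
        case True
        \<comment> \<open>A charge is real, so in an imaginary field it is fixed by
          \<open>qconj\<close> and hence a rational integer.\<close>
        have "qconj (a i i) = a i i"
          using cnj_imag[OF neg O_K[OF entry[OF ij(1) ij(1)]]] S.herm[OF ij(1) ij(1)] by simp
        moreover have "(cmod (a i i))\<^sup>2 < 4" using S.entry_le_deg[OF ij(1), of i] S.deg_less_4[OF ij(1)] by linarith
        ultimately show ?thesis using O_real_int[OF entry[OF ij(1) ij(1)]] True by auto
      next
        case ne: False
        then have "(cmod (a i j))\<^sup>2 < 2" using False ij by (meson not_le)
        then have "(cmod (a i j))\<^sup>2 = 0 \<or> (cmod (a i j))\<^sup>2 = 1"
          using nat_cases_less_2 O_imag(1)[OF neg entry[OF ij]] by blast
        then show ?thesis using square_1[of "a i j"] by auto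
      qed
    qed (use entry O_mult O_add O_0 O_1 O_imag[OF neg] in auto)
    then show ?thesis using unit_weights.unit_dichotomy by blast
  qed
qed

text \<open>Let \<open>T\<close> be the trace and \<open>N\<close> the norm. Distinct conjugates
  strictly between -2 and 2 give the integer inequalities \<open>4 - 2 * T + N > 0\<close>,
  \<open>4 + 2 * T + N > 0\<close> and \<open>T^2 - 4 * N > 0\<close>. With
  \<open>N \<noteq> 0\<close> they leave \<open>T = 0\<close>, a square root of an integer, or
  \<open>|T| = 1\<close> and \<open>N = - 1\<close>, the golden ratio up to sign and
  conjugation.\<close>

lemma small_conjugates:
  assumes pos: "d > 0" and x: "x \<in> O\<^sub>d" and b: "(cmod x)\<^sup>2 < 4" "(cmod (qconj x))\<^sup>2 < 4"
  shows "((cmod x)\<^sup>2 = (cmod (qconj x))\<^sup>2 \<and> (cmod x)\<^sup>2 \<in> \<nat>) \<or>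
    ((cmod x)\<^sup>2 = phi_sq \<and> (cmod (qconj x))\<^sup>2 = psi_sq) \<or> ((cmod x)\<^sup>2 = psi_sq \<and> (cmod (qconj x))\<^sup>2 = phi_sq)"
proof -
  have "x \<in> \<real>" "qconj x \<in> \<real>"
    using cnj_real[OF pos O_K[OF x]] cnj_real[OF pos O_K[OF O_qconj[OF x]]] by (auto simp: Reals_cnj_iff)
  then obtain X Y where X: "x = of_real X" and Y: "qconj x = of_real Y" by (auto elim!: Reals_cases)
  obtain T where T': "x + qconj x = of_int T" using O_trace[OF x] by (auto elim: Ints_cases)
  obtain N where N': "x * qconj x = of_int N" using O_norm[OF x] by (auto elim: Ints_cases)
  have "complex_of_real (X + Y) = of_real (of_int T)" "complex_of_real (X * Y) = of_real (of_int N)"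
    using T' N' unfolding Y unfolding X by simp_all
  then have T: "X + Y = of_int T" and N: "X * Y = of_int N" by (simp_all only: of_real_eq_iff)
  have nx: "(cmod x)\<^sup>2 = X\<^sup>2" and ny: "(cmod (qconj x))\<^sup>2 = Y\<^sup>2" unfolding Y unfolding X by simp_all

  show ?thesis
  proof (cases "qconj x = x")
    case True
    then have "x = 0 \<or> x = 1 \<or> x = - 1" using O_real_int[OF x _ b(1)] by blast
    then show ?thesis using True by auto
  next
    case False
    then have ne: "X \<noteq> Y" using X Y by auto
    have X4: "\<bar>X\<bar> < 2" "\<bar>Y\<bar> < 2"
      using b power2_less_imp_less[of "\<bar>X\<bar>" 2] power2_less_imp_less[of "\<bar>Y\<bar>" 2] unfolding nx ny by auto
    have "(2 - X) * (2 - Y) > 0" "(2 + X) * (2 + Y) > 0" using X4 by (auto intro!: mult_pos_pos)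
    then have "4 - 2 * (X + Y) + X * Y > 0" "4 + 2 * (X + Y) + X * Y > 0" by (simp_all add: algebra_simps)
    then have "real_of_int (4 - 2 * T + N) > 0" "real_of_int (4 + 2 * T + N) > 0" unfolding T N by simp_all
    then have TN: "4 - 2 * T + N > 0" "4 + 2 * T + N > 0" by (simp_all only: of_int_0_less_iff)
    have "(X - Y)\<^sup>2 > 0" using ne by simp
    moreover have "(X - Y)\<^sup>2 = (X + Y)\<^sup>2 - 4 * (X * Y)" by (simp add: power2_eq_square algebra_simps)
    ultimately have "real_of_int (T\<^sup>2 - 4 * N) > 0" unfolding T N by simp
    then have D: "T\<^sup>2 - 4 * N > 0" by (simp only: of_int_0_less_iff)
    have "\<bar>X * Y\<bar> < 2 * 2" unfolding abs_mult using X4 by (intro mult_strict_mono) auto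
    then have N4: "- 4 < N" "N < 4" unfolding N by linarith+
    have N0: "N \<noteq> 0"
    proof
      assume "N = 0"
      then have "x = 0 \<or> qconj x = 0" using N' by simp
      then have "x = of_int T \<or> x = of_int 0" using T' by auto
      then show False using False K_of_int(2) by metis
    qed
    have T4: "\<bar>T\<bar> < 4" using TN N4 by linarith
    have "T = 0 \<or> (\<bar>T\<bar> = 1 \<and> N = - 1)"
    proof -
      have "T \<in> {-3, -2, -1, 0, 1, 2, 3}" using T4 by auto
      moreover have "N \<in> {-3, -2, -1, 0, 1, 2, 3}" using N4 by auto
      ultimately show ?thesis using TN D N0 by auto
    qed
    then show ?thesis
    proof
      assume "T = 0"
      then have "Y = - X" using T by simp
      then have e: "X\<^sup>2 = Y\<^sup>2" "X\<^sup>2 = - (X * Y)" by (simp_all add: power2_eq_square)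
      then have "X\<^sup>2 = of_int (- N)" using N by simp
      moreover from this have "- N \<ge> 0" by (metis of_int_0_le_iff zero_le_power2)
      ultimately have "X\<^sup>2 \<in> \<nat>" by (metis nonneg_int_cases of_int_of_nat_eq of_nat_in_Nats)
      then show ?thesis using e(1) unfolding nx ny by simp
    next
      assume TN1: "\<bar>T\<bar> = 1 \<and> N = - 1"
      then have "(X + Y)\<^sup>2 = 1" unfolding T by (auto simp: abs_if split: if_splits)
      moreover have N1: "X * Y = - 1" using N TN1 by simp
      ultimately have sum: "X\<^sup>2 + Y\<^sup>2 = 3" by (simp add: power2_sum)
      have "X\<^sup>2 * Y\<^sup>2 = 1" using N1 by (simp flip: power_mult_distrib)
      moreover have Y3: "Y\<^sup>2 = 3 - X\<^sup>2" using sum by simp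
      ultimately have q: "X\<^sup>2 * (3 - X\<^sup>2) = 1" by simp
      have "(X\<^sup>2 - phi_sq) * (X\<^sup>2 - psi_sq) = X\<^sup>2 * X\<^sup>2 - (phi_sq + psi_sq) * X\<^sup>2 + phi_sq * psi_sq" by (simp add: algebra_simps)
      also have "\<dots> = 0" unfolding phi_psi(1,2) using q by (simp add: algebra_simps)
      finally have "X\<^sup>2 = phi_sq \<or> X\<^sup>2 = psi_sq" by simp
      then show ?thesis using Y3 phi_psi(1) unfolding nx ny by auto
    qed
  qed
qed

text \<open>\<open>phi_pair\<close> makes all squared moduli integers, equal to those of the
  conjugate matrix. Without heavy edges it remains to exclude charges \<open>sqrt 2\<close> and
  \<open>- sqrt 2\<close>; then all weights are 0, 1 or -1.\<close>

lemma real_dichotomy: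
  assumes pos: "d > 0" and ssw: "small_span_weights n a" "small_span_weights n (\<lambda>i j. qconj (a i j))"
    and entry: "\<And>i j. i < n \<Longrightarrow> j < n \<Longrightarrow> a i j \<in> O\<^sub>d"
  shows "(\<exists>e\<in>{0, 1}. has_pattern n (path_pattern e n) a) \<or> (\<forall>i<n. \<forall>j<n. a i j \<in> \<rat>)"
proof -
  let ?b = "\<lambda>i j. qconj (a i j)"
  interpret A: small_span_weights n a by (rule ssw)
  interpret B: small_span_weights n ?b by (rule ssw)
  interpret P: phi_pair n a ?b
  proof unfold_locales
    fix i j assume ij: "i < n" "j < n"
    show "((cmod (a i j))\<^sup>2 = (cmod (?b i j))\<^sup>2 \<and> (cmod (a i j))\<^sup>2 \<in> \<nat>) \<or>
      ((cmod (a i j))\<^sup>2 = phi_sq \<and> (cmod (?b i j))\<^sup>2 = psi_sq) \<or> ((cmod (a i j))\<^sup>2 = psi_sq \<and> (cmod (?b i j))\<^sup>2 = phi_sq)"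
    proof (rule small_conjugates[OF pos entry[OF ij]])
      show "(cmod (a i j))\<^sup>2 < 4" using A.entry_le_deg[OF ij(1), of j] A.deg_less_4[OF ij(2)] by linarith
      show "(cmod (?b i j))\<^sup>2 < 4" using B.entry_le_deg[OF ij(1), of j] B.deg_less_4[OF ij(2)] by linarith
    qed
  qed
  have norm: "(cmod (a i j))\<^sup>2 = (cmod (?b i j))\<^sup>2" "(cmod (a i j))\<^sup>2 \<in> \<nat>" if "i < n" "j < n" for i j
    using P.integral_norms[OF that] by blast+
  have deg: "B.deg v = A.deg v" if "v < n" for v
    unfolding A.deg_def B.deg_def by (rule sum.cong) (use norm(1) that in simp_all)
  have paths_K: "a u x * a x w \<in> K" if "u < n" "w < n" "x < n" for u w x
    using that by (intro K_mult O_K entry)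
  have paths: "A.paths2 u w \<in> O\<^sub>d" "B.paths2 u w = qconj (A.paths2 u w)" if uw: "u < n" "w < n" for u w
  proof -
    show "A.paths2 u w \<in> O\<^sub>d" unfolding A.paths2_def using uw entry by (intro O_sum O_mult) auto
    have "qconj (A.paths2 u w) = (\<Sum>x<n. qconj (a u x * a x w))"
      unfolding A.paths2_def by (rule K_sum_prod(2)) (use paths_K uw in auto)
    also have "\<dots> = (\<Sum>x<n. ?b u x * ?b x w)"
      by (rule sum.cong) (use uw in \<open>simp_all add: K_mult(2)[OF O_K[OF entry] O_K[OF entry]]\<close>)
    finally show "B.paths2 u w = qconj (A.paths2 u w)" unfolding B.paths2_def by simp
  qed
  have int_0: "z = 0" if "z \<in> \<int>" "cmod z < 1" for z :: complex
    using that by (auto elim!: Ints_cases)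
  have "integral_weights n a"
  proof unfold_locales
    fix i j assume "i < n" "j < n"
    then show "(cmod (a i j))\<^sup>2 \<in> \<nat>" by (rule norm(2))
  next
    fix u w assume uw: "u < n" "w < n" "u \<noteq> w" "a u w = 0" "A.deg u = 3" "A.deg w = 3"
    \<comment> \<open>In a real field a modulus below 1 does not force zero. The conjugate has
      modulus below 1 too, so the norm, an integer, vanishes.\<close>
    let ?s = "A.paths2 u w"
    have b0: "?b u w = 0" using uw(4) K_of_int(2)[of 0] by simp
    have "(cmod ?s)\<^sup>2 < 1" using A.paths2_bound[OF uw(1,2,3)] uw(4,5,6) by simp
    then have s1: "cmod ?s < 1" by (simp add: abs_square_less_1)
    have "(cmod (qconj ?s))\<^sup>2 < 1"
      using B.paths2_bound[OF uw(1,2,3)] b0 uw(5,6) deg uw(1,2) paths(2)[OF uw(1,2)] by simp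
    then have s2: "cmod (qconj ?s) < 1" by (simp add: abs_square_less_1)
    have "cmod (?s * qconj ?s) < 1 * 1" unfolding norm_mult using s1 s2 by (intro mult_strict_mono) auto
    then have "?s * qconj ?s = 0" using int_0[OF O_norm[OF paths(1)[OF uw(1,2)]]] by simp
    then have "?s = 0 \<or> qconj ?s = 0" by simp
    then show "?s = 0"
    proof
      assume "qconj ?s = 0"
      then have "?s \<in> \<int>" using O_trace[OF paths(1)[OF uw(1,2)]] by simp
      then show ?thesis using int_0 s1 by blast
    qed
  qed
  then interpret I: integral_weights n a .
  show ?thesis
  proof (cases "\<exists>u<n. \<exists>v<n. u \<noteq> v \<and> (cmod (a u v))\<^sup>2 \<ge> 2")
    case True
    then show ?thesis using I.heavy_edge_pattern by blast
  next
    case False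
    have edge1: "(cmod (a i j))\<^sup>2 = 0 \<or> (cmod (a i j))\<^sup>2 = 1" if "i < n" "j < n" "i \<noteq> j" for i j
    proof -
      have "(cmod (a i j))\<^sup>2 < 2" using False that by (meson not_le)
      then show ?thesis using nat_cases_less_2 norm(2) that by blast
    qed
    have real: "\<exists>r. x = complex_of_real r" if "x \<in> O\<^sub>d" for x
      using cnj_real[OF pos O_K[OF that]] by (metis Reals_cnj_iff Reals_cases)
    have charge: "(cmod (a v v))\<^sup>2 < 2" if v: "v < n" for v
    proof (rule ccontr)
      assume h: "\<not> (cmod (a v v))\<^sup>2 < 2"
      obtain k where k: "(cmod (a v v))\<^sup>2 = real k" using norm(2)[OF v v] by (auto elim: Nats_cases)
      obtain u where u: "u < n" "u \<noteq> v" "a u v \<noteq> 0" using A.neighbour_exists[OF v] .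
      have uv1: "(cmod (a u v))\<^sup>2 = 1" using edge1[OF u(1) v u(2)] u(3) by auto
      have vu: "a v u \<noteq> 0" "(cmod (a v u))\<^sup>2 = 1" using A.zero_sym[of v u] A.cmod_sym[OF u(1) v] u v uv1 by auto
      have "(\<Sum>x\<in>{v, u}. (cmod (a x v))\<^sup>2) \<le> 3"
        using A.deg_ge[of "{v, u}" v] I.deg_le_3[OF v] v u by auto
      then have "real k \<le> 2" using u k uv1 by auto
      then have vv: "(cmod (a v v))\<^sup>2 = 2" using h k by auto
      have sum3: "(\<Sum>x\<in>{v, u}. (cmod (a x v))\<^sup>2) \<ge> 3" using vv uv1 u by auto
      note sat = I.saturated[OF v _ sum3]
      have dv: "A.deg v = 3" using sat(1) u v by auto
      have z: "a x v = 0" "a v x = 0" if "x < n" "x \<notin> {v, u}" for x using sat(2,3)[OF _ that] u v by auto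
      obtain x w where xw: "x \<in> set [v, u]" "w < n" "w \<notin> set [v, u]" "a x w \<noteq> 0"
        using A.closed_large[of "[v, u]"] u v by auto
      have w: "w < n" "w \<noteq> v" "w \<noteq> u" "a w u \<noteq> 0" "a w v = 0"
        using xw z[of w] A.zero_sym[of u w] u by auto
      have wu1: "(cmod (a w u))\<^sup>2 = 1" using edge1[OF w(1) u(1) w(3)] w(4) by auto
      have s: "A.paths2 u v = a u v * a v v + a u u * a u v"
        using A.paths2_supp[of "{v, u}" u v] z u v by auto
      have bd: "(cmod (A.paths2 u v))\<^sup>2 < 4 - A.deg u"
        using A.paths2_bound[OF u(1) v u(2)] w dv by auto
      have bw: "?b w u \<noteq> 0" "?b w v = 0"
        using norm(1)[OF w(1) u(1)] w(4) norm(1)[OF w(1) v] w(5) by auto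
      have bd': "(cmod (qconj (A.paths2 u v)))\<^sup>2 < 4 - A.deg u"
        using B.paths2_bound[OF u(1) v u(2)] w(1-3) bw deg[OF u(1)] deg[OF v] dv paths(2)[OF u(1) v] by auto
      show False
      proof (cases "a u u = 0")
        case True
        then have "(cmod (A.paths2 u v))\<^sup>2 = 2" unfolding s using uv1 vv by (simp add: norm_mult power_mult_distrib)
        moreover have "A.deg u \<ge> 2" using A.deg_ge[of "{v, w}" u] v w vu wu1 by auto
        ultimately show False using bd by linarith
      next
        case False
        have uu1: "(cmod (a u u))\<^sup>2 \<ge> 1" by (rule I.norm_ge_1[OF u(1) u(1) False])
        have d3: "(\<Sum>x\<in>{u, v, w}. (cmod (a x u))\<^sup>2) \<le> A.deg u" using A.deg_ge[of "{u, v, w}" u] u v w by auto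
        then have du: "A.deg u \<ge> (cmod (a u u))\<^sup>2 + 2" using u w vu wu1 by auto
        have uu: "(cmod (a u u))\<^sup>2 = 1" using du I.deg_le_3[OF u(1)] uu1 by linarith
        obtain c where c: "a u u = of_real c" using real entry u by blast
        obtain X where X: "a v v = of_real X" using real entry v by blast
        obtain Y where Y: "?b v v = of_real Y" using real O_qconj entry v by blast
        have c1: "c = 1 \<or> c = - 1" using uu unfolding c by (simp add: power2_eq_1_iff)
        then have "a u u = of_int (if c = 1 then 1 else - 1)" using c by auto
        then have qc: "?b u u = of_real c" using K_of_int(2) c by metis
        have X2: "X\<^sup>2 = 2" using vv unfolding X by simp
        have Y2: "Y\<^sup>2 = 2" using vv unfolding norm(1)[OF v v] Y by simp
        have "X \<noteq> Y"
        proof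
          assume "X = Y"
          then have "qconj (a v v) = a v v" using X Y by simp
          then have "a v v = 0 \<or> a v v = 1 \<or> a v v = - 1" using O_real_int[OF entry[OF v v]] vv by simp
          then show False using vv by auto
        qed
        \<comment> \<open>Conjugation changes the sign of the charge \<open>X\<close> and fixes the
          rational charge \<open>c\<close>. The squares of \<open>X + c\<close> and
          \<open>- X + c\<close> add up to 6, while each is below
          \<open>4 - deg u \<le> 1\<close>.\<close>
        then have YX: "Y = - X" using X2 Y2 by (metis power2_eq_iff)
        have "A.paths2 u v = a u v * of_real (X + c)" unfolding s X c by (simp add: algebra_simps)
        then have sA: "(cmod (A.paths2 u v))\<^sup>2 = (X + c)\<^sup>2" using uv1 by (simp add: norm_mult power_mult_distrib del: of_real_add)
        have "B.paths2 u v = ?b u v * ?b v v + ?b u u * ?b u v"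
          using B.paths2_supp[of "{v, u}" u v] z u v K_of_int(2)[of 0] by auto
        then have "B.paths2 u v = ?b u v * of_real (Y + c)" unfolding Y qc by (simp add: algebra_simps)
        then have sB: "(cmod (qconj (A.paths2 u v)))\<^sup>2 = (Y + c)\<^sup>2"
          unfolding paths(2)[OF u(1) v, symmetric] using uv1 norm(1)[OF u(1) v]
          by (simp add: norm_mult power_mult_distrib del: of_real_add)
        have "(X + c)\<^sup>2 + (Y + c)\<^sup>2 = 2 * X\<^sup>2 + 2 * c\<^sup>2" unfolding YX by (simp add: power2_eq_square algebra_simps)
        then have "(X + c)\<^sup>2 + (Y + c)\<^sup>2 = 6" using X2 c1 by auto
        then show False using bd bd' sA sB du uu by linarith
      qed
    qed
    have "a i j \<in> \<rat>" if ij: "i < n" "j < n" for i j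
    proof -
      obtain r where r: "a i j = of_real r" using real entry ij by blast
      have "(cmod (a i j))\<^sup>2 = 0 \<or> (cmod (a i j))\<^sup>2 = 1"
      proof (cases "i = j")
        case True
        then show ?thesis using nat_cases_less_2[OF norm(2)[OF ij]] charge[OF ij(1)] by simp
      qed (rule edge1[OF ij])
      then have "r = 0 \<or> r = 1 \<or> r = - 1" unfolding r by (simp add: power2_eq_1_iff)
      then show ?thesis unfolding r by auto
    qed
    then show ?thesis by blast
  qed
qed

end

subsection \<open>Equivalence by monomial matrices\<close>

lemma mat_adjoint_dim [simp]:
  fixes A :: "complex mat"
  shows "dim_row (mat_adjoint A) = dim_col A" "dim_col (mat_adjoint A) = dim_row A"
  by (simp_all add: mat_adjoint_def)

lemma mat_adjoint_index:
  fixes A :: "complex mat"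
  shows "i < dim_col A \<Longrightarrow> j < dim_row A \<Longrightarrow> mat_adjoint A $$ (i, j) = cnj (A $$ (j, i))"
  by (simp add: mat_adjoint_def mat_of_rows_def)

lemma elements_mat_subset_iff:
  "A \<in> carrier_mat n m \<Longrightarrow> elements_mat A \<subseteq> R \<longleftrightarrow> (\<forall>i<n. \<forall>j<m. A $$ (i, j) \<in> R)"
  by (auto dest!: elements_matD)

lemma graph_over_iff:
  assumes A: "A \<in> carrier_mat n n"
  shows "graph_over R A \<longleftrightarrow> (\<forall>i<n. \<forall>j<n. A $$ (j, i) = cnj (A $$ (i, j)) \<and> A $$ (i, j) \<in> R)"
proof -
  have "mat_adjoint A = A \<longleftrightarrow> (\<forall>i<n. \<forall>j<n. A $$ (j, i) = cnj (A $$ (i, j)))"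
  proof
    assume h: "mat_adjoint A = A"
    show "\<forall>i<n. \<forall>j<n. A $$ (j, i) = cnj (A $$ (i, j))"
    proof (intro allI impI)
      fix i j assume "i < n" "j < n"
      then show "A $$ (j, i) = cnj (A $$ (i, j))" using mat_adjoint_index[of j A i] A h by simp
    qed
  next
    assume h: "\<forall>i<n. \<forall>j<n. A $$ (j, i) = cnj (A $$ (i, j))"
    show "mat_adjoint A = A"
    proof (rule eq_matI)
      fix i j assume "i < dim_row A" "j < dim_col A"
      then have ij: "i < n" "j < n" using A by auto
      then have "A $$ (i, j) = cnj (A $$ (j, i))" using h by blast
      then show "mat_adjoint A $$ (i, j) = A $$ (i, j)" using mat_adjoint_index[of i A j] A ij by simp
    qed (use A in simp_all)
  qed
  moreover have "square_mat A" using A by simp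
  ultimately show ?thesis
    unfolding graph_over_def using elements_mat_subset_iff[OF A, of R] by blast
qed

lemma unit_cnj: "cmod z = 1 \<Longrightarrow> z * cnj z = 1" "cmod z = 1 \<Longrightarrow> cnj z * z = 1"
  using complex_norm_square[of z] by (simp_all add: mult.commute)

text \<open>\<open>Q\<close> is the permutation matrix of \<open>p\<close> with its nonzero entries
  replaced by the values of \<open>t\<close>, and the automorphism is the identity. Hermitian
  symmetry allows comparing only the entries with \<open>j \<le> i\<close>.\<close>

lemma strongly_equivalent_monomial:
  assumes A: "A \<in> carrier_mat n n" "graph_over R A" and B: "B \<in> carrier_mat n n" "graph_over R B"
    and R: "0 \<in> R" and t: "\<And>i. i < n \<Longrightarrow> t i \<in> R" "\<And>i. i < n \<Longrightarrow> cmod (t i) = 1"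
    and p: "bij_betw p {..<n} {..<n}"
    and AB: "\<And>i j. i < n \<Longrightarrow> j \<le> i \<Longrightarrow> A $$ (p i, p j) = t i * B $$ (i, j) * cnj (t j)"
  shows "strongly_equivalent R A B"
proof -
  have pn: "p i < n" if "i < n" for i using p that by (auto simp: bij_betw_def)
  have AB': "A $$ (p i, p j) = t i * B $$ (i, j) * cnj (t j)" if ij: "i < n" "j < n" for i j
  proof (cases "j \<le> i")
    case False
    have "A $$ (p i, p j) = cnj (A $$ (p j, p i))"
      using A(2) pn[OF ij(1)] pn[OF ij(2)] unfolding graph_over_iff[OF A(1)] by blast
    also have "\<dots> = cnj (t j * B $$ (j, i) * cnj (t i))" using AB[of j i] False ij by simp
    also have "\<dots> = t i * cnj (B $$ (j, i)) * cnj (t j)" by simp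
    also have "cnj (B $$ (j, i)) = B $$ (i, j)"
      using B(2) ij unfolding graph_over_iff[OF B(1)] by (metis complex_cnj_cnj)
    finally show ?thesis .
  qed (use AB ij in simp)
  define q where "q = inv_into {..<n} p"
  have q: "q k < n" "p (q k) = k" if "k < n" for k
    using p that unfolding q_def bij_betw_def
    by (metis inv_into_into lessThan_iff, metis f_inv_into_f lessThan_iff)
  define Q where "Q = Matrix.mat n n (\<lambda>(k, i). if i = q k then t i else 0)"
  have Q: "Q \<in> carrier_mat n n" by (simp add: Q_def)
  have Qi: "Q $$ (k, i) = (if i = q k then t (q k) else 0)" if "k < n" "i < n" for k i
    using that by (simp add: Q_def)
  have adj: "mat_adjoint Q \<in> carrier_mat n n" using Q by auto
  have adji: "mat_adjoint Q $$ (i, k) = (if i = q k then cnj (t (q k)) else 0)" if "k < n" "i < n" for k i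
    using that Q Qi[OF that] mat_adjoint_index[of i Q k] by simp
  have QB: "(Q * B) $$ (k, j) = t (q k) * B $$ (q k, j)" if k: "k < n" "j < n" for k j
  proof -
    have "(Q * B) $$ (k, j) = (\<Sum>i<n. Q $$ (k, i) * B $$ (i, j))"
      using Q B k by (auto simp: scalar_prod_def lessThan_atLeast0 intro!: sum.cong)
    also have "\<dots> = (\<Sum>i<n. if i = q k then t (q k) * B $$ (q k, j) else 0)"
      by (rule sum.cong) (use Qi k in auto)
    finally show ?thesis using q(1)[OF k(1)] by simp
  qed
  have mult_adj: "(M * mat_adjoint Q) $$ (k, l) = M $$ (k, q l) * cnj (t (q l))"
    if M: "M \<in> carrier_mat n n" and k: "k < n" "l < n" for M k l
  proof -
    have "(M * mat_adjoint Q) $$ (k, l) = (\<Sum>i<n. M $$ (k, i) * mat_adjoint Q $$ (i, l))"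
      using adj Q M k by (auto simp: scalar_prod_def lessThan_atLeast0 intro!: sum.cong)
    also have "\<dots> = (\<Sum>i<n. if i = q l then M $$ (k, q l) * cnj (t (q l)) else 0)"
      by (rule sum.cong) (use adji k in auto)
    finally show ?thesis using q(1)[OF k(2)] by simp
  qed
  have QQ: "Q * mat_adjoint Q = 1\<^sub>m n"
  proof (rule eq_matI)
    fix k l assume "k < dim_row (1\<^sub>m n :: complex mat)" "l < dim_col (1\<^sub>m n :: complex mat)"
    then have k: "k < n" "l < n" by simp_all
    have "q l = q k \<longleftrightarrow> k = l" using q(2) k by metis
    then show "(Q * mat_adjoint Q) $$ (k, l) = 1\<^sub>m n $$ (k, l)"
      using mult_adj[OF Q k] Qi[OF k(1) q(1)[OF k(2)]] unit_cnj(1)[OF t(2)[OF q(1)[OF k(1)]]] k by auto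
  qed (use Q adj in auto)
  have "A = Q * B * mat_adjoint Q"
  proof (rule eq_matI)
    fix k l assume "k < dim_row (Q * B * mat_adjoint Q)" "l < dim_col (Q * B * mat_adjoint Q)"
    then have k: "k < n" "l < n" using Q by auto
    have QBc: "Q * B \<in> carrier_mat n n" using Q B by auto
    show "A $$ (k, l) = (Q * B * mat_adjoint Q) $$ (k, l)"
      unfolding mult_adj[OF QBc k] QB[OF k(1) q(1)[OF k(2)]]
      using AB'[OF q(1)[OF k(1)] q(1)[OF k(2)]] q(2) k by simp
  qed (use A Q in auto)
  then have "A = map_mat id (Q * B * mat_adjoint Q)" by (auto intro: eq_matI)
  moreover have "unitary_over R (dim_row A) Q"
    unfolding unitary_over_def
    using A(1) Q QQ mat_mult_left_right_inverse[OF Q adj QQ] elements_mat_subset_iff[OF Q] Qi R t(1) q(1) by auto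
  moreover have "galois_aut (galois_closure (field_generated R)) id" by (simp add: galois_aut_def)
  moreover have "dim_row A = dim_row B" using A(1) B(1) by simp
  ultimately show ?thesis using A(2) B(2) unfolding strongly_equivalent_def by blast
qed

lemma equivalentI:
  assumes B: "B \<in> carrier_mat n n" and "strongly_equivalent R A B \<or> strongly_equivalent R A (- B)"
  shows "equivalent R A B"
proof -
  have "B + of_int 0 \<cdot>\<^sub>m 1\<^sub>m (dim_row B) = B" "- B + of_int 0 \<cdot>\<^sub>m 1\<^sub>m (dim_row B) = - B"
    using B by (auto intro!: eq_matI)
  then show ?thesis using assms(2) unfolding equivalent_def by metis
qed

subsection \<open>Templates\<close>

lemma submatrix_initial:
  assumes "n \<le> m"
  shows "submatrix (Matrix.mat m m g) {..<n} {..<n} = Matrix.mat n n g"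
proof -
  have c: "{i. i < m \<and> i < n} = {..<n}" using assms by auto
  have pick: "pick {..<n} i = i" if "i < n" for i
  proof -
    have "{a \<in> {..<n}. a < i} = {..<i}" using that by auto
    then show ?thesis using pick_card_in_set[of i "{..<n}"] that by simp
  qed
  show ?thesis
  proof (rule eq_matI)
    fix i j assume "i < dim_row (Matrix.mat n n g)" "j < dim_col (Matrix.mat n n g)"
    then have ij: "i < n" "j < n" by simp_all
    then show "submatrix (Matrix.mat m m g) {..<n} {..<n} $$ (i, j) = Matrix.mat n n g $$ (i, j)"
      using submatrix_index[of i "Matrix.mat m m g" "{..<n}" j "{..<n}"] assms by (simp add: c pick)
  qed (use c in \<open>simp_all add: dim_submatrix\<close>)
qed

lemma subst_cnj_weight: "subst_weight \<rho> (cnj_weight w) = cnj (subst_weight \<rho> w)"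
  by (cases w) auto

text \<open>\<open>alpha_norm\<close> fixes the modulus of every substituted value, whatever the
  field; a pattern found in one graph is thereby carried over to all others.\<close>

lemma template_graphs_cmod:
  assumes "A \<in> template_graphs T d" "A' \<in> template_graphs T d'"
    and "i < dim_row (weights T)" "j < dim_col (weights T)"
  shows "(cmod (A $$ (i, j)))\<^sup>2 = (cmod (A' $$ (i, j)))\<^sup>2"
proof -
  have nrm: "(cmod (B $$ (i, j)))\<^sup>2 = (case weights T $$ (i, j) of Det z \<Rightarrow> (cmod z)\<^sup>2 | _ \<Rightarrow> alpha_norm T)"
    if "B \<in> template_graphs T e" for B e
  proof -
    obtain \<rho> where \<rho>: "\<rho> * cnj \<rho> = of_real (alpha_norm T)" and B: "B = map_mat (subst_weight \<rho>) (weights T)"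
      using \<open>B \<in> template_graphs T e\<close> unfolding template_graphs_def by blast
    have "complex_of_real ((cmod \<rho>)\<^sup>2) = of_real (alpha_norm T)" using \<rho> complex_norm_square[of \<rho>] by simp
    then have "(cmod \<rho>)\<^sup>2 = alpha_norm T" by (simp only: of_real_eq_iff)
    then show ?thesis using assms(3,4) unfolding B by (cases "weights T $$ (i, j)") auto
  qed
  show ?thesis using nrm[OF assms(1)] nrm[OF assms(2)] by simp
qed

lemma template_graphs_graph_over:
  assumes T: "is_template T" and A: "A \<in> template_graphs T d"
  shows "A \<in> carrier_mat (dim_row (weights T)) (dim_row (weights T))" "graph_over (quadratic_integers d) A"
proof -
  obtain \<rho> where \<rho>: "A = map_mat (subst_weight \<rho>) (weights T)" "elements_mat A \<subseteq> quadratic_integers d"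
    using A unfolding template_graphs_def by auto
  have sq: "dim_col (weights T) = dim_row (weights T)" using T by (simp add: is_template_def)
  then show c: "A \<in> carrier_mat (dim_row (weights T)) (dim_row (weights T))" using \<rho> by auto
  have e: "\<forall>i<dim_row (weights T). \<forall>j<dim_row (weights T). A $$ (i, j) \<in> quadratic_integers d"
    using elements_mat_subset_iff[OF c] \<rho>(2) by blast
  show "graph_over (quadratic_integers d) A"
    unfolding graph_over_iff[OF c]
  proof (intro allI impI conjI)
    fix i j assume ij: "i < dim_row (weights T)" "j < dim_row (weights T)"
    show "A $$ (i, j) \<in> quadratic_integers d" using e ij by blast
    have "weights T $$ (j, i) = cnj_weight (weights T $$ (i, j))" using T ij unfolding is_template_def by blast
    then show "A $$ (j, i) = cnj (A $$ (i, j))" using ij sq by (simp add: \<rho>(1) subst_cnj_weight)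
  qed
qed

section \<open>From the moduli of the weights to the templates\<close>

context quadratic
begin

lemma unit_products:
  assumes "\<And>k. Suc k < n \<Longrightarrow> h k \<in> O\<^sub>d \<and> cmod (h k) = 1" "i < n"
  shows "(\<Prod>k<i. h k) \<in> O\<^sub>d" "cmod (\<Prod>k<i. h k) = 1"
proof -
  have "(\<Prod>k<i. h k) \<in> O\<^sub>d \<and> cmod (\<Prod>k<i. h k) = 1"
    using assms(2)
  proof (induction i)
    case (Suc i)
    then show ?case using assms(1)[of i] O_mult by (simp add: norm_mult)
  qed (simp add: O_1)
  then show "(\<Prod>k<i. h k) \<in> O\<^sub>d" "cmod (\<Prod>k<i. h k) = 1" by simp_all
qed

lemma qconj_eq_0: assumes "x \<in> O\<^sub>d" shows "qconj x = 0 \<longleftrightarrow> x = 0"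
proof
  assume "qconj x = 0"
  moreover from this obtain k where "x = of_int k" using O_trace[OF assms] by (auto elim: Ints_cases)
  ultimately show "x = 0" using K_of_int(2)[of k] by simp
qed (use K_of_int(2)[of 0] in simp)

text \<open>In a real field the conjugate matrix has the same characteristic polynomial and the same
  zero entries, so it satisfies the hypotheses together with \<open>A\<close>.\<close>

lemma dichotomy:
  assumes A: "A \<in> carrier_mat n n" "graph_over O\<^sub>d A" and size: "n > 6"
    and A_props: "connected_graph A" "cyclotomic_graph A" "small_span_graph A"
  shows "(\<exists>e\<in>{0, 1}. has_pattern n (path_pattern e n) (\<lambda>i j. A $$ (i, j))) \<or>
    has_pattern n (cycle_pattern n) (\<lambda>i j. A $$ (i, j)) \<or>
    (\<exists>t. (\<forall>i<n. t i \<in> O\<^sub>d \<and> cmod (t i) = 1) \<and> (\<forall>i<n. \<forall>j<n. t i * A $$ (i, j) * cnj (t j) \<in> \<rat>))"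
proof -
  let ?a = "\<lambda>i j. A $$ (i, j)"
  obtain p where p: "char_poly A = of_int_poly p" "monic p" "poly_span p < 4"
    using A_props(3) unfolding small_span_graph_def by blast
  have cyc: "z \<in> complex_of_real ` {-2..2}" if "poly (char_poly A) z = 0" for z
    using that A_props(2) eigenvalue_root_char_poly[OF A(1), of z] unfolding cyclotomic_graph_def spectrum_def by auto
  have herm: "A $$ (j, i) = cnj (A $$ (i, j))" and entry: "A $$ (i, j) \<in> O\<^sub>d" if "i < n" "j < n" for i j
    using A(2) that unfolding graph_over_iff[OF A(1)] by blast+
  have ssw: "small_span_weights n ?a"
    by (rule small_span_weights_mat[OF A(1) size refl herm A_props(1) p cyc])
  show ?thesis
  proof (cases "d < 0")
    case True
    show ?thesis using imaginary_dichotomy[OF True ssw entry] by blast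
  next
    case False
    then have pos: "d > 0" using d_cases by blast
    let ?A = "map_mat qconj A"
    have A': "?A \<in> carrier_mat n n" using A by simp
    have cp: "char_poly ?A = char_poly A" by (rule char_poly_qconj[OF A(1) O_K[OF entry] p(1)])
    have "{(i, j). i < dim_row ?A \<and> j < dim_row ?A \<and> ?A $$ (i, j) \<noteq> 0} =
        {(i, j). i < dim_row A \<and> j < dim_row A \<and> A $$ (i, j) \<noteq> 0}"
      using A(1) qconj_eq_0[OF entry] K_of_int(2)[of 0] by auto
    then have conn: "connected_graph ?A" using A_props(1) unfolding connected_graph_def by simp
    have ssw': "small_span_weights n (\<lambda>i j. qconj (A $$ (i, j)))"
    proof (rule small_span_weights_mat[OF A' size _ _ conn, where p = p])
      fix i j assume ij: "i < n" "j < n"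
      show "?A $$ (i, j) = qconj (A $$ (i, j))" using ij A by simp
      have "A $$ (j, i) = A $$ (i, j)" using herm[OF ij] cnj_real[OF pos O_K[OF entry[OF ij]]] by simp
      then show "qconj (A $$ (j, i)) = cnj (qconj (A $$ (i, j)))"
        using cnj_real[OF pos O_K[OF O_qconj[OF entry[OF ij]]]] by simp
    qed (use p cyc cp in auto)
    have "(\<exists>e\<in>{0, 1}. has_pattern n (path_pattern e n) ?a) \<or> (\<forall>i<n. \<forall>j<n. ?a i j \<in> \<rat>)"
      by (rule real_dichotomy[OF pos ssw ssw' entry])
    then show ?thesis
    proof
      assume "\<forall>i<n. \<forall>j<n. A $$ (i, j) \<in> \<rat>"
      then have "(\<forall>i<n. (1 :: complex) \<in> O\<^sub>d \<and> cmod 1 = 1) \<and> (\<forall>i<n. \<forall>j<n. 1 * A $$ (i, j) * cnj 1 \<in> \<rat>)"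
        using O_1 by simp
      then show ?thesis by (intro disjI2 exI[of _ "\<lambda>_. 1"])
    qed (rule disjI1)
  qed
qed

lemma equivalent_integral:
  assumes A: "A \<in> carrier_mat n n" "graph_over O\<^sub>d A"
    and t: "\<And>i. i < n \<Longrightarrow> t i \<in> O\<^sub>d" "\<And>i. i < n \<Longrightarrow> cmod (t i) = 1"
    and rat: "\<And>i j. i < n \<Longrightarrow> j < n \<Longrightarrow> t i * A $$ (i, j) * cnj (t j) \<in> \<rat>"
  shows "\<exists>B. graph_over \<int> B \<and> equivalent O\<^sub>d A B"
proof -
  define B where "B = Matrix.mat n n (\<lambda>(i, j). t i * A $$ (i, j) * cnj (t j))"
  have B: "B \<in> carrier_mat n n" by (simp add: B_def)
  have Bi: "B $$ (i, j) = t i * A $$ (i, j) * cnj (t j)" if "i < n" "j < n" for i j using that by (simp add: B_def)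
  have herm: "A $$ (j, i) = cnj (A $$ (i, j))" and entry: "A $$ (i, j) \<in> O\<^sub>d" if "i < n" "j < n" for i j
    using A(2) that unfolding graph_over_iff[OF A(1)] by blast+
  have O: "B $$ (i, j) \<in> O\<^sub>d" if "i < n" "j < n" for i j
    unfolding Bi[OF that] using that by (intro O_mult O_cnj t entry)
  have Z: "B $$ (i, j) \<in> \<int>" if "i < n" "j < n" for i j
    using O_rat[OF O[OF that]] rat[OF that] Bi[OF that] by simp
  have hermB: "B $$ (j, i) = cnj (B $$ (i, j))" if "i < n" "j < n" for i j
    using Bi[OF that] Bi[OF that(2,1)] herm[OF that] by simp
  have g: "graph_over O\<^sub>d B" "graph_over \<int> B" unfolding graph_over_iff[OF B] using O Z hermB by blast+
  have "strongly_equivalent O\<^sub>d A B"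
  proof (rule strongly_equivalent_monomial[OF A B g(1) O_0, where t = "\<lambda>i. cnj (t i)" and p = id])
    fix i j assume i: "i < n" and "j \<le> i"
    then have j: "j < n" by simp
    have "cnj (t i) * B $$ (i, j) * cnj (cnj (t j)) = (cnj (t i) * t i) * A $$ (i, j) * (cnj (t j) * t j)"
      unfolding Bi[OF i j] by (simp add: mult_ac)
    then show "A $$ (id i, id j) = cnj (t i) * B $$ (i, j) * cnj (cnj (t j))"
      unfolding unit_cnj(2)[OF t(2)[OF i]] unit_cnj(2)[OF t(2)[OF j]] by simp
  qed (use t O_cnj in auto)
  then show ?thesis using equivalentI[OF B] g by blast
qed

text \<open>For \<open>e = 0\<close> the graph is \<open>template_P (n + 1)\<close> without its last
  vertex. A path has no cycles, so its unit edges can be switched to 1 one after another; switching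
  does not change the sign of the final charge, which the sign \<open>g\<close> absorbs.\<close>

lemma path_equivalent:
  assumes A: "A \<in> carrier_mat n n" "graph_over O\<^sub>d A" and n: "n \<ge> 3"
    and e: "e = 0 \<and> m = Suc n \<or> e = 1 \<and> m = n"
    and pat: "has_pattern n (path_pattern e n) (\<lambda>i j. A $$ (i, j))"
  shows "\<exists>B\<in>template_graphs (sub_template (template_P m) {..<n}) d. equivalent O\<^sub>d A B"
proof -
  have herm: "A $$ (j, i) = cnj (A $$ (i, j))" and entry: "A $$ (i, j) \<in> O\<^sub>d" if "i < n" "j < n" for i j
    using A(2) that unfolding graph_over_iff[OF A(1)] by blast+
  obtain p where p: "bij_betw p {..<n} {..<n}"
    and P: "\<And>i j. i < n \<Longrightarrow> j < n \<Longrightarrow> (cmod (A $$ (p i, p j)))\<^sup>2 = path_pattern e n i j"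
    using pat unfolding has_pattern_def by blast
  have pn: "p i < n" if "i < n" for i using p that by (auto simp: bij_betw_def)
  define c where "c = A $$ (p (n - 1), p (n - 1))"
  have "cnj c = c" using herm[of "p (n - 1)" "p (n - 1)"] pn n by (simp add: c_def)
  then obtain r where r: "c = of_real r" by (metis Reals_cnj_iff Reals_cases)
  have "path_pattern e n (n - 1) (n - 1) = e" unfolding path_pattern_def using n by auto
  then have "(cmod c)\<^sup>2 = e" unfolding c_def using P[of "n - 1" "n - 1"] n by simp
  then have "r\<^sup>2 = e" unfolding r by simp
  then have "e = 0 \<and> r = 0 \<or> e = 1 \<and> (r = 1 \<or> r = - 1)" using e by (auto simp: power2_eq_1_iff)
  then obtain g :: complex where g: "g = 1 \<or> g = - 1" and cg: "c = g * of_real e" unfolding r by force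
  have gg: "g * g = 1" "cmod g = 1" "cnj g = g" and gO: "g \<in> O\<^sub>d" using g O_1 O_uminus by auto
  define \<rho> where "\<rho> = g * A $$ (p 1, p 0)"
  have \<rho>O: "\<rho> \<in> O\<^sub>d" unfolding \<rho>_def using n by (intro O_mult gO entry pn) auto
  have n\<rho>: "(cmod \<rho>)\<^sup>2 = 2" using P[of 1 0] n gg by (simp add: \<rho>_def norm_mult path_pattern_def)
  have irr: "\<rho> \<notin> \<rat>"
  proof
    assume "\<rho> \<in> \<rat>"
    then obtain k where k: "\<rho> = of_int k" using O_rat[OF \<rho>O] by (auto elim: Ints_cases)
    have "(of_int k)\<^sup>2 = (2 :: real)" using n\<rho> unfolding k by simp
    then have k2: "k\<^sup>2 = 2" by (metis of_int_eq_iff of_int_numeral of_int_power)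
    then have "\<bar>k\<bar> < 2" using power2_less_imp_less[of "\<bar>k\<bar>" 2] by simp
    then have "k = 0 \<or> k = 1 \<or> k = - 1" by auto
    then show False using k2 by auto
  qed
  have \<rho>\<rho>: "\<rho> * cnj \<rho> = 2" using complex_norm_square[of \<rho>] n\<rho> by simp
  let ?S = "sub_template (template_P m) {..<n}"
  have nm: "n \<le> m" using e by auto
  have W: "weights ?S = Matrix.mat n n (\<lambda>(i, j).
       if i = 1 \<and> j = 0 then Alpha
       else if i = 0 \<and> j = 1 then CnjAlpha
       else if j = i + 1 \<or> i = j + 1 then Det 1
       else if i = m - 1 \<and> j = m - 1 then Det 1
       else Det 0)" and aS: "alpha_norm ?S = 2"
    by (simp_all add: sub_template_def template_P_def submatrix_initial[OF nm])
  define B where "B = map_mat (subst_weight \<rho>) (weights ?S)"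
  have B: "B \<in> carrier_mat n n" by (simp add: B_def W)
  have Bi: "B $$ (i, j) = (if i = 1 \<and> j = 0 then \<rho> else if i = 0 \<and> j = 1 then cnj \<rho>
      else if j = i + 1 \<or> i = j + 1 then 1 else if i = m - 1 \<and> j = m - 1 then 1 else 0)" if "i < n" "j < n" for i j
    using that by (simp add: B_def W)
  have BO: "B $$ (i, j) \<in> O\<^sub>d" and hermB: "B $$ (j, i) = cnj (B $$ (i, j))" if "i < n" "j < n" for i j
    using Bi[OF that] Bi[OF that(2,1)] \<rho>O O_cnj[OF \<rho>O] O_1 O_0 by auto
  have gB: "graph_over O\<^sub>d B" unfolding graph_over_iff[OF B] using BO hermB by blast
  have mB: "- B \<in> carrier_mat n n" using B by simp
  have gmB: "graph_over O\<^sub>d (- B)"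
    unfolding graph_over_iff[OF mB]
  proof (intro allI impI conjI)
    fix i j assume ij: "i < n" "j < n"
    show "(- B) $$ (i, j) \<in> O\<^sub>d" using O_uminus[OF BO[OF ij]] B ij by simp
    show "(- B) $$ (j, i) = cnj ((- B) $$ (i, j))" using hermB[OF ij] B ij by simp
  qed
  have "B \<in> template_graphs ?S d"
    unfolding template_graphs_def using \<rho>O irr \<rho>\<rho> aS B_def elements_mat_subset_iff[OF B] BO by auto
  \<comment> \<open>Switching values are products of edge weights along the path, corrected by
    \<open>g\<close> because \<open>A\<close> is compared with \<open>g\<close> times
    \<open>B\<close>. The first factor is 1 since the heavy edge keeps its weight, up to
    \<open>g\<close>, as \<rho>.\<close>
  define h where "h k = (if k = 0 then 1 else g * A $$ (p (Suc k), p k))" for k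
  have h: "h k \<in> O\<^sub>d \<and> cmod (h k) = 1" if k: "Suc k < n" for k
  proof (cases "k = 0")
    case False
    have "(cmod (A $$ (p (Suc k), p k)))\<^sup>2 = 1" using P[of "Suc k" k] k False by (simp add: path_pattern_def)
    then have "cmod (A $$ (p (Suc k), p k)) = 1" by (rule square_1)
    moreover have "A $$ (p (Suc k), p k) \<in> O\<^sub>d" using k by (intro entry pn) auto
    ultimately show ?thesis using False gO O_mult gg by (simp add: h_def norm_mult)
  qed (simp add: h_def O_1)
  define t where "t i = (\<Prod>k<i. h k)" for i
  have tO: "t i \<in> O\<^sub>d" and tn: "cmod (t i) = 1" if "i < n" for i
    unfolding t_def using unit_products[of n h i, OF h that] by blast+
  have AB: "A $$ (p i, p j) = t i * (g * B $$ (i, j)) * cnj (t j)" if i: "i < n" and ji: "j \<le> i" for i j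
  proof -
    have j: "j < n" using i ji by simp
    consider "i = 1" "j = 0" | "i = Suc j" "j > 0" | "i = n - 1" "j = n - 1" | "i \<noteq> Suc j" "\<not> (i = n - 1 \<and> j = n - 1)"
      using ji by (metis One_nat_def neq0_conv)
    then show ?thesis
    proof cases
      case 1
      have "t 0 = 1" "t 1 = 1" by (simp_all add: t_def h_def)
      moreover have "g * \<rho> = A $$ (p 1, p 0)" unfolding \<rho>_def using gg(1) by (simp add: mult.assoc[symmetric])
      ultimately show ?thesis using 1 Bi[OF i j] by simp
    next
      case 2
      have "t i = h j * t j" using 2 by (simp add: t_def mult.commute)
      then have "t i * (g * B $$ (i, j)) * cnj (t j) = (g * g) * A $$ (p i, p j) * (t j * cnj (t j))"
        using 2 Bi[OF i j] by (simp add: h_def mult_ac)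
      then show ?thesis using gg(1) unit_cnj(1)[OF tn[OF j]] by simp
    next
      case 3
      have "B $$ (i, j) = of_real e" using Bi[OF i j] 3 e n by auto
      then have "t i * (g * B $$ (i, j)) * cnj (t j) = c * (t i * cnj (t i))" using 3 cg by (simp add: mult_ac)
      moreover have "A $$ (p i, p j) = c" unfolding c_def 3 ..
      ultimately show ?thesis unfolding unit_cnj(1)[OF tn[OF i]] by (simp only: mult_1_right)
    next
      case 4
      have "i + j \<noteq> 1" using 4(1) ji by presburger
      then have "path_pattern e n i j = 0" using 4 ji by (auto simp: path_pattern_def)
      then have "A $$ (p i, p j) = 0" using P[OF i j] by simp
      moreover have "B $$ (i, j) = 0" using Bi[OF i j] 4 ji i j e by auto
      ultimately show ?thesis by simp
    qed
  qed
  have "strongly_equivalent O\<^sub>d A B \<or> strongly_equivalent O\<^sub>d A (- B)"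
    using g
  proof
    assume "g = 1"
    then show ?thesis
      using strongly_equivalent_monomial[OF A B gB O_0 tO tn p] AB by simp
  next
    assume "g = - 1"
    then have AB': "A $$ (p i, p j) = t i * (- B) $$ (i, j) * cnj (t j)" if "i < n" "j \<le> i" for i j
      using AB[OF that] B that by simp
    show ?thesis by (rule disjI2, rule strongly_equivalent_monomial[OF A mB gmB O_0 tO tn p AB'])
  qed
  then show ?thesis using equivalentI[OF B] \<open>B \<in> template_graphs ?S d\<close> by blast
qed

text \<open>Switching along the path from \<open>p 0\<close> to \<open>p (n - 1)\<close> collects
  the gain of the whole cycle in the closing edge. If its weight \<rho> were rational it would be an
  integer and \<open>B\<close> an integer graph, contrary to \<open>not_Z\<close>.\<close>

lemma cycle_equivalent:
  assumes A: "A \<in> carrier_mat n n" "graph_over O\<^sub>d A" and n: "n \<ge> 3"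
    and pat: "has_pattern n (cycle_pattern n) (\<lambda>i j. A $$ (i, j))"
    and not_Z: "\<not> (\<exists>B. graph_over \<int> B \<and> equivalent O\<^sub>d A B)"
  shows "\<exists>B\<in>template_graphs (sub_template (template_Q n) {..<n}) d. equivalent O\<^sub>d A B"
proof -
  have entry: "A $$ (i, j) \<in> O\<^sub>d" if "i < n" "j < n" for i j
    using A(2) that unfolding graph_over_iff[OF A(1)] by blast
  obtain p where p: "bij_betw p {..<n} {..<n}"
    and P: "\<And>i j. i < n \<Longrightarrow> j < n \<Longrightarrow> (cmod (A $$ (p i, p j)))\<^sup>2 = cycle_pattern n i j"
    using pat unfolding has_pattern_def by blast
  have pn: "p i < n" if "i < n" for i using p that by (auto simp: bij_betw_def)
  define h where "h k = A $$ (p (Suc k), p k)" for k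
  have h: "h k \<in> O\<^sub>d \<and> cmod (h k) = 1" if k: "Suc k < n" for k
  proof -
    have "(cmod (h k))\<^sup>2 = 1" using P[of "Suc k" k] k by (simp add: cycle_pattern_def h_def)
    moreover have "h k \<in> O\<^sub>d" unfolding h_def using k by (intro entry pn) auto
    ultimately show ?thesis using square_1 by blast
  qed
  define t where "t i = (\<Prod>k<i. h k)" for i
  have tO: "t i \<in> O\<^sub>d" and tn: "cmod (t i) = 1" if "i < n" for i
    unfolding t_def using unit_products[of n h i, OF h that] by blast+
  have n1: "n - 1 < n" "0 < n" using n by auto
  define \<rho> where "\<rho> = cnj (t (n - 1)) * A $$ (p (n - 1), p 0)"
  have \<rho>O: "\<rho> \<in> O\<^sub>d" unfolding \<rho>_def using n1 by (intro O_mult O_cnj tO entry pn) auto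
  have "(cmod (A $$ (p (n - 1), p 0)))\<^sup>2 = 1" using P[OF n1] by (simp add: cycle_pattern_def)
  then have n\<rho>: "(cmod \<rho>)\<^sup>2 = 1" using tn[OF n1(1)] by (simp add: \<rho>_def norm_mult)
  have \<rho>\<rho>: "\<rho> * cnj \<rho> = 1" using complex_norm_square[of \<rho>] n\<rho> by simp
  let ?S = "sub_template (template_Q n) {..<n}"
  have W: "weights ?S = Matrix.mat n n (\<lambda>(i, j).
       if i = n - 1 \<and> j = 0 then Alpha
       else if i = 0 \<and> j = n - 1 then CnjAlpha
       else if j = i + 1 \<or> i = j + 1 then Det 1
       else Det 0)" and aS: "alpha_norm ?S = 1"
    by (simp_all add: sub_template_def template_Q_def submatrix_initial)
  define B where "B = map_mat (subst_weight \<rho>) (weights ?S)"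
  have B: "B \<in> carrier_mat n n" by (simp add: B_def W)
  have Bi: "B $$ (i, j) = (if i = n - 1 \<and> j = 0 then \<rho> else if i = 0 \<and> j = n - 1 then cnj \<rho>
      else if j = i + 1 \<or> i = j + 1 then 1 else 0)" if "i < n" "j < n" for i j
    using that by (simp add: B_def W)
  have BO: "B $$ (i, j) \<in> O\<^sub>d" and hermB: "B $$ (j, i) = cnj (B $$ (i, j))" if "i < n" "j < n" for i j
    using Bi[OF that] Bi[OF that(2,1)] \<rho>O O_cnj[OF \<rho>O] O_1 O_0 n by auto
  have gB: "graph_over O\<^sub>d B" unfolding graph_over_iff[OF B] using BO hermB by blast
  have AB: "A $$ (p i, p j) = t i * B $$ (i, j) * cnj (t j)" if i: "i < n" and ji: "j \<le> i" for i j
  proof -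
    have j: "j < n" using i ji by simp
    consider "i = n - 1" "j = 0" | "i = Suc j" "\<not> (i = n - 1 \<and> j = 0)" | "i \<noteq> Suc j" "\<not> (i = n - 1 \<and> j = 0)" by blast
    then show ?thesis
    proof cases
      case 1
      have "t i * B $$ (i, j) * cnj (t j) = (t (n - 1) * cnj (t (n - 1))) * A $$ (p i, p j)"
        using 1 Bi[OF i j] by (simp add: \<rho>_def t_def mult_ac)
      then show ?thesis using unit_cnj(1)[OF tn[OF n1(1)]] by simp
    next
      case 2
      have "t i = h j * t j" using 2 by (simp add: t_def mult.commute)
      moreover have "B $$ (i, j) = 1" using 2 Bi[OF i j] by auto
      ultimately have "t i * B $$ (i, j) * cnj (t j) = A $$ (p i, p j) * (t j * cnj (t j))"
        using 2(1) by (simp add: h_def mult_ac)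
      then show ?thesis using unit_cnj(1)[OF tn[OF j]] by simp
    next
      case 3
      have "cycle_pattern n i j = 0" using 3 ji n by (auto simp: cycle_pattern_def)
      then have "A $$ (p i, p j) = 0" using P[OF i j] by simp
      moreover have "B $$ (i, j) = 0" using Bi[OF i j] 3 ji n by auto
      ultimately show ?thesis by simp
    qed
  qed
  have eq: "equivalent O\<^sub>d A B"
    using equivalentI[OF B] strongly_equivalent_monomial[OF A B gB O_0 tO tn p AB] by blast
  have irr: "\<rho> \<notin> \<rat>"
  proof
    assume "\<rho> \<in> \<rat>"
    then have Z: "\<rho> \<in> \<int>" by (rule O_rat[OF \<rho>O])
    then have "cnj \<rho> \<in> \<int>" by (auto elim!: Ints_cases)
    then have "B $$ (i, j) \<in> \<int>" if "i < n" "j < n" for i j using Z Bi[OF that] by simp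
    then have "graph_over \<int> B" unfolding graph_over_iff[OF B] using hermB by blast
    then show False using not_Z eq by blast
  qed
  have "B \<in> template_graphs ?S d"
    unfolding template_graphs_def using \<rho>O irr \<rho>\<rho> aS B_def elements_mat_subset_iff[OF B] BO by auto
  then show ?thesis using eq by blast
qed

end

theorem theorem3p3:
  fixes T :: template
  assumes "is_template T"
    and "template_has connected_graph T"
    and "dim_row (weights T) > 6"
    and "template_has cyclotomic_graph T"
    and "template_has small_span_graph T"
  shows "\<exists>n\<ge>3. \<exists>I\<subseteq>{..<n}.
           template_equivalent T (sub_template (template_P n) I) \<or>
           template_equivalent T (sub_template (template_Q n) I)"
proof (cases "\<exists>d. quadratic_param d \<and> template_graphs T d \<noteq> {}")
  case False
  \<comment> \<open>With no graph to test, equivalence holds vacuously, and any sub-template will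
    do.\<close>
  then have "template_equivalent T (sub_template (template_P 3) {})" by (auto simp: template_equivalent_def)
  then show ?thesis by (intro exI[of _ 3]) auto
next
  case True
  then obtain d\<^sub>0 A\<^sub>0 where d0: "quadratic_param d\<^sub>0" and A0: "A\<^sub>0 \<in> template_graphs T d\<^sub>0" by blast
  let ?n = "dim_row (weights T)"
  have n3: "?n \<ge> 3" using assms(3) by simp
  have not_Z: "\<not> (\<exists>B. graph_over \<int> B \<and> equivalent (quadratic_integers d) A B)"
    if "quadratic_param d" "A \<in> template_graphs T d" for d A
    using assms(1) that unfolding is_template_def by blast
  have transfer: "has_pattern ?n P (\<lambda>i j. A $$ (i, j))"
    if A: "A \<in> template_graphs T d" and pat: "has_pattern ?n P (\<lambda>i j. A\<^sub>0 $$ (i, j))" for A d P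
  proof -
    obtain p where p: "bij_betw p {..<?n} {..<?n}"
      and P: "\<And>i j. i < ?n \<Longrightarrow> j < ?n \<Longrightarrow> (cmod (A\<^sub>0 $$ (p i, p j)))\<^sup>2 = P i j"
      using pat unfolding has_pattern_def by blast
    have sq: "dim_col (weights T) = ?n" using assms(1) by (simp add: is_template_def)
    have "(cmod (A $$ (p i, p j)))\<^sup>2 = P i j" if ij: "i < ?n" "j < ?n" for i j
    proof -
      have "p i < ?n" "p j < ?n" using p ij by (auto simp: bij_betw_def)
      then show ?thesis using template_graphs_cmod[OF A A0, of "p i" "p j"] P[OF ij] sq by simp
    qed
    then show ?thesis unfolding has_pattern_def using p by blast
  qed
  have path_case: "template_equivalent T (sub_template (template_P m) {..<?n})"
    if e: "e = 0 \<and> m = Suc ?n \<or> e = 1 \<and> m = ?n"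
      and pat: "has_pattern ?n (path_pattern e ?n) (\<lambda>i j. A\<^sub>0 $$ (i, j))" for e m
    unfolding template_equivalent_def
  proof (intro allI impI ballI)
    fix d A assume d: "quadratic_param d" and A: "A \<in> template_graphs T d"
    interpret quadratic d by unfold_locales (rule d)
    show "\<exists>B\<in>template_graphs (sub_template (template_P m) {..<?n}) d. equivalent O\<^sub>d A B"
      by (rule path_equivalent[OF template_graphs_graph_over[OF assms(1) A] n3 e transfer[OF A pat]])
  qed
  have cycle_case: "template_equivalent T (sub_template (template_Q ?n) {..<?n})"
    if pat: "has_pattern ?n (cycle_pattern ?n) (\<lambda>i j. A\<^sub>0 $$ (i, j))"
    unfolding template_equivalent_def
  proof (intro allI impI ballI)
    fix d A assume d: "quadratic_param d" and A: "A \<in> template_graphs T d"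
    interpret quadratic d by unfold_locales (rule d)
    show "\<exists>B\<in>template_graphs (sub_template (template_Q ?n) {..<?n}) d. equivalent O\<^sub>d A B"
      by (rule cycle_equivalent[OF template_graphs_graph_over[OF assms(1) A] n3 transfer[OF A pat] not_Z[OF d A]])
  qed
  interpret Q: quadratic d\<^sub>0 by unfold_locales (rule d0)
  note c0 = template_graphs_graph_over[OF assms(1) A0]
  have props: "connected_graph A\<^sub>0" "cyclotomic_graph A\<^sub>0" "small_span_graph A\<^sub>0"
    using assms(2,4,5) d0 A0 unfolding template_has_def by blast+
  from Q.dichotomy[OF c0 assms(3) props]
  consider (path) e where "e \<in> {0, 1}" "has_pattern ?n (path_pattern e ?n) (\<lambda>i j. A\<^sub>0 $$ (i, j))"
    | (cycle) "has_pattern ?n (cycle_pattern ?n) (\<lambda>i j. A\<^sub>0 $$ (i, j))"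
    | (rational) t where "\<forall>i<?n. t i \<in> quadratic_integers d\<^sub>0 \<and> cmod (t i) = 1"
        "\<forall>i<?n. \<forall>j<?n. t i * A\<^sub>0 $$ (i, j) * cnj (t j) \<in> \<rat>"
    by blast
  then show ?thesis
  proof cases
    case path
    define m where "m = (if e = 0 then Suc ?n else ?n)"
    have "e = 0 \<and> m = Suc ?n \<or> e = 1 \<and> m = ?n" using path(1) by (auto simp: m_def)
    then have "template_equivalent T (sub_template (template_P m) {..<?n})" using path_case path(2) by blast
    moreover have "m \<ge> 3" "{..<?n} \<subseteq> {..<m}" using n3 by (auto simp: m_def)
    ultimately show ?thesis by blast
  next
    case cycle
    then show ?thesis using cycle_case n3 by blast
  next
    case rational
    \<comment> \<open>Rational gains would make the graph equivalent to an integer graph, which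
      \<open>is_template\<close> forbids.\<close>
    then show ?thesis using Q.equivalent_integral[OF c0, of t] not_Z[OF d0 A0] by blast
  qed
qed

end
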